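(* For $n\ge1$ let $B(n)=\sum_{\lambda\vdash n}\mathrm{AO}(K_\lambda)$, the sum over all integer partitions $\lambda$ of $n$, and let $B_d(n)=\sum_{\lambda}\mathrm{AO}(K_\lambda)$, the sum over all partitions $\lambda$ of $n$ into distinct parts. (1) Let $c$ be the unique real solution of $$\int_0^\infty \frac{x}{\exp(cx+x^2/2)-1}\,dx=1 .$$ Then, as $n\to\infty$, $\log\frac{B(n)}{n!}\sim C\sqrt n$, where $$C=c+\int_0^\infty -\log\bigl(1-\exp(-cx-x^2/2)\bigr)\,dx .$$ Numerically, $c=0.7649964422795443\ldots$ and $C=2.1587520056577855\ldots$. (2) Let $c_d$ be the unique real solution of $$\int_0^\infty \frac{x}{\exp(c_dx+x^2/2)+1}\,dx=1 .$$ Then, as $n\to\infty$, $\log\frac{B_d(n)}{n!}\sim C_d\sqrt n$, where $$C_d=c_d+\int_0^\infty \log\bigl(1+\exp(-c_dx-x^2/2)\bigr)\,dx .$$ Numerically, $c_d=-0.3236973140950319\ldots$ and $C_d=0.9057298217201990\ldots$.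
   Context: $\mathrm{AO}(G)$ is the number of acyclic orientations of a finite simple graph $G$. For a partition $\lambda=(\lambda_1,\ldots,\lambda_r)$, $K_\lambda=K_{\lambda_1,\ldots,\lambda_r}$ is the complete multipartite graph with part sizes $\lambda_1,\ldots,\lambda_r$; for a one-part partition it is the edgeless graph on $n$ vertices, with one acyclic orientation. $B(n)$ and $B_d(n)$ are the OEIS sequences A372395 and A370613. The first integral equation is considered for those $c$ for which the integral converges (i.e. $c>0$). $a_n\sim b_n$ means $a_n/b_n\to1$. *)

theory Defs
  imports "HOL-Analysis.Analysis" "HOL-Library.Landau_Symbols"
begin

type_synonym 'a ugraph = "'a set \<times> 'a set set"

definition finite_simple_graph :: "'a ugraph \<Rightarrow> bool" where
  "finite_simple_graph G \<longleftrightarrow> finite (fst G) \<and> (\<forall>e\<in>snd G. e \<subseteq> fst G \<and> card e = 2)"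

text \<open>An orientation is a set of arcs containing, for every edge, exactly one of its two
  directions, and no other arcs.\<close>

definition orientations :: "'a ugraph \<Rightarrow> ('a \<times> 'a) set set" where
  "orientations G = {D. bij_betw (\<lambda>(u, v). {u, v}) D (snd G)}"

definition AO :: "'a ugraph \<Rightarrow> nat" where
  "AO G = card {D \<in> orientations G. acyclic D}"

text \<open>The vertex \<open>(i, j)\<close> is the \<open>j\<close>-th vertex of the \<open>i\<close>-th part, all indices starting at 0.\<close>

definition multipartite_verts :: "nat list \<Rightarrow> (nat \<times> nat) set" where
  "multipartite_verts ks = {(i, j). i < length ks \<and> j < ks ! i}"

definition complete_multipartite :: "nat list \<Rightarrow> (nat \<times> nat) ugraph" where
  "complete_multipartite ks =
     (multipartite_verts ks,
      {{u, v} | u v. u \<in> multipartite_verts ks \<and> v \<in> multipartite_verts ks \<and> fst u \<noteq> fst v})"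

definition int_partitions :: "nat \<Rightarrow> nat list set" where
  "int_partitions n = {ks. sorted_wrt (\<ge>) ks \<and> (\<forall>k\<in>set ks. 0 < k) \<and> sum_list ks = n}"

definition B :: "nat \<Rightarrow> nat" where
  "B n = (\<Sum>ks\<in>int_partitions n. AO (complete_multipartite ks))"

definition B_d :: "nat \<Rightarrow> nat" where
  "B_d n = (\<Sum>ks\<in>{ks \<in> int_partitions n. distinct ks}. AO (complete_multipartite ks))"

text \<open>The sums and cardinalities above range over finite sets.\<close>

lemma length_le_sum_list:
  assumes "\<forall>k\<in>set ks. 0 < (k::nat)"
  shows "length ks \<le> sum_list ks"
  using assms by (induction ks) auto

lemma finite_int_partitions: "finite (int_partitions n)"
proof (rule finite_subset)
  show "int_partitions n \<subseteq> {ks. set ks \<subseteq> {..n} \<and> length ks \<le> n}"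
    using member_le_sum_list length_le_sum_list by (fastforce simp: int_partitions_def)
  show "finite {ks. set ks \<subseteq> {..n} \<and> length ks \<le> n}"
    by (rule finite_lists_length_le) simp
qed

lemma finite_multipartite_verts: "finite (multipartite_verts ks)"
proof -
  have "multipartite_verts ks = Sigma {..<length ks} (\<lambda>i. {..<ks ! i})"
    by (auto simp: multipartite_verts_def)
  then show ?thesis by simp
qed

lemma finite_simple_graph_complete_multipartite:
  "finite_simple_graph (complete_multipartite ks)"
  by (auto simp: finite_simple_graph_def complete_multipartite_def finite_multipartite_verts
      card_2_iff)

lemma finite_orientations:
  assumes "finite_simple_graph G"
  shows "finite (orientations G)"
proof (rule finite_subset)
  show "orientations G \<subseteq> Pow (fst G \<times> fst G)"
  proof (clarsimp simp: orientations_def)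
    fix D u v assume "bij_betw (\<lambda>(u, v). {u, v}) D (snd G)" "(u, v) \<in> D"
    then have "{u, v} \<in> snd G" by (auto simp: bij_betw_def image_iff)
    then show "u \<in> fst G \<and> v \<in> fst G" using assms by (auto simp: finite_simple_graph_def)
  qed
  show "finite (Pow (fst G \<times> fst G))" using assms by (auto simp: finite_simple_graph_def)
qed

lemma AO_complete_multipartite_single: "AO (complete_multipartite [n]) = 1"
proof -
  have "snd (complete_multipartite [n]) = {}"
    by (auto simp: complete_multipartite_def multipartite_verts_def)
  then have "{D \<in> orientations (complete_multipartite [n]). acyclic D} = {{}}"
    by (auto simp: orientations_def bij_betw_def acyclic_def)
  then show ?thesis by (simp add: AO_def)
qed

text \<open>The defining equations of the two constants. A point where the integrand is not improperly
  integrable over the half-line is not a solution.\<close>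

definition c_equation :: "real \<Rightarrow> bool" where
  "c_equation c \<longleftrightarrow> ((\<lambda>x. x / (exp (c * x + x\<^sup>2 / 2) - 1)) has_integral 1) {0<..}"

definition c_d_equation :: "real \<Rightarrow> bool" where
  "c_d_equation c \<longleftrightarrow> ((\<lambda>x. x / (exp (c * x + x\<^sup>2 / 2) + 1)) has_integral 1) {0<..}"

end

theory Submission
  imports Defs "HOL-Computational_Algebra.Polynomial" "HOL-Library.Multiset" "HOL-Library.FuncSet"
    "HOL-Real_Asymp.Real_Asymp"
begin

text \<open>
  The number of acyclic orientations of \<open>K_\<lambda>\<close> is the integral of \<open>exp (- t)\<close> times a product of polynomials
  \<open>touch \<lambda>\<^sub>i\<close>, which satisfy \<open>touch m t \<approx> t ^ m * exp (- m\<^sup>2 / (2 * t))\<close>. As the integral concentrates near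
  \<open>t = n\<close>, the quotient by \<open>n!\<close> is about \<open>exp (- (\<Sum>\<lambda>\<^sub>i\<^sup>2) / (2 * n))\<close>, and the sum over \<open>\<lambda>\<close> becomes a partition function
  with Gaussian weights on the part sizes. With parts rescaled by \<open>sqrt n\<close>, introducing the factor \<open>exp (- c x)\<close> gives the
  upper bound \<open>c + \<integral> \<plusminus> ln (1 \<plusminus> exp (- c x - x\<^sup>2 / 2))\<close> for every \<open>c\<close>; the stated equation for \<open>c\<close> says that the expected sum of
  the parts under the tilted weights is \<open>n\<close>, which makes the bound sharp. The decimals come from piecewise
  polynomial approximations of the integrands, certified through the differential equation \<open>W' = - (c + x) W\<close>
  of the weight in exact integer arithmetic.
\<close>

section \<open>Acyclic orientations of complete multipartite graphs\<close>

text \<open>The polynomials \<open>touch m\<close> are Touchard polynomials with alternating signs.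
  They change sign at small \<open>t\<close>, so the concentration argument needs a crude absolute
  bound there and a separate treatment of partitions with a part of order \<open>n\<close>. Both
  give errors \<open>exp (- \<delta> * n)\<close>, harmless because there are only
  \<open>exp (O (sqrt n))\<close> partitions. The upper bound simply drops the condition that the
  parts add up to \<open>n\<close>; for the lower bound this condition is the main obstacle. Instead
  of a local limit theorem, a pigeonhole argument picks one likely total below \<open>n\<close>, and
  a few large distinct parts supply the exact difference. The cost of this filling vanishes in the
  limit because the integrand of the defining equation has a finite first moment. For the decimals,
  integration by parts expresses the constant through that same moment, so that no logarithm has to
  be integrated numerically.\<close>

definition cross_pairs :: "'a set \<Rightarrow> ('a \<Rightarrow> 'b) \<Rightarrow> ('a \<times> 'a) set" where
  "cross_pairs V cls = {(u, v). u \<in> V \<and> v \<in> V \<and> cls u \<noteq> cls v}"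

text \<open>The set \<open>E\<close> is symmetric: it contains both directions of every edge.\<close>

definition acyc_or :: "('a \<times> 'a) set \<Rightarrow> ('a \<times> 'a) set set" where
  "acyc_or E = {D. D \<subseteq> E \<and> (\<forall>(u, v)\<in>E. (u, v) \<in> D \<or> (v, u) \<in> D) \<and> acyclic D}"

lemma acyclic_no_2cycle:
  assumes "acyclic D" "(u, v) \<in> D" "(v, u) \<in> D"
  shows False
  using assms by (meson acyclic_def trancl.r_into_trancl trancl_trans)

text \<open>An acyclic relation cannot contain both directions of an edge, so the bijection demanded
  by \<open>orientations\<close> reduces to having at least one direction of each edge. That form is
  easier to preserve when vertices are removed or arcs are added.\<close>

lemma acyclic_orientation_iff:
  "D \<in> orientations (complete_multipartite ks) \<and> acyclic D \<longleftrightarrow>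
   D \<in> acyc_or (cross_pairs (multipartite_verts ks) fst)"
proof -
  let ?V = "multipartite_verts ks"
  let ?E = "{{u, v} | u v. u \<in> ?V \<and> v \<in> ?V \<and> fst u \<noteq> fst v}"
  have E: "snd (complete_multipartite ks) = ?E" by (simp add: complete_multipartite_def)
  show ?thesis
  proof
    assume "D \<in> orientations (complete_multipartite ks) \<and> acyclic D"
    then have b: "bij_betw (\<lambda>(u, v). {u, v}) D ?E" and a: "acyclic D"
      by (auto simp: orientations_def E)
    have "(u, v) \<in> cross_pairs ?V fst" if "(u, v) \<in> D" for u v
    proof -
      have "(\<lambda>(u, v). {u, v}) (u, v) \<in> (\<lambda>(u, v). {u, v}) ` D" using that by (rule imageI)
      then have "(\<lambda>(u, v). {u, v}) (u, v) \<in> ?E" unfolding bij_betw_imp_surj_on[OF b] .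
      then have "{u, v} \<in> ?E" by (simp only: split_conv)
      then show ?thesis by (auto simp: cross_pairs_def doubleton_eq_iff)
    qed
    moreover have "(u, v) \<in> D \<or> (v, u) \<in> D" if "(u, v) \<in> cross_pairs ?V fst" for u v
    proof -
      have "u \<in> ?V" "v \<in> ?V" "fst u \<noteq> fst v" using that by (auto simp: cross_pairs_def)
      then have "{u, v} \<in> ?E" by blast
      then have "{u, v} \<in> (\<lambda>(u, v). {u, v}) ` D" using b by (simp add: bij_betw_def)
      then show ?thesis by (auto simp: doubleton_eq_iff)
    qed
    ultimately show "D \<in> acyc_or (cross_pairs ?V fst)"
      using a unfolding acyc_or_def by (intro CollectI conjI subrelI ballI) (simp_all add: case_prod_beta, metis prod.collapse)
  next
    assume "D \<in> acyc_or (cross_pairs ?V fst)"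
    then have sub: "D \<subseteq> cross_pairs ?V fst" and a: "acyclic D"
      and tot: "\<And>u v. (u, v) \<in> cross_pairs ?V fst \<Longrightarrow> (u, v) \<in> D \<or> (v, u) \<in> D"
      by (auto simp: acyc_or_def)
    have "inj_on (\<lambda>(u, v). {u, v}) D"
    proof (rule inj_onI, clarify)
      fix u v u' v' assume "(u, v) \<in> D" "(u', v') \<in> D" "{u, v} = {u', v'}"
      then show "u = u' \<and> v = v'"
        using acyclic_no_2cycle[OF a, of u v] by (auto simp: doubleton_eq_iff)
    qed
    moreover have "(\<lambda>(u, v). {u, v}) ` D = ?E"
    proof
      show "(\<lambda>(u, v). {u, v}) ` D \<subseteq> ?E" using sub by (fastforce simp: cross_pairs_def)
      show "?E \<subseteq> (\<lambda>(u, v). {u, v}) ` D"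
      proof clarify
        fix u v assume "u \<in> ?V" "v \<in> ?V" "fst u \<noteq> fst v"
        then have "(u, v) \<in> D \<or> (v, u) \<in> D" using tot by (auto simp: cross_pairs_def)
        then show "{u, v} \<in> (\<lambda>(u, v). {u, v}) ` D"
        proof
          assume "(u, v) \<in> D"
          then have "(\<lambda>(u, v). {u, v}) (u, v) \<in> (\<lambda>(u, v). {u, v}) ` D" by (rule imageI)
          then show ?thesis by (simp only: split_conv)
        next
          assume "(v, u) \<in> D"
          then have "(\<lambda>(u, v). {u, v}) (v, u) \<in> (\<lambda>(u, v). {u, v}) ` D" by (rule imageI)
          then show ?thesis by (simp only: split_conv insert_commute)
        qed
      qed
    qed
    ultimately show "D \<in> orientations (complete_multipartite ks) \<and> acyclic D"
      using a by (auto simp: orientations_def E bij_betw_def)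
  qed
qed

lemma AO_eq_card_acyc_or:
  "AO (complete_multipartite ks) =
   card (acyc_or (cross_pairs (multipartite_verts ks) fst))"
  unfolding AO_def using acyclic_orientation_iff[of _ ks] by (intro arg_cong[where f = card]) auto

lemma finite_cross_pairs: "finite V \<Longrightarrow> finite (cross_pairs V cls)"
  by (rule finite_subset[of _ "V \<times> V"]) (auto simp: cross_pairs_def)

lemma finite_acyc_or: "finite E \<Longrightarrow> finite (acyc_or E)"
  by (rule finite_subset[of _ "Pow E"]) (auto simp: acyc_or_def)

section \<open>Recursion over sets of sources\<close>

definition sources :: "'a set \<Rightarrow> ('a \<times> 'a) set \<Rightarrow> 'a set" where
  "sources V D = {v \<in> V. \<forall>u. (u, v) \<notin> D}"

lemma sources_nonempty:
  assumes "finite D" "acyclic D" "V \<noteq> {}" "D \<subseteq> V \<times> V"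
  shows "sources V D \<noteq> {}"
proof -
  have "wf D" using assms by (simp add: finite_acyclic_wf)
  moreover obtain x where "x \<in> V" using assms by auto
  ultimately obtain z where "z \<in> V" "\<And>y. (y, z) \<in> D \<Longrightarrow> y \<notin> V"
    by (metis wfE_min)
  then have "z \<in> sources V D" using assms by (auto simp: sources_def)
  then show ?thesis by auto
qed

text \<open>Expansion of \<open>(1 - 1) ^ card A\<close> with the term of the empty set moved to the
  other side. It lets each orientation, whose set of sources is nonempty, be counted exactly
  once.\<close>

lemma sum_sign_nonempty_subsets:
  assumes "finite A" "A \<noteq> {}"
  shows "(\<Sum>S\<in>Pow A - {{}}. (-1) ^ (card S + 1)) = (1::int)"
proof -
  have "(\<Sum>S\<in>Pow A. (-1) ^ card S) = (0::int)"
  proof -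
    have "(\<Sum>S\<in>Pow A. (-1::int) ^ card S) = (\<Prod>a\<in>A. 1 - 1)"
      by (subst prod_diff_conv_sum[OF assms(1)]) simp
    then show ?thesis using assms by (simp add: prod_constant card_gt_0_iff)
  qed
  then have "(\<Sum>S\<in>Pow A - {{}}. (-1) ^ card S) = (-1::int)"
    using assms by (subst sum_diff) auto
  then show ?thesis by (simp add: sum_negf)
qed

text \<open>No arc enters \<open>S\<close>, so a path starting outside \<open>S\<close> never uses
  an added arc; a cycle would therefore already lie in \<open>D\<close>.\<close>

lemma acyclic_add_sources:
  assumes D: "acyclic D" "D \<subseteq> W \<times> W" and S: "S \<inter> W = {}" and B: "A \<subseteq> S \<times> W"
  shows "acyclic (D \<union> A)"
proof -
  have 1: "(x, y) \<in> D\<^sup>+ \<or> x \<in> S" if "(x, y) \<in> (D \<union> A)\<^sup>+" for x y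
    using that
  proof (induction rule: trancl_induct)
    case (base y) then show ?case using B by auto
  next
    case (step y z)
    show ?case
    proof (cases "x \<in> S")
      case False
      then have "(x, y) \<in> D\<^sup>+" using step by auto
      then have "y \<in> W" using D(2) by (metis mem_Sigma_iff subsetD trancl_subset_Sigma)
      then have "(y, z) \<in> D" using step S B by auto
      then show ?thesis using \<open>(x, y) \<in> D\<^sup>+\<close> by (meson trancl.trancl_into_trancl)
    qed auto
  qed
  have 2: "y \<in> W" if "(x, y) \<in> (D \<union> A)\<^sup>+" for x y
    using that by (induction rule: trancl_induct) (use D B in auto)
  show ?thesis unfolding acyclic_def
  proof clarify
    fix x assume x: "(x, x) \<in> (D \<union> A)\<^sup>+"
    then have "x \<in> W" by (rule 2)
    then show False using 1[OF x] S D(1) by (auto simp: acyclic_def)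
  qed
qed

text \<open>Once \<open>S\<close> is declared a set of sources, every arc between \<open>S\<close>
  and the rest is forced to leave \<open>S\<close>, and there are no edges inside \<open>S\<close>;
  only the orientation of the rest remains free.\<close>

lemma card_acyc_or_with_sources:
  assumes fin: "finite V" and S: "S \<subseteq> V" and mono: "\<And>u v. u \<in> S \<Longrightarrow> v \<in> S \<Longrightarrow> cls u = cls v"
  shows "card {D \<in> acyc_or (cross_pairs V cls). S \<subseteq> sources V D} =
         card (acyc_or (cross_pairs (V - S) cls))"
proof (rule bij_betw_same_card)
  let ?W = "V - S"
  let ?B = "{(s, v). s \<in> S \<and> v \<in> ?W \<and> cls s \<noteq> cls v}"
  show "bij_betw (\<lambda>D. D \<inter> ?W \<times> ?W) {D \<in> acyc_or (cross_pairs V cls). S \<subseteq> sources V D}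
         (acyc_or (cross_pairs ?W cls))"
  proof (rule bij_betw_byWitness[where f' = "\<lambda>D. D \<union> ?B"])
    show "\<forall>D\<in>{D \<in> acyc_or (cross_pairs V cls). S \<subseteq> sources V D}. D \<inter> ?W \<times> ?W \<union> ?B = D"
    proof clarify
      fix D assume D: "D \<in> acyc_or (cross_pairs V cls)" and src: "S \<subseteq> sources V D"
      have "(u, v) \<in> D \<longleftrightarrow> (u, v) \<in> D \<inter> ?W \<times> ?W \<union> ?B" for u v
      proof
        assume uv: "(u, v) \<in> D"
        then have "u \<in> V" "v \<in> V" "cls u \<noteq> cls v" using D by (auto simp: acyc_or_def cross_pairs_def)
        moreover have "v \<notin> S" using uv src by (auto simp: sources_def)
        ultimately show "(u, v) \<in> D \<inter> ?W \<times> ?W \<union> ?B" using uv by auto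
      next
        assume "(u, v) \<in> D \<inter> ?W \<times> ?W \<union> ?B"
        then consider "(u, v) \<in> D" | "u \<in> S" "v \<in> ?W" "cls u \<noteq> cls v" by auto
        then show "(u, v) \<in> D"
        proof cases
          case 2
          then have "(u, v) \<in> cross_pairs V cls" using S by (auto simp: cross_pairs_def)
          then have "(u, v) \<in> D \<or> (v, u) \<in> D" using D by (auto simp: acyc_or_def)
          then show ?thesis using 2 src by (auto simp: sources_def)
        qed
      qed
      then show "D \<inter> ?W \<times> ?W \<union> ?B = D" by (metis (no_types, lifting) subrelI subset_antisym)
    qed
    show "\<forall>D\<in>acyc_or (cross_pairs ?W cls). (D \<union> ?B) \<inter> ?W \<times> ?W = D"
      by (auto simp: acyc_or_def cross_pairs_def)
    show "(\<lambda>D. D \<inter> ?W \<times> ?W) ` {D \<in> acyc_or (cross_pairs V cls). S \<subseteq> sources V D}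
            \<subseteq> acyc_or (cross_pairs ?W cls)"
      by (auto simp: acyc_or_def cross_pairs_def intro: acyclic_subset)
    show "(\<lambda>D. D \<union> ?B) ` acyc_or (cross_pairs ?W cls)
            \<subseteq> {D \<in> acyc_or (cross_pairs V cls). S \<subseteq> sources V D}"
    proof clarify
      fix D assume D: "D \<in> acyc_or (cross_pairs ?W cls)"
      have "D \<subseteq> ?W \<times> ?W" using D by (auto simp: acyc_or_def cross_pairs_def)
      moreover have "acyclic D" using D by (auto simp: acyc_or_def)
      ultimately have ac: "acyclic (D \<union> ?B)" by (intro acyclic_add_sources[where S = S and W = ?W]) auto
      have "(u, v) \<in> D \<union> ?B \<or> (v, u) \<in> D \<union> ?B" if "(u, v) \<in> cross_pairs V cls" for u v
      proof -
        have uv: "u \<in> V" "v \<in> V" "cls u \<noteq> cls v" using that by (auto simp: cross_pairs_def)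
        consider "u \<in> S" "v \<in> S" | "u \<in> S" "v \<in> ?W" | "u \<in> ?W" "v \<in> S" | "u \<in> ?W" "v \<in> ?W"
          using uv by auto
        then show ?thesis
        proof cases
          case 1 then show ?thesis using mono[of u v] uv by simp
        next
          case 4
          then have "(u, v) \<in> cross_pairs ?W cls" using uv by (auto simp: cross_pairs_def)
          then show ?thesis using D by (auto simp: acyc_or_def)
        qed (use uv in auto)
      qed
      moreover have "D \<union> ?B \<subseteq> cross_pairs V cls" using D S by (auto simp: acyc_or_def cross_pairs_def)
      moreover have "S \<subseteq> sources V (D \<union> ?B)"
        using D S by (auto simp: sources_def acyc_or_def cross_pairs_def)
      ultimately show "D \<union> ?B \<in> acyc_or (cross_pairs V cls) \<and> S \<subseteq> sources V (D \<union> ?B)"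
        using ac by (auto simp: acyc_or_def)
    qed
  qed
qed

text \<open>Each orientation is weighted by the signed sum over the nonempty subsets of its source
  set, which is 1, and the two summations are exchanged. Vertices of different classes are adjacent
  and cannot both be sources, so only subsets of single classes survive.\<close>

lemma card_acyc_or_recursion:
  assumes fin: "finite V" and ne: "V \<noteq> {}"
  shows "int (card (acyc_or (cross_pairs V cls))) =
    (\<Sum>S | S \<subseteq> V \<and> S \<noteq> {} \<and> (\<forall>u\<in>S. \<forall>v\<in>S. cls u = cls v).
       (-1) ^ (card S + 1) * int (card (acyc_or (cross_pairs (V - S) cls))))"
proof -
  let ?A = "acyc_or (cross_pairs V cls)"
  let ?P = "Pow V - {{}}"
  have fA: "finite ?A" by (simp add: finite_acyc_or finite_cross_pairs fin)
  have "int (card ?A) = (\<Sum>D\<in>?A. 1)" by simp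
  also have "\<dots> = (\<Sum>D\<in>?A. \<Sum>S\<in>?P. if S \<subseteq> sources V D then (-1) ^ (card S + 1) else 0)"
  proof (rule sum.cong[OF refl])
    fix D assume D: "D \<in> ?A"
    have sub: "D \<subseteq> V \<times> V" using D by (auto simp: acyc_or_def cross_pairs_def)
    then have "sources V D \<noteq> {}"
      using D fin ne by (intro sources_nonempty) (auto simp: acyc_or_def intro: finite_subset)
    moreover have "finite (sources V D)" using fin by (auto simp: sources_def)
    ultimately have "(1::int) = (\<Sum>S\<in>Pow (sources V D) - {{}}. (-1) ^ (card S + 1))"
      using sum_sign_nonempty_subsets[of "sources V D"] by simp
    also have "Pow (sources V D) - {{}} = {S \<in> ?P. S \<subseteq> sources V D}" by (auto simp: sources_def)
    also have "(\<Sum>S\<in>\<dots>. (-1::int) ^ (card S + 1)) = (\<Sum>S\<in>?P. if S \<subseteq> sources V D then (-1) ^ (card S + 1) else 0)"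
      using fin by (intro sum.inter_filter) auto
    finally show "(1::int) = (\<Sum>S\<in>?P. if S \<subseteq> sources V D then (-1) ^ (card S + 1) else 0)" .
  qed
  also have "\<dots> = (\<Sum>S\<in>?P. \<Sum>D\<in>?A. if S \<subseteq> sources V D then (-1) ^ (card S + 1) else 0)"
    by (rule sum.swap)
  also have "\<dots> = (\<Sum>S\<in>?P. (-1) ^ (card S + 1) * int (card {D \<in> ?A. S \<subseteq> sources V D}))"
    using fA by (intro sum.cong refl) (simp add: sum.inter_filter[symmetric])
  also have "\<dots> = (\<Sum>S | S \<subseteq> V \<and> S \<noteq> {} \<and> (\<forall>u\<in>S. \<forall>v\<in>S. cls u = cls v).
       (-1) ^ (card S + 1) * int (card (acyc_or (cross_pairs (V - S) cls))))"
  proof (rule sum.mono_neutral_cong_right)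
    show "finite ?P" using fin by auto
    show "\<forall>S\<in>?P - {S. S \<subseteq> V \<and> S \<noteq> {} \<and> (\<forall>u\<in>S. \<forall>v\<in>S. cls u = cls v)}.
       (-1) ^ (card S + 1) * int (card {D \<in> ?A. S \<subseteq> sources V D}) = 0"
    proof
      fix S assume "S \<in> ?P - {S. S \<subseteq> V \<and> S \<noteq> {} \<and> (\<forall>u\<in>S. \<forall>v\<in>S. cls u = cls v)}"
      then obtain u v where uv: "u \<in> S" "v \<in> S" "cls u \<noteq> cls v" "S \<subseteq> V" by auto
      have "\<not> S \<subseteq> sources V D" if "D \<in> ?A" for D
      proof -
        have "(u, v) \<in> cross_pairs V cls" using uv by (auto simp: cross_pairs_def)
        then have "(u, v) \<in> D \<or> (v, u) \<in> D" using that by (auto simp: acyc_or_def)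
        then show ?thesis using uv by (auto simp: sources_def)
      qed
      then have "{D \<in> ?A. S \<subseteq> sources V D} = {}" by blast
      then show "(-1) ^ (card S + 1) * int (card {D \<in> ?A. S \<subseteq> sources V D}) = 0"
        by (simp only: card.empty of_nat_0 mult_zero_right)
    qed
    fix S assume S: "S \<in> {S. S \<subseteq> V \<and> S \<noteq> {} \<and> (\<forall>u\<in>S. \<forall>v\<in>S. cls u = cls v)}"
    have "card {D \<in> ?A. S \<subseteq> sources V D} = card (acyc_or (cross_pairs (V - S) cls))"
      using S fin by (intro card_acyc_or_with_sources) blast+
    then show "(-1) ^ (card S + 1) * int (card {D \<in> ?A. S \<subseteq> sources V D}) =
       (-1) ^ (card S + 1) * int (card (acyc_or (cross_pairs (V - S) cls)))"
      by (simp only:)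
  qed auto
  finally show ?thesis .
qed

text \<open>Inclusion-exclusion over the sets of sources, which lie inside a single class, expresses the number of
  acyclic orientations through smaller ones. The derivative of \<open>touch m\<close> is the corresponding alternating sum,
  and \<open>facL\<close>, which integrates against \<open>exp (- t)\<close> over the half-line, kills \<open>q - q'\<close> up to the constant
  coefficient. Hence \<open>facL\<close> of a product of these polynomials satisfies the same recursion.\<close>

fun touch :: "nat \<Rightarrow> real poly" where
  "touch 0 = 1"
| "touch (Suc m) = [:0, 1:] * (touch m - pderiv (touch m))"

lemma pderiv_sum: "pderiv (\<Sum>i\<in>A. f i) = (\<Sum>i\<in>A. pderiv (f i))"
  by (induction A rule: infinite_finite_induct) (auto simp: pderiv_add)

text \<open>The exponential generating function of \<open>touch m\<close> in \<open>z\<close> is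
  \<open>exp (t * (1 - exp (- z)))\<close>; differentiating in \<open>t\<close> multiplies it by
  \<open>1 - exp (- z)\<close>, whose coefficients produce this alternating sum. The induction
  obtains it from the recursion, with Pascal's rule joining two shifted sums.\<close>

lemma pderiv_touch:
  "pderiv (touch m) = (\<Sum>j<m. smult ((-1) ^ j * of_nat (m choose Suc j)) (touch (m - Suc j)))"
proof (induction m)
  case (Suc m)
  let ?c = "\<lambda>j. (-1) ^ j * real (m choose Suc j)"
  have "pderiv (touch (Suc m)) = touch m - pderiv (touch m) +
      [:0, 1:] * (pderiv (touch m) - pderiv (pderiv (touch m)))"
    by (simp add: pderiv_mult pderiv_diff pderiv_pCons algebra_simps)
  also have "[:0, 1:] * (pderiv (touch m) - pderiv (pderiv (touch m))) =
      (\<Sum>j<m. smult (?c j) (touch (Suc m - Suc j)))"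
  proof -
    have "pderiv (pderiv (touch m)) = (\<Sum>j<m. smult (?c j) (pderiv (touch (m - Suc j))))"
      by (subst Suc.IH) (simp add: pderiv_sum pderiv_smult)
    then have "[:0, 1:] * (pderiv (touch m) - pderiv (pderiv (touch m))) =
       [:0, 1:] * (\<Sum>j<m. smult (?c j) (touch (m - Suc j) - pderiv (touch (m - Suc j))))"
      using Suc.IH by (simp add: sum_subtractf smult_diff_right del: mult_pCons_left)
    also have "\<dots> = (\<Sum>j<m. smult (?c j) ([:0, 1:] * (touch (m - Suc j) - pderiv (touch (m - Suc j)))))"
      by (simp only: sum_distrib_left mult_smult_right)
    also have "\<dots> = (\<Sum>j<m. smult (?c j) (touch (Suc m - Suc j)))"
      by (intro sum.cong refl arg_cong2[where f = smult])
        (simp only: diff_Suc_Suc lessThan_iff flip: touch.simps, metis Suc_diff_Suc)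
    finally show ?thesis .
  qed
  also have "\<dots> = (\<Sum>j<Suc m. smult (?c j) (touch (Suc m - Suc j)))" by simp
  also have "touch m - pderiv (touch m) = (\<Sum>j<Suc m. smult ((-1) ^ j * real (m choose j)) (touch (Suc m - Suc j)))"
    unfolding Suc.IH by (subst sum.lessThan_Suc_shift) (simp add: sum_negf)
  finally show ?case
    by (simp only: sum.distrib[symmetric] smult_add_left[symmetric] choose_reduce_nat)
       (simp add: algebra_simps)
qed simp

section \<open>The functional sending \<open>t ^ k\<close> to the factorial of
  \<open>k\<close>\<close>

definition facL :: "real poly \<Rightarrow> real" where
  "facL q = (\<Sum>k\<le>degree q. coeff q k * fact k)"

lemma facL_cutoff: "degree q \<le> N \<Longrightarrow> facL q = (\<Sum>k\<le>N. coeff q k * fact k)"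
  unfolding facL_def by (rule sum.mono_neutral_left) (auto simp: coeff_eq_0)

lemma facL_add: "facL (p + q) = facL p + facL q"
proof -
  define N where "N = max (degree p) (degree q)"
  have "degree (p + q) \<le> N" "degree p \<le> N" "degree q \<le> N"
    by (auto simp: N_def degree_add_le)
  then show ?thesis by (simp add: facL_cutoff[of _ N] sum.distrib algebra_simps)
qed

lemma facL_smult: "facL (smult a p) = a * facL p"
  by (subst facL_cutoff[of _ "degree p"]) (auto simp: facL_def degree_smult_le sum_distrib_left mult.assoc)

lemma facL_0 [simp]: "facL 0 = 0" by (simp add: facL_def)
lemma facL_1 [simp]: "facL 1 = 1" by (simp add: facL_def)

lemma facL_minus: "facL (- p) = - facL p"
  using facL_smult[of "-1" p] by simp

lemma facL_diff: "facL (p - q) = facL p - facL q"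
  using facL_add[of p "- q"] by (simp add: facL_minus)

lemma facL_sum: "facL (\<Sum>i\<in>A. f i) = (\<Sum>i\<in>A. facL (f i))"
  by (induction A rule: infinite_finite_induct) (auto simp: facL_add)

lemma facL_pderiv: "facL (q - pderiv q) = coeff q 0"
proof -
  define N where "N = degree q"
  have d: "degree (pderiv q) \<le> N" "degree q \<le> N" by (auto simp: N_def degree_pderiv)
  then have "facL (q - pderiv q) = (\<Sum>k\<le>N. coeff q k * fact k) - (\<Sum>k\<le>N. coeff q (Suc k) * fact (Suc k))"
    by (simp add: facL_diff facL_cutoff[of _ N] coeff_pderiv algebra_simps)
  also have "\<dots> = (\<Sum>k\<le>N. coeff q k * fact k - coeff q (Suc k) * fact (Suc k))"
    by (simp only: sum_subtractf)
  also have "\<dots> = coeff q 0 * fact 0 - coeff q (Suc N) * fact (Suc N)"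
    by (rule sum_telescope)
  also have "\<dots> = coeff q 0" by (simp add: N_def coeff_eq_0)
  finally show ?thesis .
qed

lemma sum_subsets_card:
  fixes g :: "nat \<Rightarrow> real"
  assumes "finite A"
  shows "(\<Sum>S\<in>Pow A. g (card S)) = (\<Sum>j\<le>card A. real (card A choose j) * g j)"
proof -
  have "(\<Sum>S\<in>Pow A. g (card S)) = (\<Sum>j\<in>{..card A}. \<Sum>S\<in>{S \<in> Pow A. card S = j}. g (card S))"
    by (rule sum.group[symmetric]) (use assms in \<open>auto simp: card_mono\<close>)
  also have "\<dots> = (\<Sum>j\<le>card A. real (card A choose j) * g j)"
    by (intro sum.cong refl) (simp add: n_subsets[OF assms])
  finally show ?thesis .
qed

lemma coeff_touch_0: "m > 0 \<Longrightarrow> coeff (touch m) 0 = 0"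
  by (cases m) simp_all

text \<open>Strong induction on the number of vertices. Grouping the source sets of the recursion by
  their class gives, through \<open>pderiv_touch\<close> and the product rule, \<open>facL\<close>
  of the derivative of the whole product. This equals \<open>facL\<close> of the product itself,
  because some class is nonempty and makes the constant coefficient vanish. The index set
  \<open>J\<close> may contain empty classes, whose factor is \<open>touch 0 = 1\<close>.\<close>

lemma card_acyc_or_facL:
  assumes "finite V" "finite J" "cls ` V \<subseteq> J"
  shows "real (card (acyc_or (cross_pairs V cls))) =
         facL (\<Prod>b\<in>J. touch (card {v \<in> V. cls v = b}))"
  using assms(1,3)
proof (induction "card V" arbitrary: V rule: less_induct)
  case less
  show ?case
  proof (cases "V = {}")
    case True
    have "acyc_or (cross_pairs {} cls) = {{}}"
      by (auto simp: acyc_or_def cross_pairs_def acyclic_def)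
    then show ?thesis using True by simp
  next
    case False
    let ?N = "\<lambda>V. real (card (acyc_or (cross_pairs V cls)))"
    let ?c = "\<lambda>V b. {v \<in> V. cls v = b}"
    let ?M = "{S. S \<subseteq> V \<and> S \<noteq> {} \<and> (\<forall>u\<in>S. \<forall>v\<in>S. cls u = cls v)}"
    let ?Q = "\<lambda>b. \<Prod>b'\<in>J - {b}. touch (card (?c V b'))"
    have finc: "finite (?c V b)" for b using less.prems by simp
    have "?N V = (\<Sum>S\<in>?M. (-1) ^ (card S + 1) * ?N (V - S))"
      using arg_cong[OF card_acyc_or_recursion[OF less.prems(1) False, of cls], of real_of_int] by simp
    also have "\<dots> = (\<Sum>(b, S)\<in>(SIGMA b:J. Pow (?c V b) - {{}}). (-1) ^ (card S + 1) * ?N (V - S))"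
    \<comment> \<open>A nonempty set inside one class determines that class, so \<open>S\<close> can
      be indexed by the pair of its class and itself.\<close>
    proof (rule sum.reindex_bij_witness[where i = snd and j = "\<lambda>S. (cls (SOME v. v \<in> S), S)"])
      fix S assume S: "S \<in> ?M"
      then have some: "(SOME v. v \<in> S) \<in> S" by (simp add: some_in_eq)
      have "cls u = cls (SOME v. v \<in> S)" if "u \<in> S" for u
        using S some that by blast
      then show "(cls (SOME v. v \<in> S), S) \<in> (SIGMA b:J. Pow (?c V b) - {{}})"
        using S some less.prems(2) by blast
    next
      fix a assume a: "a \<in> (SIGMA b:J. Pow (?c V b) - {{}})"
      then have "(SOME v. v \<in> snd a) \<in> snd a" by (auto simp: some_in_eq)
      then have "cls (SOME v. v \<in> snd a) = fst a" using a by auto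
      then show "(cls (SOME v. v \<in> snd a), snd a) = a" by simp
      have sub: "snd a \<subseteq> {v \<in> V. cls v = fst a}" and ne: "snd a \<noteq> {}" using a by auto
      show "snd a \<in> ?M"
      proof (intro CollectI conjI ballI ne)
        show "snd a \<subseteq> V" using sub by blast
        fix u v assume "u \<in> snd a" "v \<in> snd a"
        then have "cls u = fst a" "cls v = fst a" using sub by blast+
        then show "cls u = cls v" by (rule trans[OF _ sym])
      qed
    qed auto
    also have "\<dots> = (\<Sum>b\<in>J. \<Sum>S\<in>Pow (?c V b) - {{}}. (-1) ^ (card S + 1) * ?N (V - S))"
      using less.prems assms(2) by (subst sum.Sigma) auto
    also have "\<dots> = (\<Sum>b\<in>J. facL (pderiv (touch (card (?c V b))) * ?Q b))"
    proof (rule sum.cong[OF refl])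
      fix b assume b: "b \<in> J"
      let ?m = "card (?c V b)"
      let ?h = "\<lambda>j. if j = 0 then 0 else (-1) ^ (j + 1) * facL (touch (?m - j) * ?Q b)"
      have "(\<Sum>S\<in>Pow (?c V b) - {{}}. (-1) ^ (card S + 1) * ?N (V - S)) =
            (\<Sum>S\<in>Pow (?c V b) - {{}}. ?h (card S))"
      proof (rule sum.cong[OF refl])
        fix S assume S: "S \<in> Pow (?c V b) - {{}}"
        then have fS: "finite S" using less.prems by (auto intro: finite_subset)
        have "card (V - S) < card V" using S less.prems by (intro psubset_card_mono) auto
        then have "?N (V - S) = facL (\<Prod>b\<in>J. touch (card (?c (V - S) b)))"
          using less.prems by (intro less.hyps) auto
        also have "(\<Prod>b\<in>J. touch (card (?c (V - S) b))) =
            touch (card (?c (V - S) b)) * (\<Prod>b'\<in>J - {b}. touch (card (?c (V - S) b')))"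
          by (rule prod.remove[OF assms(2) b])
        also have "(\<Prod>b'\<in>J - {b}. touch (card (?c (V - S) b'))) = ?Q b"
          using S by (intro prod.cong refl arg_cong[where f = touch] arg_cong[where f = card]) auto
        also have "?c (V - S) b = ?c V b - S" by auto
        also have "card (?c V b - S) = ?m - card S"
          using S fS by (intro card_Diff_subset) auto
        finally show "(-1) ^ (card S + 1) * ?N (V - S) = ?h (card S)"
          using S fS by (simp add: card_gt_0_iff)
      qed
      also have "\<dots> = (\<Sum>S\<in>Pow (?c V b). ?h (card S))"
        using finc by (intro sum.mono_neutral_left) (auto)
      also have "\<dots> = (\<Sum>j\<le>?m. real (?m choose j) * ?h j)"
        by (rule sum_subsets_card[OF finc])
      also have "\<dots> = (\<Sum>j<?m. real (?m choose Suc j) * ?h (Suc j))"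
        by (subst sum.atMost_shift) simp
      also have "\<dots> = facL (pderiv (touch ?m) * ?Q b)"
        unfolding pderiv_touch sum_distrib_right facL_sum mult_smult_left facL_smult
        by (intro sum.cong) (simp_all add: algebra_simps)
      finally show "(\<Sum>S\<in>Pow (?c V b) - {{}}. (-1) ^ (card S + 1) * ?N (V - S)) = \<dots>" .
    qed
    also have "\<dots> = facL (pderiv (\<Prod>b\<in>J. touch (card (?c V b))))"
      by (simp add: pderiv_prod facL_sum mult.commute)
    also have "\<dots> = facL (\<Prod>b\<in>J. touch (card (?c V b))) - coeff (\<Prod>b\<in>J. touch (card (?c V b))) 0"
      using facL_pderiv[of "\<Prod>b\<in>J. touch (card (?c V b))"] by (simp add: facL_diff)
    also have "coeff (\<Prod>b\<in>J. touch (card (?c V b))) 0 = 0"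
    proof -
      obtain v where v: "v \<in> V" using False by auto
      then have "card (?c V (cls v)) > 0" using finc by (auto simp: card_gt_0_iff)
      then have "coeff (touch (card (?c V (cls v)))) 0 = 0" by (rule coeff_touch_0)
      then have "poly (touch (card (?c V (cls v)))) 0 = 0" by (simp add: poly_0_coeff_0)
      moreover have "cls v \<in> J" using v less.prems by auto
      ultimately have "poly (\<Prod>b\<in>J. touch (card (?c V b))) 0 = 0"
        unfolding poly_prod using assms(2) by (intro prod_zero) auto
      then show ?thesis by (simp add: poly_0_coeff_0)
    qed
    finally show ?thesis by simp
  qed
qed

text \<open>The case of \<open>N\<close> singleton classes and one class of size \<open>m\<close>:
  the singletons are linearly ordered in \<open>fact N\<close> ways, and each of the other vertices
  falls into one of \<open>N + 1\<close> gaps.\<close>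

lemma facL_touch_monom: "facL (touch m * monom 1 N) = fact N * real (N + 1) ^ m"
proof (induction m arbitrary: N)
  case 0
  have "(\<Sum>k\<le>N. coeff (monom 1 N) k * fact k) = (\<Sum>k\<le>N. if k = N then fact N else (0::real))"
    by (intro sum.cong) auto
  then show ?case by (simp add: facL_def degree_monom_eq)
next
  case (Suc m)
  let ?q = "touch m * monom 1 (Suc N)"
  have X: "[:0, 1:] * monom 1 N = (monom 1 (Suc N) :: real poly)" by (simp add: monom_Suc)
  have d: "pderiv (monom 1 (Suc N) :: real poly) = smult (real (Suc N)) (monom 1 N)"
    by (simp add: pderiv_monom smult_monom)
  have "touch (Suc m) * monom 1 N = ?q - pderiv (touch m) * monom 1 (Suc N)"
    unfolding X[symmetric] touch.simps by (simp only: algebra_simps)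
  also have "\<dots> = ?q - pderiv ?q + smult (real (Suc N)) (touch m * monom 1 N)"
    by (simp only: pderiv_mult d mult_smult_right) (simp add: mult.commute)
  finally have "facL (touch (Suc m) * monom 1 N) = coeff ?q 0 + real (Suc N) * facL (touch m * monom 1 N)"
    by (simp only: facL_add facL_pderiv facL_smult)
  also have "coeff ?q 0 = 0" by (simp add: monom_Suc coeff_mult)
  finally show ?case by (simp add: Suc.IH)
qed

text \<open>A new edge is oriented so that it does not close a cycle.\<close>

lemma acyc_or_insert_edge:
  assumes "finite E" "u \<noteq> v" "(u, v) \<notin> E" "(v, u) \<notin> E"
  shows "card (acyc_or E) \<le> card (acyc_or (insert (u, v) (insert (v, u) E)))"
proof (rule card_inj_on_le)
  let ?f = "\<lambda>D. if (v, u) \<in> D\<^sup>* then insert (v, u) D else insert (u, v) D"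
  show "inj_on ?f (acyc_or E)"
  proof (rule inj_on_inverseI[where g = "\<lambda>D. D \<inter> E"])
    fix D assume "D \<in> acyc_or E"
    then show "?f D \<inter> E = D" using assms by (auto simp: acyc_or_def)
  qed
  show "?f ` acyc_or E \<subseteq> acyc_or (insert (u, v) (insert (v, u) E))"
  proof clarify
    fix D assume D: "D \<in> acyc_or E"
    then have ac: "acyclic D" by (simp add: acyc_or_def)
    have "acyclic (?f D)"
    proof (cases "(v, u) \<in> D\<^sup>*")
      case True
      have "(u, v) \<notin> D\<^sup>*"
      proof
        assume "(u, v) \<in> D\<^sup>*"
        then have "(u, v) \<in> D\<^sup>+" using assms(2) by (metis rtranclD)
        then have "(u, u) \<in> D\<^sup>+" using True by (metis trancl_rtrancl_trancl)
        then show False using ac by (auto simp: acyclic_def)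
      qed
      then show ?thesis using True ac by (simp add: acyclic_insert)
    next
      case False
      then show ?thesis using ac by (simp add: acyclic_insert)
    qed
    moreover have "?f D \<subseteq> insert (u, v) (insert (v, u) E)" using D by (auto simp: acyc_or_def)
    moreover have "(a, b) \<in> ?f D \<or> (b, a) \<in> ?f D" if "(a, b) \<in> insert (u, v) (insert (v, u) E)" for a b
      using that D by (auto simp: acyc_or_def)
    ultimately show "?f D \<in> acyc_or (insert (u, v) (insert (v, u) E))"
      unfolding acyc_or_def by blast
  qed
  show "finite (acyc_or (insert (u, v) (insert (v, u) E)))"
    using assms by (simp add: finite_acyc_or)
qed

text \<open>Missing edges are inserted one at a time, both directions together because the relations
  are symmetric.\<close>

lemma card_acyc_or_mono:
  assumes "finite E'" "E \<subseteq> E'" "sym E" "sym E'" "irrefl E'"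
  shows "card (acyc_or E) \<le> card (acyc_or E')"
  using assms
proof (induction "card (E' - E)" arbitrary: E rule: less_induct)
  case less
  show ?case
  proof (cases "E = E'")
    case False
    then obtain u v where uv: "(u, v) \<in> E' - E" using less.prems by auto
    have ne: "u \<noteq> v" using uv less.prems by (auto simp: irrefl_def)
    have vu: "(v, u) \<in> E' - E" using uv less.prems by (auto dest: symD)
    let ?E = "insert (u, v) (insert (v, u) E)"
    have fE: "finite E" using less.prems by (auto intro: finite_subset)
    have "card (acyc_or E) \<le> card (acyc_or ?E)"
      using ne uv vu fE by (intro acyc_or_insert_edge) auto
    also have "\<dots> \<le> card (acyc_or E')"
    proof (rule less.hyps)
      show "card (E' - ?E) < card (E' - E)" using uv less.prems by (intro psubset_card_mono) auto
      show "sym ?E" using less.prems(3) by (auto simp: sym_def)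
    qed (use less.prems uv vu in auto)
    finally show ?thesis .
  qed simp
qed

text \<open>Each vertex outside \<open>A\<close> is made adjacent to all others by giving it its own
  class. This can only increase the count, and the count of the resulting graph is explicit.\<close>

lemma card_acyc_or_single_class:
  assumes "finite V" "A \<subseteq> V" "\<And>u v. u \<in> A \<Longrightarrow> v \<in> A \<Longrightarrow> cls u = cls v"
  shows "real (card (acyc_or (cross_pairs V cls))) \<le>
         fact (card V - card A) * real (card V - card A + 1) ^ card A"
proof -
  let ?k = "\<lambda>v. if v \<in> A then None else Some v"
  have "card (acyc_or (cross_pairs V cls)) \<le> card (acyc_or (cross_pairs V ?k))"
  proof (intro card_acyc_or_mono finite_cross_pairs assms(1))
    show "cross_pairs V cls \<subseteq> cross_pairs V ?k"
    proof (rule subrelI)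
      fix u v assume "(u, v) \<in> cross_pairs V cls"
      then show "(u, v) \<in> cross_pairs V ?k"
        using assms(3)[of u v] by (auto simp: cross_pairs_def split: if_splits)
    qed
  qed (auto simp: cross_pairs_def sym_def irrefl_def)
  also have "real (card (acyc_or (cross_pairs V ?k))) =
      facL (\<Prod>b\<in>insert None (Some ` (V - A)). touch (card {v \<in> V. ?k v = b}))"
    using assms(1) by (intro card_acyc_or_facL) auto
  also have "(\<Prod>b\<in>insert None (Some ` (V - A)). touch (card {v \<in> V. ?k v = b})) =
      touch (card A) * (\<Prod>b\<in>Some ` (V - A). touch (card {v \<in> V. ?k v = b}))"
  proof (subst prod.insert)
    have "{v \<in> V. ?k v = None} = A" using assms(2) by auto
    then show "touch (card {v \<in> V. ?k v = None}) * (\<Prod>b\<in>Some ` (V - A). touch (card {v \<in> V. ?k v = b})) =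
      touch (card A) * (\<Prod>b\<in>Some ` (V - A). touch (card {v \<in> V. ?k v = b}))" by simp
  qed (use assms(1) in auto)
  also have "(\<Prod>b\<in>Some ` (V - A). touch (card {v \<in> V. ?k v = b})) = (\<Prod>b\<in>Some ` (V - A). [:0, 1:])"
  proof (rule prod.cong[OF refl])
    fix b assume "b \<in> Some ` (V - A)"
    then obtain w where w: "w \<in> V - A" "b = Some w" by auto
    then have "{v \<in> V. ?k v = b} = {w}" by auto
    then show "touch (card {v \<in> V. ?k v = b}) = [:0, 1:]" by simp
  qed
  also have "\<dots> = monom 1 (card V - card A)"
    using assms(1,2) by (simp add: card_image card_Diff_subset finite_subset[OF assms(2)] monom_altdef)
  also have "facL (touch (card A) * monom 1 (card V - card A)) =
      fact (card V - card A) * real (card V - card A + 1) ^ card A"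
    by (rule facL_touch_monom)
  finally show ?thesis by simp
qed

section \<open>Bounds for complete multipartite graphs\<close>

declare touch.simps(2) [simp del]

section \<open>The polynomials at arguments large compared with \<open>m\<close>\<close>

lemma alternating_sum_bounds:
  fixes a :: "nat \<Rightarrow> real"
  assumes "\<And>j. 0 \<le> a j" "\<And>j. a (Suc j) \<le> a j"
  shows "0 \<le> (\<Sum>j<n. (-1) ^ j * a j) \<and> (\<Sum>j<n. (-1) ^ j * a j) \<le> a 0"
  using assms
proof (induction n arbitrary: a)
  case (Suc n)
  have "(\<Sum>j<Suc n. (-1) ^ j * a j) = a 0 - (\<Sum>j<n. (-1) ^ j * a (Suc j))"
    by (subst sum.lessThan_Suc_shift) (simp add: sum_negf)
  moreover have "0 \<le> (\<Sum>j<n. (-1) ^ j * a (Suc j)) \<and> (\<Sum>j<n. (-1) ^ j * a (Suc j)) \<le> a (Suc 0)"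
    by (rule Suc.IH) (use Suc.prems in auto)
  ultimately show ?case using Suc.prems(2)[of 0] by linarith
qed simp

lemma alternating_sum_lower:
  fixes a :: "nat \<Rightarrow> real"
  assumes "\<And>j. 0 \<le> a j" "\<And>j. a (Suc j) \<le> a j"
  shows "a 0 - a 1 \<le> (\<Sum>j<Suc n. (-1) ^ j * a j)"
proof -
  have "(\<Sum>j<Suc n. (-1) ^ j * a j) = a 0 - (\<Sum>j<n. (-1) ^ j * a (Suc j))"
    by (subst sum.lessThan_Suc_shift) (simp add: sum_negf)
  then show ?thesis using alternating_sum_bounds[of "\<lambda>j. a (Suc j)" n] assms by simp
qed

lemma poly_touch_Suc:
  "poly (touch (Suc m)) t =
   t * (poly (touch m) t - (\<Sum>j<m. (-1) ^ j * (real (m choose Suc j) * poly (touch (m - Suc j)) t)))"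
  by (simp add: touch.simps pderiv_touch poly_sum mult.assoc)

lemma choose_Suc_le: "real (m choose Suc k) \<le> real m * real (m choose k)"
proof -
  have "m choose Suc k \<le> Suc k * (m choose Suc k)" by simp
  also have "\<dots> = (m - k) * (m choose k)"
    by (simp only: binomial_absorption binomial_absorb_comp)
  also have "\<dots> \<le> m * (m choose k)" by (intro mult_right_mono) auto
  finally have "real (m choose Suc k) \<le> real (m * (m choose k))" by (simp only: of_nat_le_iff)
  then show ?thesis by simp
qed

text \<open>The terms of \<open>pderiv_touch\<close> evaluated at \<open>t\<close>. Each is at most
  \<open>2 * m / t \<le> 1/2\<close> times the one before, so the partial sums of the alternating
  series enclose its value. The facts about smaller indices are hypotheses because
  \<open>touch_ratio\<close> supplies them from its induction.\<close>

lemma touch_alternating_terms: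
  fixes m :: nat and t :: real
  defines "a \<equiv> \<lambda>j. real (m choose Suc j) * poly (touch (m - Suc j)) t"
  assumes t: "t > 0" "4 * real m \<le> t"
    and pos: "\<And>i. i < m \<Longrightarrow> 0 < poly (touch i) t"
    and ratio: "\<And>i. i < m \<Longrightarrow> t / 2 * poly (touch i) t \<le> poly (touch (Suc i)) t"
  shows "0 \<le> a j" "a (Suc j) \<le> real m * 2 / t * a j" "a (Suc j) \<le> a j"
proof -
  show nn: "0 \<le> a j" for j
    using pos[of "m - Suc j"] by (cases "Suc j \<le> m") (auto simp: a_def binomial_eq_0 less_imp_le)
  show r: "a (Suc j) \<le> real m * 2 / t * a j"
  proof (cases "Suc (Suc j) \<le> m")
    case True
    let ?i = "m - Suc (Suc j)"
    have i: "m - Suc j = Suc ?i" "?i < m" using True by auto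
    have "poly (touch ?i) t \<le> 2 / t * poly (touch (Suc ?i)) t"
      using ratio[OF i(2)] t by (simp add: field_simps)
    then have "a (Suc j) \<le> (real m * real (m choose Suc j)) * (2 / t * poly (touch (Suc ?i)) t)"
      unfolding a_def using choose_Suc_le[of m "Suc j"] pos[OF i(2)] by (intro mult_mono) auto
    then show ?thesis unfolding a_def i(1) by (simp add: mult_ac)
  next
    case False
    then have "a (Suc j) = 0" by (simp add: a_def binomial_eq_0)
    then show ?thesis using nn[of j] t by simp
  qed
  have "real m * 2 / t \<le> 1" using t by (simp add: field_simps)
  then have "real m * 2 / t * a j \<le> 1 * a j" using nn by (intro mult_right_mono)
  then show "a (Suc j) \<le> a j" using r by simp
qed

text \<open>\<open>touch (Suc m)\<close> is \<open>t\<close> times the difference of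
  \<open>touch m\<close> and its derivative; the alternating sum for the derivative lies between 0
  and its first term, which is at most half of \<open>touch m\<close>.\<close>

lemma touch_ratio:
  fixes t :: real
  assumes "t > 0" "4 * real m \<le> t"
  shows "0 < poly (touch m) t \<and> t / 2 * poly (touch m) t \<le> poly (touch (Suc m)) t \<and>
         poly (touch (Suc m)) t \<le> t * poly (touch m) t"
  using assms(2)
proof (induction m rule: less_induct)
  case (less m)
  let ?a = "\<lambda>j. real (m choose Suc j) * poly (touch (m - Suc j)) t"
  have IH: "0 < poly (touch i) t" "t / 2 * poly (touch i) t \<le> poly (touch (Suc i)) t" if "i < m" for i
    using less.IH[OF that] less.prems that by auto
  note a = touch_alternating_terms[OF assms(1) less.prems IH]
  have pos: "0 < poly (touch m) t"
  proof (cases m)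
    case (Suc k)
    have "0 < t / 2 * poly (touch k) t" using IH(1)[of k] Suc assms by simp
    then show ?thesis using IH(2)[of k] Suc by simp
  qed simp
  let ?S = "\<Sum>j<m. (-1) ^ j * ?a j"
  have S: "0 \<le> ?S" "?S \<le> ?a 0" using alternating_sum_bounds[of ?a m] a by auto
  have "?a 0 \<le> poly (touch m) t / 2"
  proof (cases m)
    case (Suc k)
    have "poly (touch k) t \<le> 2 / t * poly (touch m) t" using IH(2)[of k] Suc assms by (simp add: field_simps)
    then have "?a 0 \<le> real m * (2 / t * poly (touch m) t)" using Suc by (intro mult_mono) (use IH(1)[of k] in auto)
    also have "\<dots> = (2 * real m / t) * poly (touch m) t" by simp
    also have "\<dots> \<le> 1 / 2 * poly (touch m) t"
      using pos less.prems assms by (intro mult_right_mono) (auto simp: field_simps)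
    finally show ?thesis by simp
  qed simp
  then have "t * (poly (touch m) t / 2) \<le> poly (touch (Suc m)) t" "poly (touch (Suc m)) t \<le> t * poly (touch m) t"
    unfolding poly_touch_Suc using S assms by (auto intro!: mult_left_mono)
  then show ?case using pos by simp
qed

text \<open>The derivative of \<open>touch m\<close> is \<open>m * touch (m - 1)\<close> up to a
  relative error of order \<open>y\<close>, and \<open>touch (m - 1)\<close> is about
  \<open>touch m / t\<close>. So each step multiplies by \<open>t * (1 - y)\<close> up to order
  \<open>y ^ 2\<close>, and the product over all steps yields the Gaussian factor.\<close>

lemma touch_ratio_refined:
  fixes t :: real
  assumes "t > 0" "4 * real m \<le> t"
  defines "y \<equiv> real m / t"
  shows "poly (touch (Suc m)) t \<le> t * poly (touch m) t * (1 - y * (1 - y))"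
    and "t * poly (touch m) t * (1 - y * (1 + 4 * y)) \<le> poly (touch (Suc m)) t"
proof -
  let ?p = "\<lambda>i. poly (touch i) t"
  have R: "0 < ?p i" "t / 2 * ?p i \<le> ?p (Suc i)" "?p (Suc i) \<le> t * ?p i" if "i \<le> m" for i
    using touch_ratio[OF assms(1), of i] that assms(2) by auto
  have "t * ?p m * (1 - y * (1 + 4 * y)) \<le> ?p (Suc m) \<and> ?p (Suc m) \<le> t * ?p m * (1 - y * (1 - y))"
  proof (cases m)
    case 0 then show ?thesis by (simp add: y_def poly_touch_Suc)
  next
    case (Suc k)
    let ?a = "\<lambda>j. real (m choose Suc j) * ?p (m - Suc j)"
    have a: "0 \<le> ?a j" "?a (Suc j) \<le> real m * 2 / t * ?a j" "?a (Suc j) \<le> ?a j" for j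
      using touch_alternating_terms[OF assms(1,2), of j] R by auto
    let ?S = "\<Sum>j<m. (-1) ^ j * ?a j"
    have S: "?S \<le> ?a 0" "?a 0 - ?a 1 \<le> ?S"
      using alternating_sum_bounds[of ?a m] alternating_sum_lower[of ?a k] a Suc by auto
    have y: "0 < y" "y \<le> 1 / 4" "real m = y * t" using assms Suc by (auto simp: y_def field_simps)
    have pk: "0 < ?p k" "0 < ?p m" using R Suc by auto
    have a0: "?a 0 = real m * ?p k" using Suc by simp
    have lo: "?p m * (1 - y * (1 + 4 * y)) \<le> ?p m - ?S"
    proof -
      \<comment> \<open>One more use of the recursion, at \<open>k = m - 1\<close>, bounds
        \<open>touch k\<close> from above by a multiple of \<open>touch m\<close>.\<close>
      have "(1 - 2 * y) * (t * ?p k) \<le> ?p m"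
      proof (cases k)
        case 0 
        then show ?thesis using Suc y assms(1) by (simp add: poly_touch_Suc mult_right_le_one_le)
      next
        case (Suc l)
        let ?b = "\<lambda>j. real (k choose Suc j) * ?p (k - Suc j)"
        have b: "0 \<le> ?b j" "?b (Suc j) \<le> ?b j" for j
          using touch_alternating_terms[of t k j] assms R \<open>m = Suc k\<close> by auto
        have "(\<Sum>j<k. (-1) ^ j * ?b j) \<le> real k * ?p l"
          using alternating_sum_bounds[of ?b k] b Suc by auto
        also have "\<dots> \<le> real m * (2 / t * ?p k)"
          using R(1)[of l] R(2)[of l] Suc \<open>m = Suc k\<close> assms(1) by (intro mult_mono) (auto simp: field_simps)
        also have "\<dots> = 2 * y * ?p k" using assms(1) by (simp add: y_def)
        finally have "t * (?p k - 2 * y * ?p k) \<le> ?p m"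
          unfolding \<open>m = Suc k\<close> poly_touch_Suc using assms(1) by (intro mult_left_mono) auto
        then show ?thesis by (simp add: algebra_simps)
      qed
      then have "t * ?p k \<le> ?p m / (1 - 2 * y)" using y by (simp add: field_simps)
      also have "\<dots> \<le> ?p m * (1 + 4 * y)"
      proof -
        have "1 \<le> (1 + 4 * y) * (1 - 2 * y)" using y by (simp add: algebra_simps)
        then have "?p m * 1 \<le> ?p m * ((1 + 4 * y) * (1 - 2 * y))" using pk by (intro mult_left_mono) auto
        then show ?thesis using y by (simp add: field_simps)
      qed
      finally have "y * (t * ?p k) \<le> y * (?p m * (1 + 4 * y))" using y by (intro mult_left_mono) auto
      moreover have "?S \<le> y * (t * ?p k)"
      proof -
        have "?a 0 = y * (t * ?p k)" unfolding a0 y(3) by simp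
        then show ?thesis using S(1) by linarith
      qed
      ultimately show ?thesis by (simp add: algebra_simps)
    qed
    have hi: "?p m - ?S \<le> ?p m * (1 - y * (1 - y))"
    proof -
      have "?a 1 \<le> y * ?a 0"
      proof (cases k)
        case 0 then show ?thesis using Suc y pk by (simp add: binomial_eq_0)
      next
        case (Suc l)
        have "real (m choose 2) = real m * real k / 2"
        proof -
          have "Suc 1 * (m choose Suc 1) = m * k"
            using binomial_absorption[of 1 m] \<open>m = Suc k\<close> by simp
          then have "real (Suc 1 * (m choose Suc 1)) = real (m * k)" by (rule arg_cong)
          then show ?thesis by (simp add: numeral_2_eq_2)
        qed
        moreover have "m choose Suc 1 = m choose 2" by (simp add: numeral_2_eq_2)
        ultimately have "?a 1 = real m * real k / 2 * ?p l" using Suc \<open>m = Suc k\<close> by simp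
        also have "\<dots> \<le> real m * real m / 2 * (2 / t * ?p k)"
          using R(1)[of l] R(2)[of l] Suc \<open>m = Suc k\<close> assms(1) by (intro mult_mono) (auto simp: field_simps)
        also have "\<dots> = y * ?a 0" unfolding a0 using assms(1) by (simp add: y_def)
        finally show ?thesis .
      qed
      then have "?a 0 * (1 - y) \<le> ?S" using S(2) by (simp add: algebra_simps)
      moreover have "y * ?p m \<le> ?a 0"
      proof -
        have "y * ?p m \<le> y * (t * ?p k)" using R(3)[of k] Suc y by (intro mult_left_mono) auto
        then show ?thesis unfolding a0 y(3) by (simp add: mult_ac)
      qed
      then have "y * ?p m * (1 - y) \<le> ?a 0 * (1 - y)" using y by (intro mult_right_mono) auto
      ultimately show ?thesis by (simp add: algebra_simps)
    qed
    have "?p (Suc m) = t * (?p m - ?S)" by (rule poly_touch_Suc)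
    moreover have "t * (?p m * (1 - y * (1 + 4 * y))) \<le> t * (?p m - ?S)"
      using lo assms(1) by (intro mult_left_mono) auto
    moreover have "t * (?p m - ?S) \<le> t * (?p m * (1 - y * (1 - y)))"
      using hi assms(1) by (intro mult_left_mono) auto
    ultimately show ?thesis by (simp add: mult.assoc)
  qed
  then show "?p (Suc m) \<le> t * ?p m * (1 - y * (1 - y))" "t * ?p m * (1 - y * (1 + 4 * y)) \<le> ?p (Suc m)"
    by auto
qed

text \<open>The successive ratios contribute factors \<open>1 - y * (1 - y)\<close> with
  \<open>y = j / t\<close>, each at most \<open>exp (- \<theta> * y)\<close> since
  \<open>1 - y \<ge> \<theta>\<close>; the numbers \<open>j < m\<close> add up to
  \<open>m * (m - 1) / 2\<close>.\<close>

lemma touch_upper: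
  fixes t :: real
  assumes t: "t > 0" "4 * real M \<le> t" "real M \<le> (1 - \<theta>) * t" and "m \<le> M"
  shows "poly (touch m) t \<le> t ^ m * exp (- \<theta> * (real m * (real m - 1) / (2 * t)))"
  using assms(4)
proof (induction m)
  case (Suc m)
  have m: "4 * real m \<le> t" "real m \<le> (1 - \<theta>) * t" using Suc.prems t by auto
  define y where "y = real m / t"
  have y: "0 \<le> y" "\<theta> \<le> 1 - y" using m t by (auto simp: y_def field_simps)
  have p: "0 < poly (touch m) t" using touch_ratio[OF t(1) m(1)] by simp
  have "poly (touch (Suc m)) t \<le> t * poly (touch m) t * (1 - y * (1 - y))"
    using touch_ratio_refined(1)[OF t(1) m(1)] by (simp add: y_def)
  also have "\<dots> \<le> t * poly (touch m) t * exp (- (\<theta> * y))"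
  proof (rule mult_left_mono)
    have "y * \<theta> \<le> y * (1 - y)" using y by (intro mult_left_mono) auto
    then show "1 - y * (1 - y) \<le> exp (- (\<theta> * y))"
      using exp_ge_add_one_self[of "- (\<theta> * y)"] by (simp add: mult.commute)
  qed (use t p in auto)
  also have "\<dots> \<le> t * (t ^ m * exp (- \<theta> * (real m * (real m - 1) / (2 * t)))) * exp (- (\<theta> * y))"
    using Suc t by (intro mult_right_mono mult_left_mono) auto
  also have "\<dots> = t ^ Suc m * exp (- \<theta> * (real m * (real m - 1) / (2 * t)) + - (\<theta> * y))"
    by (simp only: exp_add) (simp add: mult_ac)
  also have "- \<theta> * (real m * (real m - 1) / (2 * t)) + - (\<theta> * y) =
      - \<theta> * (real (Suc m) * (real (Suc m) - 1) / (2 * t))"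
    using t by (simp add: y_def field_simps)
  finally show ?case .
qed simp

lemma touch_lower:
  fixes t :: real
  assumes t: "t > 0" "4 * real M \<le> t" and "m \<le> M"
  shows "t ^ m * exp (- (1 + 12 * (M / t)) * (real m * (real m - 1) / (2 * t))) \<le> poly (touch m) t"
  using assms(3)
proof (induction m)
  case (Suc m)
  let ?c = "1 + 12 * (M / t)"
  have m: "4 * real m \<le> t" using Suc.prems t by auto
  define y where "y = real m / t"
  have y: "0 \<le> y" "y \<le> 1 / 4" using m t by (auto simp: y_def field_simps)
  have p: "0 < poly (touch m) t" using touch_ratio[OF t(1) m] by simp
  define z where "z = y * (1 + 4 * y)"
  have z: "0 \<le> z" "z \<le> 2 * y" using y mult_left_mono[of "1 + 4 * y" 2 y] by (auto simp: z_def mult.commute)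
  have "y \<le> M / t" using Suc.prems t by (auto simp: y_def field_simps)
  have "exp (- ?c * y) \<le> exp (- z - 2 * z\<^sup>2)"
  proof -
    \<comment> \<open>\<open>z\<close> exceeds \<open>y\<close> by \<open>4 * y ^ 2\<close>, and the
      bound for the logarithm costs another \<open>8 * y ^ 2\<close>; together they give the
      constant 12.\<close>
    have "2 * z\<^sup>2 \<le> 8 * y\<^sup>2" using z power_mono[of z "2 * y" 2] by simp
    then have "z + 2 * z\<^sup>2 \<le> (1 + 12 * y) * y" by (simp add: z_def algebra_simps power2_eq_square)
    also have "\<dots> \<le> ?c * y" using y \<open>y \<le> M / t\<close> by (intro mult_right_mono) auto
    finally have "- (?c * y) \<le> - z - 2 * z\<^sup>2" by linarith
    then show ?thesis by (simp only: exp_le_cancel_iff mult_minus_left)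
  qed
  also have "\<dots> \<le> 1 - z"
  proof -
    have "- z - 2 * z\<^sup>2 \<le> ln (1 - z)" using z y by (intro ln_one_minus_pos_lower_bound) auto
    then have "exp (- z - 2 * z\<^sup>2) \<le> exp (ln (1 - z))" by simp
    then show ?thesis using z y by simp
  qed
  finally have e: "exp (- ?c * y) \<le> 1 - z" .
  have "t ^ Suc m * exp (- ?c * (real (Suc m) * (real (Suc m) - 1) / (2 * t))) =
      t ^ Suc m * exp (- ?c * (real m * (real m - 1) / (2 * t)) + - ?c * y)"
  proof -
    have "real (Suc m) * (real (Suc m) - 1) / (2 * t) = real m * (real m - 1) / (2 * t) + y"
      using t by (simp add: y_def field_simps)
    then show ?thesis by (simp only: distrib_left)
  qed
  also have "\<dots> = t * (t ^ m * exp (- ?c * (real m * (real m - 1) / (2 * t)))) * exp (- ?c * y)"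
    by (simp only: exp_add) (simp add: mult_ac)
  also have "\<dots> \<le> t * poly (touch m) t * (1 - z)"
    using Suc t e p by (intro mult_mono) auto
  also have "\<dots> \<le> poly (touch (Suc m)) t"
    using touch_ratio_refined(2)[OF t(1) m] by (simp add: z_def y_def)
  finally show ?case .
qed simp

text \<open>For small \<open>t\<close> the polynomial can change sign and only its absolute value is
  controlled. The recursion leads to a binomial sum \<open>(1 + 3 * s) ^ k\<close>, which exceeds
  \<open>(3 * s) ^ k\<close> by a factor of at most \<open>exp 1 \<le> 3\<close> as long as
  \<open>k \<le> 3 * s\<close>.\<close>

lemma touch_abs_le:
  fixes s t :: real
  assumes "0 \<le> t" "t \<le> s" "0 < s" "real m \<le> 3 * s"
  shows "\<bar>poly (touch m) t\<bar> \<le> (3 * s) ^ m"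
  using assms(4)
proof (induction m rule: less_induct)
  case (less m)
  show ?case
  proof (cases m)
    case (Suc k)
    let ?a = "\<lambda>j. (-1) ^ j * (real (k choose j) * poly (touch (k - j)) t)"
    have "poly (touch m) t = t * (\<Sum>j\<le>k. ?a j)"
      unfolding Suc poly_touch_Suc by (subst sum.atMost_shift) (simp add: sum_negf)
    also have "\<bar>\<dots>\<bar> \<le> s * (\<Sum>j\<le>k. real (k choose j) * (3 * s) ^ (k - j))"
      unfolding abs_mult
    proof (intro mult_mono order.trans[OF sum_abs] sum_mono)
      fix j assume "j \<in> {..k}"
      then have "\<bar>poly (touch (k - j)) t\<bar> \<le> (3 * s) ^ (k - j)"
        using less Suc by (intro less.IH) auto
      then show "\<bar>?a j\<bar> \<le> real (k choose j) * (3 * s) ^ (k - j)"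
        by (simp add: abs_mult mult_left_mono)
    qed (use assms in auto)
    also have "(\<Sum>j\<le>k. real (k choose j) * (3 * s) ^ (k - j)) = (1 + 3 * s) ^ k"
      by (subst binomial_ring) simp
    also have "1 + 3 * s = 3 * s * (1 + 1 / (3 * s))" using assms by (simp add: field_simps)
    also have "(3 * s * (1 + 1 / (3 * s))) ^ k \<le> (3 * s) ^ k * 3"
    proof -
      have "(1 + 1 / (3 * s)) ^ k \<le> exp (1 / (3 * s)) ^ k"
        using assms by (intro power_mono) auto
      also have "\<dots> = exp (real k / (3 * s))" by (simp add: exp_of_nat_mult[symmetric])
      also have "\<dots> \<le> exp 1" using assms less.prems Suc by (simp add: field_simps)
      also have "\<dots> \<le> 3" by (rule exp_le)
      finally show ?thesis unfolding power_mult_distrib using assms by (intro mult_left_mono) auto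
    qed
    finally show ?thesis using assms Suc by (simp add: mult_ac)
  qed simp
qed

section \<open>The count as an integral against \<open>exp (- t)\<close>\<close>

lemma has_integral_power_exp:
  fixes a :: real
  assumes "a > 0"
  shows "((\<lambda>t. t ^ n * exp (- (a * t))) has_integral (fact n / a ^ Suc n)) {0<..}"
proof -
  let ?f = "\<lambda>t::real. t ^ n * exp (- t)"
  have "((\<lambda>t. t powr (real (Suc n) - 1) / exp t) has_integral Gamma (real (Suc n))) {0..}"
    by (rule Gamma_integral_real) simp
  then have "((\<lambda>t. t powr (real (Suc n) - 1) / exp t) has_integral Gamma (real (Suc n))) {0<..}"
    by (subst has_integral_spike_set_eq[where T = "{0..}"]) (auto intro: negligible_subset[of "{0}"])
  then have "((\<lambda>t. t powr (real (Suc n) - 1) / exp t) has_integral fact n) {0<..}"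
    using Gamma_fact[of n, where 'a = real] by (simp add: add.commute)
  then have f: "(?f has_integral fact n) {0<..}"
    by (rule has_integral_eq[rotated]) (auto simp: powr_realpow exp_minus divide_inverse)
  have "?f absolutely_integrable_on {0<..} \<and> integral {0<..} ?f = fact n"
    using f by (subst absolutely_integrable_on_iff_nonneg) (auto simp: integrable_on_def integral_unique)
  moreover have img: "(\<lambda>x. a * x) ` {0<..} = {0<..}"
  proof -
    have "x \<in> (\<lambda>x. a * x) ` {0<..}" if "x > 0" for x
      using that assms by (intro image_eqI[of _ _ "x / a"]) auto
    then show ?thesis using assms by auto
  qed
  ultimately have "(\<lambda>x. \<bar>a\<bar> * ?f (a * x)) absolutely_integrable_on {0<..} \<and>
      integral {0<..} (\<lambda>x. \<bar>a\<bar> * ?f (a * x)) = fact n"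
    using assms by (subst has_absolute_integral_change_of_variables_1'[where g = "\<lambda>x. a * x" and g' = "\<lambda>_. a"])
      (auto intro!: derivative_eq_intros inj_onI)
  then have "((\<lambda>x. \<bar>a\<bar> * ?f (a * x)) has_integral fact n) {0<..}"
    by (simp add: has_integral_iff set_lebesgue_integral_eq_integral(1))
  then have "((\<lambda>x. inverse (a ^ Suc n) * (\<bar>a\<bar> * ?f (a * x))) has_integral (inverse (a ^ Suc n) * fact n)) {0<..}"
    by (rule has_integral_mult_right)
  moreover have "inverse (a ^ Suc n) * (\<bar>a\<bar> * ?f (a * x)) = x ^ n * exp (- (a * x))" for x
    using assms by (simp add: power_mult_distrib field_simps)
  ultimately have "((\<lambda>x. x ^ n * exp (- (a * x))) has_integral (inverse (a ^ Suc n) * fact n)) {0<..}"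
    by (simp only:)
  then show ?thesis by (simp only: divide_inverse_commute)
qed

lemma has_integral_facL: "((\<lambda>t. exp (- t) * poly q t) has_integral facL q) {0<..}"
proof -
  have "((\<lambda>t. \<Sum>k\<le>degree q. coeff q k * (t ^ k * exp (- (1 * t)))) has_integral
      (\<Sum>k\<le>degree q. coeff q k * (fact k / 1 ^ Suc k))) {0<..}"
    by (intro has_integral_sum has_integral_mult_right has_integral_power_exp) auto
  then show ?thesis
    by (simp add: facL_def poly_altdef sum_distrib_left mult_ac)
qed

lemma AO_eq_facL: "real (AO (complete_multipartite ks)) = facL (prod_list (map touch ks))"
proof -
  have "real (AO (complete_multipartite ks)) =
      facL (\<Prod>i<length ks. touch (card {v \<in> multipartite_verts ks. fst v = i}))"
    unfolding AO_eq_card_acyc_or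
    by (rule card_acyc_or_facL[OF finite_multipartite_verts]) (auto simp: multipartite_verts_def)
  also have "(\<Prod>i<length ks. touch (card {v \<in> multipartite_verts ks. fst v = i})) =
      (\<Prod>i<length ks. touch (ks ! i))"
  proof (intro prod.cong refl arg_cong[where f = touch])
    fix i assume "i \<in> {..<length ks}"
    then have "{v \<in> multipartite_verts ks. fst v = i} = Pair i ` {..<ks ! i}"
      by (auto simp: multipartite_verts_def)
    then show "card {v \<in> multipartite_verts ks. fst v = i} = ks ! i"
      by (simp add: card_image inj_on_def)
  qed
  also have "\<dots> = prod_list (map touch ks)"
    by (simp add: prod.list_conv_set_nth lessThan_atLeast0)
  finally show ?thesis .
qed

lemma card_multipartite_verts: "card (multipartite_verts ks) = sum_list ks"
proof -
  have "multipartite_verts ks = Sigma {..<length ks} (\<lambda>i. {..<ks ! i})"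
    by (auto simp: multipartite_verts_def)
  then show ?thesis by (simp add: sum_list_sum_nth lessThan_atLeast0)
qed

lemma poly_prod_list: "poly (prod_list ps) t = prod_list (map (\<lambda>p. poly p t) ps)"
  by (induction ps) auto

lemma prod_list_map_mono:
  fixes f g :: "'a \<Rightarrow> real"
  assumes "\<And>k. k \<in> set ks \<Longrightarrow> 0 \<le> f k \<and> f k \<le> g k"
  shows "0 \<le> prod_list (map f ks) \<and> prod_list (map f ks) \<le> prod_list (map g ks)"
  using assms by (induction ks) (auto intro!: mult_mono mult_nonneg_nonneg, smt (verit))

lemma prod_list_power_exp:
  fixes t :: real
  shows "prod_list (map (\<lambda>k. t ^ k * exp (a * f k)) ks) = t ^ sum_list ks * exp (a * sum_list (map f ks))"
  by (induction ks) (auto simp: power_add exp_add algebra_simps)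

lemma prod_list_power: "prod_list (map (\<lambda>k. (t::real) ^ k) ks) = t ^ sum_list ks"
  by (induction ks) (auto simp: power_add)

lemma abs_prod_list: "\<bar>prod_list (map f ks)\<bar> = prod_list (map (\<lambda>k. \<bar>f k :: real\<bar>) ks)"
  by (induction ks) (auto simp: abs_mult)

text \<open>Twice the number of vertex pairs inside a common part; this is the form in which the
  exponents of \<open>touch_upper\<close> and \<open>touch_lower\<close> accumulate over the
  parts.\<close>

definition pairs2 :: "nat list \<Rightarrow> real" where
  "pairs2 ks = sum_list (map (\<lambda>k. real k * (real k - 1)) ks)"

lemma pairs2_nonneg: "0 \<le> pairs2 ks"
proof -
  have "0 \<le> real k * (real k - 1)" for k by (cases k) auto
  then show ?thesis unfolding pairs2_def by (intro sum_list_nonneg) auto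
qed

lemma power_self_le_fact_exp: "real n ^ n \<le> fact n * exp (real n)"
proof -
  have "real n ^ n / fact n \<le> exp (real n)"
  proof -
    have s: "(\<lambda>k. real n ^ k /\<^sub>R fact k) sums exp (real n)" by (rule exp_converges)
    have "(\<Sum>k\<in>{n}. real n ^ k /\<^sub>R fact k) \<le> (\<Sum>k. real n ^ k /\<^sub>R fact k)"
      by (rule sum_le_suminf) (use s in \<open>auto simp: sums_iff\<close>)
    then show ?thesis using s by (simp add: sums_iff divide_inverse_commute)
  qed
  then show ?thesis by (simp add: field_simps)
qed

text \<open>All majorants and minorants of the integrand in the following bounds have this shape;
  \<open>a = 0\<close> is the untilted integral, and a small nonzero \<open>a\<close> penalises one
  side of \<open>t = n\<close>.\<close>

lemma has_integral_power_exp_shift: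
  fixes a b :: real
  assumes "a < 1"
  shows "((\<lambda>t. exp (- t) * t ^ n * exp (a * t + b)) has_integral (exp b * fact n / (1 - a) ^ Suc n)) {0<..}"
proof -
  have "((\<lambda>t. exp b * (t ^ n * exp (- ((1 - a) * t)))) has_integral (exp b * (fact n / (1 - a) ^ Suc n))) {0<..}"
    using assms by (intro has_integral_mult_right has_integral_power_exp) auto
  moreover have "exp b * (t ^ n * exp (- ((1 - a) * t))) = exp (- t) * t ^ n * exp (a * t + b)" for t
  proof -
    have "- ((1 - a) * t) + b = - t + (a * t + b)" by (simp add: algebra_simps)
    then have "exp (- ((1 - a) * t)) * exp b = exp (- t) * exp (a * t + b)" by (metis exp_add)
    then show ?thesis by (simp add: mult_ac)
  qed
  ultimately show ?thesis by simp
qed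

section \<open>Bounds for a single complete multipartite graph\<close>

lemma touch_le_power:
  fixes t :: real
  assumes "t > 0" "4 * real k \<le> t"
  shows "0 \<le> poly (touch k) t \<and> poly (touch k) t \<le> t ^ k"
proof -
  have "real k \<le> (1 - 0) * t" using assms by simp
  then have "poly (touch k) t \<le> t ^ k * exp (- 0 * (real k * (real k - 1) / (2 * t)))"
    by (intro touch_upper[OF assms]) auto
  moreover have "0 < poly (touch k) t" using touch_ratio[OF assms] by blast
  ultimately show ?thesis by (simp only: minus_zero mult_zero_left exp_zero mult_1_right less_imp_le)
qed

text \<open>The half-line is cut at \<open>4 * \<epsilon> * n\<close> and at
  \<open>(1 \<plusminus> 4 * s) * n\<close>. In the central window the Gaussian bound holds with
  \<open>\<theta> = 1 - 2 * \<epsilon>\<close>, because every part is at most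
  \<open>2 * \<epsilon> * t\<close> there. On either side of the window the trivial bound
  \<open>t ^ n\<close> is multiplied by an exponential tilt that is at least 1, and near 0 only
  \<open>touch_abs_le\<close> is available. The four majorants are added, so that each can be
  integrated over the whole half-line in closed form.\<close>

lemma AO_upper:
  fixes ks :: "nat list" and \<epsilon> s :: real
  assumes n: "sum_list ks = n" "n > 0" and small: "\<And>k. k \<in> set ks \<Longrightarrow> real k \<le> \<epsilon> * n"
    and eps: "0 < \<epsilon>" "\<epsilon> \<le> 1/64" and s: "0 < s" "s \<le> 1/8"
  shows "real (AO (complete_multipartite ks)) / fact n \<le>
     exp (- ((1 - 2 * \<epsilon>) / (1 + 4 * s)) * (pairs2 ks / (2 * n))) +
     ((12 * \<epsilon> * exp 1) ^ n + exp (- 3 * s\<^sup>2 * n) + 2 * exp (- 2 * s\<^sup>2 * n))"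
proof -
  let ?f = "\<lambda>t. prod_list (map (\<lambda>k. poly (touch k) t) ks)"
  let ?E = "exp (- ((1 - 2 * \<epsilon>) / (1 + 4 * s)) * (pairs2 ks / (2 * n)))"
  let ?u = "(1 - 4 * s) * n" and ?v = "(1 + 4 * s) * n"
  have npos: "0 < real n" using n by simp
  have en: "0 < \<epsilon> * n" using eps npos by simp
  have bd: "exp (- t) * ?f t \<le> (12 * \<epsilon> * n) ^ n * (exp (- t) * t ^ 0 * exp (0 * t + 0)) +
     ?E * (exp (- t) * t ^ n * exp (0 * t + 0)) +
     exp (- t) * t ^ n * exp ((- s) * t + s * ?u) + exp (- t) * t ^ n * exp (s * t + - s * ?v)"
    (is "_ \<le> ?b1 + ?b2 + ?b3 + ?b4") if t: "t \<ge> 0" for t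
  proof -
    have b: "0 \<le> ?b1" "0 \<le> ?b2" "0 \<le> ?b3" "0 \<le> ?b4" using t eps by auto
    consider "t \<le> 4 * \<epsilon> * n" | "4 * \<epsilon> * n \<le> t" "t \<le> ?u" | "4 * \<epsilon> * n \<le> t" "?u \<le> t" "t \<le> ?v"
      | "4 * \<epsilon> * n \<le> t" "?v \<le> t" by linarith
    then show ?thesis
    proof cases
      case 1
      have "\<bar>?f t\<bar> \<le> prod_list (map (\<lambda>k. (3 * (4 * \<epsilon> * n)) ^ k) ks)"
        unfolding abs_prod_list
      proof (rule conjunct2[OF prod_list_map_mono], intro conjI)
        fix k assume "k \<in> set ks"
        then have "real k \<le> 3 * (4 * \<epsilon> * n)" using small[of k] en by linarith
        then show "\<bar>poly (touch k) t\<bar> \<le> (3 * (4 * \<epsilon> * n)) ^ k"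
          using 1 t eps npos by (intro touch_abs_le) auto
      qed auto
      also have "\<dots> = (12 * \<epsilon> * n) ^ n" unfolding prod_list_power n by (simp add: mult_ac)
      finally have "exp (- t) * ?f t \<le> exp (- t) * (12 * \<epsilon> * n) ^ n" by (intro mult_left_mono) auto
      also have "\<dots> = ?b1" by simp
      finally show ?thesis using b by linarith
    next
      case 2
      have tpos: "t > 0" using 2 en by linarith
      have "0 \<le> ?f t \<and> ?f t \<le> prod_list (map (\<lambda>k. t ^ k) ks)"
      proof (rule prod_list_map_mono)
        fix k assume "k \<in> set ks"
        then have k: "4 * real k \<le> t" using small[of k] 2 by simp
        show "0 \<le> poly (touch k) t \<and> poly (touch k) t \<le> t ^ k"
by (rule touch_le_power[OF tpos k])
      qed
      then have "exp (- t) * ?f t \<le> exp (- t) * t ^ n" unfolding prod_list_power n by (intro mult_left_mono) auto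
      also have "\<dots> \<le> ?b3"
      proof -
        have "s * t \<le> s * ?u" using 2 s by (intro mult_left_mono) auto
        then have "0 \<le> (- s) * t + s * ?u" by simp
        then have "exp (- t) * t ^ n * 1 \<le> ?b3" using t by (intro mult_left_mono) auto
        then show ?thesis by simp
      qed
      finally show ?thesis using b by linarith
    next
      case 3
      have tpos: "t > 0" using 3 en by linarith
      have nt: "n \<le> 2 * t" 
      proof -
        have "1 / 2 * real n \<le> (1 - 4 * s) * real n" using s by (intro mult_right_mono) auto
        then show ?thesis using 3 by linarith
      qed
      have "?f t \<le> prod_list (map (\<lambda>k. t ^ k * exp ((- (1 - 2 * \<epsilon>)/(2 * t)) * (real k * (real k - 1)))) ks)"
      proof (rule conjunct2[OF prod_list_map_mono])
        fix k assume kk: "k \<in> set ks"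
        then have k: "4 * real k \<le> t" using small[of k] 3 by simp
        have k2: "real k \<le> (1 - (1 - 2 * \<epsilon>)) * t" 
        proof -
          have "\<epsilon> * n \<le> \<epsilon> * (2 * t)" using nt eps by (intro mult_left_mono) auto
          then show ?thesis using small[OF kk] by (simp add: algebra_simps)
        qed
        show "0 \<le> poly (touch k) t \<and> poly (touch k) t \<le> t ^ k * exp ((- (1 - 2 * \<epsilon>)/(2 * t)) * (real k * (real k - 1)))"
        proof
          show "0 \<le> poly (touch k) t" using touch_ratio[OF tpos k] by linarith
          have "- (1 - 2 * \<epsilon>) * (real k * (real k - 1) / (2 * t)) = (- (1 - 2 * \<epsilon>)/(2 * t)) * (real k * (real k - 1))"
            by simp
          then show "poly (touch k) t \<le> t ^ k * exp ((- (1 - 2 * \<epsilon>)/(2 * t)) * (real k * (real k - 1)))"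
            using touch_upper[OF tpos k k2, of k] by (simp only:) 
        qed
      qed
      also have "\<dots> = t ^ n * exp ((- (1 - 2 * \<epsilon>)/(2 * t)) * pairs2 ks)"
        unfolding prod_list_power_exp n pairs2_def ..
      also have "\<dots> \<le> t ^ n * ?E"
      proof -
        have "(1 - 2 * \<epsilon>) * pairs2 ks / (2 * ?v) \<le> (1 - 2 * \<epsilon>) * pairs2 ks / (2 * t)"
          using 3 tpos eps s npos pairs2_nonneg[of ks] by (intro divide_left_mono mult_nonneg_nonneg mult_pos_pos) auto
        moreover have "(1 - 2 * \<epsilon>) * pairs2 ks / (2 * ?v) = ((1 - 2 * \<epsilon>) / (1 + 4 * s)) * (pairs2 ks / (2 * n))"
          by (simp add: field_simps)
        moreover have "(- (1 - 2 * \<epsilon>)/(2 * t)) * pairs2 ks = - ((1 - 2 * \<epsilon>) * pairs2 ks / (2 * t))"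
          by (simp only: times_divide_eq_left mult_minus_left minus_divide_left)
        moreover have "- ((1 - 2 * \<epsilon>) / (1 + 4 * s)) * (pairs2 ks / (2 * n)) =
            - (((1 - 2 * \<epsilon>) / (1 + 4 * s)) * (pairs2 ks / (2 * n)))" by (rule mult_minus_left)
        ultimately have "(- (1 - 2 * \<epsilon>)/(2 * t)) * pairs2 ks \<le> - ((1 - 2 * \<epsilon>) / (1 + 4 * s)) * (pairs2 ks / (2 * n))"
          by linarith
        then show ?thesis using t by (intro mult_left_mono) (simp_all only: exp_le_cancel_iff, simp)
      qed
      finally have "exp (- t) * ?f t \<le> exp (- t) * (t ^ n * ?E)" by (intro mult_left_mono) auto
      also have "\<dots> = ?b2" by simp
      finally show ?thesis using b by linarith
    next
      case 4
      have tpos: "t > 0" using 4 en by linarith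
      have "0 \<le> ?f t \<and> ?f t \<le> prod_list (map (\<lambda>k. t ^ k) ks)"
      proof (rule prod_list_map_mono)
        fix k assume "k \<in> set ks"
        then have k: "4 * real k \<le> t" using small[of k] 4 by simp
        show "0 \<le> poly (touch k) t \<and> poly (touch k) t \<le> t ^ k"
by (rule touch_le_power[OF tpos k])
      qed
      then have "exp (- t) * ?f t \<le> exp (- t) * t ^ n" unfolding prod_list_power n by (intro mult_left_mono) auto
      also have "\<dots> \<le> ?b4"
      proof -
        have "s * ?v \<le> s * t" using 4 s by (intro mult_left_mono) auto
        then have "0 \<le> s * t + - s * ?v" by simp
        then have "exp (- t) * t ^ n * 1 \<le> ?b4" using t by (intro mult_left_mono) auto
        then show ?thesis by simp
      qed
      finally show ?thesis using b by linarith
    qed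
  qed
  have "((\<lambda>t. exp (- t) * ?f t) has_integral real (AO (complete_multipartite ks))) {0<..}"
    using has_integral_facL[of "prod_list (map touch ks)"]
    by (simp add: AO_eq_facL poly_prod_list o_def)
  moreover have "((\<lambda>t. (12 * \<epsilon> * n) ^ n * (exp (- t) * t ^ 0 * exp (0 * t + 0)) +
     ?E * (exp (- t) * t ^ n * exp (0 * t + 0)) +
     exp (- t) * t ^ n * exp ((- s) * t + s * ?u) + exp (- t) * t ^ n * exp (s * t + - s * ?v)) has_integral
     ((12 * \<epsilon> * n) ^ n * (exp 0 * fact 0 / (1 - 0) ^ Suc 0) + ?E * (exp 0 * fact n / (1 - 0) ^ Suc n) +
      exp (s * ?u) * fact n / (1 - - s) ^ Suc n + exp (- s * ?v) * fact n / (1 - s) ^ Suc n)) {0<..}"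
    using s by (intro has_integral_add has_integral_mult_right has_integral_power_exp_shift) auto
  ultimately have "real (AO (complete_multipartite ks)) \<le>
     (12 * \<epsilon> * n) ^ n * (exp 0 * fact 0 / (1 - 0) ^ Suc 0) + ?E * (exp 0 * fact n / (1 - 0) ^ Suc n) +
      exp (s * ?u) * fact n / (1 - - s) ^ Suc n + exp (- s * ?v) * fact n / (1 - s) ^ Suc n"
    by (rule has_integral_le) (rule bd, simp)
  then have "real (AO (complete_multipartite ks)) / fact n \<le>
     ((12 * \<epsilon> * n) ^ n + ?E * fact n + exp (s * ?u) * fact n / (1 + s) ^ Suc n
      + exp (- s * ?v) * fact n / (1 - s) ^ Suc n) / fact n" by (intro divide_right_mono) auto
  also have "\<dots> = (12 * \<epsilon> * n) ^ n / fact n + ?E + exp (s * ?u) / (1 + s) ^ Suc n + exp (- s * ?v) / (1 - s) ^ Suc n"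
    by (simp add: add_divide_distrib)
  also have "\<dots> \<le> (12 * \<epsilon> * exp 1) ^ n + ?E + exp (- 3 * s\<^sup>2 * n) + 2 * exp (- 2 * s\<^sup>2 * n)"
  proof (intro add_mono order_refl)
    have "(12 * \<epsilon> * n) ^ n / fact n = (12 * \<epsilon>) ^ n * (real n ^ n / fact n)" by (simp add: power_mult_distrib)
    also have "\<dots> \<le> (12 * \<epsilon>) ^ n * exp (real n)"
      using power_self_le_fact_exp[of n] eps by (intro mult_left_mono) (auto simp: field_simps)
    also have "\<dots> = (12 * \<epsilon> * exp 1) ^ n" by (simp add: power_mult_distrib exp_of_nat_mult[symmetric])
    finally show "(12 * \<epsilon> * n) ^ n / fact n \<le> (12 * \<epsilon> * exp 1) ^ n" .
    show "exp (s * ?u) / (1 + s) ^ Suc n \<le> exp (- 3 * s\<^sup>2 * n)"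
    proof -
      have "exp (s - s\<^sup>2) ^ n \<le> (1 + s) ^ n"
      proof (rule power_mono)
        have "s - s\<^sup>2 \<le> ln (1 + s)" using s by (intro ln_one_plus_pos_lower_bound) auto
        then have "exp (s - s\<^sup>2) \<le> exp (ln (1 + s))" by simp
        then show "exp (s - s\<^sup>2) \<le> 1 + s" using s by simp
      qed auto
      also have "(1 + s) ^ n \<le> (1 + s) ^ Suc n" using s by (intro power_increasing) auto
      finally have "exp (s * ?u) / (1 + s) ^ Suc n \<le> exp (s * ?u) / exp (s - s\<^sup>2) ^ n"
        using s by (intro divide_left_mono) auto
      also have "\<dots> = exp (s * ?u - real n * (s - s\<^sup>2))" by (simp add: exp_diff exp_of_nat_mult)
      \<comment> \<open>The position of the cut gains \<open>4 * s ^ 2 * n\<close> in the exponent,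
        and the bound for \<open>(1 + s) ^ n\<close> takes back only
        \<open>s ^ 2 * n\<close>.\<close>
      also have "s * ?u - real n * (s - s\<^sup>2) = - 3 * s\<^sup>2 * n" by (simp add: algebra_simps power2_eq_square)
      finally show ?thesis .
    qed
    show "exp (- s * ?v) / (1 - s) ^ Suc n \<le> 2 * exp (- 2 * s\<^sup>2 * n)"
    proof -
      have "exp (- s - 2 * s\<^sup>2) ^ n \<le> (1 - s) ^ n"
      proof (rule power_mono)
        have "- s - 2 * s\<^sup>2 \<le> ln (1 - s)" using s by (intro ln_one_minus_pos_lower_bound) auto
        then have "exp (- s - 2 * s\<^sup>2) \<le> exp (ln (1 - s))" by simp
        then show "exp (- s - 2 * s\<^sup>2) \<le> 1 - s" using s by simp
      qed auto
      then have "1 / 2 * exp (- s - 2 * s\<^sup>2) ^ n \<le> (1 - s) * (1 - s) ^ n" using s by (intro mult_mono) auto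
      then have "exp (- s * ?v) / (1 - s) ^ Suc n \<le> exp (- s * ?v) / (1 / 2 * exp (- s - 2 * s\<^sup>2) ^ n)"
        using s by (intro divide_left_mono) auto
      also have "\<dots> = 2 * exp (- s * ?v - real n * (- s - 2 * s\<^sup>2))" by (simp add: exp_diff exp_of_nat_mult)
      also have "- s * ?v - real n * (- s - 2 * s\<^sup>2) = - 2 * s\<^sup>2 * n" by (simp add: algebra_simps power2_eq_square)
      finally show ?thesis .
    qed
  qed
  finally show ?thesis by (simp add: algebra_simps)
qed

text \<open>Near 0 the integrand may be negative, which costs at most \<open>(12 * M) ^ n\<close>.
  The main term is \<open>?b2 - ?b3\<close>: the tilt makes it nonpositive to the left of
  \<open>(1 - 4 * s) * n\<close>, where at most nonnegativity of the integrand is used, and to the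
  right it lies below the Gaussian bound with \<open>1 / t\<close> replaced by its largest
  value.\<close>

lemma AO_lower:
  fixes ks :: "nat list" and M s :: real
  assumes n: "sum_list ks = n" "n > 0" and small: "\<And>k. k \<in> set ks \<Longrightarrow> real k \<le> M"
    and M: "0 < M" "8 * M \<le> n" and s: "0 < s" "s \<le> 1/8"
  shows "exp (- ((1 + 24 * (M / n)) / (1 - 4 * s)) * (pairs2 ks / (2 * n))) * (1 - exp (- 3 * s\<^sup>2 * n))
     - (12 * exp 1 * (M / n)) ^ n \<le> real (AO (complete_multipartite ks)) / fact n"
proof -
  let ?f = "\<lambda>t. prod_list (map (\<lambda>k. poly (touch k) t) ks)"
  let ?E = "exp (- ((1 + 24 * (M / n)) / (1 - 4 * s)) * (pairs2 ks / (2 * n)))"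
  let ?u = "(1 - 4 * s) * n"
  have npos: "0 < real n" using n by simp
  have u: "n \<le> 2 * ?u"
  proof -
    have "1 / 2 * real n \<le> (1 - 4 * s) * real n" using s by (intro mult_right_mono) auto
    then show ?thesis by linarith
  qed
  have bd: "?E * (exp (- t) * t ^ n * exp (0 * t + 0)) - ?E * (exp (- t) * t ^ n * exp ((- s) * t + s * ?u)) -
     (12 * M) ^ n * (exp (- t) * t ^ 0 * exp (0 * t + 0)) \<le> exp (- t) * ?f t"
    (is "?b2 - ?b3 - ?b1 \<le> _") if t: "t \<ge> 0" for t
  proof -
    have b: "0 \<le> ?b1" "0 \<le> ?b2" "0 \<le> ?b3" using t M by auto
    have diff: "?b2 - ?b3 \<le> 0" if "t \<le> ?u"
    proof -
      have "s * t \<le> s * ?u" using that s by (intro mult_left_mono) auto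
      then have "1 \<le> exp ((- s) * t + s * ?u)" by simp
      then have "?E * (exp (- t) * t ^ n * 1) \<le> ?b3" using t by (intro mult_left_mono) auto
      then show ?thesis by simp
    qed
    consider "t \<le> 4 * M" | "4 * M \<le> t" "t \<le> ?u" | "4 * M \<le> t" "?u \<le> t" by linarith
    then show ?thesis
    proof cases
      case 1
      have "\<bar>?f t\<bar> \<le> prod_list (map (\<lambda>k. (3 * (4 * M)) ^ k) ks)"
        unfolding abs_prod_list
      proof (rule conjunct2[OF prod_list_map_mono], intro conjI)
        fix k assume "k \<in> set ks"
        then have "real k \<le> 3 * (4 * M)" using small[of k] M by simp
        then show "\<bar>poly (touch k) t\<bar> \<le> (3 * (4 * M)) ^ k"
          using 1 t M by (intro touch_abs_le) auto
      qed auto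
      also have "\<dots> = (12 * M) ^ n" unfolding prod_list_power n by simp
      finally have "- ((12 * M) ^ n) \<le> ?f t" by linarith
      then have "exp (- t) * (- ((12 * M) ^ n)) \<le> exp (- t) * ?f t" by (intro mult_left_mono) auto
      moreover have "exp (- t) * (- ((12 * M) ^ n)) = - ?b1" by simp
      moreover have "t \<le> ?u" using 1 M u by linarith
      ultimately show ?thesis using b diff by linarith
    next
      case 2
      have tpos: "t > 0" using 2 M by simp
      have "0 \<le> ?f t"
      proof (rule conjunct1[OF prod_list_map_mono])
        fix k assume "k \<in> set ks"
        then have k: "4 * real k \<le> t" using small[of k] 2 by simp
        show "0 \<le> poly (touch k) t \<and> poly (touch k) t \<le> poly (touch k) t"
          using touch_ratio[OF tpos k] by simp
      qed
      then have "0 \<le> exp (- t) * ?f t" by simp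
      then show ?thesis using b diff 2 by linarith
    next
      case 3
      have tpos: "t > 0" using 3 M by simp
      let ?c = "1 + 12 * (M / t)"
      have "t ^ n * ?E \<le> t ^ n * exp ((- ?c/(2 * t)) * pairs2 ks)"
      proof -
        have "n / 2 \<le> t" using 3 u by linarith
        then have "M / t \<le> M / (n / 2)" using M tpos npos by (intro divide_left_mono) auto
        then have "?c \<le> 1 + 24 * (M / n)" by simp
        then have "?c * pairs2 ks / (2 * t) \<le> (1 + 24 * (M / n)) * pairs2 ks / (2 * ?u)"
          using 3 tpos M npos s pairs2_nonneg[of ks] by (intro frac_le mult_nonneg_nonneg mult_right_mono mult_pos_pos) auto
        moreover have "(1 + 24 * (M / n)) * pairs2 ks / (2 * ?u) = ((1 + 24 * (M / n)) / (1 - 4 * s)) * (pairs2 ks / (2 * n))"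
          using s npos by (simp add: field_simps)
        moreover have "- ((1 + 24 * (M / n)) / (1 - 4 * s)) * (pairs2 ks / (2 * n)) =
           - (((1 + 24 * (M / n)) / (1 - 4 * s)) * (pairs2 ks / (2 * n)))" by (rule mult_minus_left)
        moreover have "(- ?c/(2 * t)) * pairs2 ks = - (?c * pairs2 ks / (2 * t))"
          by (simp only: times_divide_eq_left mult_minus_left minus_divide_left)
        ultimately have "- ((1 + 24 * (M / n)) / (1 - 4 * s)) * (pairs2 ks / (2 * n)) \<le> (- ?c/(2 * t)) * pairs2 ks"
          by linarith
        then show ?thesis using t by (intro mult_left_mono) (simp_all only: exp_le_cancel_iff, simp)
      qed
      also have "\<dots> = prod_list (map (\<lambda>k. t ^ k * exp ((- ?c/(2 * t)) * (real k * (real k - 1)))) ks)"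
        unfolding prod_list_power_exp n pairs2_def ..
      also have "\<dots> \<le> ?f t"
      proof (rule conjunct2[OF prod_list_map_mono])
        fix k assume kk: "k \<in> set ks"
        then have k: "4 * real k \<le> t" "real k \<le> M" using small[of k] 3 by auto
        have "t ^ k * exp ((- ?c/(2 * t)) * (real k * (real k - 1))) \<le>
            t ^ k * exp (- (1 + 12 * (real k / t)) * (real k * (real k - 1) / (2 * t)))"
        proof -
          have "real k / t \<le> M / t" using k tpos by (intro divide_right_mono) auto
          moreover have "0 \<le> real k * (real k - 1) / (2 * t)" using tpos by (cases k) auto
          ultimately have "(1 + 12 * (real k / t)) * (real k * (real k - 1) / (2 * t)) \<le> ?c * (real k * (real k - 1) / (2 * t))"
            by (intro mult_right_mono) auto
          moreover have "- (1 + 12 * (real k / t)) * (real k * (real k - 1) / (2 * t)) =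
            - ((1 + 12 * (real k / t)) * (real k * (real k - 1) / (2 * t)))" by (rule mult_minus_left)
          moreover have "(- ?c/(2 * t)) * (real k * (real k - 1)) = - (?c * (real k * (real k - 1) / (2 * t)))"
            by (simp only: times_divide_eq_left times_divide_eq_right mult_minus_left minus_divide_left)
          ultimately have "(- ?c/(2 * t)) * (real k * (real k - 1)) \<le>
            - (1 + 12 * (real k / t)) * (real k * (real k - 1) / (2 * t))" by linarith
          then show ?thesis using t by (intro mult_left_mono) (simp_all only: exp_le_cancel_iff, simp)
        qed
        also have "\<dots> \<le> poly (touch k) t" by (rule touch_lower[OF tpos k(1)]) simp
        finally show "0 \<le> t ^ k * exp ((- ?c/(2 * t)) * (real k * (real k - 1))) \<and>
           t ^ k * exp ((- ?c/(2 * t)) * (real k * (real k - 1))) \<le> poly (touch k) t" using t by simp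
      qed
      finally have "exp (- t) * (t ^ n * ?E) \<le> exp (- t) * ?f t" by (intro mult_left_mono) auto
      moreover have "exp (- t) * (t ^ n * ?E) = ?b2" by simp
      ultimately show ?thesis using b by linarith
    qed
  qed
  have int: "((\<lambda>t. exp (- t) * ?f t) has_integral real (AO (complete_multipartite ks))) {0<..}"
    using has_integral_facL[of "prod_list (map touch ks)"]
    by (simp add: AO_eq_facL poly_prod_list o_def)
  have "((\<lambda>t. ?E * (exp (- t) * t ^ n * exp (0 * t + 0)) - ?E * (exp (- t) * t ^ n * exp ((- s) * t + s * ?u)) -
     (12 * M) ^ n * (exp (- t) * t ^ 0 * exp (0 * t + 0))) has_integral
     (?E * (exp 0 * fact n / (1 - 0) ^ Suc n) - ?E * (exp (s * ?u) * fact n / (1 - - s) ^ Suc n) -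
      (12 * M) ^ n * (exp 0 * fact 0 / (1 - 0) ^ Suc 0))) {0<..}"
    using s by (intro has_integral_diff has_integral_mult_right has_integral_power_exp_shift) auto
  then have "?E * (exp 0 * fact n / (1 - 0) ^ Suc n) - ?E * (exp (s * ?u) * fact n / (1 - - s) ^ Suc n) -
      (12 * M) ^ n * (exp 0 * fact 0 / (1 - 0) ^ Suc 0) \<le> real (AO (complete_multipartite ks))"
    by (rule has_integral_le[OF _ int]) (rule bd, simp)
  then have "(?E * fact n - ?E * (exp (s * ?u) * fact n / (1 + s) ^ Suc n) - (12 * M) ^ n) / fact n \<le>
      real (AO (complete_multipartite ks)) / fact n" by (intro divide_right_mono) auto
  moreover have "(?E * fact n - ?E * (exp (s * ?u) * fact n / (1 + s) ^ Suc n) - (12 * M) ^ n) / fact n =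
      ?E - ?E * (exp (s * ?u) / (1 + s) ^ Suc n) - (12 * M) ^ n / fact n"
    by (simp add: diff_divide_distrib)
  moreover have "(12 * M) ^ n / fact n \<le> (12 * exp 1 * (M / n)) ^ n"
  proof -
    have "(12 * M) ^ n / fact n = (12 * (M / n)) ^ n * (real n ^ n / fact n)"
      using npos by (simp add: power_mult_distrib power_divide)
    also have "\<dots> \<le> (12 * (M / n)) ^ n * exp (real n)"
      using power_self_le_fact_exp[of n] M by (intro mult_left_mono) (auto simp: field_simps)
    also have "exp (real n) = exp 1 ^ n" using exp_of_nat_mult[of n "1 :: real"] by simp
    also have "(12 * (M / n)) ^ n * exp 1 ^ n = (12 * exp 1 * (M / n)) ^ n"
      by (simp only: power_mult_distrib[symmetric]) (simp add: mult_ac)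
    finally show ?thesis .
  qed
  moreover have "?E * (exp (s * ?u) / (1 + s) ^ Suc n) \<le> ?E * exp (- 3 * s\<^sup>2 * n)"
  proof (rule mult_left_mono)
      have "exp (s - s\<^sup>2) ^ n \<le> (1 + s) ^ n"
      proof (rule power_mono)
        have "s - s\<^sup>2 \<le> ln (1 + s)" using s by (intro ln_one_plus_pos_lower_bound) auto
        then have "exp (s - s\<^sup>2) \<le> exp (ln (1 + s))" by simp
        then show "exp (s - s\<^sup>2) \<le> 1 + s" using s by simp
      qed auto
      also have "(1 + s) ^ n \<le> (1 + s) ^ Suc n" using s by (intro power_increasing) auto
      finally have "exp (s * ?u) / (1 + s) ^ Suc n \<le> exp (s * ?u) / exp (s - s\<^sup>2) ^ n"
        using s by (intro divide_left_mono) auto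
      also have "\<dots> = exp (s * ?u - real n * (s - s\<^sup>2))" by (simp add: exp_diff exp_of_nat_mult)
      also have "s * ?u - real n * (s - s\<^sup>2) = - 3 * s\<^sup>2 * n" by (simp add: algebra_simps power2_eq_square)
      finally show "exp (s * ?u) / (1 + s) ^ Suc n \<le> exp (- 3 * s\<^sup>2 * n)" .
  qed auto
  ultimately show ?thesis by (simp only: right_diff_distrib mult_1_right)
qed

text \<open>Splitting all parts but one into single vertices only adds edges, and \<open>facL_touch_monom\<close> evaluates
  the result.\<close>

lemma AO_big_part:
  assumes n: "sum_list ks = n" "n > 0" and k: "k \<in> set ks"
  shows "real (AO (complete_multipartite ks)) / fact n \<le> exp (- (real k * (real k - 1) / (2 * n)))"
proof -
  obtain i where i: "i < length ks" "ks ! i = k" using k by (auto simp: in_set_conv_nth)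
  let ?A = "Pair i ` {..<k}"
  have sub: "?A \<subseteq> multipartite_verts ks" using i by (auto simp: multipartite_verts_def)
  have cA: "card ?A = k" by (simp add: card_image inj_on_def)
  have kn: "k \<le> n" using k n member_le_sum_list by blast
  define N where "N = n - k"
  have "real (AO (complete_multipartite ks)) \<le>
      fact (card (multipartite_verts ks) - card ?A) * real (card (multipartite_verts ks) - card ?A + 1) ^ card ?A"
    unfolding AO_eq_card_acyc_or by (rule card_acyc_or_single_class[OF finite_multipartite_verts sub]) auto
  then have "real (AO (complete_multipartite ks)) \<le> fact N * real (N + 1) ^ k"
    by (simp only: cA card_multipartite_verts n N_def)
  also have "\<dots> \<le> fact n * exp (- (real k * (real k - 1) / (2 * n)))"
  proof -
    \<comment> \<open>Adding one vertex to the part multiplies the left side by \<open>N + 1\<close>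
      and the factorial by \<open>N + j + 1\<close>; the quotient is at most
      \<open>1 - j / n\<close> since \<open>N + j + 1 \<le> n\<close>.\<close>
    have "fact N * real (N + 1) ^ j \<le> fact (N + j) * exp (- (real j * (real j - 1) / (2 * n)))"
      if "j \<le> k" for j using that
    proof (induction j)
      case (Suc j)
      have "real (N + 1) \<le> real (N + Suc j) * exp (- (real j / n))"
      proof -
        have "real j * real (N + Suc j) \<le> real j * real n" using Suc.prems kn by (intro mult_left_mono) (auto simp: N_def)
        then have "real (N + 1) \<le> real (N + Suc j) * (1 - real j / n)"
          using n by (simp add: field_simps)
        also have "\<dots> \<le> real (N + Suc j) * exp (- (real j / n))"
          using exp_ge_add_one_self[of "- (real j / n)"] by (intro mult_left_mono) auto
        finally show ?thesis .
      qed
      note step = this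
      have "fact N * real (N + 1) ^ j * real (N + 1) \<le>
         fact (N + j) * exp (- (real j * (real j - 1) / (2 * n))) * (real (N + Suc j) * exp (- (real j / n)))"
      proof (rule mult_mono)
        show "fact N * real (N + 1) ^ j \<le> fact (N + j) * exp (- (real j * (real j - 1) / (2 * n)))"
          using Suc by simp
      qed (use step in simp_all)
      also have "\<dots> = fact (N + Suc j) * exp (- (real j * (real j - 1) / (2 * n)) + - (real j / n))"
        by (simp only: exp_add) (simp add: algebra_simps)
      also have "- (real j * (real j - 1) / (2 * n)) + - (real j / n) = - (real (Suc j) * (real (Suc j) - 1) / (2 * n))"
        using n by (simp add: field_simps)
      finally show ?case by (simp add: mult_ac)
    qed simp
    from this[of k] show ?thesis using kn by (simp add: N_def)
  qed
  finally show ?thesis by (simp add: field_simps)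
qed

section \<open>Sums over partitions and products over part sizes\<close>

lemma prod_list_eq_prod_count:
  fixes y :: "nat \<Rightarrow> real"
  assumes "finite A" "set ks \<subseteq> A"
  shows "prod_list (map y ks) = (\<Prod>m\<in>A. y m ^ count_list ks m)"
  using assms(2)
proof (induction ks)
  case (Cons k ks)
  have "(\<Prod>m\<in>A. y m ^ count_list (k # ks) m) =
      (\<Prod>m\<in>A. (if m = k then y m else 1) * y m ^ count_list ks m)"
    by (intro prod.cong refl) auto
  also have "\<dots> = y k * (\<Prod>m\<in>A. y m ^ count_list ks m)"
    using Cons.prems assms(1) by (simp add: prod.distrib)
  finally show ?case using Cons by simp
qed simp

lemma sorted_desc_eqI:
  fixes xs ys :: "nat list"
  assumes "sorted_wrt (\<ge>) xs" "sorted_wrt (\<ge>) ys" "mset xs = mset ys"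
  shows "xs = ys"
proof -
  have "sorted (rev xs)" "sorted (rev ys)" using assms(1,2) by (simp_all add: sorted_wrt_rev)
  then have "rev xs = rev ys" using assms(3) by (metis mset_rev properties_for_sort)
  then show ?thesis by simp
qed

lemma int_partitions_upper_bound: "ks \<in> int_partitions n \<Longrightarrow> set ks \<subseteq> {1..n}"
  using member_le_sum_list[of _ ks] by (fastforce simp: int_partitions_def)

text \<open>A partition is determined by its multiplicities. Expanding the product gives one term
  for each choice of multiplicities up to \<open>\<kappa>\<close>, and the terms with a total
  different from \<open>n\<close> are nonnegative.\<close>

lemma sum_partitions_le_prod:
  fixes y :: "nat \<Rightarrow> real"
  assumes P: "P \<subseteq> int_partitions n" and y: "\<And>m. 0 \<le> y m"
    and mult: "\<And>ks m. ks \<in> P \<Longrightarrow> count_list ks m \<le> \<kappa>"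
  shows "(\<Sum>ks\<in>P. prod_list (map y ks)) \<le> (\<Prod>m\<in>{1..n}. \<Sum>k\<le>\<kappa>. y m ^ k)"
proof -
  let ?c = "\<lambda>ks. restrict (count_list ks) {1..n}"
  have inj: "inj_on ?c P"
  proof (rule inj_onI)
    fix xs ys assume xy: "xs \<in> P" "ys \<in> P" "?c xs = ?c ys"
    have "count_list xs m = count_list ys m" for m
    proof (cases "m \<in> {1..n}")
      case True then show ?thesis using fun_cong[OF xy(3), of m] by simp
    next
      case False
      then have "m \<notin> set xs" "m \<notin> set ys" using xy P int_partitions_upper_bound by blast+
      then show ?thesis by (simp add: count_list_0_iff)
    qed
    then have "mset xs = mset ys" by (intro multiset_eqI) (simp add: count_mset)
    then show "xs = ys" using xy P by (intro sorted_desc_eqI) (auto simp: int_partitions_def)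
  qed
  have "(\<Sum>ks\<in>P. prod_list (map y ks)) = (\<Sum>ks\<in>P. \<Prod>m\<in>{1..n}. y m ^ (?c ks m))"
  proof (rule sum.cong[OF refl])
    fix ks assume "ks \<in> P"
    then have "set ks \<subseteq> {1..n}" using P int_partitions_upper_bound by blast
    then have "prod_list (map y ks) = (\<Prod>m\<in>{1..n}. y m ^ count_list ks m)"
      by (intro prod_list_eq_prod_count) auto
    then show "prod_list (map y ks) = (\<Prod>m\<in>{1..n}. y m ^ (?c ks m))" by simp
  qed
  also have "\<dots> = (\<Sum>f\<in>?c ` P. \<Prod>m\<in>{1..n}. y m ^ f m)"
    by (subst sum.reindex[OF inj]) simp
  also have "\<dots> \<le> (\<Sum>f\<in>PiE {1..n} (\<lambda>_. {..\<kappa>}). \<Prod>m\<in>{1..n}. y m ^ f m)"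
    using mult y by (intro sum_mono2 finite_PiE prod_nonneg) auto
  also have "\<dots> = (\<Prod>m\<in>{1..n}. \<Sum>k\<le>\<kappa>. y m ^ k)"
    by (simp add: prod_sum_PiE)
  finally show ?thesis .
qed

definition mult_mset :: "nat \<Rightarrow> (nat \<Rightarrow> nat) \<Rightarrow> nat multiset" where
  "mult_mset M f = (\<Sum>m\<in>{1..M}. replicate_mset (f m) m)"

text \<open>The partition with \<open>f m\<close> copies of each small part \<open>m \<le> M\<close>
  and one copy of each element of \<open>T\<close>; the set \<open>T\<close> supplies what the small
  parts lack to a prescribed total.\<close>

definition fill_list :: "nat \<Rightarrow> nat set \<Rightarrow> (nat \<Rightarrow> nat) \<Rightarrow> nat list" where
  "fill_list M T f = rev (sorted_list_of_multiset (mult_mset M f + mset_set T))"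

lemma count_mult_mset: "count (mult_mset M f) m = (if m \<in> {1..M} then f m else 0)"
proof -
  have "count (mult_mset M f) m = (\<Sum>i\<in>{1..M}. if i = m then f m else 0)"
    unfolding mult_mset_def count_sum by (intro sum.cong) auto
  then show ?thesis by simp
qed

lemma sum_mset_image_mult_mset:
  fixes h :: "nat \<Rightarrow> 'a :: comm_semiring_1"
  shows "sum_mset (image_mset h (mult_mset M f)) = (\<Sum>m\<in>{1..M}. of_nat (f m) * h m)"
proof -
  have "sum_mset (image_mset h (\<Sum>m\<in>A. replicate_mset (f m) m)) = (\<Sum>m\<in>A. of_nat (f m) * h m)"
    if "finite A" for A
    using that by (induction A rule: finite_induct) (auto simp: image_replicate_mset)
  then show ?thesis by (simp add: mult_mset_def)
qed

lemma sum_list_fill_list: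
  fixes h :: "nat \<Rightarrow> 'a :: comm_semiring_1"
  shows "sum_list (map h (fill_list M T f)) = (\<Sum>m\<in>{1..M}. of_nat (f m) * h m) + (\<Sum>m\<in>T. h m)"
proof -
  have "sum_list (map h (fill_list M T f)) = sum_mset (image_mset h (mset (fill_list M T f)))"
    by (metis mset_map sum_mset_sum_list)
  also have "mset (fill_list M T f) = mult_mset M f + mset_set T" by (simp add: fill_list_def)
  finally show ?thesis by (simp add: sum_mset_image_mult_mset sum_unfold_sum_mset)
qed

lemma set_fill_list: "finite T \<Longrightarrow> set (fill_list M T f) \<subseteq> {1..M} \<union> T"
proof -
  assume T: "finite T"
  have "set (fill_list M T f) = set_mset (mult_mset M f + mset_set T)" by (simp add: fill_list_def)
  moreover have "m \<in> {1..M}" if "m \<in># mult_mset M f" for m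
    using that by (metis count_eq_zero_iff count_mult_mset)
  ultimately show ?thesis using T by auto
qed

lemma fill_list_int_partition:
  assumes "finite T" "0 \<notin> T" "(\<Sum>m\<in>{1..M}. m * f m) + \<Sum>T = n"
  shows "fill_list M T f \<in> int_partitions n"
proof -
  have "sum_list (map id (fill_list M T f)) = n"
    unfolding sum_list_fill_list using assms(3) by (simp add: mult.commute)
  moreover have "sorted_wrt (\<ge>) (fill_list M T f)"
    by (simp add: fill_list_def sorted_wrt_rev)
  moreover have "\<forall>k\<in>set (fill_list M T f). 0 < k"
    using set_fill_list[OF assms(1), of M f] assms(2) by (metis UnE atLeastAtMost_iff gr0I not_one_le_zero subsetD)
  ultimately show ?thesis by (simp add: int_partitions_def)
qed

lemma distinct_fill_list:
  assumes "finite T" "T \<subseteq> {M<..}" "\<And>m. m \<in> {1..M} \<Longrightarrow> f m \<le> 1"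
  shows "distinct (fill_list M T f)"
proof -
  have "count (mset (fill_list M T f)) a \<le> 1" for a
    using assms by (auto simp: fill_list_def count_mult_mset count_mset_set' not_less)
  then show ?thesis by (metis count_mset_0_iff count_eq_zero_iff distinct_count_atmost_1 le_neq_implies_less less_one set_mset_mset)
qed

lemma inj_on_fill_list:
  assumes "finite T" "T \<subseteq> {M<..}"
  shows "inj_on (fill_list M T) (PiE {1..M} S)"
proof (rule inj_onI)
  fix f g assume fg: "f \<in> PiE {1..M} S" "g \<in> PiE {1..M} S" "fill_list M T f = fill_list M T g"
  have "mset (fill_list M T f) = mset (fill_list M T g)" using fg by simp
  then have "mult_mset M f = mult_mset M g" by (simp add: fill_list_def)
  then have "f m = g m" if "m \<in> {1..M}" for m using that by (metis count_mult_mset)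
  then show "f = g" using fg(1,2) by (intro PiE_ext) auto
qed

text \<open>For fixed \<open>T\<close> the filling is injective on multiplicity functions, so the
  filled partitions are distinct terms of the sum.\<close>

lemma sum_partitions_ge:
  fixes V :: "nat list \<Rightarrow> real"
  assumes T: "finite T" "T \<subseteq> {M<..}" "N + \<Sum>T = n"
    and P: "P \<subseteq> int_partitions n"
    and PP: "\<And>f. f \<in> PiE {1..M} (\<lambda>_. {..\<kappa>}) \<Longrightarrow> (\<Sum>m\<in>{1..M}. m * f m) = N \<Longrightarrow>
        fill_list M T f \<in> int_partitions n \<Longrightarrow> fill_list M T f \<in> P"
    and V: "\<And>ks. ks \<in> P \<Longrightarrow> 0 \<le> V ks"
    and W: "\<And>f. f \<in> PiE {1..M} (\<lambda>_. {..\<kappa>}) \<Longrightarrow> (\<Sum>m\<in>{1..M}. m * f m) = N \<Longrightarrow>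
        fill_list M T f \<in> P \<Longrightarrow> W f \<le> V (fill_list M T f)"
  shows "(\<Sum>f | f \<in> PiE {1..M} (\<lambda>_. {..\<kappa>}) \<and> (\<Sum>m\<in>{1..M}. m * f m) = N. W f) \<le> (\<Sum>ks\<in>P. V ks)"
proof -
  let ?F = "{f. f \<in> PiE {1..M} (\<lambda>_. {..\<kappa>}) \<and> (\<Sum>m\<in>{1..M}. m * f m) = N}"
  have mem: "fill_list M T f \<in> P" if "f \<in> ?F" for f
    using that T by (intro PP fill_list_int_partition) auto
  have inj: "inj_on (fill_list M T) ?F"
    using inj_on_fill_list[OF T(1,2), of "\<lambda>_. {..\<kappa>}"] by (rule inj_on_subset) auto
  have "(\<Sum>f\<in>?F. W f) \<le> (\<Sum>f\<in>?F. V (fill_list M T f))"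
    using mem W by (intro sum_mono) auto
  also have "\<dots> = (\<Sum>ks\<in>fill_list M T ` ?F. V ks)" unfolding sum.reindex[OF inj] by (simp only: o_def)
  also have "\<dots> \<le> (\<Sum>ks\<in>P. V ks)"
    using mem V finite_subset[OF P finite_int_partitions] by (intro sum_mono2) auto
  finally show ?thesis .
qed

text \<open>Take \<open>s + 1\<close>, \<open>s + 2\<close>, ... as long as the sum does not exceed
  \<open>r\<close>, and add the remainder to the last one. The remainder is less than the next
  number, hence the bound on the largest element; all elements exceed \<open>s\<close>, hence the
  bound on their number.\<close>

lemma exists_distinct_sum:
  assumes "s < r"
  shows "\<exists>T. finite T \<and> T \<subseteq> {s<..} \<and> \<Sum>T = r \<and> real (card T) * (real s + 1) \<le> real r \<and>
     (\<forall>k\<in>T. k \<le> 2 * s + 2 * card T + 1)"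
proof -
  let ?S = "\<lambda>j. \<Sum>i\<in>{1..j}. s + i"
  have S: "?S j = j * s + \<Sum>{1..j}" for j by (simp add: sum.distrib)
  have ex: "\<exists>j. r < ?S (Suc j)"
  proof
    have "r < (Suc r) * (s + 1)" by simp
    also have "\<dots> = (\<Sum>i\<in>{1..Suc r}. s + 1)" by simp
    also have "\<dots> \<le> ?S (Suc r)" by (intro sum_mono) auto
    finally show "r < ?S (Suc r)" .
  qed
  define j where "j = (LEAST j. r < ?S (Suc j))"
  have j1: "r < ?S (Suc j)" unfolding j_def using ex by (rule LeastI_ex)
  have jpos: "j > 0" using j1 assms by (cases j) auto
  have j2: "?S j \<le> r"
  proof (rule ccontr)
    assume "\<not> ?S j \<le> r"
    then have "r < ?S (Suc (j - 1))" using jpos by simp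
    then have "j \<le> j - 1" unfolding j_def by (rule Least_le)
    then show False using jpos by simp
  qed
  define e where "e = r - ?S j"
  let ?A = "(\<lambda>i. s + i) ` {1..<j}"
  let ?T = "insert (s + j + e) ?A"
  have nin: "s + j + e \<notin> ?A" by auto
  have cardT: "card ?T = j" using nin jpos by (simp add: card_image)
  have "\<Sum>?T = s + j + e + \<Sum>?A"
    using nin by (intro sum.insert) auto
  also have "\<Sum>?A = (\<Sum>i\<in>{1..<j}. s + i)"
    by (rule sum.reindex_cong[where l = "\<lambda>i. s + i"]) (auto simp: inj_on_def)
  also have "s + j + e + (\<Sum>i\<in>{1..<j}. s + i) = e + ?S j" using jpos by (cases j) (auto simp: atLeastLessThanSuc_atLeastAtMost)
  also have "\<dots> = r" using j2 by (simp add: e_def)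
  finally have sumT: "\<Sum>?T = r" .
  have "j * (s + 1) = (\<Sum>i\<in>{1..j}. s + 1)" by simp
  also have "\<dots> \<le> ?S j" by (intro sum_mono) auto
  finally have "j * (s + 1) \<le> r" using j2 by simp
  then have "real (j * (s + 1)) \<le> real r" by (simp only: of_nat_le_iff)
  then have "real (card ?T) * (real s + 1) \<le> real r" unfolding cardT by (simp add: algebra_simps)
  moreover have "\<forall>k\<in>?T. k \<le> 2 * s + 2 * card ?T + 1"
  proof -
    have "e \<le> s + j" using j1 by (simp add: e_def)
    then show ?thesis unfolding cardT by auto
  qed
  moreover have "finite ?T" by simp
  moreover have "?T \<subseteq> {s<..}" using jpos by auto
  ultimately show ?thesis using sumT by blast
qed

section \<open>Bose and Fermi integrals\<close>

text \<open>The sign \<open>s = 1\<close> stands for distinct parts (Fermi statistics) and \<open>s = -1\<close> for all partitions (Bose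
  statistics): \<open>Lf s y\<close> is the logarithm of the sum of \<open>y\<^sup>k\<close> over the permitted multiplicities \<open>k\<close> of a part.
  The weight of the theorem has \<open>\<theta> = 1\<close>; smaller \<open>\<theta>\<close> give room for the error terms of the upper bound.\<close>

definition bw :: "real \<Rightarrow> real \<Rightarrow> real \<Rightarrow> real" where
  "bw \<theta> b x = exp (- (b * x) - \<theta> * x\<^sup>2 / 2)"

definition Lf :: "real \<Rightarrow> real \<Rightarrow> real" where
  "Lf s y = s * ln (1 + s * y)"

definition adm :: "real \<Rightarrow> real \<Rightarrow> real \<Rightarrow> bool" where
  "adm s \<theta> b \<longleftrightarrow> s = 1 \<and> \<theta> \<ge> 1/2 \<or> s = -1 \<and> b > 0 \<and> \<theta> \<ge> 0"

text \<open>The integrand of the equations for the constants. It is minus the derivative of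
  \<open>Lf s (bw 1 b x)\<close> in \<open>b\<close>, that is, the mean contribution of parts of
  rescaled size \<open>x\<close> to the rescaled total.\<close>

definition fF :: "real \<Rightarrow> real \<Rightarrow> real \<Rightarrow> real" where
  "fF s b x = x / (exp (b * x + x\<^sup>2 / 2) + s)"

definition okY :: "real \<Rightarrow> real \<Rightarrow> bool" where
  "okY s y \<longleftrightarrow> 0 \<le> y \<and> (s = 1 \<or> s = -1 \<and> y < 1)"

lemma okY_bw: "adm s \<theta> b \<Longrightarrow> 0 < x \<Longrightarrow> okY s (bw \<theta> b x)"
proof -
  assume a: "adm s \<theta> b" "0 < x"
  have "bw \<theta> b x < 1" if "b > 0" "\<theta> \<ge> 0"
  proof -
    have "0 < b * x" "0 \<le> \<theta> * x\<^sup>2 / 2" using that a by auto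
    then show ?thesis unfolding bw_def by simp
  qed
  then show ?thesis using a by (auto simp: okY_def adm_def bw_def)
qed

lemma bw_pos: "0 < bw \<theta> b x" by (simp add: bw_def)

lemma Lf_nonneg: "okY s y \<Longrightarrow> 0 \<le> Lf s y"
  by (auto simp: okY_def Lf_def)

text \<open>Near \<open>x = 0\<close> the Bose weight tends to 1 and \<open>Lf (-1)\<close> grows
  logarithmically. The bound \<open>ln (1 + z) \<le> 2 * sqrt z\<close> trades this for an
  integrable inverse square root.\<close>

lemma Lf_le_Bose:
  assumes "0 \<le> y" "y < 1"
  shows "Lf (-1) y \<le> 2 * sqrt (y / (1 - y))"
proof -
  define z where "z = y / (1 - y)"
  have z: "0 \<le> z" using assms by (simp add: z_def)
  have "1 + z = inverse (1 - y)" using assms by (simp add: z_def field_simps)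
  then have "Lf (-1) y = ln (1 + z)" using assms by (simp add: Lf_def ln_inverse)
  also have "\<dots> = 2 * ln (sqrt (1 + z))" using z by (simp add: ln_sqrt)
  also have "\<dots> \<le> 2 * (sqrt (1 + z) - 1)" using z ln_le_minus_one[of "sqrt (1 + z)"] by simp
  also have "sqrt (1 + z) \<le> 1 + sqrt z"
    using z by (intro real_le_lsqrt) (auto simp: power2_eq_square algebra_simps)
  finally show ?thesis by (simp add: z_def)
qed

lemma exp_inverse_bound:
  fixes u :: real
  assumes "u > 0"
  shows "1 / (exp u - 1) \<le> exp (- u) * (1 + 1 / u)"
proof -
  have "1 + u \<le> exp u" by (rule exp_ge_add_one_self)
  then have "1 * exp u \<le> (exp u - 1) * (1 + 1 / u)" using assms by (simp add: field_simps)
  then have "1 \<le> (exp u - 1) * (exp (- u) * (1 + 1 / u))"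
    by (simp add: exp_minus field_simps)
  then show ?thesis using assms by (simp add: field_simps)
qed

text \<open>Decreasing integrable majorants, for the convergence of Riemann sums.\<close>

definition env :: "real \<Rightarrow> real \<Rightarrow> real \<Rightarrow> real" where
  "env s b x = (if s = 1 then exp ((1 - b)\<^sup>2) * exp (- x) else 2 * exp (- (b / 2 * x)) * (1 + 1 / sqrt (b * x)))"

text \<open>Completing the square: \<open>x ^ 2 / 4\<close> absorbs the linear term for every real
  \<open>b\<close>.\<close>

lemma bw_le_exp:
  assumes "\<theta> \<ge> 1/2"
  shows "bw \<theta> b x \<le> exp ((1 - b)\<^sup>2) * exp (- x)"
proof -
  have "0 \<le> (x / 2 - (1 - b))\<^sup>2" by simp
  then have "x * (1 - b) - x\<^sup>2 / 4 \<le> (1 - b)\<^sup>2" by (simp add: power2_eq_square algebra_simps)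
  moreover have "x\<^sup>2 / 4 \<le> \<theta> * x\<^sup>2 / 2" using assms mult_right_mono[of "1/2" \<theta> "x\<^sup>2 / 2"] by simp
  ultimately have "- (b * x) - \<theta> * x\<^sup>2 / 2 \<le> (1 - b)\<^sup>2 + - x" by (simp add: algebra_simps)
  then show ?thesis unfolding bw_def exp_add[symmetric] by simp
qed

lemma Lf_le_env:
  assumes "adm s \<theta> b" "0 < x"
  shows "Lf s (bw \<theta> b x) \<le> env s b x"
proof -
  have "Lf s (bw \<theta> b x) \<le> env s b x" if "s = 1" "\<theta> \<ge> 1/2"
  proof -
    have "Lf 1 (bw \<theta> b x) \<le> bw \<theta> b x" using bw_pos[of \<theta> b x] by (simp add: Lf_def ln_add_one_self_le_self)
    then show ?thesis using that bw_le_exp[of \<theta> b x] by (simp add: env_def)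
  qed
  moreover have "Lf s (bw \<theta> b x) \<le> env s b x" if s: "s = -1" "b > 0" "\<theta> \<ge> 0"
  proof -
    define u where "u = b * x + \<theta> * x\<^sup>2 / 2"
    have u: "0 < b * x" "b * x \<le> u" using s assms by (auto simp: u_def)
    have y: "bw \<theta> b x = exp (- u)" by (simp add: bw_def u_def)
    have "Lf (-1) (exp (- u)) \<le> 2 * sqrt (exp (- u) / (1 - exp (- u)))"
      using u by (intro Lf_le_Bose) auto
    also have "exp (- u) / (1 - exp (- u)) = 1 / (exp u - 1)" using u by (simp add: exp_minus field_simps)
    also have "sqrt \<dots> \<le> sqrt (exp (- u) * (1 + 1 / u))" using u by (intro real_sqrt_le_mono exp_inverse_bound) auto
    also have "\<dots> \<le> sqrt (exp (- (b * x)) * (1 + 1 / (b * x)))"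
      using u by (intro real_sqrt_le_mono mult_mono add_mono divide_left_mono) auto
    also have "\<dots> = exp (- (b / 2 * x)) * sqrt (1 + 1 / (b * x))"
    proof -
      have "exp (- (b * x)) = (exp (- (b / 2 * x)))\<^sup>2" by (simp add: exp_double[symmetric])
      then show ?thesis by (simp add: real_sqrt_mult)
    qed
    also have "sqrt (1 + 1 / (b * x)) \<le> 1 + 1 / sqrt (b * x)"
    proof (rule real_le_lsqrt)
      have "(1 / sqrt (b * x))\<^sup>2 = 1 / (b * x)" using u by (simp add: power_divide)
      moreover have "0 \<le> 1 / sqrt (b * x)" using u by simp
      ultimately show "1 + 1 / (b * x) \<le> (1 + 1 / sqrt (b * x))\<^sup>2" by (simp add: power2_sum)
    qed (use u in auto)
    finally show ?thesis using s y by (simp add: env_def mult.assoc)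
  qed
  ultimately show ?thesis using assms by (auto simp: adm_def)
qed

lemma env_antimono:
  assumes "s = 1 \<or> b > 0" "0 < x" "x \<le> y"
  shows "env s b y \<le> env s b x"
proof (cases "s = 1")
  case False
  then have b: "b > 0" using assms by simp
  have "exp (- (b / 2 * y)) * (1 + 1 / sqrt (b * y)) \<le> exp (- (b / 2 * x)) * (1 + 1 / sqrt (b * x))"
    using assms b by (intro mult_mono add_mono divide_left_mono) auto
  then show ?thesis using False by (simp add: env_def)
qed (use assms in \<open>simp add: env_def\<close>)

lemma integrable_powr_exp:
  fixes z a :: real
  assumes "z > -1" "a > 0"
  shows "(\<lambda>t. t powr z * exp (- (a * t))) integrable_on {0<..}"
proof -
  have "(\<lambda>t. complex_of_real t powr (complex_of_real (z + 1) - 1) / of_real (exp (a * t)))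
     absolutely_integrable_on {0<..}"
    using assms by (intro absolutely_integrable_Gamma_integral) auto
  then have "(\<lambda>t. norm (complex_of_real t powr (complex_of_real (z + 1) - 1) / of_real (exp (a * t)))) integrable_on {0<..}"
    by (simp add: absolutely_integrable_on_def)
  then show ?thesis
    by (rule integrable_eq) (auto simp: norm_mult norm_inverse norm_powr_real_powr exp_minus divide_inverse)
qed

lemma env_integrable:
  assumes "s = 1 \<or> b > 0"
  shows "env s b integrable_on {0<..}"
proof (cases "s = 1")
  case True
  have "(\<lambda>t::real. t powr 0 * exp (- (1 * t))) integrable_on {0<..}" by (rule integrable_powr_exp) auto
  then have "(\<lambda>t::real. exp ((1 - b)\<^sup>2) * (t powr 0 * exp (- (1 * t)))) integrable_on {0<..}"
    by (rule integrable_on_mult_right)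
  then show ?thesis by (rule integrable_eq) (use True in \<open>auto simp: env_def\<close>)
next
  case False
  then have b: "b > 0" using assms by simp
  have "(\<lambda>t. 2 * (t powr 0 * exp (- (b / 2 * t))) + 2 / sqrt b * (t powr (-1/2) * exp (- (b / 2 * t)))) integrable_on {0<..}"
    using b by (intro integrable_add integrable_on_mult_right integrable_powr_exp) auto
  then show ?thesis
  proof (rule integrable_eq)
    fix t :: real assume "t \<in> {0<..}"
    have "t powr (-1/2) = t powr (- (1/2))" by (rule arg_cong[where f = "\<lambda>z. t powr z"]) simp
    also have "\<dots> = 1 / t powr (1/2)" by (rule powr_minus_divide)
    also have "t powr (1/2) = sqrt t" using \<open>t \<in> {0<..}\<close> by (intro powr_half_sqrt) auto
    finally have "t powr (-1/2) = 1 / sqrt t" .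
    then show "2 * (t powr 0 * exp (- (b / 2 * t))) + 2 / sqrt b * (t powr (-1/2) * exp (- (b / 2 * t))) = env s b t"
      using False \<open>t \<in> {0<..}\<close> by (simp add: env_def real_sqrt_mult algebra_simps)
  qed
qed

lemma cont_bounded_absolutely_integrable:
  fixes f H :: "real \<Rightarrow> real"
  assumes "continuous_on {0<..} f" "H integrable_on {0<..}" "\<And>x. 0 < x \<Longrightarrow> \<bar>f x\<bar> \<le> H x"
  shows "f absolutely_integrable_on {0<..}"
  using assms
  by (intro measurable_bounded_by_integrable_imp_absolutely_integrable[where g = H]
      continuous_imp_measurable_on_sets_lebesgue) auto

lemma continuous_on_Lf_bw:
  assumes "adm s \<theta> b"
  shows "continuous_on {0<..} (\<lambda>x. Lf s (bw \<theta> b x))"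
proof -
  have "1 + s * bw \<theta> b x \<noteq> 0" if "x \<in> {0<..}" for x
    using okY_bw[OF assms, of x] that by (auto simp: okY_def)
  then show ?thesis unfolding Lf_def bw_def by (intro continuous_intros) auto
qed

lemma Lf_bw_absolutely_integrable:
  assumes "adm s \<theta> b"
  shows "(\<lambda>x. Lf s (bw \<theta> b x)) absolutely_integrable_on {0<..}"
proof (rule cont_bounded_absolutely_integrable[where H = "env s b"])
  show "env s b integrable_on {0<..}" using assms by (intro env_integrable) (auto simp: adm_def)
  fix x :: real assume "0 < x"
  then show "\<bar>Lf s (bw \<theta> b x)\<bar> \<le> env s b x"
    using Lf_le_env[OF assms] Lf_nonneg[OF okY_bw[OF assms]] by simp
qed (rule continuous_on_Lf_bw[OF assms])

lemma denom_pos: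
  assumes "adm s 1 b" "0 < x"
  shows "0 < exp (b * x + x\<^sup>2 / 2) + s"
proof -
  have "1 < exp (b * x + x\<^sup>2 / 2)" if "b > 0" using that assms by (simp add: add_pos_pos)
  then show ?thesis using assms by (auto simp: adm_def add_pos_pos)
qed

lemma fF_nonneg: "adm s 1 b \<Longrightarrow> 0 < x \<Longrightarrow> 0 \<le> fF s b x"
  using denom_pos[of s b x] by (simp add: fF_def)

lemma fF_antimono:
  assumes "adm s 1 b" "b \<le> b'" "0 < x"
  shows "fF s b' x \<le> fF s b x"
  using assms denom_pos[OF assms(1,3)] unfolding fF_def
  by (intro divide_left_mono mult_pos_pos) (auto intro: add_pos_pos mult_right_mono order.strict_trans2)

lemma continuous_on_fF:
  assumes "adm s 1 b"
  shows "continuous_on {0<..} (fF s b)"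
proof -
  have "exp (b * x + x\<^sup>2 / 2) + s \<noteq> 0" if "x \<in> {0<..}" for x
    using denom_pos[OF assms, of x] that by simp
  then show ?thesis unfolding fF_def by (intro continuous_intros) auto
qed

text \<open>Its shape, powers of \<open>x\<close> times exponentials, makes all moments of
  \<open>fF\<close> integrable at once.\<close>

definition envF :: "real \<Rightarrow> real \<Rightarrow> real \<Rightarrow> real" where
  "envF s b x = (if s = 1 then exp ((1 - b)\<^sup>2) * (x * exp (- (1 * x)))
     else x * exp (- (b * x)) + 1 / b * exp (- (b * x)))"

lemma fF_le_envF:
  assumes "adm s 1 b" "0 < x"
  shows "fF s b x \<le> envF s b x"
proof (cases "s = 1")
  case True
  have "fF s b x \<le> x / exp (b * x + x\<^sup>2 / 2)"
    unfolding fF_def True using assms by (intro divide_left_mono) (auto simp: add_pos_pos)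
  also have "\<dots> = x * bw 1 b x"
  proof -
    have "bw 1 b x = exp (- (b * x + x\<^sup>2 / 2))" by (simp add: bw_def)
    then show ?thesis by (simp only: exp_minus divide_inverse)
  qed
  also have "\<dots> \<le> x * (exp ((1 - b)\<^sup>2) * exp (- x))" using assms by (intro mult_left_mono bw_le_exp) auto
  finally show ?thesis using True by (simp add: envF_def mult_ac)
next
  case False
  then have s: "s = -1" "b > 0" using assms by (auto simp: adm_def)
  define u where "u = b * x + x\<^sup>2 / 2"
  have u: "0 < b * x" "b * x \<le> u" using s assms by (auto simp: u_def)
  have "fF s b x = x * (1 / (exp u - 1))" by (simp add: fF_def s u_def)
  also have "\<dots> \<le> x * (exp (- u) * (1 + 1 / u))" using u assms by (intro mult_left_mono exp_inverse_bound) auto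
  also have "\<dots> \<le> x * (exp (- (b * x)) * (1 + 1 / (b * x)))"
    using u assms by (intro mult_left_mono mult_mono add_mono divide_left_mono) auto
  also have "\<dots> = envF s b x" using s assms by (simp add: envF_def field_simps)
  finally show ?thesis .
qed

lemma integrable_power_exp:
  fixes a :: real
  shows "a > 0 \<Longrightarrow> (\<lambda>t. t ^ n * exp (- (a * t))) integrable_on {0<..}"
  using has_integral_power_exp[of a n] by (auto simp: integrable_on_def)

lemma envF_integrable:
  assumes "s = 1 \<or> b > 0"
  shows "(\<lambda>x. x ^ k * envF s b x) integrable_on {0<..}"
proof (cases "s = 1")
  case True
  have "(\<lambda>x. exp ((1 - b)\<^sup>2) * (x ^ Suc k * exp (- (1 * x)))) integrable_on {0<..}"
    by (intro integrable_on_mult_right integrable_power_exp) auto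
  then show ?thesis by (rule integrable_eq) (use True in \<open>auto simp: envF_def\<close>)
next
  case False
  then have b: "b > 0" using assms by simp
  have "(\<lambda>x. x ^ Suc k * exp (- (b * x)) + 1 / b * (x ^ k * exp (- (b * x)))) integrable_on {0<..}"
    using b by (intro integrable_add integrable_on_mult_right integrable_power_exp) auto
  then show ?thesis by (rule integrable_eq) (use False in \<open>auto simp: envF_def algebra_simps\<close>)
qed

lemma fF_moment_absolutely_integrable:
  assumes "adm s 1 b"
  shows "(\<lambda>x. x ^ k * fF s b x) absolutely_integrable_on {0<..}"
proof (rule cont_bounded_absolutely_integrable[where H = "\<lambda>x. x ^ k * envF s b x"])
  show "(\<lambda>x. x ^ k * envF s b x) integrable_on {0<..}"
    using assms by (intro envF_integrable) (auto simp: adm_def)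
  fix x :: real assume "0 < x"
  then show "\<bar>x ^ k * fF s b x\<bar> \<le> x ^ k * envF s b x"
    using fF_le_envF[OF assms] fF_nonneg[OF assms] by (simp add: mult_left_mono)
qed (intro continuous_intros continuous_on_fF assms)

lemma fF_absolutely_integrable:
  assumes "adm s 1 b" shows "fF s b absolutely_integrable_on {0<..}"
  using fF_moment_absolutely_integrable[OF assms, of 0] by simp

text \<open>The function \<open>u \<mapsto> Lf s (exp (- u))\<close> is convex with derivative \<open>- 1 / (exp u + s)\<close>.\<close>

lemma Lf_tangent:
  fixes u v :: real
  assumes "s = 1 \<or> s = -1 \<and> 0 < u \<and> 0 < v"
  shows "Lf s (exp (- u)) - (v - u) / (exp u + s) \<le> Lf s (exp (- v))"
proof (cases "s = 1")
  case True
  define p where "p = 1 / (exp u + 1)"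
  have p: "0 \<le> p" "p \<le> 1" by (auto simp: p_def add_pos_pos field_simps)
  have q: "(1 - p) = 1 / (1 + exp (- u))" "p = exp (- u) / (1 + exp (- u))"
    by (auto simp: p_def exp_minus field_simps add_pos_pos add_nonneg_eq_0_iff)
  \<comment> \<open>Convexity of \<open>exp\<close> between 0 and \<open>- (v - u)\<close> with
    weight \<open>p\<close>; the logarithm of this inequality is the tangent inequality.\<close>
  have "exp ((1 - p) *\<^sub>R 0 + p *\<^sub>R (- (v - u))) \<le> (1 - p) * exp 0 + p * exp (- (v - u))"
    using p by (intro convex_onD[OF exp_convex]) auto
  also have "\<dots> = (1 + exp (- v)) / (1 + exp (- u))"
  proof -
    have "exp (- u) * exp (- (v - u)) = exp (- v)" by (simp add: exp_add[symmetric])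
    moreover have "(1 - p) * exp 0 + p * exp (- (v - u)) =
        1 / (1 + exp (- u)) * exp 0 + exp (- u) / (1 + exp (- u)) * exp (- (v - u))"
      by (simp only: q(1)) (simp only: q(2))
    ultimately show ?thesis by (simp add: add_divide_distrib)
  qed
  also have "(1 - p) *\<^sub>R 0 + p *\<^sub>R (- (v - u)) = - (p * (v - u))" by (simp add: algebra_simps)
  finally have "exp (- (p * (v - u))) \<le> (1 + exp (- v)) / (1 + exp (- u))" .
  then have "ln (exp (- (p * (v - u)))) \<le> ln ((1 + exp (- v)) / (1 + exp (- u)))"
    by (subst ln_le_cancel_iff) (auto intro!: divide_pos_pos add_pos_pos)
  then have "- (p * (v - u)) \<le> ln (1 + exp (- v)) - ln (1 + exp (- u))"
    by (simp add: ln_divide_pos add_pos_pos)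
  then show ?thesis using True by (simp add: Lf_def p_def)
next
  case False
  then have s: "s = -1" "0 < u" "0 < v" using assms by auto
  define p where "p = 1 / (exp u - 1)"
  have p: "0 \<le> p" using s by (simp add: p_def)
  have q: "p = exp (- u) / (1 - exp (- u))" using s by (simp add: p_def exp_minus field_simps)
  have "(1 - exp (- v)) / (1 - exp (- u)) = 1 + p * (1 - exp (- (v - u)))"
  proof -
    have "exp (- u) * exp (- (v - u)) = exp (- v)" by (simp add: exp_add[symmetric])
    then have "exp (- u) * (1 - exp (- (v - u))) = exp (- u) - exp (- v)" by (simp add: algebra_simps)
    then show ?thesis unfolding q using s by (simp add: field_simps)
  qed
  also have "\<dots> \<le> 1 + p * (v - u)"
  proof (intro add_left_mono mult_left_mono p)
    show "1 - exp (- (v - u)) \<le> v - u" using exp_ge_add_one_self[of "- (v - u)"] by linarith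
  qed
  also have "\<dots> \<le> exp (p * (v - u))" by (rule exp_ge_add_one_self)
  finally have "ln ((1 - exp (- v)) / (1 - exp (- u))) \<le> ln (exp (p * (v - u)))"
    using s by (subst ln_le_cancel_iff) auto
  then have "ln (1 - exp (- v)) - ln (1 - exp (- u)) \<le> p * (v - u)" using s by (simp add: ln_div)
  then show ?thesis using s by (simp add: Lf_def p_def)
qed

lemma Lf_bw_tangent:
  assumes "adm s 1 b" "adm s 1 b'" "0 < x"
  shows "Lf s (bw 1 b x) - (b' - b) * fF s b x \<le> Lf s (bw 1 b' x)"
proof -
  let ?u = "\<lambda>b. b * x + x\<^sup>2 / 2"
  have "Lf s (exp (- ?u b)) - (?u b' - ?u b) / (exp (?u b) + s) \<le> Lf s (exp (- ?u b'))"
    using assms by (intro Lf_tangent) (auto simp: adm_def add_pos_pos)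
  moreover have "bw 1 b x = exp (- ?u b)" for b by (simp add: bw_def)
  moreover have "(?u b' - ?u b) / (exp (?u b) + s) = (b' - b) * fF s b x"
    by (simp add: fF_def algebra_simps diff_divide_distrib)
  ultimately show ?thesis by (simp only:)
qed

section \<open>Riemann sums of step \<open>1 / sqrt n\<close>\<close>

lemma has_integral_step:
  fixes f :: "real \<Rightarrow> real"
  assumes h: "h > 0"
  shows "((\<lambda>x. f (of_int \<lceil>x / h\<rceil> * h)) has_integral (h * (\<Sum>m\<in>{1..M}. f (real m * h)))) {0..real M * h}"
proof (induction M)
  case 0
  show ?case using has_integral_refl(2)[of "\<lambda>x. f (of_int \<lceil>x / h\<rceil> * h)" 0] by simp
next
  case (Suc M)
  let ?g = "\<lambda>x. f (of_int \<lceil>x / h\<rceil> * h)"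
  have "((\<lambda>x. f (real (Suc M) * h)) has_integral (measure lborel {real M * h..real (Suc M) * h} *\<^sub>R f (real (Suc M) * h)))
      {real M * h..real (Suc M) * h}" by (rule has_integral_const_real)
  then have "(?g has_integral (measure lborel {real M * h..real (Suc M) * h} *\<^sub>R f (real (Suc M) * h)))
      {real M * h..real (Suc M) * h}"
  proof (rule has_integral_spike_finite[of "{real M * h}", rotated 2])
    fix x assume "x \<in> {real M * h..real (Suc M) * h} - {real M * h}"
    then have "real M < x / h" "x / h \<le> real (Suc M)" using h by (auto simp: field_simps)
    then have "\<lceil>x / h\<rceil> = int (Suc M)" by (intro ceiling_unique) auto
    then show "?g x = f (real (Suc M) * h)" by simp
  qed simp
  moreover have "measure lborel {real M * h..real (Suc M) * h} = h" using h by (simp add: algebra_simps)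
  ultimately have "(?g has_integral (h * (\<Sum>m\<in>{1..M}. f (real m * h)) + h * f (real (Suc M) * h))) {0..real (Suc M) * h}"
    using h Suc by (intro has_integral_combine[where c = "real M * h"]) (auto intro: mult_right_mono)
  then show ?case by (simp add: algebra_simps)
qed

text \<open>The Riemann sum is the integral of a step function, and dominated convergence applies.
  Right endpoints are essential: they keep the step function below the decreasing majorant
  \<open>H\<close> even where \<open>f\<close> is unbounded near 0. The finite set \<open>N\<close>
  admits the jump of a truncated function.\<close>

lemma riemann_sum_limit:
  fixes f H :: "real \<Rightarrow> real"
  assumes H: "H integrable_on {0<..}" and anti: "\<And>x y. 0 < x \<Longrightarrow> x \<le> y \<Longrightarrow> H y \<le> H x"
    and bd: "\<And>x. 0 < x \<Longrightarrow> \<bar>f x\<bar> \<le> H x"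
    and cont: "\<And>x. 0 < x \<Longrightarrow> x \<notin> N \<Longrightarrow> isCont f x" and N: "finite N"
  shows "(\<lambda>n. (\<Sum>m\<in>{1..n}. f (real m / sqrt n)) / sqrt n) \<longlonglongrightarrow> integral {0<..} f"
proof -
  let ?I = "\<lambda>n. (\<Sum>m\<in>{1..n}. f (real m / sqrt n)) / sqrt n"
  define t where "t n x = of_int \<lceil>x * sqrt n\<rceil> / sqrt n" for n :: nat and x :: real
  \<comment> \<open>At the exceptional points the sequence is put equal to \<open>f\<close>, so that
    convergence holds everywhere; finitely many points do not change the integral.\<close>
  define \<phi> where "\<phi> n x = (if x \<in> N then f x else if x \<in> {0..sqrt n} then f (t n x) else 0)" for n :: nat and x :: real
  have int: "(\<phi> (Suc n) has_integral ?I (Suc n)) {0<..}" for n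
  proof -
    let ?s = "sqrt (real (Suc n))"
    have s: "?s > 0" by simp
    have "((\<lambda>x. f (of_int \<lceil>x / (1 / ?s)\<rceil> * (1 / ?s))) has_integral
       (1 / ?s * (\<Sum>m\<in>{1..Suc n}. f (real m * (1 / ?s))))) {0..real (Suc n) * (1 / ?s)}"
      by (rule has_integral_step) simp
    moreover have "real (Suc n) * (1 / ?s) = ?s" by (simp add: real_div_sqrt del: of_nat_Suc)
    moreover have "1 / ?s * (\<Sum>m\<in>{1..Suc n}. f (real m * (1 / ?s))) = ?I (Suc n)" by simp
    moreover have "f (of_int \<lceil>x / (1 / ?s)\<rceil> * (1 / ?s)) = f (t (Suc n) x)" for x by (simp add: t_def)
    ultimately have "((\<lambda>x. f (t (Suc n) x)) has_integral ?I (Suc n)) {0..?s}" by (simp only:)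
    then have "((\<lambda>x. if x \<in> {0..?s} then f (t (Suc n) x) else 0) has_integral ?I (Suc n)) UNIV"
      by (simp only: has_integral_restrict_UNIV)
    then have "((\<lambda>x. if x \<in> {0<..} then \<phi> (Suc n) x else 0) has_integral ?I (Suc n)) UNIV"
      by (rule has_integral_spike_finite[of "insert 0 N", rotated 2]) (use N in \<open>auto simp: \<phi>_def\<close>)
    then show ?thesis by (simp only: has_integral_restrict_UNIV)
  qed
  have bound: "norm (\<phi> (Suc n) x) \<le> H x" if x: "x \<in> {0<..}" for n x
  proof -
    have Hx: "0 \<le> H x" "\<bar>f x\<bar> \<le> H x" using bd[of x] x by auto
    have "x \<le> t (Suc n) x"
      using le_of_int_ceiling[of "x * sqrt (real (Suc n))"] by (simp add: t_def pos_le_divide_eq del: of_nat_Suc)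
    then have "\<bar>f (t (Suc n) x)\<bar> \<le> H x" using x bd[of "t (Suc n) x"] anti[of x "t (Suc n) x"] by simp
    then show ?thesis using Hx by (simp add: \<phi>_def)
  qed
  have lim: "(\<lambda>n. \<phi> (Suc n) x) \<longlonglongrightarrow> f x" if x: "x \<in> {0<..}" for x
  proof (cases "x \<in> N")
    case False
    have sq: "filterlim (\<lambda>n. sqrt (real (Suc n))) at_top sequentially" by real_asymp
    have "(\<lambda>n. t (Suc n) x) \<longlonglongrightarrow> x"
    proof (rule real_tendsto_sandwich)
      show "eventually (\<lambda>n. x \<le> t (Suc n) x) sequentially"
        using le_of_int_ceiling[of "x * sqrt (real (Suc n))" for n]
        by (intro always_eventually allI) (simp add: t_def pos_le_divide_eq del: of_nat_Suc)
      show "eventually (\<lambda>n. t (Suc n) x \<le> x + 1 / sqrt (real (Suc n))) sequentially"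
      proof (intro always_eventually allI)
        fix n
        have "of_int \<lceil>x * sqrt (real (Suc n))\<rceil> \<le> x * sqrt (real (Suc n)) + 1" by linarith
        then have "t (Suc n) x \<le> (x * sqrt (real (Suc n)) + 1) / sqrt (real (Suc n))"
          unfolding t_def by (rule divide_right_mono) simp
        also have "\<dots> = x + 1 / sqrt (real (Suc n))" by (simp add: add_divide_distrib del: of_nat_Suc)
        finally show "t (Suc n) x \<le> x + 1 / sqrt (real (Suc n))" .
      qed
      show "(\<lambda>n. x + 1 / sqrt (real (Suc n))) \<longlonglongrightarrow> x" by real_asymp
    qed simp
    then have "(\<lambda>n. f (t (Suc n) x)) \<longlonglongrightarrow> f x"
      using cont[of x] False x by (intro isCont_tendsto_compose[of x f]) auto
    moreover have "eventually (\<lambda>n. f (t (Suc n) x) = \<phi> (Suc n) x) sequentially"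
      using filterlim_at_top[THEN iffD1, OF sq, rule_format, of x]
      by eventually_elim (use x False in \<open>auto simp: \<phi>_def\<close>)
    ultimately show ?thesis by (rule Lim_transform_eventually)
  qed (simp add: \<phi>_def)
  have "(\<lambda>n. integral {0<..} (\<phi> (Suc n))) \<longlonglongrightarrow> integral {0<..} f"
    by (rule dominated_convergence(2)[where h = H]) (use int H bound lim in \<open>auto simp: integrable_on_def\<close>)
  then have "(\<lambda>n. ?I (Suc n)) \<longlonglongrightarrow> integral {0<..} f" by (simp only: integral_unique[OF int])
  then show ?thesis by (rule filterlim_sequentially_Suc[THEN iffD1])
qed

lemma absolutely_integrable_subset:
  fixes f :: "real \<Rightarrow> real"
  assumes "f absolutely_integrable_on S" "T \<subseteq> S" "T \<in> sets lebesgue"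
  shows "f absolutely_integrable_on T"
  by (rule set_integrable_subset[OF assms(1,3,2)])

lemma integral_trunc_tendsto:
  fixes f :: "real \<Rightarrow> real"
  assumes f: "f absolutely_integrable_on {0<..}"
  shows "(\<lambda>j. integral {0<..real j} f) \<longlonglongrightarrow> integral {0<..} f"
proof -
  let ?g = "\<lambda>j x. if x \<in> {..real j} then f x else 0"
  have I: "integral {0<..real j} f = integral {0<..} (?g j)" for j
  proof -
    have "{..real j} \<inter> {0<..} = {0<..real j}" by auto
    then show ?thesis using integral_restrict_Int[of "{0<..}" "{..real j}" f] by (simp only:)
  qed
  have int: "?g j integrable_on {0<..}" for j
  proof -
    have "f integrable_on ({..real j} \<inter> {0<..})"
      using f by (intro set_lebesgue_integral_eq_integral(1) absolutely_integrable_subset[OF f]) auto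
    then show ?thesis by (subst integrable_restrict_Int)
  qed
  have "(\<lambda>j. integral {0<..} (?g j)) \<longlonglongrightarrow> integral {0<..} f"
  proof (rule dominated_convergence(2)[where h = "\<lambda>x. norm (f x)"])
    show "(\<lambda>x. norm (f x)) integrable_on {0<..}" using f by (simp add: absolutely_integrable_on_def)
    fix x :: real
    have "eventually (\<lambda>j. ?g j x = f x) sequentially"
      using eventually_ge_at_top[of "nat \<lceil>x\<rceil>"]
    proof eventually_elim
      case (elim j)
      then have "x \<le> real j" by linarith
      then show ?case by simp
    qed
    then show "(\<lambda>j. ?g j x) \<longlonglongrightarrow> f x" by (rule tendsto_eventually)
  qed (use int in auto)
  then show ?thesis by (simp only: I)
qed

lemma adm_mono: "adm s \<theta> b \<Longrightarrow> b \<le> b' \<Longrightarrow> \<theta> \<le> \<theta>' \<Longrightarrow> adm s \<theta>' b'"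
  by (auto simp: adm_def)

section \<open>Dependence of the integrals on the parameters\<close>

definition Fint :: "real set \<Rightarrow> real \<Rightarrow> real \<Rightarrow> real" where
  "Fint T s b = integral T (fF s b)"

definition Gint :: "real set \<Rightarrow> real \<Rightarrow> real \<Rightarrow> real" where
  "Gint T s b = integral T (\<lambda>x. Lf s (bw 1 b x))"

context
  fixes T :: "real set"
  assumes T: "T \<subseteq> {0<..}" "T \<in> sets lebesgue"
begin

lemma fF_integrable_T: "adm s 1 b \<Longrightarrow> fF s b integrable_on T"
  by (rule set_lebesgue_integral_eq_integral(1)[OF absolutely_integrable_subset[OF fF_absolutely_integrable T]])

lemma Lf_integrable_T: "adm s \<theta> b \<Longrightarrow> (\<lambda>x. Lf s (bw \<theta> b x)) integrable_on T"
  by (rule set_lebesgue_integral_eq_integral(1)[OF absolutely_integrable_subset[OF Lf_bw_absolutely_integrable T]])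

lemma Fint_antimono: "adm s 1 b \<Longrightarrow> b \<le> b' \<Longrightarrow> Fint T s b' \<le> Fint T s b"
  unfolding Fint_def using T
  by (intro integral_le fF_integrable_T fF_antimono) (auto intro: adm_mono)

text \<open>Convexity in the parameter with slope \<open>- Fint\<close>. Applied at neighbouring
  parameters it replaces differentiation under the integral sign.\<close>

lemma Gint_tangent:
  assumes "adm s 1 b" "adm s 1 b'"
  shows "Gint T s b - (b' - b) * Fint T s b \<le> Gint T s b'"
proof -
  have "Gint T s b - (b' - b) * Fint T s b = integral T (\<lambda>x. Lf s (bw 1 b x) - (b' - b) * fF s b x)"
    unfolding Gint_def Fint_def using assms
    by (subst integral_diff) (auto intro!: integrable_on_mult_right fF_integrable_T Lf_integrable_T)
  also have "\<dots> \<le> Gint T s b'"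
    unfolding Gint_def using assms T
    by (intro integral_le integrable_diff integrable_on_mult_right fF_integrable_T Lf_integrable_T Lf_bw_tangent) auto
  finally show ?thesis .
qed

lemma Fint_tendsto:
  assumes b0: "adm s 1 b0" and b: "\<And>j. b0 \<le> u j" "u \<longlonglongrightarrow> b"
  shows "(\<lambda>j. Fint T s (u j)) \<longlonglongrightarrow> Fint T s b"
  unfolding Fint_def
proof (rule dominated_convergence(2)[where h = "fF s b0"])
  have adm: "adm s 1 (u j)" for j using b0 b(1) by (rule adm_mono) simp
  have bb: "b0 \<le> b" using b by (intro LIMSEQ_le_const) auto
  show "fF s (u j) integrable_on T" for j by (rule fF_integrable_T[OF adm])
  show "fF s b0 integrable_on T" by (rule fF_integrable_T[OF b0])
  fix x :: real assume "x \<in> T"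
  then have x: "x > 0" using T by auto
  show "norm (fF s (u j) x) \<le> fF s b0 x" for j
    using fF_nonneg[OF adm x] fF_antimono[OF b0 b(1) x] by simp
  have "exp (b * x + x\<^sup>2 / 2) + s \<noteq> 0" using denom_pos[OF adm_mono[OF b0 bb] x] by simp
  then show "(\<lambda>j. fF s (u j) x) \<longlonglongrightarrow> fF s b x"
    unfolding fF_def by (intro tendsto_intros b(2))
qed

lemma isCont_Fint:
  assumes b0: "adm s 1 b0" "b0 < b"
  shows "isCont (Fint T s) b"
proof (rule continuous_at_sequentiallyI)
  fix u assume u: "u \<longlonglongrightarrow> b"
  \<comment> \<open>Taking the maximum with \<open>b0\<close> changes only finitely many terms and
    keeps \<open>fF s b0\<close> as a dominating function.\<close>
  have "(\<lambda>j. Fint T s (max b0 (u j))) \<longlonglongrightarrow> Fint T s (max b0 b)"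
    using u by (intro Fint_tendsto[OF b0(1)] tendsto_max tendsto_const) auto
  moreover have "eventually (\<lambda>j. Fint T s (max b0 (u j)) = Fint T s (u j)) sequentially"
    using order_tendstoD(1)[OF u b0(2)] by eventually_elim (simp add: max_def)
  ultimately show "(\<lambda>j. Fint T s (u j)) \<longlonglongrightarrow> Fint T s b"
    using b0(2) by (simp add: max_def Lim_transform_eventually)
qed

end

text \<open>The majorant \<open>env\<close> is the same for all \<open>\<theta> \<ge> 1/2\<close>,
  so the limit can be taken under the integral.\<close>

lemma Gint_theta_tendsto:
  assumes adm: "adm s (1/2) b" and u: "\<And>j. 1/2 \<le> u j" "u \<longlonglongrightarrow> 1"
  shows "(\<lambda>j. integral {0<..} (\<lambda>x. Lf s (bw (u j) b x))) \<longlonglongrightarrow> Gint {0<..} s b"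
  unfolding Gint_def
proof (rule dominated_convergence(2)[where h = "env s b"])
  have a: "adm s (u j) b" for j using adm_mono[OF adm order_refl u(1)] .
  show "(\<lambda>x. Lf s (bw (u j) b x)) integrable_on {0<..}" for j
    by (rule Lf_integrable_T[OF _ _ a]) auto
  show "env s b integrable_on {0<..}" using adm by (intro env_integrable) (auto simp: adm_def)
  fix x :: real assume "x \<in> {0<..}"
  then have x: "x > 0" by simp
  show "norm (Lf s (bw (u j) b x)) \<le> env s b x" for j
    using Lf_le_env[OF a x] Lf_nonneg[OF okY_bw[OF a x]] by simp
  have "adm s 1 b" using adm by (auto simp: adm_def)
  then have "1 + s * bw 1 b x \<noteq> 0" using okY_bw[of s 1 b x] x by (auto simp: okY_def)
  then show "(\<lambda>j. Lf s (bw (u j) b x)) \<longlonglongrightarrow> Lf s (bw 1 b x)"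
    unfolding Lf_def bw_def by (intro tendsto_intros u(2)) (simp_all add: bw_def)
qed

lemma riemann_Lf:
  assumes "adm s \<theta> b"
  shows "(\<lambda>n. (\<Sum>m\<in>{1..n}. Lf s (bw \<theta> b (real m / sqrt n))) / sqrt n) \<longlonglongrightarrow> integral {0<..} (\<lambda>x. Lf s (bw \<theta> b x))"
proof (rule riemann_sum_limit[where H = "env s b" and N = "{}"])
  have sb: "s = 1 \<or> b > 0" using assms by (auto simp: adm_def)
  show "env s b integrable_on {0<..}" by (rule env_integrable[OF sb])
  show "env s b y \<le> env s b x" if "0 < x" "x \<le> y" for x y by (rule env_antimono[OF sb that])
  fix x :: real assume x: "0 < x"
  show "\<bar>Lf s (bw \<theta> b x)\<bar> \<le> env s b x" using Lf_le_env[OF assms x] Lf_nonneg[OF okY_bw[OF assms x]] by simp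
  show "isCont (\<lambda>x. Lf s (bw \<theta> b x)) x"
    using continuous_on_Lf_bw[OF assms] x by (simp add: continuous_on_eq_continuous_at)
qed simp

lemma riemann_Lf_trunc:
  assumes adm: "adm s 1 b" and K: "K > 0"
  shows "(\<lambda>n. (\<Sum>m\<in>{1..nat \<lfloor>K * sqrt n\<rfloor>}. Lf s (bw 1 b (real m / sqrt n))) / sqrt n) \<longlonglongrightarrow> Gint {0<..K} s b"
proof -
  let ?f = "\<lambda>x. if x \<in> {..K} then Lf s (bw 1 b x) else 0"
  have sb: "s = 1 \<or> b > 0" using adm by (auto simp: adm_def)
  have "(\<lambda>n. (\<Sum>m\<in>{1..n}. ?f (real m / sqrt n)) / sqrt n) \<longlonglongrightarrow> integral {0<..} ?f"
  proof (rule riemann_sum_limit[where H = "env s b" and N = "{K}"])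
    show "env s b integrable_on {0<..}" by (rule env_integrable[OF sb])
    show "env s b y \<le> env s b x" if "0 < x" "x \<le> y" for x y by (rule env_antimono[OF sb that])
    fix x :: real assume x: "0 < x"
    show "\<bar>?f x\<bar> \<le> env s b x" using Lf_le_env[OF adm x] Lf_nonneg[OF okY_bw[OF adm x]] by simp
    assume "x \<notin> {K}"
    then consider "x < K" | "x > K" by fastforce
    then show "isCont ?f x"
    proof cases
      case 1
      have "isCont (\<lambda>x. Lf s (bw 1 b x)) x"
        using continuous_on_Lf_bw[OF adm] x by (simp add: continuous_on_eq_continuous_at)
      moreover have "eventually (\<lambda>y. ?f y = Lf s (bw 1 b y)) (nhds x)"
        using eventually_nhds_in_open[of "{..<K}" x] 1 by (auto elim!: eventually_mono)
      ultimately show ?thesis by (simp only: isCont_cong)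
    next
      case 2
      have "eventually (\<lambda>y. ?f y = 0) (nhds x)"
        using eventually_nhds_in_open[of "{K<..}" x] 2 by (auto elim!: eventually_mono)
      then have "isCont ?f x = isCont (\<lambda>_. 0::real) x" by (rule isCont_cong)
      then show ?thesis by simp
    qed
  qed simp
  moreover have "integral {0<..} ?f = Gint {0<..K} s b"
  proof -
    have "{..K} \<inter> {0<..} = {0<..K}" by auto
    then show ?thesis unfolding Gint_def
      using integral_restrict_Int[of "{0<..}" "{..K}" "\<lambda>x. Lf s (bw 1 b x)"] by (simp only:)
  qed
  moreover have "eventually (\<lambda>n. (\<Sum>m\<in>{1..n}. ?f (real m / sqrt n)) / sqrt n =
      (\<Sum>m\<in>{1..nat \<lfloor>K * sqrt n\<rfloor>}. Lf s (bw 1 b (real m / sqrt n))) / sqrt n) sequentially"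
  proof -
    have "eventually (\<lambda>n. K * sqrt (real n) \<le> real n) sequentially" using K by real_asymp
    then show ?thesis using eventually_gt_at_top[of 0]
    proof eventually_elim
      case (elim n)
      have "(\<Sum>m\<in>{1..n}. ?f (real m / sqrt n)) = (\<Sum>m\<in>{1..nat \<lfloor>K * sqrt n\<rfloor>}. Lf s (bw 1 b (real m / sqrt n)))"
      proof (rule sum.mono_neutral_cong_right)
        have *: "m \<le> nat \<lfloor>K * sqrt n\<rfloor> \<longleftrightarrow> real m / sqrt n \<le> K" for m
          using K elim by (simp add: le_nat_iff le_floor_iff pos_divide_le_eq)
        show "{1..nat \<lfloor>K * sqrt n\<rfloor>} \<subseteq> {1..n}"
        proof -
          have "nat \<lfloor>K * sqrt n\<rfloor> \<le> n" using elim by linarith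
          then show ?thesis by auto
        qed
        show "\<forall>i\<in>{1..n} - {1..nat \<lfloor>K * sqrt n\<rfloor>}. ?f (real i / sqrt n) = 0" using * by auto
        show "?f (real x / sqrt n) = Lf s (bw 1 b (real x / sqrt n))" if "x \<in> {1..nat \<lfloor>K * sqrt n\<rfloor>}" for x
          using that * by auto
      qed simp
      then show ?case by simp
    qed
  qed
  ultimately show ?thesis by (simp add: Lim_transform_eventually)
qed

section \<open>Asymptotics of the sums\<close>

definition parts :: "real \<Rightarrow> nat \<Rightarrow> nat list set" where
  "parts s n = (if s = 1 then {ks \<in> int_partitions n. distinct ks} else int_partitions n)"

definition maxmult :: "real \<Rightarrow> nat \<Rightarrow> nat" where
  "maxmult s n = (if s = 1 then 1 else n)"

definition AOsum :: "real \<Rightarrow> nat \<Rightarrow> real" where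
  "AOsum s n = (\<Sum>ks\<in>parts s n. real (AO (complete_multipartite ks)) / fact n)"

definition sqsum :: "nat list \<Rightarrow> real" where
  "sqsum ks = sum_list (map (\<lambda>k. (real k)\<^sup>2) ks)"

lemma finite_parts: "finite (parts s n)"
  by (simp add: parts_def finite_int_partitions)

lemma parts_subset: "parts s n \<subseteq> int_partitions n"
  by (auto simp: parts_def)

lemma sum_list_int_partition: "ks \<in> int_partitions n \<Longrightarrow> sum_list ks = n"
  by (simp add: int_partitions_def)

lemma count_parts: "ks \<in> parts s n \<Longrightarrow> count_list ks m \<le> maxmult s n"
proof -
  assume ks: "ks \<in> parts s n"
  show ?thesis
  proof (cases "s = 1")
    case True
    then have "distinct ks" using ks by (simp add: parts_def)
    then show ?thesis using True by (simp add: maxmult_def distinct_count_atmost_1 flip: count_mset)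
  next
    case False
    have "set ks \<subseteq> {0<..}" "sum_list ks = n" using ks False by (auto simp: parts_def int_partitions_def)
    then have "length ks \<le> n" using length_le_sum_list[of ks] by auto
    then show ?thesis using count_le_length[of ks m] False by (simp add: maxmult_def)
  qed
qed

lemma pairs2_sqsum: "pairs2 ks = sqsum ks - real (sum_list ks)"
  unfolding pairs2_def sqsum_def by (induction ks) (auto simp: power2_eq_square algebra_simps)

lemma sum_power_le_Lf:
  assumes "okY s y"
  shows "(\<Sum>k\<le>maxmult s n. y ^ k) \<le> exp (Lf s y)"
proof (cases "s = 1")
  case True
  then show ?thesis using assms by (simp add: maxmult_def okY_def Lf_def add_pos_nonneg)
next
  case False
  then have y: "0 \<le> y" "y < 1" "s = -1" using assms by (auto simp: okY_def)
  have "(\<Sum>k\<le>n. y ^ k) = (1 - y ^ Suc n) / (1 - y)" using y by (simp add: sum_gp0)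
  also have "\<dots> \<le> 1 / (1 - y)" using y by (intro divide_right_mono) auto
  also have "\<dots> = exp (Lf s y)" using y by (simp add: Lf_def exp_minus divide_inverse)
  finally show ?thesis using False by (simp add: maxmult_def)
qed

text \<open>\<open>z\<close> bounds the share of the geometric series that is lost by stopping at
  multiplicity \<open>n\<close>.\<close>

lemma sum_power_ge_Lf:
  assumes "okY s y" "s = -1 \<Longrightarrow> y ^ Suc n \<le> z" "0 \<le> z"
  shows "exp (Lf s y) * (1 - z) \<le> (\<Sum>k\<le>maxmult s n. y ^ k)"
proof (cases "s = 1")
  case True
  then have "0 \<le> y" using assms by (auto simp: okY_def)
  then have "(1 + y) * (1 - z) \<le> (1 + y) * 1" using assms by (intro mult_left_mono) auto
  then show ?thesis using True \<open>0 \<le> y\<close> by (simp add: maxmult_def Lf_def add_pos_nonneg)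
next
  case False
  then have y: "0 \<le> y" "y < 1" "s = -1" using assms by (auto simp: okY_def)
  have "exp (Lf s y) * (1 - z) = (1 - z) / (1 - y)" using y by (simp add: Lf_def exp_minus divide_inverse)
  also have "\<dots> \<le> (1 - y ^ Suc n) / (1 - y)" using y assms by (intro divide_right_mono) auto
  also have "\<dots> = (\<Sum>k\<le>n. y ^ k)" using y by (simp add: sum_gp0)
  finally show ?thesis using False by (simp add: maxmult_def)
qed

section \<open>Upper bound for the sums\<close>

lemma prod_list_bw:
  assumes "h > 0"
  shows "prod_list (map (\<lambda>m. bw \<theta> b (real m / h)) ks) =
    exp (- (b * real (sum_list ks) / h) - \<theta> * sqsum ks / (2 * h\<^sup>2))"
proof (induction ks)
  case (Cons k ks)
  have "- (b * real (sum_list (k # ks)) / h) - \<theta> * sqsum (k # ks) / (2 * h\<^sup>2) =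
     (- (b * (real k / h)) - \<theta> * (real k / h)\<^sup>2 / 2) + (- (b * real (sum_list ks) / h) - \<theta> * sqsum ks / (2 * h\<^sup>2))"
    using assms by (simp add: sqsum_def power_divide field_simps)
  then show ?case using Cons by (simp add: bw_def exp_add[symmetric])
qed (simp add: sqsum_def)

text \<open>On partitions of \<open>n\<close> the factor \<open>exp (b * sqrt n)\<close> cancels the
  tilt of the parts exactly, whatever \<open>b\<close> is. The condition on the total can then be
  dropped, and the sum factorises over part sizes.\<close>

lemma weighted_partitions_upper:
  assumes adm: "adm s \<theta> b" and n: "n > 0"
  shows "(\<Sum>ks\<in>parts s n. exp (- (\<theta> * sqsum ks / (2 * real n)))) \<le>
     exp (b * sqrt n + (\<Sum>m\<in>{1..n}. Lf s (bw \<theta> b (real m / sqrt n))))"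
proof -
  let ?h = "sqrt (real n)"
  let ?y = "\<lambda>m. bw \<theta> b (real m / ?h)"
  have h: "?h > 0" "?h\<^sup>2 = n" using n by auto
  have "(\<Sum>ks\<in>parts s n. exp (- (\<theta> * sqsum ks / (2 * real n)))) = (\<Sum>ks\<in>parts s n. exp (b * ?h) * prod_list (map ?y ks))"
  proof (rule sum.cong[OF refl])
    fix ks assume "ks \<in> parts s n"
    then have "sum_list ks = n" using parts_subset sum_list_int_partition by blast
    then have "prod_list (map ?y ks) = exp (- (b * ?h) - \<theta> * sqsum ks / (2 * real n))"
      unfolding prod_list_bw[OF h(1)] using h by (simp add: real_div_sqrt flip: times_divide_eq_right)
    then show "exp (- (\<theta> * sqsum ks / (2 * real n))) = exp (b * ?h) * prod_list (map ?y ks)"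
      by (simp add: exp_add[symmetric])
  qed
  also have "\<dots> = exp (b * ?h) * (\<Sum>ks\<in>parts s n. prod_list (map ?y ks))" by (simp add: sum_distrib_left)
  also have "\<dots> \<le> exp (b * ?h) * (\<Prod>m\<in>{1..n}. \<Sum>k\<le>maxmult s n. ?y m ^ k)"
    using bw_pos by (intro mult_left_mono sum_partitions_le_prod parts_subset count_parts) (auto intro: less_imp_le)
  also have "\<dots> \<le> exp (b * ?h) * (\<Prod>m\<in>{1..n}. exp (Lf s (?y m)))"
    using bw_pos okY_bw[OF adm] h
    by (intro mult_left_mono prod_mono conjI sum_nonneg sum_power_le_Lf zero_le_power) (auto intro: less_imp_le)
  also have "\<dots> = exp (b * ?h + (\<Sum>m\<in>{1..n}. Lf s (?y m)))" by (simp add: exp_add exp_sum)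
  finally show ?thesis by simp
qed

text \<open>If all parts are at most \<open>e * n\<close>, \<open>AO_upper\<close> applies with both
  of its parameters equal to \<open>e\<close>. Otherwise a single large part already makes the
  quotient exponentially small by \<open>AO_big_part\<close>. The slack \<open>\<theta> < 1\<close>
  pays for the distortion of the Gaussian exponent.\<close>

lemma AO_upper_uniform:
  assumes th: "1/2 \<le> \<theta>" "\<theta> < 1"
  shows "\<exists>\<delta>>0. \<forall>n>0. \<forall>ks\<in>int_partitions n.
    real (AO (complete_multipartite ks)) / fact n \<le> 2 * exp (- (\<theta> * sqsum ks / (2 * real n))) + 6 * exp (- \<delta> * n)"
proof -
  \<comment> \<open>Small enough that \<open>6 * e \<le> 1 - \<theta>\<close>, from which
    \<open>\<theta> \<le> (1 - 2 * e) / (1 + 4 * e)\<close> follows, and that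
    \<open>12 * e * exp 1\<close> stays below \<open>exp (- (1/2))\<close>.\<close>
  define e where "e = (1 - \<theta>) / 64"
  have e: "0 < e" "e \<le> 1 / 128" "6 * e \<le> 1 - \<theta>" using th by (auto simp: e_def)
  define \<delta> where "\<delta> = e\<^sup>2 / 4"
  have d: "0 < \<delta>" "\<delta> \<le> 1/2" "\<delta> \<le> 2 * e\<^sup>2" "\<delta> \<le> 3 * e\<^sup>2"
  proof -
    have "e\<^sup>2 \<le> 1\<^sup>2" using e by (intro power_mono) auto
    then show "0 < \<delta>" "\<delta> \<le> 1/2" "\<delta> \<le> 2 * e\<^sup>2" "\<delta> \<le> 3 * e\<^sup>2" using e by (auto simp: \<delta>_def)
  qed
  have half: "exp (1/2) \<le> (2::real)"
  proof -
    have "exp (1/2) ^ 2 \<le> (2::real) ^ 2" using exp_le by (simp add: exp_double[symmetric])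
    then show ?thesis by (rule power2_le_imp_le) simp
  qed
  have bound: "real (AO (complete_multipartite ks)) / fact n \<le> 2 * exp (- (\<theta> * sqsum ks / (2 * real n))) + 6 * exp (- \<delta> * n)"
    if n: "n > 0" and ks: "ks \<in> int_partitions n" for n ks
  proof -
    have sum: "sum_list ks = n" using ks by (rule sum_list_int_partition)
    show ?thesis
    proof (cases "\<forall>k\<in>set ks. real k \<le> e * n")
      case True
      have "real (AO (complete_multipartite ks)) / fact n \<le>
         exp (- ((1 - 2 * e) / (1 + 4 * e)) * (pairs2 ks / (2 * real n))) +
         ((12 * e * exp 1) ^ n + exp (- 3 * e\<^sup>2 * n) + 2 * exp (- 2 * e\<^sup>2 * n))"
        using AO_upper[OF sum n, of e e] True e by (simp only: of_nat_mult of_nat_numeral)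
      also have "exp (- ((1 - 2 * e) / (1 + 4 * e)) * (pairs2 ks / (2 * real n))) \<le> 2 * exp (- (\<theta> * sqsum ks / (2 * real n)))"
      proof -
        have "\<theta> * (1 + 4 * e) \<le> (1 - 6 * e) * (1 + 4 * e)" using e by (intro mult_right_mono) auto
        also have "\<dots> \<le> 1 - 2 * e" using e by (simp add: algebra_simps)
        finally have "\<theta> \<le> (1 - 2 * e) / (1 + 4 * e)" using e by (simp add: pos_le_divide_eq)
        then have "\<theta> * (pairs2 ks / (2 * real n)) \<le> (1 - 2 * e) / (1 + 4 * e) * (pairs2 ks / (2 * real n))"
          using pairs2_nonneg by (intro mult_right_mono) auto
        \<comment> \<open>\<open>pairs2\<close> falls short of the sum of squares by
          \<open>n\<close>, which costs at most the factor \<open>exp (1/2) \<le> 2\<close>.\<close>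
        moreover have "\<theta> * (pairs2 ks / (2 * real n)) = \<theta> * sqsum ks / (2 * real n) - \<theta> / 2"
          unfolding pairs2_sqsum sum using n by (simp add: field_simps)
        ultimately have "- ((1 - 2 * e) / (1 + 4 * e)) * (pairs2 ks / (2 * real n)) \<le> 1/2 + - (\<theta> * sqsum ks / (2 * real n))"
          using th unfolding mult_minus_left by linarith
        then have "exp (- ((1 - 2 * e) / (1 + 4 * e)) * (pairs2 ks / (2 * real n))) \<le> exp (1/2 + - (\<theta> * sqsum ks / (2 * real n)))"
          by (simp only: exp_le_cancel_iff)
        also have "\<dots> = exp (1/2) * exp (- (\<theta> * sqsum ks / (2 * real n)))" by (rule exp_add)
        also have "\<dots> \<le> 2 * exp (- (\<theta> * sqsum ks / (2 * real n)))" using half by (intro mult_right_mono) auto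
        finally show ?thesis .
      qed
      also have "(12 * e * exp 1) ^ n \<le> exp (- \<delta> * n)"
      proof -
        have "12 * e * exp 1 \<le> 12 * (1/128) * 3" using e exp_le by (intro mult_mono) auto
        also have "\<dots> \<le> 1 + - (1/2 :: real)" by simp
        also have "\<dots> \<le> exp (- (1/2))" by (rule exp_ge_add_one_self)
        finally have "(12 * e * exp 1) ^ n \<le> exp (- (1/2)) ^ n" using e by (intro power_mono) auto
        also have "\<dots> = exp (real n * - (1/2))" by (rule exp_of_nat_mult[symmetric])
        also have "\<dots> \<le> exp (- \<delta> * n)"
        proof -
          have "\<delta> * n \<le> 1/2 * n" using d by (intro mult_right_mono) auto
          then show ?thesis by simp
        qed
        finally show ?thesis .
      qed
      also have "exp (- 3 * e\<^sup>2 * n) \<le> exp (- \<delta> * n)" using d by (simp add: mult_right_mono)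
      also have "exp (- 2 * e\<^sup>2 * n) \<le> exp (- \<delta> * n)" using d by (simp add: mult_right_mono)
      finally show ?thesis using exp_gt_zero[of "- \<delta> * n"] by linarith
    next
      case False
      then obtain k where k: "k \<in> set ks" "e * n < real k" by auto
      have kn: "real k \<le> n" using member_le_sum_list[of k ks] k sum by simp
      have "real (AO (complete_multipartite ks)) / fact n \<le> exp (- (real k * (real k - 1) / (2 * real n)))"
        using AO_big_part[OF sum n k(1)] by simp
      also have "\<dots> \<le> exp (1/2 + - \<delta> * n)"
      proof -
        have "(e * n)\<^sup>2 \<le> (real k)\<^sup>2" using k e by (intro power_mono) auto
        moreover have "(e * n)\<^sup>2 = e\<^sup>2 * n * n" by (simp add: power2_eq_square)
        moreover have "real k * (real k - 1) = (real k)\<^sup>2 - real k" by (simp add: power2_eq_square algebra_simps)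
        ultimately have "(e\<^sup>2 * n - 1) * n \<le> real k * (real k - 1)" using kn by (simp add: left_diff_distrib)
        then have "(e\<^sup>2 * n - 1) * n / (2 * real n) \<le> real k * (real k - 1) / (2 * real n)" by (intro divide_right_mono) auto
        moreover have "(e\<^sup>2 * n - 1) * n / (2 * real n) = e\<^sup>2 * n / 2 - 1/2" using n by (simp add: diff_divide_distrib)
        ultimately have "e\<^sup>2 * n / 2 - 1/2 \<le> real k * (real k - 1) / (2 * real n)" by simp
        moreover have "\<delta> * n \<le> e\<^sup>2 * n / 2" by (simp add: \<delta>_def)
        ultimately have "- (real k * (real k - 1) / (2 * real n)) \<le> 1/2 + - \<delta> * n" by linarith
        then show ?thesis by (simp only: exp_le_cancel_iff)
      qed
      also have "\<dots> = exp (1/2) * exp (- \<delta> * n)" by (rule exp_add)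
      also have "\<dots> \<le> 6 * exp (- \<delta> * n)"
      proof (rule mult_right_mono)
        show "exp (1/2) \<le> (6::real)" using half by linarith
      qed (rule exp_ge_zero)
      finally show ?thesis using exp_gt_zero[of "- (\<theta> * sqsum ks / (2 * real n))"] by linarith
    qed
  qed
  show ?thesis
  proof (intro exI[of _ \<delta>] conjI allI impI ballI d(1))
    fix n :: nat and ks assume "0 < n" "ks \<in> int_partitions n"
    then show "real (AO (complete_multipartite ks)) / fact n \<le>
        2 * exp (- (\<theta> * sqsum ks / (2 * real n))) + 6 * exp (- \<delta> * real n)" by (rule bound)
  qed
qed

text \<open>The main term is a weighted sum over partitions whose logarithm is a Riemann sum. The
  error \<open>exp (- \<delta> * n)\<close> is multiplied by the number of partitions, which the
  same estimate with the weight \<open>bw 0 1\<close>, without Gaussian factor, bounds by an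
  exponential of order \<open>sqrt n\<close>.\<close>

lemma AOsum_upper_theta:
  assumes adm: "adm s (1/2) b" and th: "1/2 \<le> \<theta>" "\<theta> < 1" and e: "e > 0"
  shows "eventually (\<lambda>n. AOsum s n \<le> exp (sqrt n * (b + integral {0<..} (\<lambda>x. Lf s (bw \<theta> b x)) + e))) sequentially"
proof -
  define I where "I = integral {0<..} (\<lambda>x. Lf s (bw \<theta> b x))"
  define R where "R n = (\<Sum>m\<in>{1..n}. Lf s (bw \<theta> b (real m / sqrt n))) / sqrt n" for n :: nat
  define I0 where "I0 = integral {0<..} (\<lambda>x. Lf (-1) (bw 0 1 x))"
  define R0 where "R0 n = (\<Sum>m\<in>{1..n}. Lf (-1) (bw 0 1 (real m / sqrt n))) / sqrt n" for n :: nat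
  obtain \<delta> where d: "\<delta> > 0" and AO: "\<And>n ks. n > 0 \<Longrightarrow> ks \<in> int_partitions n \<Longrightarrow>
     real (AO (complete_multipartite ks)) / fact n \<le> 2 * exp (- (\<theta> * sqsum ks / (2 * real n))) + 6 * exp (- \<delta> * n)"
    using AO_upper_uniform[OF th] by blast
  have adm': "adm s \<theta> b" using adm_mono[OF adm order_refl th(1)] .
  have "R \<longlonglongrightarrow> I" unfolding R_def I_def by (rule riemann_Lf[OF adm'])
  then have ev1: "eventually (\<lambda>n. R n < I + e / 2) sequentially" using e by (intro order_tendstoD) auto
  have "R0 \<longlonglongrightarrow> I0" unfolding R0_def I0_def by (rule riemann_Lf) (simp add: adm_def)
  then have ev2: "eventually (\<lambda>n. R0 n < I0 + 1) sequentially" by (intro order_tendstoD) auto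
  have ev3: "eventually (\<lambda>n. 6 * exp (- \<delta> * real n + sqrt n * (I0 + 2)) \<le> exp (sqrt n * (b + I + e)) / 2) sequentially"
  proof -
    have "eventually (\<lambda>n. ln 12 + sqrt (real n) * ((I0 + 2) - (b + I + e)) \<le> \<delta> * real n) sequentially"
      using d by real_asymp
    then show ?thesis
    proof eventually_elim
      case (elim n)
      then have "ln 12 + (- \<delta> * real n + sqrt n * (I0 + 2)) \<le> sqrt n * (b + I + e)" by (simp add: algebra_simps)
      then have "exp (ln 12 + (- \<delta> * real n + sqrt n * (I0 + 2))) \<le> exp (sqrt n * (b + I + e))"
        by (simp only: exp_le_cancel_iff)
      then show ?case by (simp add: exp_add[of "ln 12"])
    qed
  qed
  have ev4: "eventually (\<lambda>n. 2 * exp (sqrt n * (b + I + e / 2)) \<le> exp (sqrt n * (b + I + e)) / 2) sequentially"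
  proof -
    have "eventually (\<lambda>n. ln 4 \<le> sqrt (real n) * (e / 2)) sequentially" using e by real_asymp
    then show ?thesis
    proof eventually_elim
      case (elim n)
      then have "ln 4 + sqrt n * (b + I + e / 2) \<le> sqrt n * (b + I + e)" by (simp add: algebra_simps)
      then have "exp (ln 4 + sqrt n * (b + I + e / 2)) \<le> exp (sqrt n * (b + I + e))" by (simp only: exp_le_cancel_iff)
      then show ?case by (simp add: exp_add[of "ln 4"])
    qed
  qed
  show ?thesis using ev1 ev2 ev3 ev4 eventually_gt_at_top[of 0]
  proof eventually_elim
    case (elim n)
    have h: "sqrt (real n) > 0" using elim by simp
    have cardp: "real (card (parts s n)) \<le> exp (sqrt n * (I0 + 2))"
    proof -
      have "real (card (parts s n)) \<le> real (card (parts (-1) n))"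
        by (intro of_nat_mono card_mono finite_parts) (auto simp: parts_def)
      also have "\<dots> = (\<Sum>ks\<in>parts (-1) n. exp (- (0 * sqsum ks / (2 * real n))))" by simp
      also have "\<dots> \<le> exp (1 * sqrt n + (\<Sum>m\<in>{1..n}. Lf (-1) (bw 0 1 (real m / sqrt n))))"
        using elim by (intro weighted_partitions_upper) (auto simp: adm_def)
      also have "(\<Sum>m\<in>{1..n}. Lf (-1) (bw 0 1 (real m / sqrt n))) = sqrt n * R0 n" using h by (simp add: R0_def)
      also have "exp (1 * sqrt n + sqrt n * R0 n) \<le> exp (sqrt n * (I0 + 2))"
      proof -
        have "sqrt n * R0 n \<le> sqrt n * (I0 + 1)" using elim h by (intro mult_left_mono) auto
        then show ?thesis by (simp add: algebra_simps)
      qed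
      finally show ?thesis .
    qed
    have "AOsum s n \<le> (\<Sum>ks\<in>parts s n. 2 * exp (- (\<theta> * sqsum ks / (2 * real n))) + 6 * exp (- \<delta> * n))"
      unfolding AOsum_def using elim AO parts_subset by (intro sum_mono) blast
    also have "\<dots> = 2 * (\<Sum>ks\<in>parts s n. exp (- (\<theta> * sqsum ks / (2 * real n)))) + real (card (parts s n)) * (6 * exp (- \<delta> * n))"
      by (simp add: sum.distrib sum_distrib_left)
    also have "\<dots> \<le> 2 * exp (sqrt n * (b + I + e / 2)) + exp (sqrt n * (I0 + 2)) * (6 * exp (- \<delta> * n))"
    proof (intro add_mono mult_left_mono mult_right_mono cardp)
      have "(\<Sum>ks\<in>parts s n. exp (- (\<theta> * sqsum ks / (2 * real n)))) \<le> exp (b * sqrt n + (\<Sum>m\<in>{1..n}. Lf s (bw \<theta> b (real m / sqrt n))))"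
        using elim by (intro weighted_partitions_upper adm') auto
      also have "(\<Sum>m\<in>{1..n}. Lf s (bw \<theta> b (real m / sqrt n))) = sqrt n * R n" using h by (simp add: R_def)
      also have "exp (b * sqrt n + sqrt n * R n) \<le> exp (sqrt n * (b + I + e / 2))"
      proof -
        have "sqrt n * R n \<le> sqrt n * (I + e / 2)" using elim h by (intro mult_left_mono) auto
        then show ?thesis by (simp add: algebra_simps)
      qed
      finally show "(\<Sum>ks\<in>parts s n. exp (- (\<theta> * sqsum ks / (2 * real n)))) \<le> exp (sqrt n * (b + I + e / 2))" .
    qed auto
    also have "exp (sqrt n * (I0 + 2)) * (6 * exp (- \<delta> * n)) = 6 * exp (- \<delta> * real n + sqrt n * (I0 + 2))"
      by (simp only: exp_add) simp
    also have "2 * exp (sqrt n * (b + I + e / 2)) + \<dots> \<le> exp (sqrt n * (b + I + e))"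
      using elim(3,4) by linarith
    finally show ?case unfolding I_def .
  qed
qed

text \<open>\<open>\<theta>\<close> is fixed so close to 1 that the integral grows by less than
  \<open>e / 2\<close>; only then does \<open>n\<close> tend to infinity.\<close>

lemma AOsum_upper:
  assumes adm: "adm s (1/2) b" and e: "e > 0"
  shows "eventually (\<lambda>n. AOsum s n \<le> exp (sqrt n * (b + Gint {0<..} s b + e))) sequentially"
proof -
  define u :: "nat \<Rightarrow> real" where "u j = 1 - 1 / (real j + 2)" for j
  have u: "1/2 \<le> u j" "u j < 1" for j by (auto simp: u_def field_simps)
  have "u \<longlonglongrightarrow> 1" unfolding u_def by real_asymp
  then have "(\<lambda>j. integral {0<..} (\<lambda>x. Lf s (bw (u j) b x))) \<longlonglongrightarrow> Gint {0<..} s b"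
    by (intro Gint_theta_tendsto[OF adm] u)
  then have "eventually (\<lambda>j. integral {0<..} (\<lambda>x. Lf s (bw (u j) b x)) < Gint {0<..} s b + e / 2) sequentially"
    using e by (intro order_tendstoD) auto
  then obtain j where j: "integral {0<..} (\<lambda>x. Lf s (bw (u j) b x)) < Gint {0<..} s b + e / 2"
    by (auto simp: eventually_sequentially)
  have "eventually (\<lambda>n. AOsum s n \<le> exp (sqrt n * (b + integral {0<..} (\<lambda>x. Lf s (bw (u j) b x)) + e / 2))) sequentially"
    using e by (intro AOsum_upper_theta adm u) auto
  then show ?thesis
  proof eventually_elim
    case (elim n)
    have "sqrt n * (b + integral {0<..} (\<lambda>x. Lf s (bw (u j) b x)) + e / 2) \<le> sqrt n * (b + Gint {0<..} s b + e)"
      using j by (intro mult_left_mono) auto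
    then show ?case using elim by (meson exp_le_cancel_iff order.trans)
  qed
qed

text \<open>Exponential tilting in both directions removes the terms outside of the window.\<close>

lemma chernoff_window:
  fixes W :: "'a \<Rightarrow> real" and \<nu> :: "'a \<Rightarrow> real" and c \<eta> lo hi :: real
  assumes fin: "finite S" and W: "\<And>f. f \<in> S \<Longrightarrow> 0 \<le> W f" and eta: "\<eta> \<ge> 0"
  defines "A \<equiv> \<lambda>b. \<Sum>f\<in>S. W f * exp (- b * \<nu> f)"
  shows "A c - exp (- \<eta> * hi) * A (c - \<eta>) - exp (\<eta> * lo) * A (c + \<eta>) \<le>
     (\<Sum>f\<in>{f\<in>S. lo \<le> \<nu> f \<and> \<nu> f \<le> hi}. W f * exp (- c * \<nu> f))"
proof -
  have "A c - exp (- \<eta> * hi) * A (c - \<eta>) - exp (\<eta> * lo) * A (c + \<eta>) =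
     (\<Sum>f\<in>S. W f * exp (- c * \<nu> f) - exp (- \<eta> * hi) * (W f * exp (- (c - \<eta>) * \<nu> f)) -
        exp (\<eta> * lo) * (W f * exp (- (c + \<eta>) * \<nu> f)))"
    unfolding A_def by (simp only: sum_subtractf sum_distrib_left)
  also have "\<dots> \<le> (\<Sum>f\<in>S. if lo \<le> \<nu> f \<and> \<nu> f \<le> hi then W f * exp (- c * \<nu> f) else 0)"
  proof (rule sum_mono)
    fix f assume f: "f \<in> S"
    have 1: "exp (- \<eta> * hi) * (W f * exp (- (c - \<eta>) * \<nu> f)) = W f * exp (- c * \<nu> f) * exp (\<eta> * (\<nu> f - hi))"
    proof -
      have "- \<eta> * hi + - (c - \<eta>) * \<nu> f = - c * \<nu> f + \<eta> * (\<nu> f - hi)" by (simp add: algebra_simps)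
      then have "exp (- \<eta> * hi) * exp (- (c - \<eta>) * \<nu> f) = exp (- c * \<nu> f) * exp (\<eta> * (\<nu> f - hi))"
        by (metis exp_add)
      then show ?thesis by (simp only: mult_ac)
    qed
    have 2: "exp (\<eta> * lo) * (W f * exp (- (c + \<eta>) * \<nu> f)) = W f * exp (- c * \<nu> f) * exp (\<eta> * (lo - \<nu> f))"
    proof -
      have "\<eta> * lo + - (c + \<eta>) * \<nu> f = - c * \<nu> f + \<eta> * (lo - \<nu> f)" by (simp add: algebra_simps)
      then have "exp (\<eta> * lo) * exp (- (c + \<eta>) * \<nu> f) = exp (- c * \<nu> f) * exp (\<eta> * (lo - \<nu> f))"
        by (metis exp_add)
      then show ?thesis by (simp only: mult_ac)
    qed
    let ?X = "W f * exp (- c * \<nu> f)"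
    have X: "0 \<le> ?X" using W[OF f] by simp
    have X1: "0 \<le> ?X * exp (\<eta> * (\<nu> f - hi))" and X2: "0 \<le> ?X * exp (\<eta> * (lo - \<nu> f))"
      using X by (simp_all only: mult_nonneg_nonneg exp_ge_zero)
    have big1: "?X \<le> ?X * exp (\<eta> * (\<nu> f - hi))" if "hi < \<nu> f"
    proof -
      have "0 \<le> \<eta> * (\<nu> f - hi)" using that eta by simp
      then have "?X * 1 \<le> ?X * exp (\<eta> * (\<nu> f - hi))" using X by (intro mult_left_mono) auto
      then show ?thesis by simp
    qed
    have big2: "?X \<le> ?X * exp (\<eta> * (lo - \<nu> f))" if "\<nu> f < lo"
    proof -
      have "0 \<le> \<eta> * (lo - \<nu> f)" using that eta by simp
      then have "?X * 1 \<le> ?X * exp (\<eta> * (lo - \<nu> f))" using X by (intro mult_left_mono) auto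
      then show ?thesis by simp
    qed
    show "?X - exp (- \<eta> * hi) * (W f * exp (- (c - \<eta>) * \<nu> f)) -
        exp (\<eta> * lo) * (W f * exp (- (c + \<eta>) * \<nu> f)) \<le>
        (if lo \<le> \<nu> f \<and> \<nu> f \<le> hi then ?X else 0)"
    proof (cases "lo \<le> \<nu> f \<and> \<nu> f \<le> hi")
      case True
      show ?thesis unfolding 1 2 if_P[OF True] using X1 X2 by linarith
    next
      case False
      then have "hi < \<nu> f \<or> \<nu> f < lo" by linarith
      then show ?thesis unfolding 1 2 if_not_P[OF False] using X1 X2 big1 big2 by (elim disjE) linarith+
    qed
  qed
  also have "\<dots> = (\<Sum>f\<in>{f\<in>S. lo \<le> \<nu> f \<and> \<nu> f \<le> hi}. W f * exp (- c * \<nu> f))"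
    by (rule sum.inter_filter[symmetric, OF fin])
  finally show ?thesis .
qed

text \<open>At most \<open>n + 1\<close> totals occur, so one of them carries at least the average
  share. The factor \<open>n + 1\<close> is negligible on the scale
  \<open>exp (e * sqrt n)\<close>.\<close>

lemma exists_heavy_value:
  fixes W :: "'a \<Rightarrow> real" and N :: "'a \<Rightarrow> nat"
  assumes fin: "finite S" and le: "\<And>f. f \<in> S \<Longrightarrow> N f \<le> n" and ne: "0 < sum W S"
  shows "\<exists>N0\<in>N ` S. sum W S \<le> real (n + 1) * (\<Sum>f\<in>{f\<in>S. N f = N0}. W f)"
proof (rule ccontr)
  assume "\<not> ?thesis"
  then have lt: "\<And>N0. N0 \<in> N ` S \<Longrightarrow> real (n + 1) * (\<Sum>f\<in>{f\<in>S. N f = N0}. W f) < sum W S" by force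
  have S: "S \<noteq> {}" using ne by auto
  have sub: "N ` S \<subseteq> {..n}" using le by auto
  have "real (n + 1) * sum W S = (\<Sum>N0\<in>N ` S. real (n + 1) * (\<Sum>f\<in>{f\<in>S. N f = N0}. W f))"
    using fin by (simp only: sum_distrib_left[symmetric] sum.image_gen[OF fin, of W N, symmetric])
  also have "\<dots> < (\<Sum>N0\<in>N ` S. sum W S)" using fin S lt by (intro sum_strict_mono) auto
  also have "\<dots> = real (card (N ` S)) * sum W S" by simp
  also have "\<dots> \<le> real (n + 1) * sum W S"
    using card_mono[OF _ sub] ne by (intro mult_right_mono) auto
  finally show False by simp
qed

lemma real_sum_list: "real (sum_list ks) = sum_list (map real ks)"
  by (induction ks) auto

text \<open>Lower bound from the filled partitions with one fixed total \<open>N\<close> of the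
  small parts. All parts are at most \<open>D * h\<close>, so \<open>pairs2\<close> is at most
  \<open>D * h * n\<close>, the Gaussian exponent is of order \<open>h\<close>, and the errors of
  \<open>AO_lower\<close> are negligible against it. The factor in front collects a cost
  \<open>D ^ 2 / 2\<close> for each filling part and the excess of \<open>\<alpha>\<close> over
  1.\<close>

lemma AOsum_ge_fill:
  fixes n M :: nat and D h :: real
  defines "h \<equiv> sqrt (real n)"
  defines "\<alpha> \<equiv> (1 + 24 * (D / h)) / (1 - 4 / sqrt h)"
  assumes n: "n > 0" and T: "finite T" "T \<subseteq> {M<..}" "N + \<Sum>T = n"
    and D: "0 < D" "real M \<le> D * h" "\<And>k. k \<in> T \<Longrightarrow> real k \<le> D * h"
    and big: "8 * D \<le> h" "64 \<le> h" "1 \<le> \<alpha>" "\<alpha> \<le> 2" "12 * exp 1 * (D / h) \<le> exp (- 1)"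
      "exp (- real n) \<le> exp (- (D * h)) / 4" "exp (- 3 * h) \<le> 1/4"
  shows "1 / 2 * exp (- (real (card T) * D\<^sup>2 / 2) - (\<alpha> - 1) * D * h / 2) *
     (\<Sum>f | f \<in> PiE {1..M} (\<lambda>_. {..maxmult s n}) \<and> (\<Sum>m\<in>{1..M}. m * f m) = N. \<Prod>m\<in>{1..M}. bw 1 0 (real m / h) ^ f m) \<le> AOsum s n"
proof -
  have h: "h > 0" "h * h = n" "h\<^sup>2 = n" using n by (auto simp: h_def)
  let ?C = "1 / 2 * exp (- (real (card T) * D\<^sup>2 / 2) - (\<alpha> - 1) * D * h / 2)"
  have "(\<Sum>f | f \<in> PiE {1..M} (\<lambda>_. {..maxmult s n}) \<and> (\<Sum>m\<in>{1..M}. m * f m) = N. ?C * (\<Prod>m\<in>{1..M}. bw 1 0 (real m / h) ^ f m)) \<le> AOsum s n"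
    unfolding AOsum_def
  proof (rule sum_partitions_ge[OF T parts_subset])
    fix f assume f: "f \<in> PiE {1..M} (\<lambda>_. {..maxmult s n})" "(\<Sum>m\<in>{1..M}. m * f m) = N" "fill_list M T f \<in> int_partitions n"
    have "distinct (fill_list M T f)" if "s = 1"
      using f(1) that by (intro distinct_fill_list T) (auto simp: maxmult_def)
    then show "fill_list M T f \<in> parts s n" using f(3) by (simp add: parts_def)
  next
    fix f assume f: "f \<in> PiE {1..M} (\<lambda>_. {..maxmult s n})" "(\<Sum>m\<in>{1..M}. m * f m) = N" "fill_list M T f \<in> parts s n"
    define ks where "ks = fill_list M T f"
    have sum: "sum_list ks = n" using f(3) parts_subset sum_list_int_partition unfolding ks_def by blast
    have kle: "real k \<le> D * h" if "k \<in> set ks" for k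
    proof -
      have "k \<in> {1..M} \<union> T" using that set_fill_list[OF T(1)] unfolding ks_def by blast
      then show ?thesis using D by (auto intro: order.trans[of "real k" "real M"])
    qed
    \<comment> \<open>The width parameter of \<open>AO_lower\<close> must tend to 0 while its error
      term stays small; this choice turns the error into \<open>exp (- 3 * h)\<close>.\<close>
    let ?sig = "1 / sqrt h"
    have sh: "sqrt h > 0" "8 \<le> sqrt h" using h big(2) by (auto intro: real_le_rsqrt)
    have sig: "0 < ?sig" "?sig \<le> 1/8" using sh by (auto simp: field_simps)
    have Dn: "D * h / real n = D / h" using h(1) unfolding h(2)[symmetric] by simp
    have base: "exp (- ((1 + 24 * (D * h / n)) / (1 - 4 * ?sig)) * (pairs2 ks / (2 * n))) * (1 - exp (- 3 * ?sig\<^sup>2 * n))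
     - (12 * exp 1 * (D * h / n)) ^ n \<le> real (AO (complete_multipartite ks)) / fact n"
    proof (rule AO_lower[OF sum n kle])
      have "8 * D * h \<le> h * h" using big h by (intro mult_right_mono) auto
      then show "8 * (D * h) \<le> real n" using h by simp
    qed (use D h sig in auto)
    have r1: "(1 + 24 * (D / h)) / (1 - 4 * ?sig) = \<alpha>" by (simp add: \<alpha>_def)
    have r2: "- 3 * ?sig\<^sup>2 * n = - 3 * h"
    proof -
      have "?sig\<^sup>2 = 1 / h" using h by (simp add: power_divide)
      then show ?thesis using h(1) unfolding h(2)[symmetric] by simp
    qed
    have low: "exp (- \<alpha> * (pairs2 ks / (2 * real n))) * (1 - exp (- 3 * h)) - (12 * exp 1 * (D / h)) ^ n
        \<le> real (AO (complete_multipartite ks)) / fact n"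
      using base unfolding Dn r1 r2 by simp
    define E where "E = exp (- \<alpha> * (pairs2 ks / (2 * real n)))"
    have p2: "pairs2 ks \<le> D * h * n"
    proof -
      have "pairs2 ks \<le> sum_list (map (\<lambda>k. D * h * real k) ks)"
        unfolding pairs2_def
      proof (rule sum_list_mono)
        fix k assume "k \<in> set ks"
        then have "(real k - 1) * real k \<le> D * h * real k" using kle[of k] by (intro mult_right_mono) auto
        then show "real k * (real k - 1) \<le> D * h * real k" by (simp only: mult.commute)
      qed
      also have "\<dots> = D * h * real (sum_list ks)" by (simp add: sum_list_const_mult real_sum_list)
      finally show ?thesis by (simp add: sum)
    qed
    have E1: "exp (- (D * h)) \<le> E"
    proof -
      have "\<alpha> * (pairs2 ks / (2 * real n)) \<le> 2 * (D * h * n / (2 * real n))"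
        using p2 big pairs2_nonneg[of ks] by (intro mult_mono divide_right_mono) auto
      also have "\<dots> = D * h" using n by simp
      finally have "- (D * h) \<le> - \<alpha> * (pairs2 ks / (2 * real n))" unfolding mult_minus_left by linarith
      then show ?thesis unfolding E_def by (simp only: exp_le_cancel_iff)
    qed
    have tiny: "(12 * exp 1 * (D / h)) ^ n \<le> E / 4"
    proof -
      have "(12 * exp 1 * (D / h)) ^ n \<le> exp (- 1) ^ n" using D h big by (intro power_mono) auto
      also have "\<dots> = exp (- real n)" using exp_of_nat_mult[of n "- 1 :: real"] by simp
      finally show ?thesis using big E1 by linarith
    qed
    have "E * (3/4) \<le> E * (1 - exp (- 3 * h))" using big by (intro mult_left_mono) (auto simp: E_def)
    then have half: "E / 2 \<le> real (AO (complete_multipartite ks)) / fact n"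
      using low tiny unfolding E_def[symmetric] by linarith
    have "(\<alpha> - 1) * (pairs2 ks / (2 * real n)) \<le> (\<alpha> - 1) * (D * h * n / (2 * real n))"
      using p2 big by (intro mult_left_mono divide_right_mono) auto
    also have "\<dots> = (\<alpha> - 1) * D * h / 2" using n by simp
    finally have a1: "\<alpha> * (pairs2 ks / (2 * real n)) \<le> pairs2 ks / (2 * real n) + (\<alpha> - 1) * D * h / 2"
      by (simp only: left_diff_distrib)
    have "pairs2 ks \<le> sqsum ks" using pairs2_sqsum[of ks] by simp
    also have "sqsum ks = (\<Sum>m\<in>{1..M}. real (f m) * (real m)\<^sup>2) + (\<Sum>m\<in>T. (real m)\<^sup>2)"
      unfolding sqsum_def ks_def by (subst sum_list_fill_list) simp
    also have "(\<Sum>m\<in>T. (real m)\<^sup>2) \<le> (\<Sum>m\<in>T. (D * h)\<^sup>2)" using D by (intro sum_mono power_mono) auto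
    also have "\<dots> = real (card T) * D\<^sup>2 * n" using h by (simp add: power_mult_distrib)
    finally have "pairs2 ks / (2 * real n) \<le>
        ((\<Sum>m\<in>{1..M}. real (f m) * (real m)\<^sup>2) + real (card T) * D\<^sup>2 * n) / (2 * real n)"
      by (intro divide_right_mono) auto
    also have "\<dots> = (\<Sum>m\<in>{1..M}. real (f m) * (real m)\<^sup>2) / (2 * real n) + real (card T) * D\<^sup>2 / 2"
      using n by (simp add: add_divide_distrib)
    finally have a2: "\<alpha> * (pairs2 ks / (2 * real n)) \<le>
       (\<Sum>m\<in>{1..M}. real (f m) * (real m)\<^sup>2) / (2 * real n) + real (card T) * D\<^sup>2 / 2 + (\<alpha> - 1) * D * h / 2"
      using a1 by linarith
    have Wf: "(\<Prod>m\<in>{1..M}. bw 1 0 (real m / h) ^ f m) = exp (- ((\<Sum>m\<in>{1..M}. real (f m) * (real m)\<^sup>2) / (2 * real n)))"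
    proof -
      have "bw 1 0 (real m / h) ^ f m = exp (- (real (f m) * (real m)\<^sup>2 / (2 * real n)))" for m
        using h by (simp add: bw_def exp_of_nat_mult[symmetric] power_divide)
      then show ?thesis by (simp add: exp_sum[symmetric] sum_negf sum_divide_distrib)
    qed
    have "?C * (\<Prod>m\<in>{1..M}. bw 1 0 (real m / h) ^ f m) =
       1/2 * exp ((- (real (card T) * D\<^sup>2 / 2) - (\<alpha> - 1) * D * h / 2) +
          - ((\<Sum>m\<in>{1..M}. real (f m) * (real m)\<^sup>2) / (2 * real n)))"
      unfolding Wf by (simp only: exp_add mult.assoc)
    also have "\<dots> \<le> 1/2 * E"
    proof (rule mult_left_mono)
      have "(- (real (card T) * D\<^sup>2 / 2) - (\<alpha> - 1) * D * h / 2) +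
          - ((\<Sum>m\<in>{1..M}. real (f m) * (real m)\<^sup>2) / (2 * real n)) \<le> - \<alpha> * (pairs2 ks / (2 * real n))"
        using a2 unfolding mult_minus_left by linarith
      then show "exp ((- (real (card T) * D\<^sup>2 / 2) - (\<alpha> - 1) * D * h / 2) +
          - ((\<Sum>m\<in>{1..M}. real (f m) * (real m)\<^sup>2) / (2 * real n))) \<le> E"
        unfolding E_def by (simp only: exp_le_cancel_iff)
    qed simp
    also have "\<dots> \<le> real (AO (complete_multipartite (fill_list M T f))) / fact n" using half by (simp add: ks_def)
    finally show "?C * (\<Prod>m\<in>{1..M}. bw 1 0 (real m / h) ^ f m) \<le> real (AO (complete_multipartite (fill_list M T f))) / fact n" .
  qed auto
  then show ?thesis by (simp only: sum_distrib_left)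
qed

text \<open>Bookkeeping for \<open>AOsum_lower_trunc\<close>, where \<open>q\<close> is one eighth
  of the permitted loss and each of five error terms is at most \<open>q\<close>.\<close>

lemma error_budget:
  fixes q :: real
  assumes "t1 \<le> t2 + q" "t3 \<le> q" "t6 \<le> q" "t5 - q \<le> t4" "l1 + l2 \<le> q" "0 \<le> q"
  shows "t5 + i - t2 - 8 * q \<le> (- t1 - t3) + (i - t6 + t4 - l1) - l2"
  using assms by linarith

text \<open>Parts of size at most \<open>K sqrt n\<close> typically add up to \<open>v n\<close>. For one total near this value the remaining
  \<open>(1 - v) n\<close> is filled with few distinct parts of size at most \<open>D sqrt n\<close>.\<close>

lemma AOsum_lower_trunc:
  fixes s c K e D :: real
  defines "v \<equiv> Fint {0<..K} s c" and "I \<equiv> Gint {0<..K} s c"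
  assumes adm0: "adm s 1 b0" "b0 < c" and K: "K \<ge> 1" and v1: "v < 1" and e: "e > 0"
    and D: "D = 2 * K + 3 / K + 1"
  shows "eventually (\<lambda>n. exp (sqrt n * (c * v + I - (1 - v) * D\<^sup>2 / (2 * K) - e)) \<le> AOsum s n) sequentially"
proof -
  have T: "{0<..K} \<subseteq> {0<..}" "{0<..K} \<in> sets lebesgue" by auto
  have Dpos: "D > 0" "2 * K \<le> D" using K by (auto simp: D add_pos_pos)
  have adm: "adm s 1 c" using adm_mono[OF adm0(1)] adm0(2) by auto
  have v0: "0 \<le> v" unfolding v_def Fint_def
    using T by (intro integral_nonneg fF_integrable_T[OF T adm] fF_nonneg[OF adm]) auto
  \<comment> \<open>Half-width of the window for the rescaled total: it must keep the total below
    \<open>n\<close>, and its effect on \<open>c * v\<close> and on the filling cost must not exceed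
    \<open>e / 8\<close> each.\<close>
  define e1 where "e1 = min ((1 - v) / 2) (min (e / (8 * (\<bar>c\<bar> + 1))) (e * K / (4 * D\<^sup>2)))"
  have e1: "0 < e1" "e1 \<le> (1 - v) / 2" "e1 \<le> e / (8 * (\<bar>c\<bar> + 1))" "e1 \<le> e * K / (4 * D\<^sup>2)"
  proof -
    show "0 < e1" using v1 e K Dpos by (simp add: e1_def add_nonneg_pos)
    show "e1 \<le> (1 - v) / 2" unfolding e1_def by (rule min.cobounded1)
    show "e1 \<le> e / (8 * (\<bar>c\<bar> + 1))" unfolding e1_def by (meson min.cobounded1 min.cobounded2 order.trans)
    show "e1 \<le> e * K / (4 * D\<^sup>2)" unfolding e1_def by (meson min.cobounded2 order.trans)
  qed
  have e1v: "2 * e1 \<le> 1 - v" using e1(2) by simp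
  have ce1: "\<bar>c\<bar> * e1 \<le> e / 8" and e1e: "e1 \<le> e"
  proof -
    have "(\<bar>c\<bar> + 1) * e1 \<le> (\<bar>c\<bar> + 1) * (e / (8 * (\<bar>c\<bar> + 1)))" using e1 by (intro mult_left_mono) auto
    also have "\<dots> = e / 8"
    proof -
      have "\<bar>c\<bar> + 1 \<noteq> 0" by linarith
      then have "(\<bar>c\<bar> + 1) * e / ((\<bar>c\<bar> + 1) * 8) = e / 8" by (rule nonzero_mult_divide_mult_cancel_left)
      then show ?thesis by (simp only: times_divide_eq_right mult.commute[of 8])
    qed
    finally have *: "\<bar>c\<bar> * e1 + e1 \<le> e / 8" by (simp add: algebra_simps)
    moreover have "0 \<le> \<bar>c\<bar> * e1" using e1 by simp
    ultimately show "\<bar>c\<bar> * e1 \<le> e / 8" "e1 \<le> e" using e1(1) e by linarith+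
  qed
  have De1: "e1 * D\<^sup>2 / (2 * K) \<le> e / 8"
  proof -
    have "e1 * D\<^sup>2 / (2 * K) \<le> e * K / (4 * D\<^sup>2) * D\<^sup>2 / (2 * K)"
      using e1 K by (intro divide_right_mono mult_right_mono) auto
    also have "\<dots> = e / 8" using K Dpos by simp
    finally show ?thesis .
  qed
  have "isCont (Fint {0<..K} s) c" by (rule isCont_Fint[OF T adm0])
  then obtain d where d: "d > 0" "\<And>b. \<bar>b - c\<bar> < d \<Longrightarrow> \<bar>Fint {0<..K} s b - v\<bar> < e1 / 4"
    using e1(1) unfolding continuous_at_eps_delta dist_real_def v_def
    by (metis zero_less_divide_iff zero_less_numeral)
  \<comment> \<open>The tilt is small enough that the mean \<open>Fint\<close> changes by less than
    \<open>e1 / 4\<close> and that \<open>c - \<eta>\<close> is still at least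
    \<open>b0\<close>.\<close>
  define \<eta> where "\<eta> = min (d / 2) (min 1 (c - b0))"
  have eta: "0 < \<eta>" "\<eta> < d" "\<eta> \<le> 1" "b0 \<le> c - \<eta>" using d adm0 by (auto simp: \<eta>_def)
  \<comment> \<open>A deviation by \<open>e1\<close> gains \<open>\<eta> * e1\<close> in the
    exponent. Of this, \<open>\<eta> * e1 / 4\<close> is lost to the change of the mean and
    \<open>2 * e2 = \<eta> * e1 / 4\<close> to the Riemann sums, so that
    \<open>\<eta> * e1 / 2\<close> remains.\<close>
  define e2 where "e2 = \<eta> * e1 / 8"
  have e2: "0 < e2" "e2 \<le> e / 8"
  proof -
    have "\<eta> * e1 \<le> 1 * e" using eta e1 e1e by (intro mult_mono) auto
    then show "0 < e2" "e2 \<le> e / 8" using eta e1 by (auto simp: e2_def)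
  qed
  have adm_m: "adm s 1 (c - \<eta>)" and adm_p: "adm s 1 (c + \<eta>)"
    using adm_mono[OF adm0(1)] eta adm0 by auto
  have Gm: "Gint {0<..K} s (c - \<eta>) \<le> I + \<eta> * (v + e1 / 4)"
  proof -
    have "Gint {0<..K} s (c - \<eta>) - (c - (c - \<eta>)) * Fint {0<..K} s (c - \<eta>) \<le> I"
      unfolding I_def by (rule Gint_tangent[OF T adm_m adm])
    moreover have "Fint {0<..K} s (c - \<eta>) \<le> v + e1 / 4" 
    proof -
      have "\<bar>Fint {0<..K} s (c - \<eta>) - v\<bar> < e1 / 4" using eta by (intro d(2)) auto
      then show ?thesis by linarith
    qed
    then have "\<eta> * Fint {0<..K} s (c - \<eta>) \<le> \<eta> * (v + e1 / 4)" using eta by (intro mult_left_mono) auto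
    ultimately show ?thesis by simp
  qed
  have Gp: "Gint {0<..K} s (c + \<eta>) \<le> I - \<eta> * (v - e1 / 4)"
  proof -
    have "Gint {0<..K} s (c + \<eta>) - (c - (c + \<eta>)) * Fint {0<..K} s (c + \<eta>) \<le> I"
      unfolding I_def by (rule Gint_tangent[OF T adm_p adm])
    moreover have "v - e1 / 4 \<le> Fint {0<..K} s (c + \<eta>)" 
    proof -
      have "\<bar>Fint {0<..K} s (c + \<eta>) - v\<bar> < e1 / 4" using eta by (intro d(2)) auto
      then show ?thesis by linarith
    qed
    then have "\<eta> * (v - e1 / 4) \<le> \<eta> * Fint {0<..K} s (c + \<eta>)" using eta by (intro mult_left_mono) auto
    ultimately show ?thesis by simp
  qed
  define M where "M n = nat \<lfloor>K * sqrt (real n)\<rfloor>" for n :: nat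
  define R where "R b n = (\<Sum>m\<in>{1..M n}. Lf s (bw 1 b (real m / sqrt n))) / sqrt n" for b :: real and n :: nat
  have Rlim: "(R b) \<longlonglongrightarrow> Gint {0<..K} s b" if "adm s 1 b" for b
    unfolding R_def M_def using riemann_Lf_trunc[OF that, of K] K by simp
  \<comment> \<open>Bounds the power \<open>n + 1\<close> of every weight in the Bose case: already
    a part of size 1 has weight at most \<open>exp (- c / sqrt n)\<close>. For distinct parts no
    series is cut off.\<close>
  define z where "z n = (if s = 1 then 0 else exp (- c * sqrt (real n)))" for n :: nat
  define \<alpha> where "\<alpha> n = (1 + 24 * (D / sqrt (real n))) / (1 - 4 / sqrt (sqrt (real n)))" for n :: nat
  have ev_a: "eventually (\<lambda>n. I - e2 < R c n) sequentially"
    using Rlim[OF adm] e2 unfolding I_def by (intro order_tendstoD) auto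
  have ev_b: "eventually (\<lambda>n. R (c - \<eta>) n < Gint {0<..K} s (c - \<eta>) + e2) sequentially"
    using Rlim[OF adm_m] e2 by (intro order_tendstoD) auto
  have ev_c: "eventually (\<lambda>n. R (c + \<eta>) n < Gint {0<..K} s (c + \<eta>) + e2) sequentially"
    using Rlim[OF adm_p] e2 by (intro order_tendstoD) auto
  have ev_d: "eventually (\<lambda>n. K * sqrt n * z n \<le> 1/2) sequentially"
  proof (cases "s = 1")
    case False
    then have "c > 0" using adm by (auto simp: adm_def)
    then have "eventually (\<lambda>n. K * sqrt (real n) * exp (- c * sqrt (real n)) \<le> 1/2) sequentially" by real_asymp
    then show ?thesis using False by (simp add: z_def)
  qed (simp add: z_def)
  have ev_e: "eventually (\<lambda>n. exp (- (sqrt (real n) * (\<eta> * e1 / 2))) \<le> 1/8) sequentially"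
  proof -
    have *: "eventually (\<lambda>n. exp (- (sqrt (real n) * q)) \<le> 1/8) sequentially" if "q > 0" for q :: real
      using that by real_asymp
    have "\<eta> * e1 / 2 > 0" using eta e1 by simp
    then show ?thesis by (rule *)
  qed
  have ev_f: "eventually (\<lambda>n. K * sqrt (real n) < (1 - v) / 2 * real n) sequentially"
    using v1 by real_asymp
  have ev_g1: "eventually (\<lambda>n. 8 * D \<le> sqrt (real n)) sequentially" by real_asymp
  have ev_g2: "eventually (\<lambda>n. 64 \<le> sqrt (real n)) sequentially" by real_asymp
  have ev_g3: "eventually (\<lambda>n. 12 * exp 1 * (D / sqrt (real n)) \<le> exp (- 1)) sequentially"
    using Dpos(1) by real_asymp
  have ev_g4: "eventually (\<lambda>n. exp (- real n) \<le> exp (- (D * sqrt (real n))) / 4) sequentially"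
  proof -
    have "eventually (\<lambda>n. D * sqrt (real n) + ln 4 \<le> real n) sequentially" using Dpos(1) by real_asymp
    then show ?thesis
    proof eventually_elim
      case (elim n)
      then have "exp (- real n) \<le> exp (- (D * sqrt (real n)) - ln 4)" by simp
      then show ?case by (simp add: exp_diff)
    qed
  qed
  have ev_g5: "eventually (\<lambda>n. exp (- 3 * sqrt (real n)) \<le> 1/4) sequentially" by real_asymp
  note ev_g = ev_g1 ev_g2 ev_g3 ev_g4 ev_g5
  have alim: "\<alpha> \<longlonglongrightarrow> 1" unfolding \<alpha>_def by real_asymp
  have ev_h: "eventually (\<lambda>n. \<alpha> n \<le> 2) sequentially" 
    using order_tendstoD(2)[OF alim, of 2] by (auto elim: eventually_mono)
  have ev_i: "eventually (\<lambda>n. (\<alpha> n - 1) * D / 2 \<le> e / 8) sequentially"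
  proof -
    have "(\<lambda>n. (\<alpha> n - 1) * D / 2) \<longlonglongrightarrow> (1 - 1) * D / 2" by (intro tendsto_intros alim) auto
    moreover have "(1 - 1) * D / 2 < e / 8" using e by simp
    ultimately have "eventually (\<lambda>n. (\<alpha> n - 1) * D / 2 < e / 8) sequentially" by (rule order_tendstoD(2))
    then show ?thesis by (rule eventually_mono) (rule less_imp_le)
  qed
  have ev_j: "eventually (\<lambda>n. ln (8 * (real n + 1)) \<le> sqrt (real n) * (e / 8)) sequentially"
    using e by real_asymp
  show ?thesis
    using ev_a ev_b ev_c ev_d ev_e ev_f ev_g ev_h ev_i ev_j eventually_gt_at_top[of 0]
  proof eventually_elim
    case (elim n)
    define h where "h = sqrt (real n)"
    have n: "n > 0" using elim by simp
    have h: "h > 0" "h * h = n" "h\<^sup>2 = n" using n by (auto simp: h_def)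
    have h64: "h \<ge> 64" using elim by (simp add: h_def)
    define S where "S = PiE {1..M n} (\<lambda>_. {..maxmult s n})"
    define W where "W f = (\<Prod>m\<in>{1..M n}. bw 1 0 (real m / h) ^ f m)" for f :: "nat \<Rightarrow> nat"
    define N where "N f = (\<Sum>m\<in>{1..M n}. m * f m)" for f :: "nat \<Rightarrow> nat"
    define \<nu> where "\<nu> f = real (N f) / h" for f
    define A where "A b = (\<Sum>f\<in>S. W f * exp (- b * \<nu> f))" for b
    have finS: "finite S" unfolding S_def by (intro finite_PiE) auto
    have W0: "0 \<le> W f" for f unfolding W_def using bw_pos by (intro prod_nonneg) (auto intro: less_imp_le)
    have A_prod: "A b = (\<Prod>m\<in>{1..M n}. \<Sum>k\<le>maxmult s n. bw 1 b (real m / h) ^ k)" for b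
    proof -
      have "W f * exp (- b * \<nu> f) = (\<Prod>m\<in>{1..M n}. bw 1 b (real m / h) ^ f m)" for f
      proof -
        have "- b * \<nu> f = (\<Sum>m\<in>{1..M n}. real (f m) * (- (b * (real m / h))))"
          unfolding \<nu>_def N_def by (simp add: sum_divide_distrib sum_distrib_left sum_negf mult_ac)
        then have "exp (- b * \<nu> f) = (\<Prod>m\<in>{1..M n}. exp (- (b * (real m / h))) ^ f m)"
          by (simp only: exp_sum[OF finite_atLeastAtMost] exp_of_nat_mult)
        moreover have "bw 1 b x = bw 1 0 x * exp (- (b * x))" for x by (simp add: bw_def exp_add[symmetric])
        ultimately show ?thesis unfolding W_def by (simp only: power_mult_distrib prod.distrib)
      qed
      then show ?thesis unfolding A_def S_def by (simp add: prod_sum_PiE)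
    qed
    have Rh: "(\<Sum>m\<in>{1..M n}. Lf s (bw 1 b (real m / h))) = h * R b n" for b
      using h(1) by (simp add: R_def h_def)
    have ok: "okY s (bw 1 b (real m / h))" if "adm s 1 b" "m \<in> {1..M n}" for b m
      using that h by (intro okY_bw) auto
    have A_le: "A b \<le> exp (h * R b n)" if "adm s 1 b" for b
    proof -
      have "A b \<le> (\<Prod>m\<in>{1..M n}. exp (Lf s (bw 1 b (real m / h))))"
        unfolding A_prod using bw_pos ok[OF that]
        by (intro prod_mono conjI sum_nonneg sum_power_le_Lf zero_le_power) (auto intro: less_imp_le)
      then show ?thesis unfolding Rh[symmetric] by (simp add: exp_sum)
    qed
    have Mn: "real (M n) \<le> K * h" "K * h < real (M n) + 1"
    proof -
      have "0 \<le> K * h" using K h by simp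
      then show "real (M n) \<le> K * h" "K * h < real (M n) + 1" unfolding M_def h_def[symmetric] by linarith+
    qed
    have z: "0 \<le> z n" "K * h * z n \<le> 1/2" using elim by (auto simp: z_def h_def)
    \<comment> \<open>Each of at most \<open>K * h\<close> factors loses \<open>1 - z n\<close> by
      the cut of its series; by Bernoulli's inequality the total loss is at most a factor 2.\<close>
    have A_ge: "exp (h * (I - e2)) / 2 \<le> A c"
    proof -
      have z1: "z n \<le> 1"
      proof -
        have "1 * z n \<le> K * h * z n" using K h64 z mult_mono[of 1 K 1 h] by (intro mult_right_mono) auto
        then show ?thesis using z by simp
      qed
      have pw: "bw 1 c (real m / h) ^ Suc n \<le> z n" if "s = -1" "m \<in> {1..M n}" for m
      proof -
        have c: "c > 0" using that adm by (auto simp: adm_def)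
        have "bw 1 c (real m / h) \<le> exp (- (c / h))"
        proof -
          have "c / h * 1 \<le> c / h * real m" using c h that by (intro mult_left_mono) auto
          moreover have "c / h * real m = c * (real m / h)" by simp
          moreover have "0 \<le> 1 * (real m / h)\<^sup>2 / 2" by simp
          ultimately have "- (c * (real m / h)) - 1 * (real m / h)\<^sup>2 / 2 \<le> - (c / h)" by linarith
          then show ?thesis unfolding bw_def by (simp only: exp_le_cancel_iff)
        qed
        then have "bw 1 c (real m / h) ^ Suc n \<le> exp (- (c / h)) ^ Suc n"
          using bw_pos by (intro power_mono) (auto intro: less_imp_le)
        also have "\<dots> = exp (real (Suc n) * - (c / h))" by (rule exp_of_nat_mult[symmetric])
        also have "\<dots> \<le> exp (- c * h)"
        proof -
          have "c * h = real n * (c / h)" using h(1) unfolding h(2)[symmetric] by simp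
          also have "\<dots> \<le> real (Suc n) * (c / h)" using c h by (intro mult_right_mono) auto
          finally show ?thesis by simp
        qed
        finally show ?thesis using that by (simp add: z_def h_def)
      qed
      have "exp (h * R c n) * (1 - z n) ^ M n = (\<Prod>m\<in>{1..M n}. exp (Lf s (bw 1 c (real m / h))) * (1 - z n))"
        unfolding Rh[symmetric] by (simp add: prod.distrib exp_sum)
      also have "\<dots> \<le> A c"
        unfolding A_prod using z z1 ok[OF adm] pw by (intro prod_mono conjI sum_power_ge_Lf mult_nonneg_nonneg) auto
      finally have 1: "exp (h * R c n) * (1 - z n) ^ M n \<le> A c" .
      have "1 + real (M n) * (- z n) \<le> (1 + (- z n)) ^ M n" using z1 by (intro Bernoulli_inequality) auto
      moreover have "real (M n) * z n \<le> K * h * z n" using Mn z by (intro mult_right_mono) auto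
      ultimately have 2: "1/2 \<le> (1 - z n) ^ M n" using z by simp
      have "h * (I - e2) \<le> h * R c n" using elim(1) h by (intro mult_left_mono) auto
      then have "exp (h * (I - e2)) * (1/2) \<le> exp (h * R c n) * (1 - z n) ^ M n"
        using 2 by (intro mult_mono) auto
      then show ?thesis using 1 by simp
    qed
    define Q where "Q = exp (h * (I - e2))"
    have Qpos: "Q > 0" by (simp add: Q_def)
    have small: "exp (- (h * (\<eta> * e1 / 2))) \<le> 1/8" using elim by (simp add: h_def)
    have tail1: "exp (- \<eta> * (h * (v + e1))) * A (c - \<eta>) \<le> Q / 8"
    proof -
      have "exp (- \<eta> * (h * (v + e1))) * A (c - \<eta>) \<le> exp (- \<eta> * (h * (v + e1))) * exp (h * R (c - \<eta>) n)"
        using A_le[OF adm_m] by (intro mult_left_mono) auto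
      also have "\<dots> = exp (h * (R (c - \<eta>) n - \<eta> * (v + e1)))" by (simp add: exp_add[symmetric] algebra_simps)
      also have "\<dots> \<le> exp (h * ((I - e2) - \<eta> * e1 / 2))"
      proof -
        have "R (c - \<eta>) n \<le> I + \<eta> * (v + e1 / 4) + e2" using elim(2) Gm by linarith
        then have "R (c - \<eta>) n - \<eta> * (v + e1) \<le> (I - e2) - \<eta> * e1 / 2" by (simp add: e2_def algebra_simps)
        then show ?thesis using h by simp
      qed
      also have "\<dots> = Q * exp (- (h * (\<eta> * e1 / 2)))" unfolding Q_def exp_add[symmetric] by (simp add: algebra_simps)
      also have "\<dots> \<le> Q * (1/8)" using small Qpos by (intro mult_left_mono) auto
      finally show ?thesis by simp
    qed
    have tail2: "exp (\<eta> * (h * (v - e1))) * A (c + \<eta>) \<le> Q / 8"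
    proof -
      have "exp (\<eta> * (h * (v - e1))) * A (c + \<eta>) \<le> exp (\<eta> * (h * (v - e1))) * exp (h * R (c + \<eta>) n)"
        using A_le[OF adm_p] by (intro mult_left_mono) auto
      also have "\<dots> = exp (h * (R (c + \<eta>) n + \<eta> * (v - e1)))" by (simp add: exp_add[symmetric] algebra_simps)
      also have "\<dots> \<le> exp (h * ((I - e2) - \<eta> * e1 / 2))"
      proof -
        have "R (c + \<eta>) n \<le> I - \<eta> * (v - e1 / 4) + e2" using elim(3) Gp by linarith
        then have "R (c + \<eta>) n + \<eta> * (v - e1) \<le> (I - e2) - \<eta> * e1 / 2" by (simp add: e2_def algebra_simps)
        then show ?thesis using h by simp
      qed
      also have "\<dots> = Q * exp (- (h * (\<eta> * e1 / 2)))" unfolding Q_def exp_add[symmetric] by (simp add: algebra_simps)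
      also have "\<dots> \<le> Q * (1/8)" using small Qpos by (intro mult_left_mono) auto
      finally show ?thesis by simp
    qed
    define S' where "S' = {f\<in>S. h * (v - e1) \<le> \<nu> f \<and> \<nu> f \<le> h * (v + e1)}"
    \<comment> \<open>A quarter of \<open>Q\<close> survives in the window: \<open>A_ge\<close>
      guarantees a half, and each tail takes at most an eighth.\<close>
    have "A c - exp (- \<eta> * (h * (v + e1))) * A (c - \<eta>) - exp (\<eta> * (h * (v - e1))) * A (c + \<eta>) \<le>
       (\<Sum>f\<in>S'. W f * exp (- c * \<nu> f))"
      unfolding A_def S'_def using W0 eta by (intro chernoff_window finS) auto
    then have mid: "Q / 4 \<le> (\<Sum>f\<in>S'. W f * exp (- c * \<nu> f))"
      using tail1 tail2 A_ge unfolding Q_def[symmetric] by linarith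
    have Nf: "real (N f) = h * \<nu> f" for f using h by (simp add: \<nu>_def)
    have N_upper: "real (N f) \<le> (v + e1) * n" "(v - e1) * n \<le> real (N f)" if "f \<in> S'" for f
    proof -
      have "h * \<nu> f \<le> h * (h * (v + e1))" "h * (h * (v - e1)) \<le> h * \<nu> f"
        using that h by (auto simp: S'_def intro!: mult_left_mono)
      then show "real (N f) \<le> (v + e1) * n" "(v - e1) * n \<le> real (N f)"
        unfolding Nf h(2)[symmetric] by (simp_all add: mult_ac)
    qed
    have ve: "v + e1 < 1"
    proof -
      have "v + e1 \<le> v + (1 - v) / 2" using e1(2) by (rule add_left_mono)
      also have "\<dots> = (v + 1) / 2" by (simp add: field_simps)
      also have "\<dots> < 1" using v1 by simp
      finally show ?thesis .
    qed
    have "\<exists>N0\<in>N ` S'. (\<Sum>f\<in>S'. W f * exp (- c * \<nu> f)) \<le>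
        real (n + 1) * (\<Sum>f\<in>{f\<in>S'. N f = N0}. W f * exp (- c * \<nu> f))"
    proof (rule exists_heavy_value)
      show "finite S'" using finS by (simp add: S'_def)
      show "0 < (\<Sum>f\<in>S'. W f * exp (- c * \<nu> f))" using mid Qpos by linarith
      fix f assume "f \<in> S'"
      then have "real (N f) \<le> (v + e1) * n" by (rule N_upper)
      also have "\<dots> \<le> 1 * real n" using ve by (intro mult_right_mono) auto
      finally show "N f \<le> n" by simp
    qed
    then obtain f0 where f0: "f0 \<in> S'" and heavy: "(\<Sum>f\<in>S'. W f * exp (- c * \<nu> f)) \<le>
        real (n + 1) * (\<Sum>f\<in>{f\<in>S'. N f = N f0}. W f * exp (- c * \<nu> f))" by auto
    define N0 where "N0 = N f0"
    have N0: "real N0 \<le> (v + e1) * n" "(v - e1) * n \<le> real N0" using N_upper[OF f0] by (auto simp: N0_def)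
    define a where "a = (\<Sum>f | f \<in> S \<and> N f = N0. W f)"
    have a: "Q / 4 \<le> real (n + 1) * (exp (- c * (real N0 / h)) * a)"
    proof -
      have "(\<Sum>f\<in>{f\<in>S'. N f = N f0}. W f * exp (- c * \<nu> f)) = exp (- c * (real N0 / h)) * (\<Sum>f\<in>{f\<in>S'. N f = N0}. W f)"
        unfolding sum_distrib_left by (intro sum.cong) (auto simp: \<nu>_def N0_def)
      also have "\<dots> \<le> exp (- c * (real N0 / h)) * a"
        unfolding a_def using W0 finS by (intro mult_left_mono sum_mono2) (auto simp: S'_def)
      finally have "real (n + 1) * (\<Sum>f\<in>{f\<in>S'. N f = N f0}. W f * exp (- c * \<nu> f)) \<le> real (n + 1) * (exp (- c * (real N0 / h)) * a)"
        by (rule mult_left_mono) simp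
      then show ?thesis using mid heavy by linarith
    qed
    \<comment> \<open>The amount left to the filling parts. It exceeds \<open>M n\<close>, as
      \<open>exists_distinct_sum\<close> demands, because the window ends well below
      \<open>n\<close>.\<close>
    define r where "r = n - N0"
    have N0n: "real N0 \<le> n"
    proof -
      have "(v + e1) * n \<le> 1 * real n" using ve by (intro mult_right_mono) auto
      then show ?thesis using N0 by simp
    qed
    have r: "real r = n - real N0" using N0n by (simp add: r_def)
    have r_upper: "real r \<le> (1 - v + e1) * n" using r N0 by (simp add: algebra_simps)
    have Mr: "M n < r"
    proof -
      have "(1 - v) / 2 * n \<le> (1 - v - e1) * n" using e1 by (intro mult_right_mono) auto
      also have "\<dots> \<le> real r" using r N0 by (simp add: algebra_simps)
      finally have "real (M n) < real r" using Mn elim(6) unfolding h_def[symmetric] by linarith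
      then show ?thesis by simp
    qed
    obtain T where T: "finite T" "T \<subseteq> {M n<..}" "\<Sum>T = r" "real (card T) * (real (M n) + 1) \<le> real r"
       "\<And>k. k \<in> T \<Longrightarrow> k \<le> 2 * M n + 2 * card T + 1"
      using exists_distinct_sum[OF Mr] by blast
    have cardT: "real (card T) \<le> (1 - v + e1) * h / K"
    proof -
      have "real (card T) * (K * h) \<le> real (card T) * (real (M n) + 1)" using Mn by (intro mult_left_mono) auto
      also have "\<dots> \<le> (1 - v + e1) * (h * h)" using T(4) r_upper h by simp
      finally have "(real (card T) * K) * h \<le> ((1 - v + e1) * h) * h" by (simp add: mult_ac)
      then have "real (card T) * K \<le> (1 - v + e1) * h" using h by simp
      then show ?thesis using K by (simp add: pos_le_divide_eq)
    qed
    \<comment> \<open>Filling parts are at most \<open>2 * M n + 2 * card T + 1\<close>, where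
      \<open>M n \<le> K * h\<close> and \<open>card T \<le> 3/2 * h / K\<close>; this is the origin
      of \<open>D = 2 * K + 3 / K + 1\<close>.\<close>
    have kD: "real k \<le> D * h" if "k \<in> T" for k
    proof -
      have "real k \<le> real (2 * M n + 2 * card T + 1)" using T(5)[OF that] by (rule of_nat_mono)
      also have "\<dots> \<le> 2 * (K * h) + 2 * ((1 - v + e1) * h / K) + 1" using Mn cardT by simp
      also have "2 * ((1 - v + e1) * h / K) \<le> 3 * h / K"
      proof -
        have "2 * (1 - v + e1) * h \<le> 3 * h" using e1v v0 v1 h(1) by (intro mult_right_mono) auto
        then have "2 * (1 - v + e1) * h / K \<le> 3 * h / K" using K by (intro divide_right_mono) auto
        then show ?thesis by (simp only: times_divide_eq_right mult.assoc)
      qed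
      also have "2 * (K * h) + 3 * h / K + 1 \<le> D * h" using h64 unfolding D by (simp add: algebra_simps)
      finally show ?thesis by simp
    qed
    have NT: "N0 + \<Sum>T = n" using T(3) N0n by (simp add: r_def)
    have MD: "real (M n) \<le> D * h"
    proof -
      have "K * h \<le> D * h" using Dpos K h by (intro mult_right_mono) auto
      then show ?thesis using Mn by linarith
    qed
    have al1: "1 \<le> \<alpha> n"
    proof -
      have "8 \<le> sqrt h" using h64 by (intro real_le_rsqrt) auto
      then have "4 / sqrt h < 1" "0 \<le> 4 / sqrt h" using h(1) by (auto simp: divide_less_eq)
      moreover have "0 \<le> 24 * (D / h)" using Dpos h by simp
      moreover have "0 < 1 - y \<and> 1 * (1 - y) \<le> 1 + z" if "y < 1" "0 \<le> y" "0 \<le> z" for y z :: real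
        using that by simp
      ultimately have "0 < 1 - 4 / sqrt h" "1 * (1 - 4 / sqrt h) \<le> 1 + 24 * (D / h)" by blast+
      then show ?thesis unfolding \<alpha>_def h_def[symmetric] by (simp only: pos_le_divide_eq)
    qed
    have fill: "1 / 2 * exp (- (real (card T) * D\<^sup>2 / 2) - (\<alpha> n - 1) * D * h / 2) * a \<le> AOsum s n"
      unfolding a_def S_def W_def N_def \<alpha>_def h_def mem_Collect_eq
      by (rule AOsum_ge_fill[OF n T(1,2) NT Dpos(1) MD[unfolded h_def] kD[unfolded h_def] elim(7,8)
            al1[unfolded \<alpha>_def] elim(12)[unfolded \<alpha>_def] elim(9-11)])
    have a0: "0 \<le> a" unfolding a_def using W0 by (intro sum_nonneg)
    have a_ge: "exp (h * (I - e2) + c * (real N0 / h) - ln (4 * (real n + 1))) \<le> a"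
    proof -
      have "Q \<le> 4 * (real (n + 1) * (exp (- c * (real N0 / h)) * a))" using a by linarith
      also have "\<dots> = 4 * (real n + 1) * (exp (- c * (real N0 / h)) * a)" by (simp only: of_nat_add of_nat_1 mult.assoc)
      finally have "Q * exp (c * (real N0 / h)) \<le> 4 * (real n + 1) * (exp (- c * (real N0 / h)) * a) * exp (c * (real N0 / h))"
        by (rule mult_right_mono) simp
      also have "\<dots> = 4 * (real n + 1) * a" by (simp add: exp_minus)
      finally have "Q * exp (c * (real N0 / h)) / (4 * (real n + 1)) \<le> a" by (simp add: pos_divide_le_eq mult.commute)
      moreover have "exp (h * (I - e2) + c * (real N0 / h) - ln (4 * (real n + 1))) = Q * exp (c * (real N0 / h)) / (4 * (real n + 1))"
        unfolding Q_def by (simp add: exp_add exp_diff)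
      ultimately show ?thesis by simp
    qed
    have "exp (h * (c * v + I - (1 - v) * D\<^sup>2 / (2 * K) - e)) \<le>
       exp ((- (real (card T) * D\<^sup>2 / 2) - (\<alpha> n - 1) * D * h / 2) + (h * (I - e2) + c * (real N0 / h) - ln (4 * (real n + 1))) - ln 2)"
    proof -
      have c1: "real (card T) * D\<^sup>2 / 2 \<le> h * ((1 - v) * D\<^sup>2 / (2 * K)) + h * (e / 8)"
      proof -
        have "real (card T) * D\<^sup>2 / 2 \<le> (1 - v + e1) * h / K * D\<^sup>2 / 2"
          using cardT by (intro divide_right_mono mult_right_mono) auto
        also have "\<dots> = h * ((1 - v) * D\<^sup>2 / (2 * K)) + h * (e1 * D\<^sup>2 / (2 * K))"
          using K by (simp add: field_simps)
        also have "h * (e1 * D\<^sup>2 / (2 * K)) \<le> h * (e / 8)" using De1 h by (intro mult_left_mono) auto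
        finally show ?thesis by simp
      qed
      have c2: "(\<alpha> n - 1) * D * h / 2 \<le> h * (e / 8)"
        using elim mult_left_mono[of "(\<alpha> n - 1) * D / 2" "e / 8" h] h by (simp add: mult_ac)
      have c3: "h * e2 \<le> h * (e / 8)" using e2 h by (intro mult_left_mono) auto
      have c4: "h * (c * v) - h * (e / 8) \<le> c * (real N0 / h)"
      proof -
        have "\<bar>real N0 - v * n\<bar> \<le> e1 * n" using N0 by (simp add: abs_le_iff algebra_simps)
        then have "\<bar>c\<bar> * \<bar>real N0 - v * n\<bar> \<le> \<bar>c\<bar> * (e1 * n)" by (intro mult_left_mono) auto
        also have "\<dots> = (\<bar>c\<bar> * e1) * n" by simp
        also have "\<dots> \<le> e / 8 * n" using ce1 by (intro mult_right_mono) auto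
        finally have "\<bar>c * (real N0 - v * n)\<bar> \<le> e / 8 * n" by (simp add: abs_mult)
        then have "- (e / 8 * n) \<le> c * (real N0 - v * n)" by linarith
        moreover have "c * (real N0 - v * n) = c * real N0 - c * v * n" by (simp only: right_diff_distrib mult.assoc)
        ultimately have "c * v * n - e / 8 * n \<le> c * real N0" by linarith
        then have "(h * (c * v) - h * (e / 8)) * h \<le> c * real N0" unfolding h(2)[symmetric] by (simp add: algebra_simps)
        then show ?thesis using h by (simp add: pos_le_divide_eq)
      qed
      have c5: "ln (4 * (real n + 1)) + ln 2 \<le> h * (e / 8)"
      proof -
        have "ln (4 * (real n + 1)) + ln 2 = ln (4 * (real n + 1) * 2)" by (rule ln_mult_pos[symmetric]) auto
        also have "4 * (real n + 1) * 2 = 8 * (real n + 1)" by simp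
        finally show ?thesis using elim by (simp add: h_def)
      qed
      have e8: "8 * (h * (e / 8)) = h * e" by simp
      have q0: "0 \<le> h * (e / 8)" using h e by simp
      have "h * (c * v + I - (1 - v) * D\<^sup>2 / (2 * K) - e) =
          h * (c * v) + h * I - h * ((1 - v) * D\<^sup>2 / (2 * K)) - 8 * (h * (e / 8))"
        unfolding e8 by (simp only: distrib_left right_diff_distrib)
      also have "\<dots> \<le> (- (real (card T) * D\<^sup>2 / 2) - (\<alpha> n - 1) * D * h / 2) + (h * I - h * e2 + c * (real N0 / h) - ln (4 * (real n + 1))) - ln 2"
        by (rule error_budget[OF c1 c2 c3 c4 c5 q0])
      finally have "h * (c * v + I - (1 - v) * D\<^sup>2 / (2 * K) - e) \<le>
        (- (real (card T) * D\<^sup>2 / 2) - (\<alpha> n - 1) * D * h / 2) + (h * (I - e2) + c * (real N0 / h) - ln (4 * (real n + 1))) - ln 2"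
        by (simp only: right_diff_distrib)
      then show ?thesis by (simp only: exp_le_cancel_iff)
    qed
    also have "\<dots> = 1 / 2 * exp (- (real (card T) * D\<^sup>2 / 2) - (\<alpha> n - 1) * D * h / 2) * exp (h * (I - e2) + c * (real N0 / h) - ln (4 * (real n + 1)))"
      by (simp only: exp_diff[of _ "ln 2"] exp_add) simp
    also have "\<dots> \<le> 1 / 2 * exp (- (real (card T) * D\<^sup>2 / 2) - (\<alpha> n - 1) * D * h / 2) * a"
      using a_ge by (intro mult_left_mono) auto
    also have "\<dots> \<le> AOsum s n" by (rule fill)
    finally show ?case unfolding h_def .
  qed
qed

lemma adm_half: "adm s 1 c \<Longrightarrow> adm s (1/2) c"
  by (auto simp: adm_def)

text \<open>Leaves room to the left of \<open>c\<close> for the tilt to \<open>c - \<eta>\<close>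
  and for continuity of \<open>Fint\<close> at \<open>c\<close>.\<close>

lemma adm_open: "adm s 1 c \<Longrightarrow> \<exists>b0<c. adm s 1 b0"
proof -
  assume a: "adm s 1 c"
  show ?thesis
  proof (cases "s = 1")
    case True
    then have "adm s 1 (c - 1)" by (simp add: adm_def)
    then show ?thesis by (intro exI[of _ "c - 1"]) auto
  next
    case False
    then have "adm s 1 (c / 2)" "c / 2 < c" using a by (auto simp: adm_def)
    then show ?thesis by blast
  qed
qed

lemma integral_split_at:
  fixes f :: "real \<Rightarrow> real"
  assumes f: "f absolutely_integrable_on {0<..}" and j: "0 \<le> j"
  shows "integral {0<..} f = integral {0<..j} f + integral {j<..} f"
proof -
  have "f integrable_on {0<..j}" "f integrable_on {j<..}"
    using j by (auto intro!: set_lebesgue_integral_eq_integral(1) absolutely_integrable_subset[OF f])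
  then have "integral ({0<..j} \<union> {j<..}) f = integral {0<..j} f + integral {j<..} f"
  proof (intro integral_Un)
    have "{0<..j} \<inter> {j<..} = {}" by auto
    then show "negligible ({0<..j} \<inter> {j<..})" by simp
  qed
  moreover have "{0<..j} \<union> {j<..} = {0<..}" using j by auto
  ultimately show ?thesis by simp
qed

text \<open>Keeps the truncated mean strictly below 1, so that a positive share of \<open>n\<close>
  is left for the filling. On an interval of length 1 beyond \<open>j\<close> the integrand is at
  least the constant \<open>\<kappa>\<close>.\<close>

lemma Fint_tail_pos:
  assumes adm: "adm s 1 c" and j: "j \<ge> 1"
  shows "0 < integral {j<..} (fF s c)"
proof -
  define \<kappa> where "\<kappa> = 1 / (exp (\<bar>c\<bar> * (j + 1) + (j + 1)\<^sup>2 / 2) + 1)"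
  have k: "\<kappa> > 0" by (simp add: \<kappa>_def add_pos_pos)
  have sub: "f integrable_on S" if "f absolutely_integrable_on {0<..}" "S \<subseteq> {0<..}" "S \<in> sets lebesgue" for f :: "real \<Rightarrow> real" and S
    by (rule set_lebesgue_integral_eq_integral(1)[OF absolutely_integrable_subset[OF that]])
  note F = fF_absolutely_integrable[OF adm]
  have "\<kappa> = integral {j<..j+1} (\<lambda>x. \<kappa>)"
  proof -
    have "((\<lambda>x. \<kappa>) has_integral (measure lborel {j..j+1} *\<^sub>R \<kappa>)) {j..j+1}" by (rule has_integral_const_real)
    then have "((\<lambda>x. \<kappa>) has_integral \<kappa>) {j..j+1}" by simp
    then have "((\<lambda>x. \<kappa>) has_integral \<kappa>) {j<..j+1}"
      by (subst has_integral_spike_set_eq[where T = "{j..j+1}"]) (auto intro: negligible_subset[of "{j}"])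
    then show ?thesis by (simp add: integral_unique)
  qed
  also have "\<dots> \<le> integral {j<..j+1} (fF s c)"
  proof (rule integral_le)
    show "(\<lambda>x. \<kappa>) integrable_on {j<..j+1}"
      by (rule integrable_spike_set[of _ "{j..j+1}"]) (auto intro: negligible_subset[of "{j}"] integrable_const_ivl)
    show "fF s c integrable_on {j<..j+1}" using j by (intro sub[OF F]) auto
    fix x assume x: "x \<in> {j<..j+1}"
    have "0 < exp (c * x + x\<^sup>2 / 2) + s" using x j by (intro denom_pos[OF adm]) auto
    moreover have "exp (c * x + x\<^sup>2 / 2) + s \<le> exp (\<bar>c\<bar> * (j + 1) + (j + 1)\<^sup>2 / 2) + 1"
    proof (intro add_mono)
      have "c * x \<le> \<bar>c\<bar> * (j + 1)"
      proof -
        have "c * x \<le> \<bar>c\<bar> * x" using x j by (intro mult_right_mono) auto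
        also have "\<dots> \<le> \<bar>c\<bar> * (j + 1)" using x by (intro mult_left_mono) auto
        finally show ?thesis .
      qed
      moreover have "x\<^sup>2 \<le> (j + 1)\<^sup>2" using x j by (intro power_mono) auto
      ultimately show "exp (c * x + x\<^sup>2 / 2) \<le> exp (\<bar>c\<bar> * (j + 1) + (j + 1)\<^sup>2 / 2)" by simp
      show "s \<le> 1" using adm by (auto simp: adm_def)
    qed
    ultimately show "\<kappa> \<le> fF s c x" unfolding \<kappa>_def fF_def using x j by (intro frac_le) auto
  qed
  also have "\<dots> \<le> integral {j<..} (fF s c)"
    using j by (intro integral_subset_le sub[OF F]) (auto intro!: fF_nonneg[OF adm])
  finally show ?thesis using k by linarith
qed

text \<open>Truncation at \<open>j\<close> leaves the share \<open>1 - v j\<close>, filled at the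
  cost \<open>(1 - v j) * (D j) ^ 2 / (2 * j)\<close>. Since \<open>D j \<le> 6 * j\<close>, this is
  at most 18 times \<open>j * (1 - v j)\<close>, which is below the tail of the first moment and
  tends to 0.\<close>

lemma AOsum_lower:
  assumes adm: "adm s 1 c" and F1: "Fint {0<..} s c = 1" and e: "e > 0"
  shows "eventually (\<lambda>n. exp (sqrt n * (c + Gint {0<..} s c - e)) \<le> AOsum s n) sequentially"
proof -
  define v where "v j = Fint {0<..real j} s c" for j :: nat
  define I where "I j = Gint {0<..real j} s c" for j :: nat
  define D where "D j = 2 * real j + 3 / real j + 1" for j :: nat
  define M1 where "M1 = integral {0<..} (\<lambda>x. x ^ 1 * fF s c x)"
  define m where "m j = integral {0<..real j} (\<lambda>x. x ^ 1 * fF s c x)" for j :: nat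
  note F = fF_absolutely_integrable[OF adm]
  note xF = fF_moment_absolutely_integrable[OF adm, of 1]
  have sub: "f integrable_on {j<..}" if "f absolutely_integrable_on {0<..}" "0 \<le> j" for f :: "real \<Rightarrow> real" and j
    using that(2) by (intro set_lebesgue_integral_eq_integral(1) absolutely_integrable_subset[OF that(1)]) auto
  have vt: "1 - v j = integral {real j<..} (fF s c)" for j
    using integral_split_at[OF F, of "real j"] F1 by (simp add: v_def Fint_def)
  have vpos: "0 < 1 - v j" if "j \<ge> 1" for j using Fint_tail_pos[OF adm, of "real j"] that by (simp add: vt)
  have vle: "real j * (1 - v j) \<le> M1 - m j" for j
  proof -
    have "real j * (1 - v j) = integral {real j<..} (\<lambda>x. real j * fF s c x)"
      unfolding vt by simp
    also have "\<dots> \<le> integral {real j<..} (\<lambda>x. x ^ 1 * fF s c x)"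
      by (intro integral_le integrable_on_mult_right sub[OF F] sub[OF xF])
         (auto intro!: mult_right_mono fF_nonneg[OF adm])
    also have "\<dots> = M1 - m j" using integral_split_at[OF xF, of "real j"] by (simp add: M1_def m_def)
    finally show ?thesis .
  qed
  have "m \<longlonglongrightarrow> M1" unfolding m_def M1_def by (rule integral_trunc_tendsto[OF xF])
  then have mlim: "(\<lambda>j. 18 * (M1 - m j)) \<longlonglongrightarrow> 18 * (M1 - M1)" by (intro tendsto_intros)
  have vlim: "v \<longlonglongrightarrow> 1" unfolding v_def Fint_def
    using integral_trunc_tendsto[OF F] F1 by (simp add: Fint_def)
  have Ilim: "I \<longlonglongrightarrow> Gint {0<..} s c" unfolding I_def Gint_def
    by (rule integral_trunc_tendsto[OF Lf_bw_absolutely_integrable[OF adm]])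
  have "(\<lambda>j. c * v j + I j - 18 * (M1 - m j)) \<longlonglongrightarrow> c * 1 + Gint {0<..} s c - 18 * (M1 - M1)"
    by (intro tendsto_intros vlim Ilim mlim)
  then have "eventually (\<lambda>j. c + Gint {0<..} s c - e / 2 < c * v j + I j - 18 * (M1 - m j)) sequentially"
    using e by (intro order_tendstoD) auto
  then have "eventually (\<lambda>j. c + Gint {0<..} s c - e / 2 < c * v j + I j - 18 * (M1 - m j) \<and> 1 \<le> j) sequentially"
    using eventually_ge_at_top[of 1] by eventually_elim auto
  then obtain j where j: "c + Gint {0<..} s c - e / 2 < c * v j + I j - 18 * (M1 - m j)" "1 \<le> j"
    by (auto simp: eventually_sequentially)
  have Dj: "(1 - v j) * (D j)\<^sup>2 / (2 * real j) \<le> 18 * (M1 - m j)"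
  proof -
    have "1 \<le> real j" using j(2) by simp
    then have "3 / real j \<le> 3" by (simp add: divide_le_eq)
    then have "D j \<le> 6 * real j" using \<open>1 \<le> real j\<close> unfolding D_def by linarith
    then have "(D j)\<^sup>2 \<le> (6 * real j)\<^sup>2" by (intro power_mono) (auto simp: D_def)
    then have "(1 - v j) * (D j)\<^sup>2 / (2 * real j) \<le> (1 - v j) * (6 * real j)\<^sup>2 / (2 * real j)"
      using vpos[OF j(2)] by (intro divide_right_mono mult_left_mono) auto
    also have "\<dots> = 18 * (real j * (1 - v j))" using j(2) by (simp add: power2_eq_square field_simps)
    also have "\<dots> \<le> 18 * (M1 - m j)" using vle[of j] by simp
    finally show ?thesis .
  qed
  obtain b0 where b0: "adm s 1 b0" "b0 < c" using adm_open[OF adm] by auto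
  have "eventually (\<lambda>n. exp (sqrt n * (c * Fint {0<..real j} s c + Gint {0<..real j} s c -
     (1 - Fint {0<..real j} s c) * (D j)\<^sup>2 / (2 * real j) - e / 2)) \<le> AOsum s n) sequentially"
    using vpos[OF j(2)] e j(2) by (intro AOsum_lower_trunc[OF b0]) (auto simp: v_def D_def)
  then show ?thesis
  proof eventually_elim
    case (elim n)
    have "c + Gint {0<..} s c - e \<le> c * v j + I j - (1 - v j) * (D j)\<^sup>2 / (2 * real j) - e / 2"
      using j(1) Dj by linarith
    then have "sqrt n * (c + Gint {0<..} s c - e) \<le> sqrt n * (c * v j + I j - (1 - v j) * (D j)\<^sup>2 / (2 * real j) - e / 2)"
      by (intro mult_left_mono) auto
    then have "exp (sqrt n * (c + Gint {0<..} s c - e)) \<le> exp (sqrt n * (c * v j + I j - (1 - v j) * (D j)\<^sup>2 / (2 * real j) - e / 2))"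
      by (simp only: exp_le_cancel_iff)
    then show ?case using elim unfolding v_def I_def by linarith
  qed
qed

lemma AOsum_asymp:
  assumes adm: "adm s 1 c" and F1: "Fint {0<..} s c = 1" and C: "C = c + Gint {0<..} s c" "C > 0"
  shows "(\<lambda>n. ln (AOsum s n)) \<sim>[at_top] (\<lambda>n. C * sqrt (real n))"
proof (rule asymp_equivI')
  show "(\<lambda>n. ln (AOsum s n) / (C * sqrt (real n))) \<longlonglongrightarrow> 1"
  proof (rule LIMSEQ_I)
    fix r :: real assume r: "r > 0"
    define e where "e = C * r / 2"
    have e: "e > 0" using r C by (simp add: e_def)
    have "eventually (\<lambda>n. norm (ln (AOsum s n) / (C * sqrt (real n)) - 1) < r) sequentially"
      using AOsum_upper[OF adm_half[OF adm] e] AOsum_lower[OF adm F1 e] eventually_gt_at_top[of 0]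
    proof eventually_elim
      case (elim n)
      have S: "0 < AOsum s n" using elim(2) exp_gt_zero by (rule order.strict_trans2[rotated])
      have h: "sqrt (real n) > 0" using elim by simp
      have up: "ln (AOsum s n) \<le> sqrt n * (C + e)"
      proof -
        have "ln (AOsum s n) \<le> ln (exp (sqrt n * (c + Gint {0<..} s c + e)))" using elim(1) S by (subst ln_le_cancel_iff) auto
        then show ?thesis by (simp add: C)
      qed
      have lo: "sqrt n * (C - e) \<le> ln (AOsum s n)"
      proof -
        have "ln (exp (sqrt n * (c + Gint {0<..} s c - e))) \<le> ln (AOsum s n)" using elim(2) S by (subst ln_le_cancel_iff) auto
        then show ?thesis by (simp add: C)
      qed
      have "\<bar>ln (AOsum s n) - C * sqrt n\<bar> \<le> e * sqrt n" using up lo by (simp add: abs_le_iff algebra_simps)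
      also have "\<dots> < r * (C * sqrt n)" using e h C r by (simp add: e_def)
      finally have "\<bar>ln (AOsum s n) - C * sqrt n\<bar> / (C * sqrt n) < r" using h C by (simp add: pos_divide_less_eq)
      moreover have "norm (ln (AOsum s n) / (C * sqrt (real n)) - 1) = \<bar>ln (AOsum s n) - C * sqrt n\<bar> / (C * sqrt n)"
      proof -
        have "ln (AOsum s n) / (C * sqrt (real n)) - 1 = (ln (AOsum s n) - C * sqrt n) / (C * sqrt n)"
          using h C by (simp add: diff_divide_distrib)
        then show ?thesis using h C by (simp add: abs_mult)
      qed
      ultimately show ?case by simp
    qed
    then show "\<exists>no. \<forall>n\<ge>no. norm (ln (AOsum s n) / (C * sqrt (real n)) - 1) < r"
      by (simp add: eventually_sequentially)
  qed
qed

lemma AOsum_B: "AOsum (-1) n = real (B n) / fact n"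
  by (simp add: AOsum_def parts_def B_def sum_divide_distrib)

lemma AOsum_B_d: "AOsum 1 n = real (B_d n) / fact n"
  by (simp add: AOsum_def parts_def B_d_def sum_divide_distrib)

section \<open>The defining equations\<close>

lemma Lf_bw_derivative:
  assumes adm: "adm s 1 c" and x: "x > 0"
  shows "((\<lambda>x. Lf s (bw 1 c x)) has_real_derivative - ((c + x) / (exp (c * x + x\<^sup>2 / 2) + s))) (at x)"
proof -
  define E where "E = exp (c * x + x\<^sup>2 / 2)"
  have E: "E > 0" "E + s > 0" using denom_pos[OF adm x] by (auto simp: E_def)
  have s2: "s * s = 1" using adm by (auto simp: adm_def)
  have b: "bw 1 c x = 1 / E"
  proof -
    have "bw 1 c x = exp (- (c * x + x\<^sup>2 / 2))" by (simp add: bw_def)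
    then show ?thesis by (simp only: E_def exp_minus inverse_eq_divide)
  qed
  have pos: "0 < 1 + s * bw 1 c x"
  proof -
    have "1 + s * (1 / E) = (E + s) / E" using E by (simp add: field_simps)
    then show ?thesis unfolding b using E by simp
  qed
  have db: "(bw 1 c has_real_derivative - ((c + x) * bw 1 c x)) (at x)"
    unfolding bw_def by (auto intro!: derivative_eq_intros simp: algebra_simps)
  have "((\<lambda>x. s * ln (1 + s * bw 1 c x)) has_real_derivative s * (s * - ((c + x) * bw 1 c x) / (1 + s * bw 1 c x))) (at x)"
    using pos by (auto intro!: derivative_eq_intros db simp: divide_inverse mult_ac)
  also have "s * (s * - ((c + x) * bw 1 c x) / (1 + s * bw 1 c x)) = - ((c + x) / (E + s))"
  proof -
    have "s * (s * - ((c + x) * bw 1 c x) / (1 + s * bw 1 c x)) = - ((s * s) * ((c + x) * (1 / E)) / (1 + s * (1 / E)))"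
      unfolding b by (simp add: mult_ac)
    also have "\<dots> = - (((c + x) * (1 / E)) * E / ((1 + s * (1 / E)) * E))" using E s2 by simp
    also have "((c + x) * (1 / E)) * E = c + x" using E by simp
    also have "(1 + s * (1 / E)) * E = E + s" using E by (simp add: distrib_right)
    finally show ?thesis .
  qed
  finally show ?thesis by (simp only: Lf_def E_def)
qed

text \<open>Controls the boundary terms of the integration by parts; at 0 the factor
  \<open>x\<close> beats the inverse square root in \<open>env\<close>.\<close>

lemma x_env_tendsto:
  assumes "s = 1 \<or> b > 0"
  shows "(\<lambda>j. (real j + 1) * env s b (real j + 1)) \<longlonglongrightarrow> 0"
    and "(\<lambda>j. 1 / (real j + 1) * env s b (1 / (real j + 1))) \<longlonglongrightarrow> 0"
proof -
  have "(\<lambda>j. (real j + 1) * env s b (real j + 1)) \<longlonglongrightarrow> 0 \<and> (\<lambda>j. 1 / (real j + 1) * env s b (1 / (real j + 1))) \<longlonglongrightarrow> 0"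
  proof (cases "s = 1")
    case True
    have "(\<lambda>j. (real j + 1) * (K * exp (- (real j + 1)))) \<longlonglongrightarrow> 0"
      "(\<lambda>j. 1 / (real j + 1) * (K * exp (- (1 / (real j + 1))))) \<longlonglongrightarrow> 0" for K :: real
    proof -
      have "(\<lambda>j. K * ((real j + 1) * exp (- (real j + 1)))) \<longlonglongrightarrow> K * 0" by (intro tendsto_mult tendsto_const) real_asymp
      then show "(\<lambda>j. (real j + 1) * (K * exp (- (real j + 1)))) \<longlonglongrightarrow> 0" by (simp add: mult_ac)
      have "(\<lambda>j. K * (1 / (real j + 1) * exp (- (1 / (real j + 1))))) \<longlonglongrightarrow> K * 0" by (intro tendsto_mult tendsto_const) real_asymp
      then show "(\<lambda>j. 1 / (real j + 1) * (K * exp (- (1 / (real j + 1))))) \<longlonglongrightarrow> 0" by (simp add: mult_ac)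
    qed
    then show ?thesis by (simp only: env_def True simp_thms if_True)
  next
    case False
    then have b: "b > 0" using assms by simp
    have "(\<lambda>j. (real j + 1) * (2 * exp (- (b / 2 * (real j + 1))) * (1 + 1 / sqrt (b * (real j + 1))))) \<longlonglongrightarrow> 0"
      using b by real_asymp
    moreover have "(\<lambda>j. 1 / (real j + 1) * (2 * exp (- (b / 2 * (1 / (real j + 1)))) * (1 + 1 / sqrt (b * (1 / (real j + 1)))))) \<longlonglongrightarrow> 0"
      using b by real_asymp
    ultimately show ?thesis using False by (simp only: env_def if_False)
  qed
  then show "(\<lambda>j. (real j + 1) * env s b (real j + 1)) \<longlonglongrightarrow> 0"
    "(\<lambda>j. 1 / (real j + 1) * env s b (1 / (real j + 1))) \<longlonglongrightarrow> 0" by auto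
qed

lemma integral_trunc2_tendsto:
  fixes f :: "real \<Rightarrow> real"
  assumes f: "f absolutely_integrable_on {0<..}"
  shows "(\<lambda>j. integral {1 / (real j + 1)..real j + 1} f) \<longlonglongrightarrow> integral {0<..} f"
proof -
  let ?S = "\<lambda>j. {1 / (real j + 1)..real j + 1}"
  let ?g = "\<lambda>j x. if x \<in> ?S j then f x else 0"
  have sub: "?S j \<subseteq> {0<..}" for j by (auto intro: order.strict_trans2[of 0 "1 / (real j + 1)"])
  have eq: "?S j \<inter> {0<..} = ?S j" for j using sub[of j] by auto
  have I: "integral (?S j) f = integral {0<..} (?g j)" for j
    using integral_restrict_Int[of "{0<..}" "?S j" f] unfolding eq by simp
  have int: "?g j integrable_on {0<..}" for j
  proof -
    have "f integrable_on (?S j \<inter> {0<..})"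
      unfolding eq by (intro set_lebesgue_integral_eq_integral(1) absolutely_integrable_subset[OF f sub]) auto
    then show ?thesis by (subst integrable_restrict_Int)
  qed
  have "(\<lambda>j. integral {0<..} (?g j)) \<longlonglongrightarrow> integral {0<..} f"
  proof (rule dominated_convergence(2)[where h = "\<lambda>x. norm (f x)"])
    show "(\<lambda>x. norm (f x)) integrable_on {0<..}" using f by (simp add: absolutely_integrable_on_def)
    fix x :: real assume "x \<in> {0<..}"
    then have x: "x > 0" by simp
    have "eventually (\<lambda>j. x \<le> real j + 1) sequentially" by real_asymp
    moreover have "eventually (\<lambda>j. 1 / (real j + 1) \<le> x) sequentially" using x by real_asymp
    ultimately have "eventually (\<lambda>j. ?g j x = f x) sequentially" by eventually_elim simp
    then show "(\<lambda>j. ?g j x) \<longlonglongrightarrow> f x" by (rule tendsto_eventually)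
  qed (use int in auto)
  then show ?thesis by (simp only: I)
qed

text \<open>Differentiating the logarithm in \<open>x\<close> produces \<open>- (c + x)\<close>
  times the same denominator as in \<open>fF\<close>, so the logarithmic integral becomes a
  combination of the zeroth and first moments. One set of certified approximations then serves both
  the equation for \<open>c\<close> and the constant.\<close>

lemma Gint_by_parts:
  assumes adm: "adm s 1 c"
  shows "Gint {0<..} s c = c * Fint {0<..} s c + integral {0<..} (\<lambda>x. x ^ 1 * fF s c x)"
proof -
  have sb: "s = 1 \<or> c > 0" using adm by (auto simp: adm_def)
  let ?L = "\<lambda>x. Lf s (bw 1 c x)"
  \<comment> \<open>This is the derivative of \<open>x * ?L x\<close>, so its integral reduces to
    boundary terms, which vanish in the limit.\<close>
  let ?D = "\<lambda>x. ?L x - (c * fF s c x + x ^ 1 * fF s c x)"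
  note LA = Lf_bw_absolutely_integrable[OF adm]
  note FA = fF_absolutely_integrable[OF adm]
  note xFA = fF_moment_absolutely_integrable[OF adm, of 1]
  have DA: "?D absolutely_integrable_on {0<..}"
    using LA FA xFA by (intro set_integral_diff(1) set_integral_add(1) set_integrable_mult_right) auto
  have D_int: "integral {1 / (real j + 1)..real j + 1} ?D =
      (real j + 1) * ?L (real j + 1) - 1 / (real j + 1) * ?L (1 / (real j + 1))" for j
  proof (rule integral_unique, rule fundamental_theorem_of_calculus)
    show "1 / (real j + 1) \<le> real j + 1"
    proof -
      have "1 / (real j + 1) \<le> 1" by simp
      then show ?thesis by linarith
    qed
    fix x assume "x \<in> {1 / (real j + 1)..real j + 1}"
    then have x: "x > 0" by (auto intro: order.strict_trans2[of 0 "1 / (real j + 1)"])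
    have "((\<lambda>x. x * ?L x) has_real_derivative 1 * ?L x + - ((c + x) / (exp (c * x + x\<^sup>2 / 2) + s)) * x) (at x)"
      by (intro DERIV_mult DERIV_ident Lf_bw_derivative[OF adm x])
    also have "1 * ?L x + - ((c + x) / (exp (c * x + x\<^sup>2 / 2) + s)) * x = ?D x"
      by (simp add: fF_def algebra_simps add_divide_distrib)
    finally show "((\<lambda>x. x * ?L x) has_vector_derivative ?D x) (at x within {1 / (real j + 1)..real j + 1})"
      by (simp add: has_real_derivative_iff_has_vector_derivative has_vector_derivative_at_within)
  qed
  have bnd: "0 \<le> x * ?L x \<and> x * ?L x \<le> x * env s c x" if "x > 0" for x
    using that Lf_le_env[OF adm that] Lf_nonneg[OF okY_bw[OF adm that]] by (auto intro: mult_left_mono)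
  have "(\<lambda>j. (real j + 1) * ?L (real j + 1)) \<longlonglongrightarrow> 0"
    by (rule real_tendsto_sandwich[OF _ _ tendsto_const x_env_tendsto(1)[OF sb]])
       (use bnd in \<open>auto intro!: always_eventually\<close>)
  moreover have "(\<lambda>j. 1 / (real j + 1) * ?L (1 / (real j + 1))) \<longlonglongrightarrow> 0"
  proof (rule real_tendsto_sandwich[OF _ _ tendsto_const x_env_tendsto(2)[OF sb]])
    have "0 < 1 / (real j + 1)" for j by simp
    note b = bnd[OF this]
    show "\<forall>\<^sub>F j in sequentially. 0 \<le> 1 / (real j + 1) * ?L (1 / (real j + 1))" using b by (intro always_eventually allI) blast
    show "\<forall>\<^sub>F j in sequentially. 1 / (real j + 1) * ?L (1 / (real j + 1)) \<le> 1 / (real j + 1) * env s c (1 / (real j + 1))"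
      using b by (intro always_eventually allI) blast
  qed
  ultimately have "(\<lambda>j. integral {1 / (real j + 1)..real j + 1} ?D) \<longlonglongrightarrow> 0 - 0"
    unfolding D_int by (rule tendsto_diff)
  then have "integral {0<..} ?D = 0"
    using integral_trunc2_tendsto[OF DA] LIMSEQ_unique by fastforce
  moreover have "integral {0<..} ?D = Gint {0<..} s c - (c * Fint {0<..} s c + integral {0<..} (\<lambda>x. x ^ 1 * fF s c x))"
  proof -
    have "(?L has_integral Gint {0<..} s c) {0<..}"
      unfolding Gint_def using LA by (simp add: integrable_integral set_lebesgue_integral_eq_integral(1))
    moreover have "(fF s c has_integral Fint {0<..} s c) {0<..}"
      unfolding Fint_def using FA by (simp add: integrable_integral set_lebesgue_integral_eq_integral(1))
    moreover have "((\<lambda>x. x ^ 1 * fF s c x) has_integral integral {0<..} (\<lambda>x. x ^ 1 * fF s c x)) {0<..}"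
      using xFA by (simp only: integrable_integral set_lebesgue_integral_eq_integral(1))
    ultimately have "(?D has_integral (Gint {0<..} s c - (c * Fint {0<..} s c + integral {0<..} (\<lambda>x. x ^ 1 * fF s c x)))) {0<..}"
      by (intro has_integral_diff has_integral_add has_integral_mult_right)
    then show ?thesis by (rule integral_unique)
  qed
  ultimately show ?thesis by simp
qed

text \<open>The uniform lower bound on the slope turns a small residual of the equation into a small error of its
  solution.\<close>

lemma fF_slope:
  assumes adm: "adm s 1 a" and ab: "-1 \<le> a" "a \<le> b" "b \<le> 1" and x: "0 < x" "x \<le> 1"
  shows "(b - a) / 24 * x\<^sup>2 \<le> fF s a x - fF s b x"
proof -
  define A B where "A = exp (a * x + x\<^sup>2 / 2)" and "B = exp (b * x + x\<^sup>2 / 2)"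
  have admb: "adm s 1 b" using adm_mono[OF adm ab(2)] by simp
  have pos: "0 < A + s" "0 < B + s" using denom_pos[OF adm x(1)] denom_pos[OF admb x(1)] by (auto simp: A_def B_def)
  have A0: "0 < A" by (simp add: A_def)
  have BA: "A * ((b - a) * x) \<le> B - A"
  proof -
    have "B = A * exp ((b - a) * x)" unfolding A_def B_def exp_add[symmetric] by (simp add: algebra_simps)
    moreover have "A * (1 + (b - a) * x) \<le> A * exp ((b - a) * x)"
      using A0 by (intro mult_left_mono exp_ge_add_one_self) auto
    ultimately show ?thesis by (simp add: algebra_simps)
  qed
  have x2: "x\<^sup>2 \<le> 1" using x by (simp add: power_le_one)
  have Bu: "B + s \<le> 6"
  proof -
    have "b * x \<le> 1 * 1" using ab x by (intro mult_mono) auto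
    then have "B \<le> exp (3/2)" unfolding B_def using x2 by simp
    also have "\<dots> \<le> 5"
    proof -
      have "exp (3/2) ^ 2 = exp (1::real) ^ 3" by (simp add: exp_of_nat_mult[symmetric])
      also have "\<dots> \<le> (2.8::real) ^ 3"
      proof (rule power_mono)
        show "exp 1 \<le> (2.8::real)"
          using exp_bound[of 1] exp_le e_less_272 by simp
      qed simp
      also have "\<dots> \<le> 5 ^ 2" by (simp add: power_divide)
      finally show ?thesis by (rule power2_le_imp_le) simp
    qed
    finally show ?thesis using adm by (auto simp: adm_def)
  qed
  have Al: "1/4 \<le> A / (A + s)"
  proof -
    have "A + s \<le> 4 * A"
    proof -
      have "exp (- 1) \<le> A"
      proof -
        have "- 1 \<le> a * x"
        proof -
          have "- 1 * x \<le> a * x" using ab x by (intro mult_right_mono) auto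
          then show ?thesis using x by linarith
        qed
        then show ?thesis unfolding A_def by (simp add: add_increasing2)
      qed
      moreover have "1 \<le> 3 * exp (- 1 :: real)"
        using exp_le by (simp add: exp_minus field_simps)
      ultimately have "1 \<le> 3 * A" by linarith
      then show ?thesis using adm by (auto simp: adm_def)
    qed
    then show ?thesis using pos by (simp add: field_simps)
  qed
  \<comment> \<open>The 24 is the product of the 4 from \<open>A / (A + s) \<ge> 1/4\<close> and the
    6 from \<open>B + s \<le> 6\<close>.\<close>
  have "(b - a) / 24 * x\<^sup>2 = (b - a) * x\<^sup>2 * (1/4) * (1/6)" by simp
  also have "\<dots> \<le> (b - a) * x\<^sup>2 * (A / (A + s)) * (1 / (B + s))"
    using Al Bu pos ab by (intro mult_mono) (auto intro!: divide_left_mono)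
  also have "\<dots> = x * (A * ((b - a) * x)) / ((A + s) * (B + s))" by (simp add: power2_eq_square)
  also have "\<dots> \<le> x * (B - A) / ((A + s) * (B + s))"
    using BA x pos by (intro divide_right_mono mult_left_mono) auto
  also have "\<dots> = fF s a x - fF s b x"
    unfolding fF_def A_def[symmetric] B_def[symmetric] using pos by (simp add: field_simps)
  finally show ?thesis .
qed

text \<open>The pointwise slope is integrated over \<open>(0, 1]\<close> only, which contributes the
  factor 1/3; beyond 1 monotonicity suffices.\<close>

lemma Fint_slope:
  assumes adm: "adm s 1 a" and ab: "-1 \<le> a" "a \<le> b" "b \<le> 1"
  shows "(b - a) / 72 \<le> Fint {0<..} s a - Fint {0<..} s b"
proof -
  have admb: "adm s 1 b" using adm_mono[OF adm ab(2)] by simp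
  have T: "{0<..} \<subseteq> {0::real<..}" "{0::real<..} \<in> sets lebesgue" by auto
  note Fa = fF_integrable_T[OF T adm] and Fb = fF_integrable_T[OF T admb]
  have T1: "{0<..1} \<subseteq> {0::real<..}" "{0::real<..1} \<in> sets lebesgue" by auto
  note Fa1 = fF_integrable_T[OF T1 adm] and Fb1 = fF_integrable_T[OF T1 admb]
  have sq: "((\<lambda>x. (b - a) / 24 * x\<^sup>2) has_integral ((b - a) / 24 * (1/3))) {0<..1}"
  proof -
    have "((\<lambda>x::real. x\<^sup>2) has_integral (1 ^ 3 / 3 - 0 ^ 3 / 3)) {0..1}"
      by (rule fundamental_theorem_of_calculus)
         (auto intro!: derivative_eq_intros simp flip: has_real_derivative_iff_has_vector_derivative)
    then have "((\<lambda>x::real. x\<^sup>2) has_integral (1/3)) {0<..1}"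
      by (subst has_integral_spike_set_eq[where T = "{0..1}"]) (auto intro: negligible_subset[of "{0}"])
    then show ?thesis by (rule has_integral_mult_right)
  qed
  have "(b - a) / 72 = integral {0<..1} (\<lambda>x. (b - a) / 24 * x\<^sup>2)" by (subst integral_unique[OF sq]) simp
  also have "\<dots> \<le> integral {0<..1} (\<lambda>x. fF s a x - fF s b x)"
    using sq by (intro integral_le integrable_diff Fa1 Fb1 fF_slope[OF adm ab]) (auto simp: integrable_on_def)
  also have "\<dots> \<le> integral {0<..} (\<lambda>x. fF s a x - fF s b x)"
    using fF_antimono[OF adm ab(2)] by (intro integral_subset_le integrable_diff Fa Fb Fa1 Fb1) auto
  also have "\<dots> = Fint {0<..} s a - Fint {0<..} s b" unfolding Fint_def by (rule integral_diff[OF Fa Fb])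
  finally show ?thesis .
qed

text \<open>Bookkeeping for \<open>root_exists\<close>: \<open>G\<close> and \<open>G1\<close> are
  the values of \<open>Gint\<close> at the root and at \<open>c0\<close>, linked by two tangent
  inequalities; \<open>p\<close> and \<open>q\<close> arise because \<open>Fint\<close> at
  \<open>c0\<close> is not exactly 1, and \<open>M\<close> is the first moment.\<close>

lemma error_combine:
  fixes G :: real
  assumes "G - (c0 - c) * 1 \<le> G1" "G1 - ((c - c0) + p) \<le> G" "\<bar>p\<bar> \<le> e1" "\<bar>q\<bar> \<le> e2" "\<bar>M - v\<bar> \<le> e3" "G1 = (c0 + q) + M"
  shows "\<bar>c + G - (2 * c0 + v)\<bar> \<le> e1 + e2 + e3"
proof -
  have "\<bar>p\<bar> \<ge> 0" "q \<le> \<bar>q\<bar>" "- q \<le> \<bar>q\<bar>" "- p \<ge> - \<bar>p\<bar>" "M - v \<le> \<bar>M - v\<bar>" "- (M - v) \<le> \<bar>M - v\<bar>" by auto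
  then have b: "0 \<le> e1" "q \<le> e2" "- e2 \<le> q" "p \<le> e1" "M - v \<le> e3" "- e3 \<le> M - v"
    using assms(3-5) by linarith+
  have "c + G - (2 * c0 + v) \<le> q + (M - v)" using assms(1,6) by simp
  moreover have "q + (M - v) - p \<le> c + G - (2 * c0 + v)" using assms(2,6) by simp
  ultimately show ?thesis using b by (intro abs_leI) linarith+
qed

text \<open>Since \<open>c + Gint c\<close> is stationary at the solution, its value is known as precisely as the integrals at the
  approximate solution \<open>c0\<close>.\<close>

lemma root_exists:
  assumes adm: "adm s 1 c0" and c0: "-9/10 \<le> c0" "c0 \<le> 9/10" "s = -1 \<longrightarrow> 1/2 \<le> c0"
    and F: "\<bar>Fint {0<..} s c0 - 1\<bar> \<le> 15 / 10 ^ 20"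
    and M: "\<bar>integral {0<..} (\<lambda>x. x ^ 1 * fF s c0 x) - v\<bar> \<le> 4 / 10 ^ 19"
  shows "\<exists>c. adm s 1 c \<and> Fint {0<..} s c = 1 \<and> \<bar>c - c0\<bar> \<le> 11 / 10 ^ 18 \<and>
     \<bar>c + Gint {0<..} s c - (2 * c0 + v)\<bar> \<le> 1 / 10 ^ 18 \<and>
     (\<forall>c'. adm s 1 c' \<and> Fint {0<..} s c' = 1 \<longrightarrow> c' = c)"
proof -
  let ?F = "Fint {0<..} s"
  \<comment> \<open>The slope is at least 1/72, so a residual of \<open>15 / 10 ^ 20\<close> moves
    the root by at most \<open>108 / 10 ^ 19\<close>.\<close>
  define d :: real where "d = 11 / 10 ^ 18"
  have T: "{0<..} \<subseteq> {0::real<..}" "{0::real<..} \<in> sets lebesgue" by auto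
  have admlow: "adm s 1 (c0 - 1/4)" using adm c0 by (auto simp: adm_def)
  have a: "adm s 1 (c0 - d)" using adm_mono[OF admlow, of "c0 - d" 1] by (simp add: d_def)
  have "(c0 - (c0 - d)) / 72 \<le> ?F (c0 - d) - ?F c0" using c0 by (intro Fint_slope a) (auto simp: d_def)
  then have lo: "1 \<le> ?F (c0 - d)" using F unfolding d_def abs_le_iff by simp
  have "((c0 + d) - c0) / 72 \<le> ?F c0 - ?F (c0 + d)" using c0 by (intro Fint_slope adm) (auto simp: d_def)
  then have hi: "?F (c0 + d) \<le> 1" using F unfolding d_def abs_le_iff by simp
  have "\<exists>c. c0 - d \<le> c \<and> c \<le> c0 + d \<and> ?F c = 1"
  proof (rule IVT2[where f = ?F])
    show "\<forall>x. c0 - d \<le> x \<and> x \<le> c0 + d \<longrightarrow> isCont ?F x"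
      by (auto simp: d_def intro!: isCont_Fint[OF T admlow])
  qed (use hi lo in \<open>auto simp: d_def\<close>)
  then obtain c where c: "c0 - d \<le> c" "c \<le> c0 + d" "?F c = 1" by auto
  have admc: "adm s 1 c" using adm_mono[OF a c(1)] by simp
  have c1: "-1 < c" "c < 1" using c c0 by (auto simp: d_def)
  have uniq: "c' = c" if c': "adm s 1 c'" "?F c' = 1" for c'
  proof (rule ccontr)
    assume "c' \<noteq> c"
    then consider "c' < c" | "c < c'" by linarith
    then show False
    proof cases
      case 1
      \<comment> \<open>The slope bound holds only between -1 and 1; a second root further out is
        clamped to this range, and monotonicity compares it with the clamped point.\<close>
      define e where "e = max c' (-1)"
      have e: "c' \<le> e" "-1 \<le> e" "e < c" using 1 c1 by (auto simp: e_def)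
      have ae: "adm s 1 e" using adm_mono[OF c'(1) e(1)] by simp
      have "(c - e) / 72 \<le> ?F e - ?F c" using e c1 by (intro Fint_slope ae) auto
      moreover have "?F e \<le> ?F c'" by (rule Fint_antimono[OF T c'(1) e(1)])
      ultimately show False using e c(3) c'(2) by simp
    next
      case 2
      define e where "e = min c' 1"
      have e: "e \<le> c'" "e \<le> 1" "c < e" using 2 c1 by (auto simp: e_def)
      have ae: "adm s 1 e" using adm_mono[OF admc, of e 1] e by simp
      have "(e - c) / 72 \<le> ?F c - ?F e" using e c1 by (intro Fint_slope admc) auto
      moreover have "?F c' \<le> ?F e" by (rule Fint_antimono[OF T ae e(1)])
      ultimately show False using e c(3) c'(2) by simp
    qed
  qed
  have t1: "Gint {0<..} s c - (c0 - c) * 1 \<le> Gint {0<..} s c0"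
    using Gint_tangent[OF T admc adm] c(3) by simp
  have t2: "Gint {0<..} s c0 - (c - c0) * ?F c0 \<le> Gint {0<..} s c" by (rule Gint_tangent[OF T adm admc])
  have cd: "\<bar>c - c0\<bar> \<le> d" using c by (auto simp: abs_le_iff)
  have prod: "\<bar>(c - c0) * (?F c0 - 1)\<bar> \<le> d * (15 / 10 ^ 20)"
    unfolding abs_mult using cd F by (intro mult_mono) auto
  have prod2: "\<bar>c0 * (?F c0 - 1)\<bar> \<le> 1 * (15 / 10 ^ 20)"
    unfolding abs_mult using c0 F by (intro mult_mono) auto
  \<comment> \<open>With \<open>Fint\<close> close to 1 this is about \<open>c0 + v\<close>, whence
    the reference value \<open>2 * c0 + v\<close>.\<close>
  have parts: "Gint {0<..} s c0 = c0 * ?F c0 + integral {0<..} (\<lambda>x. x ^ 1 * fF s c0 x)" by (rule Gint_by_parts[OF adm])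
  have r1: "c0 * ?F c0 = c0 + c0 * (?F c0 - 1)" and r2: "(c - c0) * ?F c0 = (c - c0) + (c - c0) * (?F c0 - 1)"
    by (simp_all add: algebra_simps)
  have "\<bar>c + Gint {0<..} s c - (2 * c0 + v)\<bar> \<le> d * (15 / 10 ^ 20) + 1 * (15 / 10 ^ 20) + 4 / 10 ^ 19"
    by (rule error_combine[OF t1 t2[unfolded r2] prod prod2 M parts[unfolded r1]])
  also have "\<dots> \<le> 1 / 10 ^ 18" by (simp add: d_def)
  finally show ?thesis using admc c(3) cd uniq unfolding d_def by blast
qed

text \<open>For \<open>c \<le> 0\<close> the denominator vanishes at \<open>x = - 2 c\<close>, where the integrand behaves like \<open>k / (x + 2 c)\<close>.\<close>

lemma Bose_not_integrable:
  fixes c :: real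
  assumes c: "c \<le> 0"
  shows "\<not> (\<lambda>x::real. x / (exp (c * x + x\<^sup>2 / 2) - 1)) integrable_on {0<..}"
proof
  let ?f = "\<lambda>x::real. x / (exp (c * x + x\<^sup>2 / 2) - 1)"
  assume int: "?f integrable_on {0<..}"
  define a where "a = - 2 * c"
  have a: "0 \<le> a" using c by (simp add: a_def)
  have u: "c * x + x\<^sup>2 / 2 = x * (x - a) / 2" for x by (simp add: a_def power2_eq_square field_simps)
  define k where "k = 2 / exp ((a + 1) / 2)"
  have k: "k > 0" by (simp add: k_def)
  have low: "k / (x - a) \<le> ?f x" if x: "a < x" "x \<le> a + 1" for x
  proof -
    define w where "w = x * (x - a) / 2"
    have w: "0 < w" using x a by (simp add: w_def)
    have "w \<le> (a + 1) / 2"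
    proof -
      have "x * (x - a) \<le> (a + 1) * 1" using x a by (intro mult_mono) auto
      then show ?thesis by (simp add: w_def)
    qed
    have "exp w - 1 \<le> w * exp w"
    proof -
      have "1 - w \<le> exp (- w)" using exp_ge_add_one_self[of "- w"] by simp
      then have "(1 - w) * exp w \<le> exp (- w) * exp w" by (intro mult_right_mono) auto
      then show ?thesis by (simp add: exp_minus algebra_simps)
    qed
    also have "\<dots> \<le> w * exp ((a + 1) / 2)" using w \<open>w \<le> _\<close> by (intro mult_left_mono) auto
    finally have "x / (w * exp ((a + 1) / 2)) \<le> x / (exp w - 1)" using w x a by (intro divide_left_mono mult_pos_pos) auto
    moreover have "x / (w * exp ((a + 1) / 2)) = k / (x - a)" using x a by (simp add: w_def k_def)
    ultimately show ?thesis unfolding u w_def by simp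
  qed
  have "?f integrable_on {0..}"
    using int by (rule integrable_spike_set) (auto intro: negligible_subset[of "{0}"])
  then have int': "?f integrable_on S" if "S = {a + e..a + 1}" "0 \<le> e" for S e
    using integrable_on_subinterval[of ?f "{0..}" "a + e" "a + 1"] a that by auto
  define I where "I = integral {a..a + 1} ?f"
  have nonneg: "0 \<le> ?f x" if "a \<le> x" "x \<le> a + 1" for x
  proof (cases "x = a")
    \<comment> \<open>Here the denominator is 0, and the quotient is 0 by the convention for
      division.\<close>
    case True
    then have "exp (c * x + x\<^sup>2 / 2) - 1 = 0" unfolding u by simp
    then show ?thesis by simp
  next
    case False
    then have "0 \<le> k / (x - a)" using that k by simp
    then show ?thesis using low[of x] that False by simp
  qed
  \<comment> \<open>Chosen so that \<open>k / (x - a)\<close> has the integral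
    \<open>\<bar>I\<bar> + 1\<close> over \<open>[a + e, a + 1]\<close>, which is more than
    \<open>I\<close> allows.\<close>
  define e where "e = exp (- ((\<bar>I\<bar> + 1) / k))"
  have e: "0 < e" "e < 1" using k by (auto simp: e_def)
  have "((\<lambda>x. k / (x - a)) has_integral (k * ln (a + 1 - a) - k * ln (a + e - a))) {a + e..a + 1}"
    using e by (intro fundamental_theorem_of_calculus)
       (auto intro!: derivative_eq_intros simp flip: has_real_derivative_iff_has_vector_derivative)
  then have L: "((\<lambda>x. k / (x - a)) has_integral (\<bar>I\<bar> + 1)) {a + e..a + 1}"
    using k by (simp add: e_def add.commute)
  have "\<bar>I\<bar> + 1 \<le> integral {a + e..a + 1} ?f"
    using e by (subst integral_unique[OF L, symmetric], intro integral_le int'[OF refl] low)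
       (use L in \<open>auto simp: integrable_on_def\<close>)
  also have "\<dots> \<le> I" unfolding I_def
    using e int'[OF refl, of 0] nonneg by (intro integral_subset_le int'[OF refl]) auto
  finally show False by simp
qed

section \<open>Certified integration\<close>

fun ladd :: "int list \<Rightarrow> int list \<Rightarrow> int list" where
  "ladd [] ys = ys"
| "ladd (x # xs) [] = x # xs"
| "ladd (x # xs) (y # ys) = (x + y) # ladd xs ys"

definition lscale :: "int \<Rightarrow> int list \<Rightarrow> int list" where
  "lscale a xs = map (\<lambda>x. a * x) xs"

fun lmul :: "int list \<Rightarrow> int list \<Rightarrow> int list" where
  "lmul [] ys = []"
| "lmul (x # xs) ys = ladd (lscale x ys) (0 # lmul xs ys)"

fun lderiv_aux :: "int \<Rightarrow> int list \<Rightarrow> int list" where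
  "lderiv_aux k [] = []"
| "lderiv_aux k (x # xs) = (k * x) # lderiv_aux (k + 1) xs"

fun lderiv :: "int list \<Rightarrow> int list" where
  "lderiv [] = []"
| "lderiv (x # xs) = lderiv_aux 1 xs"

text \<open>Dominates the polynomial on \<open>[-1, 1]\<close>, so that an estimate for a residual
  becomes an inequality between integers.\<close>

fun lnorm :: "int list \<Rightarrow> int" where
  "lnorm [] = 0"
| "lnorm (x # xs) = \<bar>x\<bar> + lnorm xs"

fun lsum :: "int list \<Rightarrow> int" where
  "lsum [] = 0"
| "lsum (x # xs) = x + lsum xs"

fun lalt :: "int list \<Rightarrow> int" where
  "lalt [] = 0"
| "lalt (x # xs) = x - lalt xs"

fun lev :: "int list \<Rightarrow> real \<Rightarrow> real" where
  "lev [] t = 0"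
| "lev (x # xs) t = of_int x + t * lev xs t"

lemma lev_ladd: "lev (ladd xs ys) t = lev xs t + lev ys t"
  by (induction xs ys rule: ladd.induct) (auto simp: algebra_simps)

lemma lev_lscale: "lev (lscale a xs) t = of_int a * lev xs t"
  by (induction xs) (auto simp: lscale_def algebra_simps)

lemma lev_lmul: "lev (lmul xs ys) t = lev xs t * lev ys t"
  by (induction xs) (auto simp: lev_ladd lev_lscale algebra_simps)

lemma lev_lderiv_aux: "lev (lderiv_aux (k + 1) xs) t = lev (lderiv_aux k xs) t + lev xs t"
proof (induction xs arbitrary: k)
  case (Cons x xs)
  show ?case using Cons.IH[of "k + 1"] by (simp add: algebra_simps)
qed simp

lemma lev_0_aux: "lev (lderiv_aux 0 xs) t = t * lev (lderiv xs) t"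
  by (cases xs) auto

lemma has_derivative_lev: "(lev xs has_real_derivative lev (lderiv xs) t) (at t)"
proof (induction xs)
  case (Cons x xs)
  have "((\<lambda>t. of_int x + t * lev xs t) has_real_derivative (0 + (1 * lev xs t + lev (lderiv xs) t * t))) (at t)"
    by (intro derivative_intros Cons)
  moreover have "lev (lderiv_aux 1 xs) t = lev xs t + lev (lderiv xs) t * t"
    using lev_lderiv_aux[of 0 xs t] lev_0_aux[of xs t] by simp
  ultimately show ?case by (simp add: fun_eq_iff)
qed simp

lemma abs_lev_le: "\<bar>t\<bar> \<le> 1 \<Longrightarrow> \<bar>lev xs t\<bar> \<le> of_int (lnorm xs)"
proof (induction xs)
  case (Cons x xs)
  have "\<bar>of_int x + t * lev xs t\<bar> \<le> \<bar>of_int x\<bar> + \<bar>t\<bar> * \<bar>lev xs t\<bar>"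
    by (metis abs_mult abs_triangle_ineq)
  also have "\<bar>t\<bar> * \<bar>lev xs t\<bar> \<le> 1 * of_int (lnorm xs)" using Cons by (intro mult_mono) auto
  finally show ?case by simp
qed simp

lemma lev_1: "lev xs 1 = of_int (lsum xs)"
  by (induction xs) auto

lemma lev_m1: "lev xs (- 1) = of_int (lalt xs)"
  by (induction xs) auto

text \<open>Half of the integral over \<open>[-1, 1]\<close>, multiplied by a common denominator \<open>L\<close>: the weights are
  \<open>L div 1, L div 3, L div 5, \<dots>\<close>.\<close>

fun lint :: "int list \<Rightarrow> int list \<Rightarrow> int" where
  "lint (w # ws) (x # y # xs) = w * x + lint ws xs"
| "lint (w # ws) [x] = w * x"
| "lint ws xs = 0"

fun weights_ok :: "int \<Rightarrow> int \<Rightarrow> int list \<Rightarrow> bool" where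
  "weights_ok L k [] = True"
| "weights_ok L k (w # ws) = (k * w = L \<and> weights_ok L (k + 2) ws)"

text \<open>\<open>lint\<close> returns 0 once its weights are exhausted; this predicate excludes
  that coefficients are dropped in this way.\<close>

fun short :: "int list \<Rightarrow> int list \<Rightarrow> bool" where
  "short (w # ws) (x # y # xs) = short ws xs"
| "short [] (x # xs) = False"
| "short ws xs = True"

text \<open>Over \<open>[-1, 1]\<close> odd powers integrate to 0 and the even power
  \<open>t ^ (k - 1)\<close> to \<open>2 / k\<close>, so coefficients are consumed in pairs while
  \<open>k\<close> runs through the odd numbers.\<close>

lemma has_integral_lev_aux:
  assumes "weights_ok L k ws" "short ws xs" "odd (nat k)" "k > 0"
  shows "((\<lambda>t. of_int L * (t ^ (nat k - 1) * lev xs t)) has_integral (2 * of_int (lint ws xs))) {-1..1}"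
  using assms
proof (induction ws xs arbitrary: k rule: lint.induct)
  case (1 w ws x y xs)
  obtain n where n: "k = int n" "odd n" "n > 0" using 1(4,5) by (metis int_nat_eq less_le nat_eq_iff2 odd_pos order_less_imp_le zero_less_nat_eq)
  have ev: "even (n - 1)" "Suc (n - 1) = n" using n by auto
  have mono: "((\<lambda>t::real. t ^ m) has_integral (if even m then 2 / (real m + 1) else 0)) {-1..1}" for m :: nat
  proof -
    have "((\<lambda>t::real. t ^ m) has_integral (1 ^ Suc m / real (Suc m) - (-1) ^ Suc m / real (Suc m))) {-1..1}"
      by (rule fundamental_theorem_of_calculus)
         (auto intro!: derivative_eq_intros simp flip: has_real_derivative_iff_has_vector_derivative simp del: power_Suc of_nat_Suc)
    then show ?thesis by (cases "even m") (auto simp: add.commute)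
  qed
  have IH: "((\<lambda>t. of_int L * (t ^ (nat (k + 2) - 1) * lev xs t)) has_integral (2 * of_int (lint ws xs))) {-1..1}"
    using 1(2-5) by (intro 1(1)) (auto simp: nat_add_distrib)
  have "((\<lambda>t. of_int L * of_int x * t ^ (n - 1) + of_int L * of_int y * t ^ n + of_int L * (t ^ (nat (k + 2) - 1) * lev xs t)) has_integral
     (of_int L * of_int x * (2 / real n) + of_int L * of_int y * 0 + 2 * of_int (lint ws xs))) {-1..1}"
  proof (intro has_integral_add has_integral_mult_right IH)
    show "((\<lambda>t::real. t ^ (n - 1)) has_integral (2 / real n)) {-1..1}" using mono[of "n - 1"] ev n by simp
    show "((\<lambda>t::real. t ^ n) has_integral 0) {-1..1}" using mono[of n] n(2) by simp
  qed
  moreover have "of_int L * of_int x * (2 / real n) + of_int L * of_int y * 0 + 2 * of_int (lint ws xs) =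
     2 * real_of_int (lint (w # ws) (x # y # xs))"
  proof -
    have "L = int n * w" using 1(2) n by simp
    then show ?thesis using n by simp
  qed
  moreover have "of_int L * of_int x * t ^ (n - 1) + of_int L * of_int y * t ^ n + of_int L * (t ^ (nat (k + 2) - 1) * lev xs t) =
     of_int L * (t ^ (nat k - 1) * lev (x # y # xs) t)" for t :: real
  proof -
    have "nat (k + 2) - 1 = (n - 1) + 2" "nat k - 1 = n - 1" using n by (auto simp: nat_add_distrib)
    moreover have "t ^ n = t ^ (n - 1) * t" using ev(2) by (metis power_Suc2)
    ultimately show ?thesis by (simp add: power_add power2_eq_square algebra_simps)
  qed
  ultimately show ?case by simp
next
  case (2 w ws x)
  obtain n where n: "k = int n" "odd n" "n > 0" using 2(3,4) by (metis int_nat_eq less_le nat_eq_iff2 odd_pos order_less_imp_le zero_less_nat_eq)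
  have "((\<lambda>t::real. t ^ (n - 1)) has_integral (1 ^ Suc (n - 1) / real (Suc (n - 1)) - (-1) ^ Suc (n - 1) / real (Suc (n - 1)))) {-1..1}"
    by (rule fundamental_theorem_of_calculus)
       (auto intro!: derivative_eq_intros simp flip: has_real_derivative_iff_has_vector_derivative simp del: power_Suc of_nat_Suc)
  then have "((\<lambda>t::real. t ^ (n - 1)) has_integral (2 / real n)) {-1..1}" using n by simp
  then have "((\<lambda>t::real. of_int L * of_int x * t ^ (n - 1)) has_integral (of_int L * of_int x * (2 / real n))) {-1..1}"
    by (rule has_integral_mult_right)
  moreover have "L = int n * w" using 2(1) n by simp
  then have "of_int L * of_int x * (2 / real n) = 2 * real_of_int (w * x)" using n by simp
  ultimately show ?case using n by (simp add: mult_ac)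
next
  case ("3_1" xs)
  then show ?case by (cases xs) auto
qed auto

lemma has_integral_lev:
  assumes "weights_ok L 1 ws" "short ws xs" "L > 0"
  shows "(lev xs has_integral (2 * of_int (lint ws xs) / of_int L)) {-1..1}"
proof -
  have "((\<lambda>t. of_int L * (t ^ (nat 1 - 1) * lev xs t)) has_integral (2 * of_int (lint ws xs))) {-1..1}"
    by (rule has_integral_lev_aux[OF assms(1,2)]) auto
  then have "((\<lambda>t. (of_int L * lev xs t) * (1 / of_int L)) has_integral (2 * of_int (lint ws xs) * (1 / of_int L))) {-1..1}"
    by (intro has_integral_mult_left) simp
  then show ?thesis using assms(3) by simp
qed

lemma has_integral_lev_shift:
  fixes m :: real
  assumes "weights_ok L 1 ws" "short ws xs" "L > 0"
  shows "((\<lambda>x. lev xs (2 * (x - m))) has_integral (of_int (lint ws xs) / of_int L)) {m - 1/2..m + 1/2}"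
proof -
  have "((\<lambda>x. lev xs (2 *\<^sub>R x + (- 2 * m))) has_integral ((2 * of_int (lint ws xs) / of_int L) /\<^sub>R 2 ^ DIM(real)))
      (cbox ((-1 - (- 2 * m)) /\<^sub>R 2) ((1 - (- 2 * m)) /\<^sub>R 2))"
    using has_integral_lev[OF assms] by (subst has_integral_affinity_iff) auto
  then show ?thesis by (simp add: algebra_simps add_divide_distrib diff_divide_distrib)
qed

text \<open>Fixed-point arithmetic: polynomial coefficients and error bounds are integers in units of \<open>1 / S0\<close>, and
  the constant is \<open>c = g / (2 * G0)\<close>.\<close>

definition S0 :: int where "S0 = 2 ^ 88"
definition G0 :: int where "G0 = 2 ^ 65"

text \<open>\<open>G0\<close> times \<open>4 * P' + (2 * c + 2 * m + t) * P\<close>, the doubled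
  residual of \<open>W' = - (c + x) * W\<close> in the variable \<open>t\<close>, where
  \<open>x = m + t / 2\<close>. The numbers \<open>2 * c\<close> and
  \<open>2 * m = 2 * i + 1\<close> become integers after multiplication by
  \<open>G0\<close>.\<close>

definition wres :: "int \<Rightarrow> int \<Rightarrow> int list \<Rightarrow> int list" where
  "wres g i P = ladd (lscale (4 * G0) (lderiv P)) (lmul [g + G0 * (2 * i + 1), G0] P)"

text \<open>With \<open>p = P / S0\<close> and \<open>q = Q / S0\<close> this is
  \<open>2 * S0 ^ 2\<close> times \<open>x * p - q * (1 + s * p)\<close>, the relation defining
  \<open>x W / (1 + s W)\<close> with its denominator cleared.\<close>

definition hres :: "int \<Rightarrow> int \<Rightarrow> int list \<Rightarrow> int list \<Rightarrow> int list" where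
  "hres s i P Q = ladd (lscale S0 (lmul [2 * i + 1, 1] P)) (lscale (-2) (ladd (lscale S0 Q) (lscale s (lmul Q P))))"

text \<open>On the interval \<open>[i, i + 1]\<close> with midpoint \<open>m\<close> put \<open>t = 2 (x - m)\<close>. A polynomial \<open>P\<close> approximating the
  weight \<open>W x = exp (- (c x + x\<^sup>2 / 2))\<close> is certified by its residual in the differential equation
  \<open>W' = - (c + x) W\<close>.\<close>

lemma ode_error:
  fixes i :: nat and c g :: real
  assumes c: "-1/3 \<le> c" and k: "\<kappa> \<ge> 1" "i = 0 \<and> c < 0 \<longrightarrow> \<kappa> \<ge> 2"
    and res: "\<And>t. \<bar>t\<bar> \<le> 1 \<Longrightarrow> \<bar>4 * lev (lderiv P) t + (2 * c + 2 * (real i + 1/2) + t) * lev P t\<bar> \<le> \<rho> * N"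
    and N: "N > 0"
    and x: "real i \<le> x" "x \<le> real i + 1"
  shows "\<bar>bw 1 c x - lev P (2 * (x - (real i + 1/2))) / N\<bar> \<le>
     \<kappa> * (\<bar>bw 1 c (real i) - of_int (lalt P) / N\<bar> + \<rho> * (x - real i) / 2)"
proof -
  let ?m = "real i + 1/2"
  let ?p = "\<lambda>x. lev P (2 * (x - ?m)) / N"
  let ?u = "\<lambda>x. c * x + x\<^sup>2 / 2"
  \<comment> \<open>The relative error of \<open>?p\<close>. Its derivative is proportional to
    \<open>exp (?u x)\<close> times the residual, so the mean value theorem bounds its
    growth.\<close>
  let ?\<Phi> = "\<lambda>x. 1 - ?p x * exp (?u x)"
  have W: "bw 1 c x = exp (- ?u x)" for x by (simp add: bw_def)
  have mono: "?u y \<le> ?u x + ln \<kappa>" if y: "real i \<le> y" "y \<le> x" for y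
  proof (cases "i = 0 \<and> c < 0")
    case True
    \<comment> \<open>With negative \<open>c\<close> the exponent first decreases, but by at most
      \<open>c ^ 2 / 2 \<le> 1/18\<close>; the factor 2 covers this generously.\<close>
    have "?u y \<le> ?u x + 1/18"
    proof -
      have "0 \<le> (x + y) / 2 * (x - y)" using y x by simp
      moreover have "- (1/3) * (x - y) \<le> c * (x - y)" using c y by (intro mult_right_mono) auto
      moreover have "?u x - ?u y = c * (x - y) + (x + y) / 2 * (x - y)" by (simp add: power2_eq_square field_simps)
      moreover have "(x - y)\<^sup>2 / 2 \<le> (x + y) / 2 * (x - y)"
      proof -
        have "(x - y) * (x - y) \<le> (x + y) * (x - y)" using y True x by (intro mult_right_mono) auto
        then show ?thesis by (simp add: power2_eq_square)
      qed
      moreover have "- (1/18) \<le> d\<^sup>2 / 2 - 1/3 * d" for d :: real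
      proof -
        have "(d - 1/3)\<^sup>2 = d\<^sup>2 - 2/3 * d + 1/9" by (simp add: power2_eq_square algebra_simps)
        then show ?thesis using zero_le_power2[of "d - 1/3"] by linarith
      qed
      note this[of "x - y"]
      ultimately show ?thesis by linarith
    qed
    also have "1/18 \<le> ln \<kappa>"
    proof -
      have "2 * ((\<kappa> - 1) / (\<kappa> + 1)) \<ge> 0" using k by simp
      have "1/2 \<le> ln (2::real)" using ln_2_less_1 ln2_ge_two_thirds by simp
      also have "\<dots> \<le> ln \<kappa>" using k True by (subst ln_le_cancel_iff) auto
      finally show ?thesis by simp
    qed
    finally show ?thesis by simp
  next
    case False
    have "0 \<le> (c + (x + y) / 2) * (x - y)"
    proof (rule mult_nonneg_nonneg)
      show "0 \<le> c + (x + y) / 2"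
      proof (cases "i = 0")
        case True
        then show ?thesis using False y x by simp
      next
        case False
        then have "1 \<le> (x + y) / 2" using y x by auto
        then show ?thesis using c by linarith
      qed
    qed (use y in simp)
    moreover have "?u x - ?u y = (c + (x + y) / 2) * (x - y)" by (simp add: power2_eq_square field_simps)
    moreover have "0 \<le> ln \<kappa>" using k by simp
    ultimately show ?thesis by linarith
  qed
  have rho: "0 \<le> \<rho>"
  proof -
    have "0 \<le> \<rho> * N" by (rule order.trans[OF abs_ge_zero res[of 0]]) simp
    then show ?thesis using N by (simp add: zero_le_mult_iff)
  qed
  have deriv: "(?\<Phi> has_real_derivative - exp (?u y) * ((4 * lev (lderiv P) (2 * (y - ?m)) +
       (2 * c + 2 * ?m + 2 * (y - ?m)) * lev P (2 * (y - ?m))) / (2 * N))) (at y)" for y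
  proof -
    have L: "((\<lambda>y. lev P (2 * (y - ?m))) has_real_derivative lev (lderiv P) (2 * (y - ?m)) * 2) (at y)"
      by (rule DERIV_chain2[OF has_derivative_lev]) (auto intro!: derivative_eq_intros)
    have E: "((\<lambda>y. exp (?u y)) has_real_derivative exp (?u y) * (c + y)) (at y)"
      by (auto intro!: derivative_eq_intros)
    have lin: "2 * c + 2 * ?m + 2 * (y - ?m) = 2 * (c + y)" by simp
    define l l' where "l = lev P (2 * (y - ?m))" and "l' = lev (lderiv P) (2 * (y - ?m))"
    have "(?\<Phi> has_real_derivative 0 - (l' * 2 / N * exp (?u y) + exp (?u y) * (c + y) * (l / N))) (at y)"
      unfolding l_def l'_def by (rule DERIV_diff[OF DERIV_const DERIV_mult[OF DERIV_cdivide[OF L] E]])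
    moreover have "0 - (l' * 2 / N * exp (?u y) + exp (?u y) * (c + y) * (l / N)) =
        - exp (?u y) * ((4 * l' + (2 * (c + y)) * l) / (2 * N))"
      using N by (simp add: field_simps)
    ultimately show ?thesis unfolding lin l_def l'_def by (simp only:)
  qed
  have "\<bar>?\<Phi> x - ?\<Phi> (real i)\<bar> \<le> (x - real i) * (\<rho> / 2 * \<kappa> * exp (?u x))"
  proof (cases "x = real i")
    case False
    then have xi: "real i < x" using x by simp
    obtain y where y: "real i < y" "y < x" "?\<Phi> x - ?\<Phi> (real i) = (x - real i) * (- exp (?u y) * ((4 * lev (lderiv P) (2 * (y - ?m)) +
       (2 * c + 2 * ?m + 2 * (y - ?m)) * lev P (2 * (y - ?m))) / (2 * N)))"
      using MVT2[OF xi deriv] by blast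
    let ?r = "4 * lev (lderiv P) (2 * (y - ?m)) + (2 * c + 2 * ?m + 2 * (y - ?m)) * lev P (2 * (y - ?m))"
    have t1: "\<bar>2 * (y - ?m)\<bar> \<le> 1" using y x by (auto simp: abs_le_iff)
    have "\<bar>?r\<bar> \<le> \<rho> * N" using res[OF t1] by simp
    then have r: "\<bar>?r\<bar> / (2 * N) \<le> \<rho> / 2" using N by (simp add: field_simps)
    have "exp (?u y) \<le> exp (?u x + ln \<kappa>)" using mono[of y] y by simp
    then have eu: "exp (?u y) \<le> exp (?u x) * \<kappa>" using k by (simp add: exp_add)
    have "\<bar>?\<Phi> x - ?\<Phi> (real i)\<bar> = (x - real i) * (exp (?u y) * (\<bar>?r\<bar> / (2 * N)))"
      unfolding y(3) using xi N by (simp add: abs_mult)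
    also have "\<dots> \<le> (x - real i) * ((exp (?u x) * \<kappa>) * (\<rho> / 2))"
      using xi N eu r k by (intro mult_left_mono mult_mono) auto
    finally show ?thesis by (simp add: mult_ac)
  qed simp
  then have main: "\<bar>?\<Phi> x\<bar> \<le> \<bar>?\<Phi> (real i)\<bar> + (x - real i) * (\<rho> / 2 * \<kappa> * exp (?u x))" by linarith
  have PhiW: "\<bar>?\<Phi> y\<bar> * exp (- ?u y) = \<bar>bw 1 c y - ?p y\<bar>" for y
  proof -
    have ee: "exp (?u y) * exp (- ?u y) = 1" by (rule exp_minus_inverse)
    have "?\<Phi> y * exp (- ?u y) = bw 1 c y - ?p y"
      by (simp only: W left_diff_distrib mult_1_left mult_1_right mult.assoc ee)
    then show ?thesis by (metis abs_exp_cancel abs_mult)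
  qed
  have start: "?p (real i) = of_int (lalt P) / N" using lev_m1[of P] by simp
  have Phi0: "\<bar>?\<Phi> (real i)\<bar> = \<bar>bw 1 c (real i) - of_int (lalt P) / N\<bar> * exp (?u (real i))"
    using PhiW[of "real i"] unfolding start by (simp add: exp_minus field_simps)
  have "\<bar>bw 1 c x - ?p x\<bar> = \<bar>?\<Phi> x\<bar> * exp (- ?u x)" by (rule PhiW[symmetric])
  also have "\<dots> \<le> (\<bar>?\<Phi> (real i)\<bar> + (x - real i) * (\<rho> / 2 * \<kappa> * exp (?u x))) * exp (- ?u x)"
    using main by (intro mult_right_mono) auto
  also have "\<dots> = \<bar>bw 1 c (real i) - of_int (lalt P) / N\<bar> * (exp (?u (real i)) * exp (- ?u x)) + (x - real i) * (\<rho> / 2 * \<kappa>)"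
  proof -
    have exx: "exp (?u x) * exp (- ?u x) = 1" by (rule exp_minus_inverse)
    show ?thesis unfolding Phi0 by (simp only: distrib_right mult.assoc exx mult_1_right)
  qed
  also have "\<dots> \<le> \<bar>bw 1 c (real i) - of_int (lalt P) / N\<bar> * \<kappa> + (x - real i) * (\<rho> / 2 * \<kappa>)"
  proof (intro add_right_mono mult_left_mono)
    have "exp (?u (real i) + - ?u x) \<le> exp (ln \<kappa>)" using mono[of "real i"] x by simp
    then show "exp (?u (real i)) * exp (- ?u x) \<le> \<kappa>" using k by (simp only: exp_add) simp
  qed simp
  also have "\<dots> = \<kappa> * (\<bar>bw 1 c (real i) - of_int (lalt P) / N\<bar> + \<rho> * (x - real i) / 2)"
    by (simp only: distrib_left mult.commute mult.left_commute times_divide_eq_right)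
  finally show ?thesis .
qed

text \<open>A bound for \<open>exp (u y - u x)\<close> with \<open>i \<le> y \<le> x \<le> i + 1\<close>, where \<open>u x = c x + x\<^sup>2 / 2\<close>; only on the first
  interval and for negative \<open>c\<close> can \<open>u\<close> decrease.\<close>

definition kap :: "int \<Rightarrow> int" where "kap i = (if i = 0 then 2 else 1)"

text \<open>\<open>P0\<close> is the polynomial of the preceding interval, whose value at the common endpoint is \<open>lsum P0\<close> with error
  \<open>w\<close>; the error of \<open>P\<close> is at most \<open>w'\<close>. In \<open>hcheck\<close>, \<open>Q\<close> approximates \<open>x W / (1 + s W)\<close> with error \<open>e\<close>.\<close>

definition wcheck :: "int \<Rightarrow> int \<Rightarrow> int list \<Rightarrow> int \<Rightarrow> int list \<Rightarrow> int \<Rightarrow> bool" where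
  "wcheck g i P0 w P w' \<longleftrightarrow> kap i * (2 * G0 * (w + \<bar>lsum P0 - lalt P\<bar>) + lnorm (wres g i P)) \<le> 2 * G0 * w'"

definition hcheck :: "int \<Rightarrow> int \<Rightarrow> int list \<Rightarrow> int \<Rightarrow> int list \<Rightarrow> int \<Rightarrow> bool" where
  "hcheck s i P w Q e \<longleftrightarrow> lnorm Q \<le> 4 * S0 \<and> lnorm (hres s i P Q) + 28 * w * S0 \<le> e * S0"

lemma S0_pos: "0 < S0" and G0_pos: "0 < G0" by (simp_all add: S0_def G0_def)

lemma wcheck_step:
  fixes i :: nat and g :: int
  defines "c \<equiv> of_int g / 2 ^ 66"
  assumes c: "-1/3 \<le> c" and chk: "wcheck g (int i) P0 w P w'"
    and start: "\<bar>bw 1 c (real i) - of_int (lsum P0) / of_int S0\<bar> \<le> of_int w / of_int S0"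
    and x: "real i \<le> x" "x \<le> real i + 1"
  shows "\<bar>bw 1 c x - lev P (2 * (x - (real i + 1/2))) / of_int S0\<bar> \<le> of_int w' / of_int S0"
proof -
  let ?N = "of_int S0 :: real"
  have N: "?N > 0" and G: "(of_int G0 :: real) > 0" using S0_pos G0_pos by auto
  have c2: "2 * c = of_int g / of_int G0" by (simp add: c_def G0_def)
  define \<rho> where "\<rho> = of_int (lnorm (wres g (int i) P)) / (of_int G0 * ?N)"
  define \<kappa> :: real where "\<kappa> = of_int (kap (int i))"
  have k: "\<kappa> \<ge> 1" "i = 0 \<and> c < 0 \<longrightarrow> \<kappa> \<ge> 2" by (auto simp: \<kappa>_def kap_def)
  have rho0: "0 \<le> \<rho>"
  proof -
    have "0 \<le> lnorm xs" for xs by (induction xs) auto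
    then show ?thesis unfolding \<rho>_def using N G by (intro divide_nonneg_nonneg) auto
  qed
  have res: "\<bar>4 * lev (lderiv P) t + (2 * c + 2 * (real i + 1/2) + t) * lev P t\<bar> \<le> \<rho> * ?N" if t: "\<bar>t\<bar> \<le> 1" for t
  proof -
    have "4 * lev (lderiv P) t + (2 * c + 2 * (real i + 1/2) + t) * lev P t = lev (wres g (int i) P) t / of_int G0"
      unfolding wres_def c2 using G by (simp add: lev_ladd lev_lscale lev_lmul field_simps)
    moreover have "\<rho> * ?N = of_int (lnorm (wres g (int i) P)) / of_int G0" unfolding \<rho>_def using N by simp
    moreover have "\<bar>lev (wres g (int i) P) t\<bar> / of_int G0 \<le> of_int (lnorm (wres g (int i) P)) / of_int G0"
      using G abs_lev_le[OF t] by (intro divide_right_mono) auto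
    ultimately show ?thesis using G by simp
  qed
  have "\<bar>bw 1 c x - lev P (2 * (x - (real i + 1/2))) / ?N\<bar> \<le>
     \<kappa> * (\<bar>bw 1 c (real i) - of_int (lalt P) / ?N\<bar> + \<rho> * (x - real i) / 2)"
    by (rule ode_error[OF c k res N x])
  also have "\<dots> \<le> \<kappa> * ((of_int w / ?N + \<bar>of_int (lsum P0) - of_int (lalt P)\<bar> / ?N) + \<rho> * 1 / 2)"
  proof (intro mult_left_mono add_mono divide_right_mono)
    have "\<bar>of_int (lsum P0) / ?N - of_int (lalt P) / ?N\<bar> = \<bar>of_int (lsum P0) - of_int (lalt P)\<bar> / ?N"
      using N by (simp add: diff_divide_distrib[symmetric])
    then show "\<bar>bw 1 c (real i) - of_int (lalt P) / ?N\<bar> \<le> of_int w / ?N + \<bar>of_int (lsum P0) - of_int (lalt P)\<bar> / ?N"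
      using start by linarith
  qed (use x rho0 k in auto)
  also have "\<dots> = of_int (kap (int i) * (2 * G0 * (w + \<bar>lsum P0 - lalt P\<bar>) + lnorm (wres g (int i) P))) / (2 * of_int G0 * ?N)"
    unfolding \<rho>_def \<kappa>_def using N G by (simp add: field_simps)
  also have "\<dots> \<le> of_int (2 * G0 * w') / (2 * of_int G0 * ?N)"
    using chk N G unfolding wcheck_def by (intro divide_right_mono) (simp_all only: of_int_le_iff, simp)
  also have "\<dots> = of_int w' / ?N" using G by simp
  finally show ?thesis .
qed

lemma wcheck_end:
  fixes i :: nat and g :: int
  defines "c \<equiv> of_int g / 2 ^ 66"
  assumes c: "-1/3 \<le> c" and chk: "wcheck g (int i) P0 w P w'"
    and start: "\<bar>bw 1 c (real i) - of_int (lsum P0) / of_int S0\<bar> \<le> of_int w / of_int S0"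
  shows "\<bar>bw 1 c (real (Suc i)) - of_int (lsum P) / of_int S0\<bar> \<le> of_int w' / of_int S0"
proof -
  have "\<bar>bw 1 c (real i + 1) - lev P (2 * ((real i + 1) - (real i + 1/2))) / of_int S0\<bar> \<le> of_int w' / of_int S0"
    using wcheck_step[OF c[unfolded c_def] chk start[unfolded c_def], of "real i + 1"] by (simp add: c_def)
  moreover have "2 * ((real i + 1) - (real i + 1/2)) = 1" by simp
  ultimately show ?thesis by (simp only: lev_1) (simp add: add.commute)
qed

lemma fF_bw: "fF s c x = x * bw 1 c x / (1 + s * bw 1 c x)"
proof -
  define E where "E = exp (c * x + x\<^sup>2 / 2)"
  have E: "E \<noteq> 0" by (simp add: E_def)
  have "bw 1 c x = exp (- (c * x + x\<^sup>2 / 2))" by (simp add: bw_def)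
  then have b: "bw 1 c x = 1 / E" by (simp only: E_def exp_minus inverse_eq_divide)
  have "x * (1 / E) / (1 + s * (1 / E)) = (x * (1 / E) * E) / ((1 + s * (1 / E)) * E)" using E by simp
  also have "\<dots> = x / (E + s)" using E by (simp add: distrib_right)
  finally show ?thesis unfolding fF_def b E_def[symmetric] by (rule sym)
qed

text \<open>The error of \<open>q\<close> as an approximation of the quotient is the residual of the
  multiplied-out relation, taken with the true weight, divided by the denominator; the assumption
  \<open>d\<close> keeps the latter away from 0.\<close>

lemma hcheck_step:
  fixes i :: nat and s :: int
  assumes s: "s = 1 \<or> s = -1" and chk: "hcheck s (int i) P w Q e"
    and W: "\<bar>bw 1 c x - lev P (2 * (x - (real i + 1/2))) / of_int S0\<bar> \<le> of_int w / of_int S0"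
    and d: "1/2 \<le> 1 + of_int s * bw 1 c x"
    and x: "real i \<le> x" "x \<le> real i + 1" "i < 10"
  shows "\<bar>fF (of_int s) c x - lev Q (2 * (x - (real i + 1/2))) / of_int S0\<bar> \<le> of_int e / of_int S0"
proof -
  let ?N = "of_int S0 :: real"
  let ?t = "2 * (x - (real i + 1/2))"
  have N: "?N > 0" using S0_pos by auto
  define p q W' where "p = lev P ?t / ?N" and "q = lev Q ?t / ?N" and "W' = bw 1 c x"
  have t: "\<bar>?t\<bar> \<le> 1" using x by (auto simp: abs_le_iff)
  have "\<bar>lev Q ?t\<bar> \<le> of_int (4 * S0)"
    using abs_lev_le[OF t, of Q] chk unfolding hcheck_def by (meson of_int_le_iff order.trans)
  then have q: "\<bar>q\<bar> \<le> 4" using N by (simp add: q_def pos_divide_le_eq)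
  have R: "lev (hres s (int i) P Q) ?t = 2 * ?N\<^sup>2 * (x * p - q * (1 + of_int s * p))"
    unfolding hres_def p_def q_def using N
    by (simp add: lev_ladd lev_lscale lev_lmul power2_eq_square field_simps)
  then have r: "2 * ?N\<^sup>2 * \<bar>x * p - q * (1 + of_int s * p)\<bar> \<le> of_int (lnorm (hres s (int i) P Q))"
    using abs_lev_le[OF t, of "hres s (int i) P Q"] N by (simp add: abs_mult)
  have e1: "x * W' - q * (1 + of_int s * W') = (x * p - q * (1 + of_int s * p)) + (W' - p) * (x - q * of_int s)"
    by (simp add: algebra_simps)
  \<comment> \<open>\<open>x \<le> 10\<close> and \<open>\<bar>q\<bar> \<le> 4\<close> give 14, and
    division by a denominator of at least 1/2 doubles it to the 28 in \<open>hcheck\<close>.\<close>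
  have "\<bar>(W' - p) * (x - q * of_int s)\<bar> \<le> of_int w / ?N * 14"
    unfolding abs_mult
  proof (intro mult_mono)
    show "\<bar>W' - p\<bar> \<le> of_int w / ?N" using W by (simp add: W'_def p_def)
    have "real i + 1 \<le> 10" using x by linarith
    then show "\<bar>x - q * of_int s\<bar> \<le> 14" using s q x by (auto simp: abs_le_iff)
    show "0 \<le> of_int w / ?N" using W by (meson abs_ge_zero order.trans)
  qed auto
  then have e2: "\<bar>x * W' - q * (1 + of_int s * W')\<bar> \<le> \<bar>x * p - q * (1 + of_int s * p)\<bar> + of_int w / ?N * 14"
    unfolding e1 by linarith
  have dp: "0 < 1 + of_int s * W'" using d by (simp add: W'_def)
  have "\<bar>fF (of_int s) c x - q\<bar> = \<bar>x * W' - q * (1 + of_int s * W')\<bar> / (1 + of_int s * W')"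
  proof -
    have "fF (of_int s) c x - q = (x * W' - q * (1 + of_int s * W')) / (1 + of_int s * W')"
      using dp unfolding fF_bw W'_def[symmetric] by (simp add: diff_divide_distrib)
    then show ?thesis using dp by simp
  qed
  also have "\<dots> \<le> (\<bar>x * p - q * (1 + of_int s * p)\<bar> + of_int w / ?N * 14) / (1 / 2)"
    using e2 d dp unfolding W'_def[symmetric] by (intro frac_le) auto
  also have "\<dots> = (2 * ?N\<^sup>2 * \<bar>x * p - q * (1 + of_int s * p)\<bar> + 28 * of_int w * ?N) / ?N\<^sup>2"
    using N by (simp add: field_simps power2_eq_square)
  also have "\<dots> \<le> (of_int (lnorm (hres s (int i) P Q)) + 28 * of_int w * ?N) / ?N\<^sup>2"
    using r by (intro divide_right_mono) auto
  also have "\<dots> \<le> (of_int (e * S0)) / ?N\<^sup>2"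
  proof (rule divide_right_mono)
    have "of_int (lnorm (hres s (int i) P Q) + 28 * w * S0) \<le> (of_int (e * S0) :: real)"
      using chk unfolding hcheck_def by (simp only: of_int_le_iff)
    then show "of_int (lnorm (hres s (int i) P Q)) + 28 * of_int w * ?N \<le> of_int (e * S0)" by simp
  qed simp
  also have "\<dots> = of_int e / ?N" using N by (simp add: power2_eq_square)
  finally show ?thesis by (simp add: q_def)
qed

text \<open>For the Bose weight on \<open>[0, 1]\<close> the factor \<open>x\<close> common to numerator and denominator is removed:
  \<open>W = 1 - x k\<close> with \<open>k\<close> approximated by the polynomial \<open>K\<close>, so \<open>x / (exp u - 1) = W / k\<close>.\<close>

definition bose_start_W :: "int list \<Rightarrow> int list" where
  "bose_start_W K = ladd [2 * S0] (lscale (-1) (lmul [1, 1] K))"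

definition bose_start_check :: "int \<Rightarrow> int list \<Rightarrow> int list \<Rightarrow> int \<Rightarrow> int \<Rightarrow> int \<Rightarrow> bool" where
  "bose_start_check g K Q a w e \<longleftrightarrow>
     lnorm (wres g 0 (bose_start_W K)) + 2 * G0 * \<bar>lsum (bose_start_W K) - 2 * a\<bar> \<le> 4 * G0 * w \<and>
     lnorm Q \<le> 4 * S0 \<and>
     2 * lnorm (ladd (lscale S0 (bose_start_W K)) (lscale (-2) (lmul Q K))) + 15 * w * S0 \<le> e * S0"

text \<open>The polynomial for the weight is exact at 0, so its error at \<open>x\<close> is at most
  a multiple of \<open>x\<close>; hence \<open>k\<close>, which results from division by
  \<open>x\<close>, is approximated uniformly by the polynomial \<open>K\<close>. As
  \<open>k \<ge> 1/3\<close>, the final division by \<open>k\<close> is harmless.\<close>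

lemma bose_start:
  fixes g :: int
  defines "c \<equiv> of_int g / 2 ^ 66"
  assumes c: "3/4 \<le> c" and chk: "bose_start_check g K Q a w e"
  shows "\<bar>bw 1 c 1 - of_int a / of_int S0\<bar> \<le> of_int w / of_int S0"
    and "0 < x \<Longrightarrow> x \<le> 1 \<Longrightarrow> \<bar>fF (-1) c x - lev Q (2 * (x - 1/2)) / of_int S0\<bar> \<le> of_int e / of_int S0"
proof -
  let ?N = "of_int S0 :: real"
  let ?P = "bose_start_W K"
  have N: "?N > 0" and G: "(of_int G0 :: real) > 0" using S0_pos G0_pos by auto
  have c2: "2 * c = of_int g / of_int G0" by (simp add: c_def G0_def)
  define \<rho> where "\<rho> = of_int (lnorm (wres g 0 ?P)) / (of_int G0 * (2 * ?N))"
  have res: "\<bar>4 * lev (lderiv ?P) t + (2 * c + 2 * (real 0 + 1/2) + t) * lev ?P t\<bar> \<le> \<rho> * (2 * ?N)" if t: "\<bar>t\<bar> \<le> 1" for t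
  proof -
    have "4 * lev (lderiv ?P) t + (2 * c + 2 * (real 0 + 1/2) + t) * lev ?P t = lev (wres g 0 ?P) t / of_int G0"
      unfolding wres_def c2 using G by (simp add: lev_ladd lev_lscale lev_lmul field_simps)
    moreover have "\<rho> * (2 * ?N) = of_int (lnorm (wres g 0 ?P)) / of_int G0" unfolding \<rho>_def using N by simp
    moreover have "\<bar>lev (wres g 0 ?P) t\<bar> / of_int G0 \<le> of_int (lnorm (wres g 0 ?P)) / of_int G0"
      using G abs_lev_le[OF t] by (intro divide_right_mono) auto
    ultimately show ?thesis using G by simp
  qed
  \<comment> \<open>Since \<open>1 + t = 2 * x\<close>, this is \<open>2 * S0\<close> times
    \<open>1 - x * k\<close> with \<open>k = lev K t / S0\<close>.\<close>
  have Pt: "lev ?P t = 2 * ?N - (1 + t) * lev K t" for t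
    by (simp add: bose_start_W_def lev_ladd lev_lscale lev_lmul algebra_simps)
  have alt: "of_int (lalt ?P) = 2 * ?N" using Pt[of "-1"] by (simp add: lev_m1)
  have err: "\<bar>bw 1 c x - lev ?P (2 * (x - 1/2)) / (2 * ?N)\<bar> \<le> \<rho> * x / 2" if x: "0 \<le> x" "x \<le> 1" for x
  proof -
    have "\<bar>bw 1 c x - lev ?P (2 * (x - (real 0 + 1/2))) / (2 * ?N)\<bar> \<le>
       1 * (\<bar>bw 1 c (real 0) - of_int (lalt ?P) / (2 * ?N)\<bar> + \<rho> * (x - real 0) / 2)"
      by (rule ode_error[OF _ _ _ res]) (use c N x in auto)
    moreover have "bw 1 c 0 = 1" by (simp add: bw_def)
    ultimately show ?thesis unfolding alt using N by simp
  qed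
  have w: "\<rho> / 2 + \<bar>of_int (lsum ?P) - 2 * of_int a\<bar> / (2 * ?N) \<le> of_int w / ?N" "0 \<le> \<rho>"
  proof -
    have "of_int (lnorm (wres g 0 ?P) + 2 * G0 * \<bar>lsum ?P - 2 * a\<bar>) \<le> (of_int (4 * G0 * w) :: real)"
      using chk unfolding bose_start_check_def by (simp only: of_int_le_iff)
    then have "of_int (lnorm (wres g 0 ?P) + 2 * G0 * \<bar>lsum ?P - 2 * a\<bar>) / (4 * of_int G0 * ?N) \<le> (of_int (4 * G0 * w)) / (4 * of_int G0 * ?N)"
      using N G by (intro divide_right_mono) auto
    then show "\<rho> / 2 + \<bar>of_int (lsum ?P) - 2 * of_int a\<bar> / (2 * ?N) \<le> of_int w / ?N"
      unfolding \<rho>_def using N G by (simp add: field_simps)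
    have "0 \<le> lnorm xs" for xs by (induction xs) auto
    then show "0 \<le> \<rho>" unfolding \<rho>_def using N G by (intro divide_nonneg_nonneg) auto
  qed
  show "\<bar>bw 1 c 1 - of_int a / ?N\<bar> \<le> of_int w / ?N"
  proof -
    have "\<bar>bw 1 c 1 - of_int (lsum ?P) / (2 * ?N)\<bar> \<le> \<rho> / 2" using err[of 1] by (simp add: lev_1)
    moreover have "\<bar>of_int (lsum ?P) / (2 * ?N) - of_int a / ?N\<bar> = \<bar>of_int (lsum ?P) - 2 * of_int a\<bar> / (2 * ?N)"
    proof -
      have "of_int (lsum ?P) / (2 * ?N) - of_int a / ?N = (of_int (lsum ?P) - 2 * of_int a) / (2 * ?N)"
        using N by (simp add: field_simps)
      then show ?thesis using N by simp
    qed
    ultimately show ?thesis using w by linarith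
  qed
  assume x: "0 < x" "x \<le> 1"
  let ?t = "2 * (x - 1/2)"
  have t: "\<bar>?t\<bar> \<le> 1" using x by (auto simp: abs_le_iff)
  define k kp q p W' where "k = (1 - bw 1 c x) / x" and "kp = lev K ?t / ?N" and "q = lev Q ?t / ?N"
    and "p = lev ?P ?t / (2 * ?N)" and "W' = bw 1 c x"
  have p: "p = 1 - x * kp" unfolding p_def kp_def Pt using N by (simp add: field_simps)
  have Wk: "W' = 1 - x * k" using x by (simp add: W'_def k_def)
  have Wp: "\<bar>W' - p\<bar> \<le> \<rho> * x / 2" using err[of x] x by (simp add: W'_def p_def)
  have "x * \<bar>k - kp\<bar> \<le> x * (\<rho> / 2)"
  proof -
    have "W' - p = - (x * (k - kp))" unfolding Wk p by (simp add: algebra_simps)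
    then have "\<bar>W' - p\<bar> = x * \<bar>k - kp\<bar>" using x by (simp add: abs_mult)
    then show ?thesis using Wp by (simp add: mult_ac)
  qed
  then have kk: "\<bar>k - kp\<bar> \<le> \<rho> / 2" using x by simp
  have "\<bar>lev Q ?t\<bar> \<le> of_int (4 * S0)"
    using abs_lev_le[OF t, of Q] chk unfolding bose_start_check_def by (meson of_int_le_iff order.trans)
  then have q: "\<bar>q\<bar> \<le> 4" using N by (simp add: q_def pos_divide_le_eq)
  have kpos: "1/3 \<le> k"
  proof -
    define u where "u = c * x + x\<^sup>2 / 2"
    have u: "3/4 * x \<le> u" using c x by (simp add: u_def add_increasing2 mult_right_mono)
    have "bw 1 c x = exp (- u)" by (simp add: bw_def u_def)
    also have "\<dots> \<le> exp (- (3/4 * x))" using u by simp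
    also have "\<dots> = 1 / exp (3/4 * x)" by (simp add: exp_minus inverse_eq_divide)
    also have "\<dots> \<le> 1 / (1 + 3/4 * x)" using x by (intro divide_left_mono) (auto intro: add_pos_pos)
    also have "\<dots> \<le> 1 - x / 3"
    proof -
      have "1 \<le> (1 - x / 3) * (1 + 3/4 * x)"
      proof -
        have "(1 - x / 3) * (1 + 3/4 * x) = 1 + x * (5/12 - x / 4)" by (simp add: field_simps)
        moreover have "0 \<le> x * (5/12 - x / 4)" using x by (intro mult_nonneg_nonneg) auto
        ultimately show ?thesis by linarith
      qed
      moreover have "0 < 1 + 3/4 * x" using x by simp
      ultimately show ?thesis by (simp only: pos_divide_le_eq)
    qed
    finally have "x * (1/3) \<le> 1 - bw 1 c x" by simp
    then show ?thesis unfolding k_def using x by (simp add: pos_le_divide_eq mult.commute)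
  qed
  have fk: "fF (-1) c x = W' / k"
    unfolding fF_bw W'_def[symmetric] k_def using x by (simp add: W'_def)
  have R: "2 * ?N\<^sup>2 * \<bar>p - q * kp\<bar> \<le> of_int (lnorm (ladd (lscale S0 ?P) (lscale (-2) (lmul Q K))))"
  proof -
    have "lev (ladd (lscale S0 ?P) (lscale (-2) (lmul Q K))) ?t = 2 * ?N\<^sup>2 * (p - q * kp)"
      unfolding p_def q_def kp_def using N
      by (simp add: lev_ladd lev_lscale lev_lmul power2_eq_square field_simps)
    then show ?thesis using abs_lev_le[OF t, of "ladd (lscale S0 ?P) (lscale (-2) (lmul Q K))"] N by (simp add: abs_mult)
  qed
  have "W' - q * k = (p - q * kp) + (W' - p) - q * (k - kp)" by (simp add: algebra_simps)
  moreover have "\<bar>q * (k - kp)\<bar> \<le> 4 * (\<rho> / 2)" unfolding abs_mult using q kk by (intro mult_mono) auto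
  moreover have "\<bar>W' - p\<bar> \<le> \<rho> / 2" using Wp x w(2) mult_left_mono[of x 1 \<rho>] by simp
  \<comment> \<open>One unit comes from the error of the weight and four from that of
    \<open>k\<close>, as \<open>\<bar>q\<bar> \<le> 4\<close>; division by
    \<open>k \<ge> 1/3\<close> turns this 5 into the 15 of \<open>bose_start_check\<close>.\<close>
  ultimately have "\<bar>W' - q * k\<bar> \<le> \<bar>p - q * kp\<bar> + 5 * (\<rho> / 2)" by linarith
  also have "\<dots> \<le> \<bar>p - q * kp\<bar> + 5 * (of_int w / ?N)"
  proof -
    have "0 \<le> \<bar>of_int (lsum ?P) - 2 * of_int a\<bar> / (2 * ?N)" using N by simp
    then show ?thesis using w(1) by linarith
  qed
  finally have e2: "\<bar>W' - q * k\<bar> \<le> \<bar>p - q * kp\<bar> + 5 * (of_int w / ?N)" .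
  have "\<bar>fF (-1) c x - q\<bar> = \<bar>W' - q * k\<bar> / k"
  proof -
    have "fF (-1) c x - q = (W' - q * k) / k" using kpos unfolding fk by (simp add: diff_divide_distrib)
    then show ?thesis using kpos by simp
  qed
  also have "\<dots> \<le> (\<bar>p - q * kp\<bar> + 5 * (of_int w / ?N)) / (1/3)" using e2 kpos by (intro frac_le) auto
  also have "\<dots> = (3/2 * (2 * ?N\<^sup>2 * \<bar>p - q * kp\<bar>) + 15 * of_int w * ?N) / ?N\<^sup>2"
    using N by (simp add: field_simps power2_eq_square)
  also have "\<dots> \<le> (2 * of_int (lnorm (ladd (lscale S0 ?P) (lscale (-2) (lmul Q K)))) + 15 * of_int w * ?N) / ?N\<^sup>2"
  proof (intro divide_right_mono add_right_mono)
    have "0 \<le> 2 * ?N\<^sup>2 * \<bar>p - q * kp\<bar>" by simp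
    then show "3/2 * (2 * ?N\<^sup>2 * \<bar>p - q * kp\<bar>) \<le> 2 * of_int (lnorm (ladd (lscale S0 ?P) (lscale (-2) (lmul Q K))))"
      using R by linarith
  qed simp
  also have "\<dots> \<le> of_int (e * S0) / ?N\<^sup>2"
  proof (rule divide_right_mono)
    have "of_int (2 * lnorm (ladd (lscale S0 ?P) (lscale (-2) (lmul Q K))) + 15 * w * S0) \<le> (of_int (e * S0) :: real)"
      using chk unfolding bose_start_check_def by (simp only: of_int_le_iff)
    then show "2 * of_int (lnorm (ladd (lscale S0 ?P) (lscale (-2) (lmul Q K)))) + 15 * of_int w * ?N \<le> (of_int (e * S0) :: real)" by simp
  qed simp
  also have "\<dots> = of_int e / ?N" using N by (simp add: power2_eq_square)
  finally show "\<bar>fF (-1) c x - lev Q (2 * (x - 1/2)) / ?N\<bar> \<le> of_int e / ?N" by (simp add: q_def)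
qed

section \<open>Moments interval by interval\<close>

definition mom :: "real \<Rightarrow> real \<Rightarrow> nat \<Rightarrow> nat \<Rightarrow> real" where
  "mom s c k n = integral {0<..real n} (\<lambda>x. x ^ k * fF s c x)"

definition weights_cover :: "int list \<Rightarrow> int list \<Rightarrow> int \<Rightarrow> bool" where
  "weights_cover ws Q i \<longleftrightarrow> short ws Q \<and> short ws (lmul [2 * i + 1, 1] Q)"

text \<open>On an interval of length 1 a uniform error bound is also a bound for the error of the
  integral; for the first moment it is multiplied by \<open>x \<le> 10\<close>.\<close>

lemma piece_moments:
  fixes i :: nat
  assumes adm: "adm s 1 c" and ws: "weights_ok L 1 ws" "L > 0" and Q: "weights_cover ws Q (int i)" and i: "i < 10"
    and H: "\<And>x. 0 < x \<Longrightarrow> real i \<le> x \<Longrightarrow> x \<le> real i + 1 \<Longrightarrow>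
       \<bar>fF s c x - lev Q (2 * (x - (real i + 1/2))) / of_int S0\<bar> \<le> of_int e / of_int S0"
  shows "\<bar>mom s c 0 (Suc i) - mom s c 0 i - of_int (lint ws Q) / (of_int L * of_int S0)\<bar> \<le> of_int e / of_int S0"
    and "\<bar>mom s c 1 (Suc i) - mom s c 1 i - of_int (lint ws (lmul [2 * int i + 1, 1] Q)) / (2 * of_int L * of_int S0)\<bar> \<le> 10 * of_int e / of_int S0"
proof -
  let ?N = "of_int S0 :: real"
  have N: "?N > 0" using S0_pos by simp
  define m where "m = real i + 1/2"
  have ends: "m - 1/2 = real i" "m + 1/2 = real i + 1" by (simp_all add: m_def)
  let ?S = "{real i<..real i + 1}"
  have step: "mom s c k (Suc i) - mom s c k i = integral ?S (\<lambda>x. x ^ k * fF s c x)" for k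
  proof -
    note A = fF_moment_absolutely_integrable[OF adm, of k]
    have "(\<lambda>x. x ^ k * fF s c x) integrable_on {0<..real i}" "(\<lambda>x. x ^ k * fF s c x) integrable_on ?S"
      by (auto intro!: set_lebesgue_integral_eq_integral(1) absolutely_integrable_subset[OF A])
    then have "integral ({0<..real i} \<union> ?S) (\<lambda>x. x ^ k * fF s c x) = mom s c k i + integral ?S (\<lambda>x. x ^ k * fF s c x)"
      unfolding mom_def
    proof (intro integral_Un)
      have "{0<..real i} \<inter> ?S = {}" by auto
      then show "negligible ({0<..real i} \<inter> ?S)" by simp
    qed
    moreover have "{0<..real i} \<union> ?S = {0<..real (Suc i)}" by auto
    ultimately show ?thesis by (simp add: mom_def)
  qed
  have err: "\<bar>integral ?S (\<lambda>x. x ^ k * fF s c x) - J\<bar> \<le> b"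
    if J: "(g has_integral J) {real i..real i + 1}"
      and g: "\<And>x. 0 < x \<Longrightarrow> real i \<le> x \<Longrightarrow> x \<le> real i + 1 \<Longrightarrow> \<bar>x ^ k * fF s c x - g x\<bar> \<le> b" for g J b k
  proof -
    have J': "(g has_integral J) ?S"
      using J by (subst has_integral_spike_set_eq[where T = "{real i..real i + 1}"]) (auto intro: negligible_subset[of "{real i}"])
    have f: "((\<lambda>x. x ^ k * fF s c x) has_integral integral ?S (\<lambda>x. x ^ k * fF s c x)) ?S"
      by (intro integrable_integral set_lebesgue_integral_eq_integral(1)
            absolutely_integrable_subset[OF fF_moment_absolutely_integrable[OF adm, of k]]) auto
    have b: "((\<lambda>x. b) has_integral b) ?S"
    proof -
      have "((\<lambda>x. b) has_integral (measure lborel {real i..real i + 1} *\<^sub>R b)) {real i..real i + 1}" by (rule has_integral_const_real)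
      then have "((\<lambda>x. b) has_integral b) {real i..real i + 1}" by simp
      then show ?thesis
        by (subst has_integral_spike_set_eq[where T = "{real i..real i + 1}"]) (auto intro: negligible_subset[of "{real i}"])
    qed
    have "integral ?S (\<lambda>x. x ^ k * fF s c x) - J \<le> b"
      by (rule has_integral_le[OF has_integral_diff[OF f J'] b]) (use g in \<open>force simp: abs_le_iff\<close>)
    moreover have "J - integral ?S (\<lambda>x. x ^ k * fF s c x) \<le> b"
      by (rule has_integral_le[OF has_integral_diff[OF J' f] b]) (use g in \<open>force simp: abs_le_iff\<close>)
    ultimately show ?thesis by linarith
  qed
  have sh: "short ws Q" "short ws (lmul [2 * int i + 1, 1] Q)" using Q by (auto simp: weights_cover_def)
  have q0: "((\<lambda>x. lev Q (2 * (x - m)) / ?N) has_integral (of_int (lint ws Q) / (of_int L * ?N))) {real i..real i + 1}"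
    using has_integral_mult_left[OF has_integral_lev_shift[OF ws(1) sh(1) ws(2), of m], of "1 / ?N"] unfolding ends by simp
  have q1: "((\<lambda>x. x * (lev Q (2 * (x - m)) / ?N)) has_integral (of_int (lint ws (lmul [2 * int i + 1, 1] Q)) / (2 * of_int L * ?N))) {real i..real i + 1}"
  proof -
    have "((\<lambda>x. lev (lmul [2 * int i + 1, 1] Q) (2 * (x - m)) * (1 / (2 * ?N))) has_integral (of_int (lint ws (lmul [2 * int i + 1, 1] Q)) / of_int L * (1 / (2 * ?N)))) {real i..real i + 1}"
      using has_integral_mult_left[OF has_integral_lev_shift[OF ws(1) sh(2) ws(2), of m], of "1 / (2 * ?N)"] unfolding ends by simp
    moreover have "lev (lmul [2 * int i + 1, 1] Q) (2 * (x - m)) * (1 / (2 * ?N)) = x * (lev Q (2 * (x - m)) / ?N)" for x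
    proof -
      have "2 * real i + 1 + 2 * (x - m) = 2 * x" by (simp add: m_def)
      then have "lev (lmul [2 * int i + 1, 1] Q) (2 * (x - m)) = 2 * x * lev Q (2 * (x - m))"
        unfolding lev_lmul by simp
      then show ?thesis using N by simp
    qed
    ultimately show ?thesis by (simp add: mult_ac)
  qed
  show "\<bar>mom s c 0 (Suc i) - mom s c 0 i - of_int (lint ws Q) / (of_int L * ?N)\<bar> \<le> of_int e / ?N"
    unfolding step by (rule err[OF q0]) (use H in \<open>simp add: m_def\<close>)
  show "\<bar>mom s c 1 (Suc i) - mom s c 1 i - of_int (lint ws (lmul [2 * int i + 1, 1] Q)) / (2 * of_int L * ?N)\<bar> \<le> 10 * of_int e / ?N"
    unfolding step
  proof (rule err[OF q1])
    fix x assume x: "0 < x" "real i \<le> x" "x \<le> real i + 1"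
    have h: "\<bar>fF s c x - lev Q (2 * (x - m)) / ?N\<bar> \<le> of_int e / ?N" using H[OF x] by (simp add: m_def)
    have "\<bar>x ^ 1 * fF s c x - x * (lev Q (2 * (x - m)) / ?N)\<bar> = x * \<bar>fF s c x - lev Q (2 * (x - m)) / ?N\<bar>"
    proof -
      have "x ^ 1 * fF s c x - x * (lev Q (2 * (x - m)) / ?N) = x * (fF s c x - lev Q (2 * (x - m)) / ?N)"
        by (simp only: power_one_right right_diff_distrib)
      then show ?thesis using x by (simp only: abs_mult)
    qed
    also have "\<dots> \<le> 10 * (of_int e / ?N)" using h x i by (intro mult_mono) auto
    finally show "\<bar>x ^ 1 * fF s c x - x * (lev Q (2 * (x - m)) / ?N)\<bar> \<le> 10 * of_int e / ?N" by simp
  qed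
qed

lemma mom_0: "mom s c k 0 = 0"
  by (simp add: mom_def)

text \<open>Beyond 10 the weight decays at least like \<open>exp (- 9 * (x - 10))\<close>, and
  \<open>x ^ 2\<close> is at most \<open>100 * exp (x - 10)\<close>; so the integrand is below
  \<open>200 * bw 1 c 10 * exp (- 8 * (x - 10))\<close>, whose integral is the bound.\<close>

lemma moment_tail:
  assumes adm: "adm s 1 c" and c: "-1/3 \<le> c" and k: "k = 0 \<or> k = 1"
    and W: "\<And>x. 10 \<le> x \<Longrightarrow> 1/2 \<le> 1 + s * bw 1 c x"
  shows "\<bar>integral {0<..} (\<lambda>x. x ^ k * fF s c x) - mom s c k 10\<bar> \<le> 25 * bw 1 c 10"
proof -
  note A = fF_moment_absolutely_integrable[OF adm, of k]
  let ?f = "\<lambda>x. x ^ k * fF s c x"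
  have sub: "?f integrable_on {0<..10}" "?f integrable_on {10<..}"
    by (auto intro!: set_lebesgue_integral_eq_integral(1) absolutely_integrable_subset[OF A])
  have "integral ({0<..10} \<union> {10<..}) ?f = integral {0<..10} ?f + integral {10<..} ?f"
  proof (intro integral_Un sub)
    have "{0<..10} \<inter> {10<..} = ({} :: real set)" by auto
    then show "negligible ({0<..10} \<inter> {10<..} :: real set)" by simp
  qed
  moreover have "{0<..10} \<union> {10<..} = ({0<..} :: real set)" by auto
  ultimately have split: "integral {0<..} ?f - mom s c k 10 = integral {10<..} ?f" by (simp add: mom_def)
  have nonneg: "0 \<le> integral {10<..} ?f"
    using sub fF_nonneg[OF adm] by (intro integral_nonneg) auto
  have E: "((\<lambda>x. 200 * bw 1 c 10 * exp 80 * exp (- 8 * x)) has_integral (200 * bw 1 c 10 * exp 80 * (exp (- 8 * 10) / 8))) {10..}"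
    by (intro has_integral_mult_right has_integral_exp_minus_to_infinity) simp
  have val: "200 * bw 1 c 10 * exp 80 * (exp (- 8 * 10) / 8) = 25 * bw 1 c 10"
    by (simp add: exp_minus)
  have E': "((\<lambda>x. 200 * bw 1 c 10 * exp 80 * exp (- 8 * x)) has_integral (25 * bw 1 c 10)) {10<..}"
    using E unfolding val by (subst has_integral_spike_set_eq[where T = "{10..}"]) (auto intro: negligible_subset[of "{10}"])
  have "integral {10<..} ?f \<le> 25 * bw 1 c 10"
  proof (rule has_integral_le[OF integrable_integral[OF sub(2)] E'])
    fix x :: real assume "x \<in> {10<..}"
    then have x: "10 < x" by simp
    have Wx: "bw 1 c x \<le> bw 1 c 10 * exp (- 9 * (x - 10))"
    proof -
      have "(x - 10) * 10 \<le> (x - 10) * ((x + 10) / 2)" by (rule mult_left_mono) (use x in auto)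
      moreover have "- 1 * (x - 10) \<le> c * (x - 10)" by (rule mult_right_mono) (use x c in auto)
      moreover have "c * x + x\<^sup>2 / 2 = (c * 10 + 10\<^sup>2 / 2) + (c * (x - 10) + (x - 10) * ((x + 10) / 2))"
        by (simp add: power2_eq_square field_simps)
      ultimately have "- (c * x) - 1 * x\<^sup>2 / 2 \<le> (- (c * 10) - 1 * 10\<^sup>2 / 2) + - 9 * (x - 10)" by simp
      then show ?thesis unfolding bw_def by (simp only: exp_add[symmetric] exp_le_cancel_iff)
    qed
    have xx: "x ^ Suc k \<le> 100 * exp (x - 10)"
    proof -
      have "x ^ Suc k \<le> x ^ 2" using x k by (intro power_increasing) auto
      also have "\<dots> \<le> (10 * exp ((x - 10) / 10)) ^ 2"
      proof (rule power_mono)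
        have "10 * (1 + (x - 10) / 10) \<le> 10 * exp ((x - 10) / 10)" by (intro mult_left_mono exp_ge_add_one_self) auto
        moreover have "10 * (1 + (x - 10) / 10) = x" by (simp add: field_simps)
        ultimately show "x \<le> 10 * exp ((x - 10) / 10)" by (simp only:)
      qed (use x in simp)
      also have "\<dots> = 100 * exp ((x - 10) / 5)" by (simp add: power_mult_distrib exp_of_nat_mult[symmetric] exp_double[symmetric])
      also have "\<dots> \<le> 100 * exp (x - 10)" using x by simp
      finally show ?thesis .
    qed
    have "x ^ k * fF s c x = x ^ Suc k * bw 1 c x / (1 + s * bw 1 c x)" by (simp add: fF_bw)
    also have "\<dots> \<le> x ^ Suc k * bw 1 c x / (1/2)"
      using W[of x] x bw_pos[of 1 c x] by (intro divide_left_mono mult_nonneg_nonneg mult_pos_pos) auto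
    also have "\<dots> \<le> (100 * exp (x - 10)) * (bw 1 c 10 * exp (- 9 * (x - 10))) / (1/2)"
      using xx Wx x bw_pos[of 1 c x] by (intro divide_right_mono mult_mono) auto
    also have "\<dots> = 200 * bw 1 c 10 * (exp (x - 10) * exp (- 9 * (x - 10)))" by simp
    also have "exp (x - 10) * exp (- 9 * (x - 10)) = exp 80 * exp (- 8 * x)"
      unfolding exp_add[symmetric] by (simp add: algebra_simps)
    finally show "x ^ k * fF s c x \<le> 200 * bw 1 c 10 * exp 80 * exp (- 8 * x)" by (simp only: mult.assoc)
  qed
  then show ?thesis using nonneg unfolding split by simp
qed

text \<open>The polynomials \<open>P i\<close> and \<open>Q i\<close> on \<open>[i, i + 1]\<close> are rounded numerical approximations; nothing but the checks
  below is used about them. The list \<open>bose_P0\<close> plays the role of \<open>K\<close> in \<open>bose_start\<close>.\<close>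

definition wts :: "int list" where
  "wts = [5132792460157432044975, 1710930820052477348325, 1026558492031486408995, 733256065736776006425,
    570310273350825782775, 466617496377948367725, 394830189242879388075, 342186164010495469665,
    301928968244554826175, 270146971587233265525, 244418688578925335475, 223164889572062262825,
    205311698406297281799, 190103424450275260925, 176992843453704553275, 165573950327659098225,
    155539165459316122575, 146651213147355201285, 138724120544795460675, 131610063080959796025,
    125190060003839805975, 119367266515289117325, 114062054670165156555, 109208350216115575425,
    104750866533825143775, 100642989414851608725, 96845140757687397075]"

text \<open>The least common multiple of 1, 3, ..., 53; the 27 weights serve polynomials with up to
  54 coefficients.\<close>

definition Lw :: int where "Lw = 5132792460157432044975"

text \<open>Numerator over \<open>2 ^ 66\<close> of an approximate root for distinct parts, about
  -0.3237.\<close>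

definition fermi_g :: int where "fermi_g = -23884646041832913955"

definition fermi_P0 :: "int list" where
  "fermi_P0 = [321101834568392251492168237, -28305557941710148160989709, -38890142848258481335029714,
    3501535935038488616656868, 2353467654248648890555964, -216569063615374598363845,
    -94879343293750833011608, 8929429633376792606136, 2866586826181979570611, -276116765195782073052,
    -69230664288179099147, 6830178848131007734, 1392131386164697980, -140789458714574866,
    -23973004762995101, 2487374482873869, 360874111853606, -38450303430303, -4823837893283, 528305455055,
    57969431898, -6532687954, -632567853, 73431900, 6319535, -756602, -58200, 7196, 497, -64, -4, 1]"

definition fermi_Q0 :: "int list" where
  "fermi_Q0 = [78796604551133674182636725, 75387571993306245790054911, -8245862741407564772760818,
    -4842475149008300181039707, -1825873217257519123560, 17140680076310631493230, 19640624408718778365435,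
    6325465291637352891536, -27976485727958327908, -69163509471257716013, -44673031654933070646,
    -9859792033326236455, 185446092377831166, 207631948312778356, 92771398956273182, 15264621637921627,
    -733409558687044, -533966716473363, -181363450773013, -22719326692050, 2311589997564, 1248325031801,
    338961850334, 31206975353, -6376026709, -2732403941, -608952279, -35962961, 16080521, 5690065, 1050310,
    22548, -37990, -11374, -1726, 46, 85, 22, 3]"

definition fermi_P1 :: "int list" where
  "fermi_P1 = [163278221900123283057572029, -96032305485451203285404463, 7830986981530253273022800,
    6467423620510787612803965, -1440392658307149928281428, -153937405753089634293762,
    75106109416848099498261, -812772525597572985671, -2287311762720866261582, 172053179599409368156,
    47063463203957901135, -6426703089750454546, -665499312332988893, 153699237440016592, 5426886798009196,
    -2774442674553624, 17191905342569, 40205836848427, -1552505181810, -480965852868, 33550350387,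
    4786132361, -509207171, -39001835, 6260032, 242744, -65684, -817, 604, -5, -5]"

definition fermi_Q1 :: "int list" where
  "fermi_Q1 = [160330241602236459606069827, -8287181515666767680591030, -28082346869799502326637523,
    1153438348243347060936541, 2003815899257488218083684, 176432950994835158638773,
    -103497471269571132306478, -31610462867701742679419, 2071176435076182663327, 2640496917378811161360,
    313967641081885790178, -134990147895407505413, -46553476927058724791, 1544863607891362684,
    3632791386186915744, 529463738672338775, -168840516835175309, -68017965958127679, 188882256105093,
    4943660178705172, 858618457904680, -205404996870017, -98227207670839, -2502090071652, 6649829021095,
    1353907272788, -241190909903, -140297253593, -7341329773, 8833170118, 2088485948, -269205761,
    -198271384, -15547621, 11570594, 3163903, -277085, -277299, -28922, 14916, 4720, -244, -384, -50, 19, 7,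
    0, -1]"

definition fermi_P2 :: "int list" where
  "fermi_P2 = [30543531937320462458262419, -33235985296107348542488746, 14264949524989054715151381,
    -2404475886246467462350606, -237450929132826450621357, 171900303796563418022247,
    -21281802357827310941642, -2831036304717389185289, 1050130818297786584189, -48326909336353355627,
    -20994571327935080172, 3175181665390237555, 149463719889273180, -73571889528288146, 3049387172960018,
    1004985175642234, -115995172610152, -7354470062283, 2055642757084, -20959626904, -24555172155,
    1521888109, 203761293, -26182398, -935413, 302539, -3667, -2653, 136, 18, -2]"

definition fermi_Q2 :: "int list" where
  "fermi_Q2 = [69499792816725281923985501, -54933098439094045606485654, 9048604529722835889050925,
    4701042580102676586344996, -1894576264493014854461454, -108827267001455861552649,
    170331525276330713430110, -12460803669722981641924, -11837485460551543396945, 2369022784246956158334,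
    633352844378920347264, -258186627771489415261, -17921405839637271646, 22047865484512946263,
    -1264252599212731437, -1548515094531971595, 283432083713974905, 85421569486469738, -32118010451143621,
    -2734102040606224, 2805716932161709, -125861174967429, -201319737139648, 33872585179262, 11463620441773,
    -3988803427129, -405503839822, 356358157394, -11493649561, -26108996808, 4020417955, 1531416636,
    -493938662, -58842826, 45163998, -881986, -3377973, 473487, 203736, -60978, -8397, 5712, -38, -436, 55,
    27, -8, -1, 1]"

definition fermi_P3 :: "int list" where
  "fermi_P3 = [2101917990589909983912664, -3338163879531352302887708, 2388014975312856946923136,
    -985996073383639587809327, 242226811065472250686946, -27638763389363497060014, -2777027262000745767948,
    1617147203271859782037, -234252210890983925283, -3584315277984478999, 6425548784504213788,
    -846242282892813546, -21868864840554640, 18945510599121277, -1758651563626880, -129558187148054,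
    40338806238524, -1863210736106, -395868940382, 57605393333, 374057616, -714067068, 47296917, 4495744,
    -790173, 5239, 7278, -477, -38, 6]"

definition fermi_Q3 :: "int list" where
  "fermi_Q3 = [7307085701101805749882887, -10482604652418964236301216, 6475541270817818816935066,
    -2068916396477325461635331, 241756392673262613175381, 71948313339903248501692, -36907936662110168690128,
    6112304027275138688263, 310942196780663507696, -383435082615205283304, 85972291583529299835,
    -4791024584197226208, -2825313536765286275, 1021141453445112467, -145462138369877352,
    -10580915997143174, 10270989102801974, -2317176926907310, 127078107383687, 80323334404184,
    -28490660505597, 3881247424458, 343196367003, -288220917007, 62717829056, -3003491602, -2294042142,
    784572323, -102830998, -10624315, 8061569, -1701761, 69431, 65549, -21600, 2713, 325, -225, 46, -2, -2,
    1]"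

definition fermi_P4 :: "int list" where
  "fermi_P4 = [53213006514829640033657, -111116811016480796450835, 109362733259977170487388, -66862245190551808325540,
    28069450943118683673457, -8379540077034839522117, 1746730854900798499857, -221793337311276155364,
    3306917679906871241, 5393665525943132537, -1208951933141138629, 106914383751626111, 6582047439449113,
    -3113300549074550, 346823633050175, 3606993476484, -5889866033405, 670422546961, 4029042587,
    -9264151970, 916884537, 19116396, -12233594, 902891, 48876, -13111, 583, 76, -11]"

definition fermi_Q4 :: "int list" where
  "fermi_Q4 = [239417363776128564125058, -473251815285353721299789, 436244367881002094141366,
    -245780891230734316679692, 92499144464924667037301, -23405465383841951695360, 3521992881097381214314,
    -58229500435557868231, -120164951154553735860, 32985620582241687343, -4347815891127333685,
    129562391004103173, 69601585644751011, -17528800140247124, 2726822081371243, -363842154009090,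
    35009491481580, 2415716313490, -2137825880403, 522785213455, -70820596322, 3076522945, 1065387596,
    -335036983, 59042068, -7316604, 431434, 96921, -42103, 8902, -1161, 51, 19, -6, 1]"

definition fermi_P5 :: "int list" where
  "fermi_P5 = [495593206931722071862, -1282670224078464814585, 1597923180640455926626, -1271666489963294862569,
    722946134656514803576, -310635477360548490961, 103872515705876805967, -27311274525697275118,
    5589697864369771044, -848796155882548475, 79938844464788108, 482291937729639, -1769412970210596,
    342995043896591, -31812131495311, -227610008158, 533882626382, -77933325554, 3790699144, 509075174,
    -113261919, 7898581, 357853, -126123, 9873, 239, -119, 9]"

definition fermi_Q5 :: "int list" where
  "fermi_Q5 = [2725758273236864289683, -6806867431812305775933, 8147187050179600031843, -6195114072597452950832,
    3340263069034506399720, -1346921957932672427114, 415905368856237408113, -98228017388829193358,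
    17062179457515113148, -1861812420895367068, 10608334770081539, 44231458340803405, -9974432112827881,
    1127717673025073, -31524289391142, -11954596589076, 2071025297839, -95181763087, -15079662396,
    1980583240, 266939256, -105014154, 13004531, -119377, -237043, 44875, -3866, -41, 59, -7]"

definition fermi_P6 :: "int list" where
  "fermi_P6 = [1698002834152701488, -5243689732625789175, 7884403390648153780, -7679102828684255879,
    5435782716352366378, -2973348797666079604, 1303867567248427658, -469029025630557186, 140308215446574166,
    -35115083061218354, 7336363705174594, -1261548242110745, 171813414315000, -16553751202033, 583366816194,
    155794185576, -39184857966, 4827072080, -283917480, -17367783, 6230686, -709493, 28789, 3847, -795, 60,
    1, -1]"

definition fermi_Q6 :: "int list" where
  "fermi_Q6 = [11037018361437483132, -33234981475642880837, 48626776061819991968, -45971964494452890329,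
    31493033032937354750, -16608872134428705718, 6988461305657459130, -2396752115496349476,
    677486998064965208, -158092807388430168, 30128232236717854, -4531606216881496, 485897974744163,
    -21649419861209, -4499666587386, 1308849768520, -178055946373, 12097999124, 496841904, -240397328,
    29220243, -1093049, -219276, 44135, -3344, -83, 53, -7]"

definition fermi_P7 :: "int list" where
  "fermi_P7 = [2140212985631149, -7679408098596754, 13509912617826169, -15518586359391497, 13076389582929540,
    -8608083650622125, 4603001585915786, -2052035058494373, 776532744305402, -252589804966935,
    71219726183186, -17490882264289, 3746250095020, -697645518724, 111906798654, -15141810013, 1647150392,
    -124986611, 2037960, 1259692, -251473, 27971, -1704, -38, 23, -3]"

definition fermi_Q7 :: "int list" where
  "fermi_Q7 = [16051597392122618, -56525454245870890, 97484640581620455, -109634441380073663, 90313628681162759,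
    -58022432573050085, 30218470052038862, -13088762129557215, 4797978039726513, -1506157155487749,
    407853037729234, -95571750349565, 19351432741823, -3359215474913, 490477856080, -57610027516,
    4782668880, -113806188, -47214277, 10468306, -1256638, 84158, 1177, -1133, 156, -10]"

definition fermi_P8 :: "int list" where
  "fermi_P8 = [992387069429, -4057028530614, 8168824934234, -10793711830860, 10521030320803, -8062627255504,
    5055163810352, -2664373986609, 1203571642362, -472698836601, 163157147307, -49894218339, 13598819073,
    -3316959683, 725752029, -142516281, 25074382, -3934047, 545244, -65554, 6584, -501, 18, 2, -1]"

definition fermi_Q8 :: "int list" where
  "fermi_Q8 = [8435290090144, -33988548975502, 67406497675680, -87662138095186, 84031901811391, -63271816511375,
    38937578760232, -20119596980986, 8898171966760, -3416154289918, 1150486333804, -342522282221,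
    90642852951, -21394747763, 4510412408, -848512372, 141874109, -20902209, 2667547, -284587, 23189, -970,
    -95, 28, -4]"

definition fermi_P9 :: "int list" where
  "fermi_P9 = [169281975, -776691321, 1760628416, -2627952267, 2904321405, -2533695617, 1816483100, -1100125067,
    574177441, -262153526, 105925569, -38224015, 12408014, -3644142, 972705, -236792, 52704, -10742, 2006,
    -343, 54, -8, 1]"

definition fermi_Q9 :: "int list" where
  "fermi_Q9 = [1608178762, -7293926558, 16337624291, -24085232328, 26277077211, -22617947662, 15989741638, -9542946587,
    4904623157, -2203369773, 875216143, -310165354, 98764129, -28415340, 7418627, -1763173, 382291, -75698,
    13687, -2256, 338, -46, 6, -1]"

text \<open>Numerator over \<open>2 ^ 66\<close> of an approximate root for all partitions, about
  0.7650.\<close>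

definition bose_g :: int where "bose_g = 56446774352116299690"

definition bose_P0 :: "int list" where
  "bose_P0 = [246350212195494923441786840, -10668846823699527164326784, -17287699422127712635245813,
    3541740897710597761727308, 379116821292332828106267, -187806001593776726201548, 4269637777966549042659,
    5481607751079587471732, -517052063212874152320, -102712828296744538270, 17798955240548475101,
    1169144444500353110, -399879531595873146, -2319207654860114, 6753047575904960, -236694979251364,
    -90182608621395, 6515628838841, 964294097203, -112414781712, -8024862572, 1510959329, 44947184,
    -16931197, -14499, 163064, -3738, -1370, 62, 10, -1]"

definition bose_Q0 :: "int list" where
  "bose_Q0 = [234057530821018333546689230, -137904492110510759954353943, 28013372795254310556684970,
    -3194915454080413444358069, 987067113470531966382560, -313710190843074925906576,
    64601771076035837845640, -16078138484358239329923, 4348469961796945853660, -1003977097636363590768,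
    245961069525565950657, -62941075553921702053, 15146992255941213933, -3713765412280245344,
    929104953696125934, -226970026043016813, 55753473915715180, -13818856274036584, 3393966433657441,
    -834786869845438, 206126412595579, -50721430244343, 12484575256329, -3078042104130, 757905630908,
    -186618790370, 45982869184, -11324801189, 2788981770, -687044084, 169218911, -41677156, 10265914,
    -2528545, 622780, -153398, 37783, -9306, 2292, -565, 139, -34, 8, -2, 1]"

definition bose_P1 :: "int list" where
  "bose_P1 = [31893907178165537498559209, -36119793144469481269492006, 16466062344753420165973390,
    -3205946009497487885350994, -121446858340574734437440, 187804970681617351764700,
    -30387846772165838230060, -1791008608094079874603, 1203159469469253042710, -101647089655320122602,
    -18567471914862828629, 4221763757134078456, -11605997192583146, -80176705239105078, 6692962525591438,
    830960543692587, -163393873060441, -1335109725709, 2353359869695, -122705180774, -22468828424,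
    2672485877, 117755527, -34846930, 417717, 329547, -18371, -2281, 256, 10, -3]"

definition bose_Q1 :: "int list" where
  "bose_Q1 = [53337549811333015114681043, -49565709602940931826610110, 17015295105459741120741376,
    -1952609139521405718095000, -177761569380054612645376, 14938195847898432932381, 17118505437344840539194,
    -1775324187857781571684, -467345184092136274518, 1313540660417749499, 27902720925128114438,
    -142773132187157753, -924082541861307523, -78006955232276997, 40589828130267968, 4161818144052065,
    -1289708884202238, -263458749976018, 44681289850224, 12252015598878, -1100896468769, -578786452596,
    20113333030, 24184064771, 463961296, -985936283, -65152356, 36841712, 4565738, -1299101, -249730, 40697,
    12318, -1072, -557, 16, 24, 0, -1]"

definition bose_P2 :: "int list" where
  "bose_P2 = [2008561012934414972314346, -3278972280666131325094582, 2425388081060238674351590,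
    -1046566219245970769149125, 275542617739741096263478, -37636255699366174545307, -1240755659226397146639,
    1633513618771106043109, -294564895255602905880, 8055362535802060262, 6049085880356789894,
    -1080814779377698832, 21013061218872597, 18146146906454928, -2491201275003343, -31310338444643,
    42119649410312, -3584274595659, -259921691727, 69494228858, -2423439103, -638918914, 74949717, 1624976,
    -891258, 41949, 5936, -747, -9, 7]"

definition bose_Q2 :: "int list" where
  "bose_Q2 = [5054204372593353498934214, -7294037522344729772529390, 4570535760759740656871414,
    -1536370859265441791949277, 248447901500316384241072, 6485554487759393351737, -9974941508261090817743,
    917941519213921260845, 318988599809647880970, -77181053983169301923, -3877506562442455516,
    3439057318051610119, -209774993225467842, -112304696251850761, 20118131358972704, 2180582566885603,
    -1005278183061226, 23630420923391, 36123515282897, -4798921766293, -872434116657, 278855998024,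
    3518342867, -11126155427, 1065016742, 313986513, -74918991, -4024835, 3321861, -203004, -106151, 19268,
    2014, -960, 26, 34, -5, -1]"

definition bose_P3 :: "int list" where
  "bose_P3 = [46533728252318386606199, -99233092721070517853404, 99990480821400677351294, -62807083100759939432193,
    27234593195499561587505, -8475190153535634621018, 1877446604560193808353, -269264858017944268387,
    13105647449833876838, 4374271625647814829, -1260453832293461366, 144940695343878304, 502306923481933,
    -2869718650520076, 428149513323943, -13039894194343, -4951864197356, 812930302398, -27533687469,
    -7606159792, 1155177205, -26755876, -10533520, 1267464, -2895, -12428, 1047, 32, -12, 1]"

definition bose_Q3 :: "int list" where
  "bose_Q3 = [162892541175163490849470, -324149928891551485480834, 300551890723749504778890,
    -170089279643777115500595, 64158940806325928294848, -16217812965585078455152, 2430593925922040293470,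
    -48056985154865364024, -72265564718584438708, 16890809368543610964, -1040928684856598620,
    -329079982586802489, 93332787717584566, -7608383946592389, -1251414198221268, 437288678615361,
    -45769892045489, -3373054193545, 1869706765872, -262939645802, -1028245227, 7532005972, -1433960503,
    64728289, 28284426, -7294601, 596407, 92582, -34505, 3968, 214, -152, 23, 0, -1]"

definition bose_P4 :: "int list" where
  "bose_P4 = [396603176397476262403, -1044057156364739528709, 1324663906399528342663, -1075387029371211706207,
    624947116314154159438, -275265082932127635594, 94733010347029886219, -25795458641248556547,
    5527905799976739689, -900370836083873024, 98824817436274019, -3187586098589622, -1359574135400122,
    336613309045836, -39017171673222, 1237287184147, 406071037937, -81076651827, 6217576790, 205337006,
    -104747175, 10686310, -88404, -106037, 12552, -261, -94, 12]"

definition bose_Q4 :: "int list" where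
  "bose_Q4 = [1784716580892194204787, -4499967402919747857424, 5438988790404177263543, -4176958842630615941065,
    2274628035038206286181, -926275627302731629004, 288709281468078209933, -68740787603764240783,
    11992928487784874624, -1294766432704422371, -2617113807070045, 34060506271805852, -7402021695826853,
    752236588757562, 11715616398983, -17598859575560, 3006030354014, -219045197144, -12547812251,
    5636622263, -787566931, 58842131, 263908, -968048, 214696, -31012, 2480, 147, -87, 15, -1]"

definition bose_P5 :: "int list" where
  "bose_P5 = [1243512184598338926, -3895299706219928658, 5945570677195309421, -5883554881140038356,
    4235958132462641592, -2359648518895353305, 1055434209139855311, -388033378990974384, 118956914643389808,
    -30624886529438966, 6619317391522748, -1188979847431348, 172470659097421, -18693774689511,
    1102896513352, 81241487080, -33138308881, 4911489521, -394480831, 412533, 4866397, -730815, 48758, 1303,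
    -678, 72, -2]"

definition bose_Q5 :: "int list" where
  "bose_Q5 = [6839317042771271243, -20802392461576872701, 30752989388248275638, -29386767542477137010,
    20355993819519911051, -10860089573601276223, 4625065598673058923, -1606467856378501402,
    460247294683943032, -108958994903727602, 21094109623226075, -3229876206154392, 354160630819134,
    -16604124035712, -3272765791675, 995711811974, -140911953023, 10256802761, 329617788, -204062462,
    28661375, -1860638, -59806, 27659, -2887, 91, 12, -1]"

definition bose_P6 :: "int list" where
  "bose_P6 = [1434331116370798, -5210205228742349, 9283739223043511, -10806871635348498, 9233751796432101,
    -6167973813229731, 3349452659247612, -1517841053314485, 584523970165735, -193758002056886,
    55769460526180, -14012996876459, 3079985091253, -591137780461, 98379333083, -13971887154, 1634876373,
    -143865513, 6326229, 683493, -203217, 27015, -2151, 46, 15, -3]"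

definition bose_Q6 :: "int list" where
  "bose_Q6 = [9323152256453398, -33149168428950455, 57739202336516980, -65602796020839512, 54615950863659678,
    -35474953894020022, 18687455385591812, -8191240523756733, 3040485285113391, -967165032449348,
    265622495095359, -63199751008913, 13013405484197, -2302403424506, 343896948684, -41627669856,
    3640778735, -117696512, -30809457, 7604991, -978940, 73931, -462, -779, 124, -10]"

definition bose_P7 :: "int list" where
  "bose_P7 = [608631342349, -2515167939589, 5120884600316, -6844418172190, 6751081192808, -5237545295401,
    3326062719697, -1776508849814, 813737997721, -324293735067, 113670878386, -35333751724, 9799912212,
    -2435744758, 543980916, -109270932, 19722919, -3187482, 457863, -57645, 6188, -531, 30]"

definition bose_Q7 :: "int list" where
  "bose_Q7 = [4564735067621, -18559443875742, 37149050532575, -48772693991268, 47210899859969, -35906049119103,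
    22326697750028, -11660785013758, 5214780558006, -2025334014145, 690384720365, -208167698735,
    55832465731, -13368129579, 2861984493, -547541532, 93286426, -14044656, 1840232, -203403, 17584, -892,
    -44, 18, -3]"

definition bose_P8 :: "int list" where
  "bose_P8 = [95008995, -440129001, 1007572282, -1519181518, 1696428152, -1495781003, 1084182633, -664075553,
    350660395, -162046085, 66301310, -24239016, 7975989, -2376077, 643798, -159225, 36041, -7480, 1424,
    -249, 40, -6, 1]"

definition bose_Q8 :: "int list" where
  "bose_Q8 = [807576458, -3693592008, 8344299895, -12409256759, 13660048532, -11865924452, 8467661880, -5102550881,
    2648575579, -1202061527, 482538095, -172880984, 55676402, -16208661, 4284247, -1031513, 226738, -45557,
    8368, -1403, 214, -30, 4]"

definition bose_P9 :: "int list" where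
  "bose_P9 = [5456, -28003, 71181, -119446, 148815, -146786, 119363, -82276, 49055, -25690, 11959, -4996, 1888, -649,
    204, -59, 16, -4, 1]"

definition bose_Q9 :: "int list" where
  "bose_Q9 = [51833, -263303, 662222, -1099146, 1354022, -1320064, 1060555, -721942, 424886, -219524, 100764, -41483,
    15435, -5224, 1616, -459, 120, -29, 7, -1]"

section \<open>Evaluation of the certificates\<close>

lemma weights_ok_wts: "weights_ok Lw 1 wts" by code_simp

lemma Lw_pos: "Lw > 0" by (simp add: Lw_def)

text \<open>The chain starts from the exact value 1 at \<open>x = 0\<close>, with error 0. From one
  interval to the next the bound for the weight is raised by 400 units of \<open>1 / S0\<close>,
  since each interval inherits the error at its left end; 150000 units, about
  \<open>5 / 10 ^ 22\<close>, suffice for every approximation of \<open>fF\<close>.\<close>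

lemma fermi_check0: "wcheck fermi_g 0 [S0] 0 fermi_P0 800 \<and> hcheck 1 0 fermi_P0 800 fermi_Q0 150000 \<and> weights_cover wts fermi_Q0 0" by code_simp

lemma fermi_check1: "wcheck fermi_g 1 fermi_P0 800 fermi_P1 1200 \<and> hcheck 1 1 fermi_P1 1200 fermi_Q1 150000 \<and> weights_cover wts fermi_Q1 1" by code_simp

lemma fermi_check2: "wcheck fermi_g 2 fermi_P1 1200 fermi_P2 1600 \<and> hcheck 1 2 fermi_P2 1600 fermi_Q2 150000 \<and> weights_cover wts fermi_Q2 2" by code_simp

lemma fermi_check3: "wcheck fermi_g 3 fermi_P2 1600 fermi_P3 2000 \<and> hcheck 1 3 fermi_P3 2000 fermi_Q3 150000 \<and> weights_cover wts fermi_Q3 3" by code_simp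

lemma fermi_check4: "wcheck fermi_g 4 fermi_P3 2000 fermi_P4 2400 \<and> hcheck 1 4 fermi_P4 2400 fermi_Q4 150000 \<and> weights_cover wts fermi_Q4 4" by code_simp

lemma fermi_check5: "wcheck fermi_g 5 fermi_P4 2400 fermi_P5 2800 \<and> hcheck 1 5 fermi_P5 2800 fermi_Q5 150000 \<and> weights_cover wts fermi_Q5 5" by code_simp

lemma fermi_check6: "wcheck fermi_g 6 fermi_P5 2800 fermi_P6 3200 \<and> hcheck 1 6 fermi_P6 3200 fermi_Q6 150000 \<and> weights_cover wts fermi_Q6 6" by code_simp

lemma fermi_check7: "wcheck fermi_g 7 fermi_P6 3200 fermi_P7 3600 \<and> hcheck 1 7 fermi_P7 3600 fermi_Q7 150000 \<and> weights_cover wts fermi_Q7 7" by code_simp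

lemma fermi_check8: "wcheck fermi_g 8 fermi_P7 3600 fermi_P8 4000 \<and> hcheck 1 8 fermi_P8 4000 fermi_Q8 150000 \<and> weights_cover wts fermi_Q8 8" by code_simp

lemma fermi_check9: "wcheck fermi_g 9 fermi_P8 4000 fermi_P9 4400 \<and> hcheck 1 9 fermi_P9 4400 fermi_Q9 150000 \<and> weights_cover wts fermi_Q9 9" by code_simp

text \<open>The approximate zeroth moment is 1 up to \<open>1 / 10 ^ 20\<close>, so
  \<open>fermi_g\<close> nearly solves the equation; the approximate first moment is located up to
  \<open>1 / 10 ^ 22\<close>; and the weight at 10 is at most \<open>1 / (2 * 10 ^ 20)\<close>,
  which controls the tail.\<close>

lemma fermi_sums: "10 ^ 20 * \<bar>(lint wts fermi_Q0 + lint wts fermi_Q1 + lint wts fermi_Q2 + lint wts fermi_Q3 + lint wts fermi_Q4 + lint wts fermi_Q5 + lint wts fermi_Q6 + lint wts fermi_Q7 + lint wts fermi_Q8 + lint wts fermi_Q9) - Lw * S0\<bar> \<le> Lw * S0 \<and>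
  \<bar>10 ^ 22 * (lint wts (lmul [1, 1] fermi_Q0) + lint wts (lmul [3, 1] fermi_Q1) + lint wts (lmul [5, 1] fermi_Q2) + lint wts (lmul [7, 1] fermi_Q3) + lint wts (lmul [9, 1] fermi_Q4) + lint wts (lmul [11, 1] fermi_Q5) + lint wts (lmul [13, 1] fermi_Q6) + lint wts (lmul [15, 1] fermi_Q7) + lint wts (lmul [17, 1] fermi_Q8) + lint wts (lmul [19, 1] fermi_Q9)) - 15531244499102627610667 * (2 * Lw * S0)\<bar> \<le> 2 * Lw * S0 \<and> 2 * 10 ^ 20 * (lsum fermi_P9 + 4400) \<le> S0" by code_simp

text \<open>Rounded value of the weight at 1 in units of \<open>1 / S0\<close>, from which the chain
  of the remaining Bose intervals starts.\<close>

definition bose_a :: int where "bose_a = 87349142101296217892573229"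

lemma bose_check0: "bose_start_check bose_g bose_P0 bose_Q0 bose_a 800 150000 \<and> weights_cover wts bose_Q0 0" by code_simp

lemma bose_check1: "wcheck bose_g 1 [bose_a] 800 bose_P1 1200 \<and> hcheck (-1) 1 bose_P1 1200 bose_Q1 150000 \<and> weights_cover wts bose_Q1 1" by code_simp

lemma bose_check2: "wcheck bose_g 2 bose_P1 1200 bose_P2 1600 \<and> hcheck (-1) 2 bose_P2 1600 bose_Q2 150000 \<and> weights_cover wts bose_Q2 2" by code_simp

lemma bose_check3: "wcheck bose_g 3 bose_P2 1600 bose_P3 2000 \<and> hcheck (-1) 3 bose_P3 2000 bose_Q3 150000 \<and> weights_cover wts bose_Q3 3" by code_simp

lemma bose_check4: "wcheck bose_g 4 bose_P3 2000 bose_P4 2400 \<and> hcheck (-1) 4 bose_P4 2400 bose_Q4 150000 \<and> weights_cover wts bose_Q4 4" by code_simp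

lemma bose_check5: "wcheck bose_g 5 bose_P4 2400 bose_P5 2800 \<and> hcheck (-1) 5 bose_P5 2800 bose_Q5 150000 \<and> weights_cover wts bose_Q5 5" by code_simp

lemma bose_check6: "wcheck bose_g 6 bose_P5 2800 bose_P6 3200 \<and> hcheck (-1) 6 bose_P6 3200 bose_Q6 150000 \<and> weights_cover wts bose_Q6 6" by code_simp

lemma bose_check7: "wcheck bose_g 7 bose_P6 3200 bose_P7 3600 \<and> hcheck (-1) 7 bose_P7 3600 bose_Q7 150000 \<and> weights_cover wts bose_Q7 7" by code_simp

lemma bose_check8: "wcheck bose_g 8 bose_P7 3600 bose_P8 4000 \<and> hcheck (-1) 8 bose_P8 4000 bose_Q8 150000 \<and> weights_cover wts bose_Q8 8" by code_simp

lemma bose_check9: "wcheck bose_g 9 bose_P8 4000 bose_P9 4400 \<and> hcheck (-1) 9 bose_P9 4400 bose_Q9 150000 \<and> weights_cover wts bose_Q9 9" by code_simp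

lemma bose_sums: "10 ^ 20 * \<bar>(lint wts bose_Q0 + lint wts bose_Q1 + lint wts bose_Q2 + lint wts bose_Q3 + lint wts bose_Q4 + lint wts bose_Q5 + lint wts bose_Q6 + lint wts bose_Q7 + lint wts bose_Q8 + lint wts bose_Q9) - Lw * S0\<bar> \<le> Lw * S0 \<and>
  \<bar>10 ^ 22 * (lint wts (lmul [1, 1] bose_Q0) + lint wts (lmul [3, 1] bose_Q1) + lint wts (lmul [5, 1] bose_Q2) + lint wts (lmul [7, 1] bose_Q3) + lint wts (lmul [9, 1] bose_Q4) + lint wts (lmul [11, 1] bose_Q5) + lint wts (lmul [13, 1] bose_Q6) + lint wts (lmul [15, 1] bose_Q7) + lint wts (lmul [17, 1] bose_Q8) + lint wts (lmul [19, 1] bose_Q9)) - 6287591210986969278900 * (2 * Lw * S0)\<bar> \<le> 2 * Lw * S0 \<and> 2 * 10 ^ 20 * (lsum bose_P9 + 4400) \<le> S0" by code_simp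

text \<open>Common to both signs. The first interval enters only through \<open>start\<close> and
  \<open>H0\<close>, because the Bose case treats it differently; the other nine follow from the
  chain of checks.\<close>

lemma moments_certificate:
  fixes s g v L :: int and P Q :: "nat \<Rightarrow> int list" and w :: "nat \<Rightarrow> int"
  defines "c \<equiv> of_int g / 2 ^ 66"
  assumes s: "s = 1 \<or> s = -1" and adm: "adm (of_int s) 1 c" and c: "-1/3 \<le> c" "s = -1 \<longrightarrow> 3/4 \<le> c"
    and ws: "weights_ok L 1 ws" "L > 0"
    and start: "\<bar>bw 1 c 1 - of_int (lsum (P 0)) / of_int S0\<bar> \<le> of_int (w 0) / of_int S0"
    and H0: "\<And>x. 0 < x \<Longrightarrow> x \<le> 1 \<Longrightarrow>
      \<bar>fF (of_int s) c x - lev (Q 0) (2 * (x - 1/2)) / of_int S0\<bar> \<le> of_int 150000 / of_int S0"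
    and p0: "weights_cover ws (Q 0) 0"
    and step: "\<And>i. i < 9 \<Longrightarrow> wcheck g (int (Suc i)) (P i) (w i) (P (Suc i)) (w (Suc i)) \<and>
      hcheck s (int (Suc i)) (P (Suc i)) (w (Suc i)) (Q (Suc i)) 150000 \<and> weights_cover ws (Q (Suc i)) (int (Suc i))"
    and sums: "10 ^ 20 * \<bar>(\<Sum>i<10. lint ws (Q i)) - L * S0\<bar> \<le> L * S0"
      "\<bar>10 ^ 22 * (\<Sum>i<10. lint ws (lmul [2 * int i + 1, 1] (Q i))) - v * (2 * L * S0)\<bar> \<le> 2 * L * S0"
      "2 * 10 ^ 20 * (lsum (P 9) + w 9) \<le> S0"
  shows "\<bar>Fint {0<..} (of_int s) c - 1\<bar> \<le> 15 / 10 ^ 20"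
    and "\<bar>integral {0<..} (\<lambda>x. x ^ 1 * fF (of_int s) c x) - of_int v / 10 ^ 22\<bar> \<le> 4 / 10 ^ 19"
proof -
  let ?N = "of_int S0 :: real" and ?L = "of_int L :: real" and ?s = "of_int s :: real"
  have N: "?N > 0" and L: "?L > 0" using S0_pos ws(2) by auto
  have W: "\<bar>bw 1 c (real (Suc j)) - of_int (lsum (P j)) / ?N\<bar> \<le> of_int (w j) / ?N" if "j \<le> 9" for j
    using that
  proof (induction j)
    case (Suc j)
    then have j: "j < 9" and IH: "\<bar>bw 1 c (real (Suc j)) - of_int (lsum (P j)) / ?N\<bar> \<le> of_int (w j) / ?N" by auto
    show ?case
      using wcheck_end[OF c(1)[unfolded c_def] conjunct1[OF step[OF j]] IH[unfolded c_def]] by (simp only: c_def)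
  qed (use start in simp)
  \<comment> \<open>Away from 0 the Bose denominator is safe: for \<open>x \<ge> 1\<close> the
    exponent of the weight is at most -5/4.\<close>
  have half: "1/2 \<le> 1 + ?s * bw 1 c x" if x: "1 \<le> x" for x
  proof (cases "s = 1")
    case True
    then show ?thesis using bw_pos[of 1 c x] by simp
  next
    case False
    then have s: "s = -1" using s by simp
    have "3/4 * 1 \<le> c * x" using c s x by (intro mult_mono) auto
    moreover have "1 \<le> x\<^sup>2" using x by (simp add: one_le_power)
    ultimately have "bw 1 c x \<le> exp (- (5/4))" by (simp add: bw_def)
    also have "\<dots> \<le> 1 / 2"
    proof -
      have "1 + 5/4 \<le> exp (5/4 :: real)" by (rule exp_ge_add_one_self)
      then have "2 \<le> exp (5/4 :: real)" by simp
      then show ?thesis by (simp add: exp_minus inverse_eq_divide pos_divide_le_eq)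
    qed
    finally show ?thesis using s by simp
  qed
  have piece: "\<bar>mom ?s c 0 (Suc i) - mom ?s c 0 i - of_int (lint ws (Q i)) / (?L * ?N)\<bar> \<le> of_int 150000 / ?N"
    "\<bar>mom ?s c 1 (Suc i) - mom ?s c 1 i - of_int (lint ws (lmul [2 * int i + 1, 1] (Q i))) / (2 * ?L * ?N)\<bar> \<le> 10 * of_int 150000 / ?N"
    if i: "i < 10" for i
  proof -
    have H: "\<bar>fF ?s c x - lev (Q i) (2 * (x - (real i + 1/2))) / ?N\<bar> \<le> of_int 150000 / ?N"
      if x: "0 < x" "real i \<le> x" "x \<le> real i + 1" for x
    proof (cases i)
      case 0
      then show ?thesis using H0[of x] x by simp
    next
      case (Suc j)
      then have j: "j < 9" and jj: "j \<le> 9" using i by auto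
      have xx: "real (Suc j) \<le> x" "x \<le> real (Suc j) + 1" using x Suc by simp_all
      have x1: "1 \<le> x" using xx(1) by simp
      have w': "\<bar>bw 1 c x - lev (P (Suc j)) (2 * (x - (real (Suc j) + 1/2))) / ?N\<bar> \<le> of_int (w (Suc j)) / ?N"
        using wcheck_step[OF c(1)[unfolded c_def] conjunct1[OF step[OF j]] W[OF jj, unfolded c_def] xx] by (simp only: c_def)
      show ?thesis
        unfolding Suc using hcheck_step[OF s conjunct1[OF conjunct2[OF step[OF j]]] w' half[OF x1] xx] i Suc by simp
    qed
    have pc: "weights_cover ws (Q i) (int i)" using p0 step i by (cases i) auto
    show "\<bar>mom ?s c 0 (Suc i) - mom ?s c 0 i - of_int (lint ws (Q i)) / (?L * ?N)\<bar> \<le> of_int 150000 / ?N"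
      "\<bar>mom ?s c 1 (Suc i) - mom ?s c 1 i - of_int (lint ws (lmul [2 * int i + 1, 1] (Q i))) / (2 * ?L * ?N)\<bar> \<le> 10 * of_int 150000 / ?N"
      using piece_moments[OF adm ws pc i H] by blast+
  qed
  have total: "\<bar>mom ?s c k 10 - (\<Sum>i<10. a i) / d\<bar> \<le> 10 * b"
    if "\<And>i. i < 10 \<Longrightarrow> \<bar>mom ?s c k (Suc i) - mom ?s c k i - a i / d\<bar> \<le> b" for k a b and d :: real
  proof -
    have "mom ?s c k 10 - (\<Sum>i<10. a i) / d = (\<Sum>i<10. mom ?s c k (Suc i) - mom ?s c k i - a i / d)"
      using sum_lessThan_telescope[of "mom ?s c k" 10]
      by (simp only: sum_subtractf[of _ "\<lambda>i. a i / d"] sum_divide_distrib mom_0 diff_0_right)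
    also have "\<bar>\<dots>\<bar> \<le> (\<Sum>i<10. \<bar>mom ?s c k (Suc i) - mom ?s c k i - a i / d\<bar>)" by (rule sum_abs)
    also have "\<dots> \<le> (\<Sum>i<(10::nat). b)" by (intro sum_mono that) auto
    finally show ?thesis by simp
  qed
  have b10: "bw 1 c 10 \<le> 1 / (2 * 10 ^ 20)"
  proof -
    have "bw 1 c 10 \<le> of_int (lsum (P 9)) / ?N + of_int (w 9) / ?N" using W[of 9] by simp
    also have "\<dots> = of_int (lsum (P 9) + w 9) / ?N" by (simp add: add_divide_distrib)
    also have "\<dots> \<le> 1 / (2 * 10 ^ 20)"
    proof -
      have "of_int (2 * 10 ^ 20 * (lsum (P 9) + w 9)) \<le> ?N" using sums(3) by (simp only: of_int_le_iff)
      then show ?thesis using N by (simp add: field_simps)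
    qed
    finally show ?thesis .
  qed
  have tail: "\<bar>integral {0<..} (\<lambda>x. x ^ k * fF ?s c x) - mom ?s c k 10\<bar> \<le> 25 * (1 / (2 * 10 ^ 20))" if "k = 0 \<or> k = 1" for k
  proof -
    have "\<bar>integral {0<..} (\<lambda>x. x ^ k * fF ?s c x) - mom ?s c k 10\<bar> \<le> 25 * bw 1 c 10"
      by (rule moment_tail[OF adm c(1) that half]) simp
    also have "\<dots> \<le> 25 * (1 / (2 * 10 ^ 20))" using b10 by (rule mult_left_mono) simp
    finally show ?thesis .
  qed
  define A where "A = (\<Sum>i<10. lint ws (Q i))"
  define A' where "A' = (\<Sum>i<10. lint ws (lmul [2 * int i + 1, 1] (Q i)))"
  have t0: "\<bar>mom ?s c 0 10 - of_int A / (?L * ?N)\<bar> \<le> 10 * (of_int 150000 / ?N)"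
    using total[OF piece(1)] by (simp add: A_def)
  have t1: "\<bar>mom ?s c 1 10 - of_int A' / (2 * ?L * ?N)\<bar> \<le> 10 * (10 * of_int 150000 / ?N)"
    using total[OF piece(2)] by (simp add: A'_def)
  have s0: "\<bar>of_int A / (?L * ?N) - 1\<bar> \<le> 1 / 10 ^ 20"
  proof -
    have LN: "?L * ?N > 0" using L N by simp
    have "real_of_int (10 ^ 20 * \<bar>A - L * S0\<bar>) \<le> of_int (L * S0)" using sums(1) by (simp only: of_int_le_iff A_def)
    then have "10 ^ 20 * \<bar>of_int A - ?L * ?N\<bar> \<le> ?L * ?N" by simp
    moreover have "\<bar>of_int A / (?L * ?N) - 1\<bar> = \<bar>of_int A - ?L * ?N\<bar> / (?L * ?N)"
    proof -
      have "of_int A / (?L * ?N) - 1 = (of_int A - ?L * ?N) / (?L * ?N)" using L N by (simp add: diff_divide_distrib)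
      then show ?thesis using LN by simp
    qed
    ultimately show ?thesis using LN by (simp add: pos_divide_le_eq)
  qed
  have s1: "\<bar>of_int A' / (2 * ?L * ?N) - of_int v / 10 ^ 22\<bar> \<le> 1 / 10 ^ 22"
  proof -
    define D where "D = 2 * ?L * ?N"
    have D: "D > 0" using L N by (simp add: D_def)
    have "real_of_int \<bar>10 ^ 22 * A' - v * (2 * L * S0)\<bar> \<le> of_int (2 * L * S0)" using sums(2) by (simp only: of_int_le_iff A'_def)
    then have "\<bar>10 ^ 22 * of_int A' - of_int v * D\<bar> \<le> D" by (simp add: D_def mult.assoc)
    moreover have "of_int A' / D - of_int v / 10 ^ 22 = (10 ^ 22 * of_int A' - of_int v * D) / (10 ^ 22 * D)"
      using D by (simp add: field_simps)
    ultimately show ?thesis unfolding D_def[symmetric] using D by (simp add: abs_mult pos_divide_le_eq)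
  qed
  have tri: "\<bar>a - d\<bar> \<le> u + v + w" if "\<bar>a - b\<bar> \<le> u" "\<bar>b - c\<bar> \<le> v" "\<bar>c - d\<bar> \<le> w" for a b c d u v w :: real
    using that by linarith
  \<comment> \<open>The tail dominates: it takes 12.5 of the 15 permitted units of
    \<open>1 / 10 ^ 20\<close>.\<close>
  have "\<bar>integral {0<..} (\<lambda>x. x ^ 0 * fF ?s c x) - 1\<bar> \<le> 25 * (1 / (2 * 10 ^ 20)) + 10 * (of_int 150000 / ?N) + 1 / 10 ^ 20"
    by (rule tri[OF tail t0 s0]) simp
  also have "\<dots> \<le> 15 / 10 ^ 20" by (simp add: S0_def)
  finally show "\<bar>Fint {0<..} ?s c - 1\<bar> \<le> 15 / 10 ^ 20" by (simp add: Fint_def)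
  have "\<bar>integral {0<..} (\<lambda>x. x ^ 1 * fF ?s c x) - of_int v / 10 ^ 22\<bar> \<le>
      25 * (1 / (2 * 10 ^ 20)) + 10 * (10 * of_int 150000 / ?N) + 1 / 10 ^ 22"
    by (rule tri[OF tail t1 s1]) simp
  also have "\<dots> \<le> 4 / 10 ^ 19" by (simp add: S0_def)
  finally show "\<bar>integral {0<..} (\<lambda>x. x ^ 1 * fF ?s c x) - of_int v / 10 ^ 22\<bar> \<le> 4 / 10 ^ 19" .
qed

lemma lt_9_cases:
  assumes "i < (9::nat)"
  shows "i = 0 \<or> i = 1 \<or> i = 2 \<or> i = 3 \<or> i = 4 \<or> i = 5 \<or> i = 6 \<or> i = 7 \<or> i = 8"
  using assms by auto

lemma sum_lessThan_10: "(\<Sum>i<10. f i) = f 0 + f 1 + f 2 + f 3 + f 4 + f 5 + f 6 + f 7 + f 8 + f (9::nat)"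
  for f :: "nat \<Rightarrow> int"
  by (simp add: eval_nat_numeral)

definition cF :: real where "cF = of_int fermi_g / 2 ^ 66"
definition cB :: real where "cB = of_int bose_g / 2 ^ 66"

lemma fermi_moments:
  "\<bar>Fint {0<..} 1 cF - 1\<bar> \<le> 15 / 10 ^ 20"
  "\<bar>integral {0<..} (\<lambda>x. x ^ 1 * fF 1 cF x) - 15531244499102627610667 / 10 ^ 22\<bar> \<le> 4 / 10 ^ 19"
proof -
  let ?P = "\<lambda>i. [fermi_P0, fermi_P1, fermi_P2, fermi_P3, fermi_P4, fermi_P5, fermi_P6, fermi_P7, fermi_P8, fermi_P9] ! i"
  let ?Q = "\<lambda>i. [fermi_Q0, fermi_Q1, fermi_Q2, fermi_Q3, fermi_Q4, fermi_Q5, fermi_Q6, fermi_Q7, fermi_Q8, fermi_Q9] ! i"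
  let ?w = "\<lambda>i. 800 + 400 * int i"
  have c: "-1/3 \<le> real_of_int fermi_g / 2 ^ 66" by (simp add: fermi_g_def)
  have st: "\<bar>bw 1 (real_of_int fermi_g / 2 ^ 66) (real 0) - of_int (lsum [S0]) / of_int S0\<bar> \<le> of_int 0 / of_int S0"
    using S0_pos by (simp add: bw_def)
  have chk0: "wcheck fermi_g (int 0) [S0] 0 fermi_P0 800" and hk0: "hcheck 1 (int 0) fermi_P0 800 fermi_Q0 150000"
    and pk0: "weights_cover wts fermi_Q0 0" using fermi_check0 by auto
  have H0: "\<bar>fF (of_int 1) (real_of_int fermi_g / 2 ^ 66) x - lev fermi_Q0 (2 * (x - 1/2)) / of_int S0\<bar> \<le> of_int 150000 / of_int S0"
    if x: "0 < x" "x \<le> 1" for x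
  proof -
    have xx: "real 0 \<le> x" "x \<le> real 0 + 1" using x by auto
    have "1/2 \<le> 1 + of_int 1 * bw 1 (real_of_int fermi_g / 2 ^ 66) x"
      using bw_pos[of 1 "real_of_int fermi_g / 2 ^ 66" x] by simp
    from hcheck_step[OF _ hk0 wcheck_step[OF c chk0 st xx] this xx] show ?thesis by simp
  qed
  have step: "wcheck fermi_g (int (Suc i)) (?P i) (?w i) (?P (Suc i)) (?w (Suc i)) \<and>
      hcheck 1 (int (Suc i)) (?P (Suc i)) (?w (Suc i)) (?Q (Suc i)) 150000 \<and> weights_cover wts (?Q (Suc i)) (int (Suc i))"
    if "i < 9" for i
    using lt_9_cases[OF that]
    by (elim disjE) (simp_all add: fermi_check1 fermi_check2 fermi_check3 fermi_check4 fermi_check5 fermi_check6 fermi_check7 fermi_check8 fermi_check9)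
  have start: "\<bar>bw 1 (real_of_int fermi_g / 2 ^ 66) 1 - of_int (lsum (?P 0)) / of_int S0\<bar> \<le> of_int (?w 0) / of_int S0"
    using wcheck_end[OF c chk0 st] by simp
  note M = moments_certificate[where s = 1 and g = fermi_g and ws = wts and L = Lw and P = ?P and Q = ?Q and w = ?w
      and v = 15531244499102627610667, OF _ _ c _ weights_ok_wts Lw_pos start _ _ step]
  have sm: "10 ^ 20 * \<bar>(\<Sum>i<10. lint wts (?Q i)) - Lw * S0\<bar> \<le> Lw * S0"
      "\<bar>10 ^ 22 * (\<Sum>i<10. lint wts (lmul [2 * int i + 1, 1] (?Q i))) - 15531244499102627610667 * (2 * Lw * S0)\<bar> \<le> 2 * Lw * S0"
      "2 * 10 ^ 20 * (lsum (?P 9) + ?w 9) \<le> S0"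
    using fermi_sums unfolding sum_lessThan_10 by simp_all
  show "\<bar>Fint {0<..} 1 cF - 1\<bar> \<le> 15 / 10 ^ 20"
    using M(1)[OF _ _ _ _ _ _ sm] H0 pk0 by (simp add: cF_def adm_def)
  show "\<bar>integral {0<..} (\<lambda>x. x ^ 1 * fF 1 cF x) - 15531244499102627610667 / 10 ^ 22\<bar> \<le> 4 / 10 ^ 19"
    using M(2)[OF _ _ _ _ _ _ sm] H0 pk0 by (simp add: cF_def adm_def)
qed

lemma bose_moments:
  "\<bar>Fint {0<..} (-1) cB - 1\<bar> \<le> 15 / 10 ^ 20"
  "\<bar>integral {0<..} (\<lambda>x. x ^ 1 * fF (-1) cB x) - 6287591210986969278900 / 10 ^ 22\<bar> \<le> 4 / 10 ^ 19"
proof -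
  \<comment> \<open>The constant polynomial \<open>[bose_a]\<close> only provides the value at the
    left end of \<open>[1, 2]\<close>; the interval \<open>(0, 1]\<close> is covered by
    \<open>bose_start\<close>.\<close>
  let ?P = "\<lambda>i. [[bose_a], bose_P1, bose_P2, bose_P3, bose_P4, bose_P5, bose_P6, bose_P7, bose_P8, bose_P9] ! i"
  let ?Q = "\<lambda>i. [bose_Q0, bose_Q1, bose_Q2, bose_Q3, bose_Q4, bose_Q5, bose_Q6, bose_Q7, bose_Q8, bose_Q9] ! i"
  let ?w = "\<lambda>i. 800 + 400 * int i"
  have c: "3/4 \<le> real_of_int bose_g / 2 ^ 66" by (simp add: bose_g_def)
  then have c': "-1/3 \<le> real_of_int bose_g / 2 ^ 66" by linarith
  have chk0: "bose_start_check bose_g bose_P0 bose_Q0 bose_a 800 150000"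
    and pk0: "weights_cover wts bose_Q0 0" using bose_check0 by auto
  have step: "wcheck bose_g (int (Suc i)) (?P i) (?w i) (?P (Suc i)) (?w (Suc i)) \<and>
      hcheck (-1) (int (Suc i)) (?P (Suc i)) (?w (Suc i)) (?Q (Suc i)) 150000 \<and> weights_cover wts (?Q (Suc i)) (int (Suc i))"
    if "i < 9" for i
    using lt_9_cases[OF that]
    by (elim disjE) (simp_all add: bose_check1 bose_check2 bose_check3 bose_check4 bose_check5 bose_check6 bose_check7 bose_check8 bose_check9)
  have start: "\<bar>bw 1 (real_of_int bose_g / 2 ^ 66) 1 - of_int (lsum (?P 0)) / of_int S0\<bar> \<le> of_int (?w 0) / of_int S0"
    using bose_start(1)[OF c chk0] by simp
  note M = moments_certificate[where s = "-1" and g = bose_g and ws = wts and L = Lw and P = ?P and Q = ?Q and w = ?w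
      and v = 6287591210986969278900, OF _ _ c' _ weights_ok_wts Lw_pos start _ _ step]
  have sm: "10 ^ 20 * \<bar>(\<Sum>i<10. lint wts (?Q i)) - Lw * S0\<bar> \<le> Lw * S0"
      "\<bar>10 ^ 22 * (\<Sum>i<10. lint wts (lmul [2 * int i + 1, 1] (?Q i))) - 6287591210986969278900 * (2 * Lw * S0)\<bar> \<le> 2 * Lw * S0"
      "2 * 10 ^ 20 * (lsum (?P 9) + ?w 9) \<le> S0"
    using bose_sums unfolding sum_lessThan_10 by simp_all
  have adm: "adm (-1) 1 (real_of_int bose_g / 2 ^ 66)" using c by (simp add: adm_def)
  show "\<bar>Fint {0<..} (-1) cB - 1\<bar> \<le> 15 / 10 ^ 20"
    using M(1)[OF _ _ _ _ _ _ sm] bose_start(2)[OF c chk0] pk0 adm c by (simp add: cB_def)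
  show "\<bar>integral {0<..} (\<lambda>x. x ^ 1 * fF (-1) cB x) - 6287591210986969278900 / 10 ^ 22\<bar> \<le> 4 / 10 ^ 19"
    using M(2)[OF _ _ _ _ _ _ sm] bose_start(2)[OF c chk0] pk0 adm c by (simp add: cB_def)
qed

section \<open>The constants\<close>

lemma Lf_bose: "Lf (-1) (bw 1 c x) = - ln (1 - exp (- c * x - x\<^sup>2 / 2))"
  and Lf_fermi: "Lf 1 (bw 1 c x) = ln (1 + exp (- c * x - x\<^sup>2 / 2))"
  by (simp_all add: Lf_def bw_def)

lemma has_integral_fF:
  assumes "adm s 1 c"
  shows "(fF s c has_integral 1) {0<..} \<longleftrightarrow> Fint {0<..} s c = 1"
proof -
  have "(fF s c has_integral Fint {0<..} s c) {0<..}"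
    unfolding Fint_def using fF_absolutely_integrable[OF assms]
    by (simp add: integrable_integral set_lebesgue_integral_eq_integral(1))
  then show ?thesis using has_integral_unique by metis
qed

text \<open>For \<open>c \<le> 0\<close> the integral diverges and the equation fails, so uniqueness
  among all reals reduces to uniqueness among admissible parameters.\<close>

lemma c_equation_iff: "c_equation c \<longleftrightarrow> adm (-1) 1 c \<and> Fint {0<..} (-1) c = 1"
proof -
  have eq: "c_equation c \<longleftrightarrow> (fF (-1) c has_integral 1) {0<..}"
    by (simp add: c_equation_def fF_def[abs_def])
  show ?thesis
  proof (cases "c > 0")
    case True
    then have "adm (-1) 1 c" by (simp add: adm_def)
    then show ?thesis using has_integral_fF eq by blast
  next
    case False
    then have "\<not> c_equation c"
      unfolding c_equation_def using Bose_not_integrable[of c] has_integral_integrable by fastforce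
    then show ?thesis using False by (simp add: adm_def)
  qed
qed

lemma c_d_equation_iff: "c_d_equation c \<longleftrightarrow> adm 1 1 c \<and> Fint {0<..} 1 c = 1"
proof -
  have "c_d_equation c \<longleftrightarrow> (fF 1 c has_integral 1) {0<..}"
    by (simp add: c_d_equation_def fF_def[abs_def])
  moreover have "adm 1 1 c" by (simp add: adm_def)
  ultimately show ?thesis using has_integral_fF by blast
qed

text \<open>The tolerance \<open>5 / 10 ^ 17\<close>, half a unit of the sixteenth decimal, is split
  between the uncertainty of the true value and the distance of its approximation from the printed
  decimals: \<open>11 + 39\<close> and \<open>1 + 49\<close> units of \<open>1 / 10 ^ 18\<close>.
  The assumption \<open>pos\<close> makes the constant positive, as the asymptotic equivalence
  requires.\<close>

lemma root_asymptotics: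
  assumes adm: "adm s 1 c0" and c0: "-9/10 \<le> c0" "c0 \<le> 9/10" "s = -1 \<longrightarrow> 1/2 \<le> c0"
    and F: "\<bar>Fint {0<..} s c0 - 1\<bar> \<le> 15 / 10 ^ 20"
    and M: "\<bar>integral {0<..} (\<lambda>x. x ^ 1 * fF s c0 x) - v\<bar> \<le> 4 / 10 ^ 19"
    and pos: "1/2 \<le> 2 * c0 + v"
    and c: "\<bar>c0 - cn\<bar> \<le> 39 / 10 ^ 18" and C: "\<bar>2 * c0 + v - Cn\<bar> \<le> 49 / 10 ^ 18"
  shows "(\<exists>!c. adm s 1 c \<and> Fint {0<..} s c = 1) \<and>
    (\<forall>c. adm s 1 c \<and> Fint {0<..} s c = 1 \<longrightarrow>
      (\<lambda>x. Lf s (bw 1 c x)) integrable_on {0<..} \<and>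
      (\<lambda>n. ln (AOsum s n)) \<sim>[at_top] (\<lambda>n. (c + Gint {0<..} s c) * sqrt (real n)) \<and>
      \<bar>c - cn\<bar> \<le> 5 / 10 ^ 17 \<and> \<bar>c + Gint {0<..} s c - Cn\<bar> \<le> 5 / 10 ^ 17)"
proof -
  obtain r where r: "adm s 1 r" "Fint {0<..} s r = 1" "\<bar>r - c0\<bar> \<le> 11 / 10 ^ 18"
      "\<bar>r + Gint {0<..} s r - (2 * c0 + v)\<bar> \<le> 1 / 10 ^ 18"
    and uniq: "\<And>c'. adm s 1 c' \<and> Fint {0<..} s c' = 1 \<Longrightarrow> c' = r"
    using root_exists[OF adm c0 F M] by blast
  have int: "(\<lambda>x. Lf s (bw 1 r x)) integrable_on {0<..}"
    by (rule set_lebesgue_integral_eq_integral(1)[OF Lf_bw_absolutely_integrable[OF r(1)]])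
  have "2 * c0 + v - (r + Gint {0<..} s r) \<le> 1 / 10 ^ 18" using r(4) by (simp only: abs_le_iff minus_diff_eq)
  then have "r + Gint {0<..} s r > 0" using pos by simp
  then have asy: "(\<lambda>n. ln (AOsum s n)) \<sim>[at_top] (\<lambda>n. (r + Gint {0<..} s r) * sqrt (real n))"
    by (rule AOsum_asymp[OF r(1,2) refl])
  have "\<bar>r - cn\<bar> \<le> \<bar>r - c0\<bar> + \<bar>c0 - cn\<bar>" by simp
  then have b1: "\<bar>r - cn\<bar> \<le> 5 / 10 ^ 17" using r(3) c by simp
  have "\<bar>r + Gint {0<..} s r - Cn\<bar> \<le> \<bar>r + Gint {0<..} s r - (2 * c0 + v)\<bar> + \<bar>2 * c0 + v - Cn\<bar>" by simp
  then have b2: "\<bar>r + Gint {0<..} s r - Cn\<bar> \<le> 5 / 10 ^ 17" using r(4) C by simp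
  show ?thesis
  proof (intro conjI allI impI)
    show "\<exists>!c. adm s 1 c \<and> Fint {0<..} s c = 1" using r(1,2) uniq by blast
  next
    fix c assume "adm s 1 c \<and> Fint {0<..} s c = 1"
    then have "c = r" by (rule uniq)
    then show "(\<lambda>x. Lf s (bw 1 c x)) integrable_on {0<..}"
      "(\<lambda>n. ln (AOsum s n)) \<sim>[at_top] (\<lambda>n. (c + Gint {0<..} s c) * sqrt (real n))"
      "\<bar>c - cn\<bar> \<le> 5 / 10 ^ 17" "\<bar>c + Gint {0<..} s c - Cn\<bar> \<le> 5 / 10 ^ 17"
      using int asy b1 b2 by simp_all
  qed
qed

theorem theorem11:
  shows "((\<exists>!c. c_equation c) \<and>
      (\<forall>c C. c_equation c \<longrightarrow>
         C = c + integral {0<..} (\<lambda>x. - ln (1 - exp (- c * x - x\<^sup>2 / 2))) \<longrightarrow>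
           (\<lambda>x. - ln (1 - exp (- c * x - x\<^sup>2 / 2))) integrable_on {0<..} \<and>
           (\<lambda>n. ln (real (B n) / fact n)) \<sim>[at_top] (\<lambda>n. C * sqrt (real n)) \<and>
           \<bar>c - 0.7649964422795443\<bar> \<le> 5 / 10 ^ 17 \<and>
           \<bar>C - 2.1587520056577855\<bar> \<le> 5 / 10 ^ 17)) \<and>
    ((\<exists>!c. c_d_equation c) \<and>
      (\<forall>c C. c_d_equation c \<longrightarrow>
         C = c + integral {0<..} (\<lambda>x. ln (1 + exp (- c * x - x\<^sup>2 / 2))) \<longrightarrow>
           (\<lambda>x. ln (1 + exp (- c * x - x\<^sup>2 / 2))) integrable_on {0<..} \<and>
           (\<lambda>n. ln (real (B_d n) / fact n)) \<sim>[at_top] (\<lambda>n. C * sqrt (real n)) \<and>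
           \<bar>c - (- 0.3236973140950319)\<bar> \<le> 5 / 10 ^ 17 \<and>
           \<bar>C - 0.9057298217201990\<bar> \<le> 5 / 10 ^ 17))"
proof -
  have bose: "adm (-1) 1 cB" "-9/10 \<le> cB" "cB \<le> 9/10" "(-1::real) = -1 \<longrightarrow> 1/2 \<le> cB"
    "1/2 \<le> 2 * cB + 6287591210986969278900 / 10 ^ 22" "\<bar>cB - 0.7649964422795443\<bar> \<le> 39 / 10 ^ 18"
    "\<bar>2 * cB + 6287591210986969278900 / 10 ^ 22 - 2.1587520056577855\<bar> \<le> 49 / 10 ^ 18"
    by (simp_all add: cB_def bose_g_def adm_def)
  have fermi: "adm 1 1 cF" "-9/10 \<le> cF" "cF \<le> 9/10" "(1::real) = -1 \<longrightarrow> 1/2 \<le> cF"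
    "1/2 \<le> 2 * cF + 15531244499102627610667 / 10 ^ 22" "\<bar>cF - (- 0.3236973140950319)\<bar> \<le> 39 / 10 ^ 18"
    "\<bar>2 * cF + 15531244499102627610667 / 10 ^ 22 - 0.9057298217201990\<bar> \<le> 49 / 10 ^ 18"
    by (simp_all add: cF_def fermi_g_def adm_def)
  note R1 = root_asymptotics[OF bose(1-4) bose_moments bose(5-7)]
  note R2 = root_asymptotics[OF fermi(1-4) fermi_moments fermi(5-7)]
  show ?thesis
    using R1 R2 unfolding c_equation_iff[symmetric] c_d_equation_iff[symmetric] Gint_def Lf_bose Lf_fermi AOsum_B AOsum_B_d
    by blast
qed

end
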